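(* Let $W$ be the Weyl group of an irreducible root system with (complexified) reflection representation $\mathfrak h$, $n=\dim\mathfrak h$, and let $\mathbf H=\mathbf H_{1,c}$ be the associated rational Cherednik algebra with $t=1$. Let $L(\mathrm{triv})$ be a finite-dimensional irreducible quotient of the standard module $M(\mathrm{triv})$ as in Berest–Etingof–Ginzburg, so that there is an exact sequence of $\mathbf H$-modules $$0\to M(\wedge^n\mathfrak h^* )\to M(\wedge^{n-1}\mathfrak h^* )\to\dots\to M(\wedge^1\mathfrak h^* )\to M(\mathrm{triv})\to L(\mathrm{triv})\to0 .$$ Then, as $\widetilde W$-modules, $$H_D(L(\mathrm{triv}))\cong\wedge^\bullet\mathfrak h\otimes\chi^{-1}.$$
   Context: **Rational Cherednik algebra.** $\mathcal R\subset W$ is the set of reflections, $\langle\ ,\ \rangle$ the natural pairing between $\mathfrak h$ and $\mathfrak h^*$. For $s\in\mathcal R$, $\alpha_s\in\mathfrak h^*$ is a nonzero vector vanishing on the hyperplane of $\mathfrak h$ fixed by $s$, $\alpha_s^\vee\in\mathfrak h$ a nonzero vector vanishing on the hyperplane of $\mathfrak h^*$ fixed by $s$, and $\lambda_s=\det_{\mathfrak h}(s)$. Let $c:\mathcal R\to\mathbb C$ be conjugation-invariant. $\mathbf H_{1,c}$ is the quotient of $T(\mathfrak h\oplus\mathfrak h^* )\rtimes\mathbb C[W]$ by the relations $[x,x']=0$, $[y,y']=0$, $[y,x]=\langle y,x\rangle-\sum_{s\in\mathcal R}c(s)\frac{\langle y,\alpha_s\rangle\langle\alpha_s^\vee,x\rangle}{\langle\alpha_s^\vee,\alpha_s\rangle}s$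 for $x,x'\in\mathfrak h^*$, $y,y'\in\mathfrak h$. Fix a basis $y_1,\dots,y_n$ of $\mathfrak h$ with dual basis $x_1,\dots,x_n$ of $\mathfrak h^*$. For a $W$-module $\sigma$, $M(\sigma)=\mathbf H\otimes_{S(\mathfrak h)\rtimes\mathbb C[W]}\sigma$, with $\mathfrak h$ acting on $\sigma$ by $0$; for irreducible $\sigma$, $L(\sigma)$ is its unique irreducible quotient. **Clifford algebra, spinors, $\widetilde W$, $\chi$.** $V=\mathfrak h\oplus\mathfrak h^*$. $C(V)$ is the tensor algebra of $V$ modulo $x_ix_j+x_jx_i=0=y_iy_j+y_jy_i$, $x_iy_j+y_jx_i=-2\delta_{ij}$. The spinor module is $S=\wedge^\bullet\mathfrak h$, where $y\in\mathfrak h$ acts by $y\wedge\cdot$ and $x\in\mathfrak h^*$ by $x(y_{i_1}\wedge\dots\wedge y_{i_p})=2\sum_j(-1)^j\langle x,y_{i_j}\rangle y_{i_1}\wedge\dots\widehat{y_{i_j}}\dots\wedge y_{i_p}$. $\widetilde W\subset C(V)^\times$ is the group generated by the elements $\pm\mu_s$, $s\in\mathcal R$, where $\mu_s=\frac{\sqrt{\lambda_s}-1/\sqrt{\lambda_s}}{2\langle\alpha_s^\vee,\alpha_s\rangle}\alpha_s\alpha_s^\vee+\sqrt{\lambda_s}$; it is a double cover $p:\widetilde W\to W$ with kernel $\{\pm1\}$ and $p(\pm\mu_s)=s$. $\chi:\widetilde W\to\mathbb C^\times$ is the character by which $\widetilde W$ acts on $\wedge^0\mathfrak h\subset S$; it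 is genuine ($\chi(-1)=-1$) and $\chi^2=\det_{\mathfrak h^*}\circ p$. $W$-modules are regarded as $\widetilde W$-modules through $p$; $\widetilde W$ acts on $M\otimes S$ by $\widetilde w\mapsto p(\widetilde w)\otimes\widetilde w$. **Dirac cohomology.** $D=\sum_i(x_i\otimes y_i+y_i\otimes x_i)\in\mathbf H\otimes C(V)$ acts on $M\otimes S$, commuting with $\widetilde W$, and $H_D(M)=\ker D/(\ker D\cap\mathrm{im}\,D)$. *)

theory Defs
  imports
    "HOL-Analysis.Analysis"
    "HOL-Algebra.QuotRing"
    "HOL-Algebra.Module"
    "HOL-Algebra.Generated_Groups"
    "HOL-Algebra.Free_Abelian_Groups"
begin

text \<open>
  Coordinates: the reflection representation is \<open>h = complex^'n\<close>, with basis \<open>y_i = axis i 1\<close>;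
  its dual \<open>h*\<close> is also written \<open>complex^'n\<close>, with respect to the dual basis \<open>x_i\<close>.
  The linear order on \<open>'n\<close> only serves to name the monomial bases of exterior powers.
\<close>

section \<open>Weyl groups\<close>

type_synonym 'n mtx = "complex^'n^'n"

definition root_reflection :: "real^'n \<Rightarrow> real^'n \<Rightarrow> real^'n" where
  "root_reflection a v = v - (2 * (v \<bullet> a) / (a \<bullet> a)) *\<^sub>R a"

text \<open>Reducedness is not required, so the non-reduced systems are included; they
  have the same Weyl groups as their reduced subsystems.\<close>

definition root_system :: "(real^'n) set \<Rightarrow> bool" where
  "root_system \<Phi> \<longleftrightarrow> finite \<Phi> \<and> span \<Phi> = UNIV \<and> 0 \<notin> \<Phi> \<and>
     (\<forall>a\<in>\<Phi>. \<forall>b\<in>\<Phi>. root_reflection a b \<in> \<Phi>) \<and>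
     (\<forall>a\<in>\<Phi>. \<forall>b\<in>\<Phi>. 2 * (b \<bullet> a) / (a \<bullet> a) \<in> \<int>)"

definition irreducible_root_system :: "(real^'n) set \<Rightarrow> bool" where
  "irreducible_root_system \<Phi> \<longleftrightarrow> root_system \<Phi> \<and>
     (\<forall>A B. \<Phi> = A \<union> B \<and> (\<forall>a\<in>A. \<forall>b\<in>B. a \<bullet> b = 0) \<longrightarrow> A = {} \<or> B = {})"

definition GLn :: "'n::finite mtx monoid" where
  "GLn = \<lparr>carrier = {A. invertible A}, mult = (**), one = mat 1\<rparr>"

definition weyl_group :: "(real^'n::finite) set \<Rightarrow> 'n mtx set" where
  "weyl_group \<Phi> =
     generate GLn ((\<lambda>a. map_matrix complex_of_real (matrix (root_reflection a))) ` \<Phi>)"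

definition reflections :: "'n::finite mtx set \<Rightarrow> 'n mtx set" where
  "reflections W = {s \<in> W. vec.dim {y. s *v y = y} = CARD('n) - 1}"

definition pairing :: "complex^'n::finite \<Rightarrow> complex^'n \<Rightarrow> complex" where
  "pairing y x = (\<Sum>i\<in>UNIV. y $ i * x $ i)"

text \<open>The matrix of the action of \<open>g\<close> on \<open>h*\<close>: \<open>pairing (g *v y) (contragredient g *v x) = pairing y x\<close>.\<close>

definition contragredient :: "'n::finite mtx \<Rightarrow> 'n mtx" where
  "contragredient g = transpose (matrix_inv g)"


section \<open>Data defining a rational Cherednik algebra\<close>

record 'n cherednik_data =
  refl_grp :: "'n mtx set"
  param :: "'n mtx \<Rightarrow> complex"
  alpha :: "'n mtx \<Rightarrow> complex^'n"
  alpha_vee :: "'n mtx \<Rightarrow> complex^'n"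

definition is_cherednik_data :: "'n::finite cherednik_data \<Rightarrow> bool" where
  "is_cherednik_data P \<longleftrightarrow>
     (\<forall>s\<in>reflections (refl_grp P). \<forall>w\<in>refl_grp P.
        param P (w ** s ** matrix_inv w) = param P s) \<and>
     (\<forall>s\<in>reflections (refl_grp P).
        alpha P s \<noteq> 0 \<and> (\<forall>y. s *v y = y \<longrightarrow> pairing y (alpha P s) = 0) \<and>
        alpha_vee P s \<noteq> 0 \<and>
        (\<forall>x. contragredient s *v x = x \<longrightarrow> pairing (alpha_vee P s) x = 0))"


section \<open>Tensor, symmetric and smash product algebras\<close>

text \<open>Lists under concatenation, written additively: then \<open>'a list \<Rightarrow>\<^sub>0 complex\<close> with the convolution
  product is the free algebra on \<open>'a\<close>.\<close>

instantiation list :: (type) monoid_add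
begin
definition zero_list :: "'a list" where "zero_list = []"
definition plus_list :: "'a list \<Rightarrow> 'a list \<Rightarrow> 'a list" where "plus_list = (@)"
instance by standard (simp_all add: zero_list_def plus_list_def)
end

text \<open>The tensor algebra of \<open>V = h \<oplus> h*\<close>; the letter \<open>Inl i\<close> is \<open>y_i\<close> and \<open>Inr i\<close> is \<open>x_i\<close>.\<close>

type_synonym 'n tens = "('n + 'n) list \<Rightarrow>\<^sub>0 complex"

text \<open>The symmetric algebra of \<open>h\<close>: polynomials in the commuting variables \<open>y_i\<close>.\<close>

type_synonym 'n sym = "('n \<Rightarrow>\<^sub>0 nat) \<Rightarrow>\<^sub>0 complex"

abbreviation scal :: "complex \<Rightarrow> ('m::monoid_add \<Rightarrow>\<^sub>0 complex)" where
  "scal z \<equiv> Poly_Mapping.single 0 z"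

definition tens_y :: "complex^'n::finite \<Rightarrow> 'n tens" where
  "tens_y v = (\<Sum>i\<in>UNIV. Poly_Mapping.single [Inl i] (v $ i))"

definition tens_x :: "complex^'n::finite \<Rightarrow> 'n tens" where
  "tens_x v = (\<Sum>i\<in>UNIV. Poly_Mapping.single [Inr i] (v $ i))"

definition sym_y :: "complex^'n::finite \<Rightarrow> 'n sym" where
  "sym_y v = (\<Sum>i\<in>UNIV. Poly_Mapping.single (Poly_Mapping.single i 1) (v $ i))"

definition tens_act :: "'n::finite mtx \<Rightarrow> 'n tens \<Rightarrow> 'n tens" where
  "tens_act g t = (\<Sum>u\<in>Poly_Mapping.keys t. scal (Poly_Mapping.lookup t u) *
     prod_list (map (case_sum (\<lambda>i. tens_y (g *v axis i 1))
                              (\<lambda>i. tens_x (contragredient g *v axis i 1))) u))"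

definition sym_act :: "'n::finite mtx \<Rightarrow> 'n sym \<Rightarrow> 'n sym" where
  "sym_act g f = (\<Sum>m\<in>Poly_Mapping.keys f. scal (Poly_Mapping.lookup f m) *
     (\<Prod>i\<in>UNIV. sym_y (g *v axis i 1) ^ Poly_Mapping.lookup m i))"

text \<open>\<open>A \<rtimes> C[W]\<close>: the function \<open>f\<close> stands for the sum of the \<open>f w \<otimes> w\<close> over \<open>w \<in> W\<close>, and
  \<open>(a \<otimes> u) (b \<otimes> v) = a (u.b) \<otimes> uv\<close>.\<close>

definition smash :: "'n::finite mtx set \<Rightarrow> ('n mtx \<Rightarrow> 'a \<Rightarrow> 'a) \<Rightarrow> ('n mtx \<Rightarrow> 'a::ring_1) ring" where
  "smash W act =
     \<lparr>carrier = {f. \<forall>w. w \<notin> W \<longrightarrow> f w = 0},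
      mult = (\<lambda>f g w. \<Sum>(u, v)\<in>{(u, v) \<in> W \<times> W. u ** v = w}. f u * act u (g v)),
      one = (\<lambda>w. if w = mat 1 then 1 else 0),
      ring.zero = (\<lambda>w. 0),
      ring.add = (\<lambda>f g w. f w + g w)\<rparr>"

abbreviation tens_smash :: "'n::finite cherednik_data \<Rightarrow> ('n mtx \<Rightarrow> 'n tens) ring" where
  "tens_smash P \<equiv> smash (refl_grp P) tens_act"

abbreviation sym_smash :: "'n::finite cherednik_data \<Rightarrow> ('n mtx \<Rightarrow> 'n sym) ring" where
  "sym_smash P \<equiv> smash (refl_grp P) sym_act"

definition at_one :: "'n::finite tens \<Rightarrow> 'n mtx \<Rightarrow> 'n tens" where
  "at_one t = (\<lambda>w. if w = mat 1 then t else 0)"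


section \<open>The rational Cherednik algebra with \<open>t = 1\<close>\<close>

definition cherednik_relators :: "'n::finite cherednik_data \<Rightarrow> ('n mtx \<Rightarrow> 'n tens) set" where
  "cherednik_relators P =
     {at_one (tens_x x * tens_x x' - tens_x x' * tens_x x) | x x'. True} \<union>
     {at_one (tens_y y * tens_y y' - tens_y y' * tens_y y) | y y'. True} \<union>
     {(\<lambda>w. at_one (tens_y y * tens_x x - tens_x x * tens_y y - scal (pairing y x)) w +
           (if w \<in> reflections (refl_grp P)
            then scal (param P w * (pairing y (alpha P w) * pairing (alpha_vee P w) x /
                                    pairing (alpha_vee P w) (alpha P w)))
            else 0)) | y x. True}"

type_synonym 'n ch = "('n mtx \<Rightarrow> 'n tens) set"

definition cherednik :: "'n::finite cherednik_data \<Rightarrow> 'n ch ring" where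
  "cherednik P = tens_smash P Quot (Idl\<^bsub>tens_smash P\<^esub> (cherednik_relators P))"

definition ch_class :: "'n::finite cherednik_data \<Rightarrow> ('n mtx \<Rightarrow> 'n tens) \<Rightarrow> 'n ch" where
  "ch_class P f = (Idl\<^bsub>tens_smash P\<^esub> (cherednik_relators P)) +>\<^bsub>tens_smash P\<^esub> f"

definition ch_y :: "'n::finite cherednik_data \<Rightarrow> complex^'n \<Rightarrow> 'n ch" where
  "ch_y P v = ch_class P (at_one (tens_y v))"

definition ch_x :: "'n::finite cherednik_data \<Rightarrow> complex^'n \<Rightarrow> 'n ch" where
  "ch_x P v = ch_class P (at_one (tens_x v))"

definition ch_scal :: "'n::finite cherednik_data \<Rightarrow> complex \<Rightarrow> 'n ch" where
  "ch_scal P z = ch_class P (at_one (scal z))"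

definition ch_grp :: "'n::finite cherednik_data \<Rightarrow> 'n mtx \<Rightarrow> 'n ch" where
  "ch_grp P w = ch_class P (\<lambda>u. if u = w then 1 else 0)"

text \<open>The homomorphism \<open>S(h) \<rtimes> C[W] \<rightarrow> H\<close>. The order of the factors in \<open>sym_to_tens\<close> is immaterial,
  since the \<open>y_i\<close> commute in \<open>H\<close>.\<close>

definition sym_to_tens :: "'n::{finite,linorder} sym \<Rightarrow> 'n tens" where
  "sym_to_tens f = (\<Sum>m\<in>Poly_Mapping.keys f. scal (Poly_Mapping.lookup f m) *
     prod_list (map (\<lambda>i. tens_y (axis i 1) ^ Poly_Mapping.lookup m i) (sorted_list_of_set UNIV)))"

definition sym_smash_to_ch ::
  "'n::{finite,linorder} cherednik_data \<Rightarrow> ('n mtx \<Rightarrow> 'n sym) \<Rightarrow> 'n ch" where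
  "sym_smash_to_ch P F = ch_class P (\<lambda>w. sym_to_tens (F w))"


section \<open>Modules over noncommutative rings\<close>

text \<open>The ring operations of a record of type \<open>module\<close> play no role for modules.\<close>

locale left_module = R?: ring R + M?: abelian_group M
  for R :: "('r, 'k) ring_scheme" and M :: "('r, 'm) module" (structure) +
  assumes smult_closed:
      "\<lbrakk>r \<in> carrier R; x \<in> carrier M\<rbrakk> \<Longrightarrow> r \<odot> x \<in> carrier M"
    and smult_l_distr:
      "\<lbrakk>r \<in> carrier R; r' \<in> carrier R; x \<in> carrier M\<rbrakk> \<Longrightarrow>
       (r \<oplus>\<^bsub>R\<^esub> r') \<odot> x = r \<odot> x \<oplus> r' \<odot> x"
    and smult_r_distr:
      "\<lbrakk>r \<in> carrier R; x \<in> carrier M; x' \<in> carrier M\<rbrakk> \<Longrightarrow>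
       r \<odot> (x \<oplus> x') = r \<odot> x \<oplus> r \<odot> x'"
    and smult_assoc:
      "\<lbrakk>r \<in> carrier R; r' \<in> carrier R; x \<in> carrier M\<rbrakk> \<Longrightarrow>
       (r \<otimes>\<^bsub>R\<^esub> r') \<odot> x = r \<odot> (r' \<odot> x)"
    and smult_one: "x \<in> carrier M \<Longrightarrow> \<one>\<^bsub>R\<^esub> \<odot> x = x"

definition irreducible_module :: "('r, 'k) ring_scheme \<Rightarrow> ('r, 'm) module \<Rightarrow> bool" where
  "irreducible_module R M \<longleftrightarrow> left_module R M \<and> carrier M \<noteq> {\<zero>\<^bsub>M\<^esub>} \<and>
     (\<forall>N. submodule N R M \<longrightarrow> N = {\<zero>\<^bsub>M\<^esub>} \<or> N = carrier M)"

definition module_homs :: "('r, 'k) ring_scheme \<Rightarrow> ('r, 'm) module \<Rightarrow> ('r, 'p) module \<Rightarrow> ('m \<Rightarrow> 'p) set" where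
  "module_homs R M N = {f \<in> carrier M \<rightarrow> carrier N.
     (\<forall>x\<in>carrier M. \<forall>x'\<in>carrier M. f (x \<oplus>\<^bsub>M\<^esub> x') = f x \<oplus>\<^bsub>N\<^esub> f x') \<and>
     (\<forall>r\<in>carrier R. \<forall>x\<in>carrier M. f (r \<odot>\<^bsub>M\<^esub> x) = r \<odot>\<^bsub>N\<^esub> f x)}"

text \<open>Finite dimension over the complex numbers, which act through \<open>ch_scal\<close>.\<close>

definition finite_dim_module :: "'n::finite cherednik_data \<Rightarrow> ('n ch, 'm) module \<Rightarrow> bool" where
  "finite_dim_module P M \<longleftrightarrow> (\<exists>B. finite B \<and> B \<subseteq> carrier M \<and>
     (\<forall>m\<in>carrier M. \<exists>z. m = (\<Oplus>\<^bsub>M\<^esub>b\<in>B. ch_scal P (z b) \<odot>\<^bsub>M\<^esub> b)))"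

text \<open>Relators of the tensor product \<open>A \<otimes>\<^sub>R B\<close> inside the free abelian group on \<open>A \<times> B\<close>, where
  \<open>ract\<close> is the right action of \<open>R\<close> on \<open>A\<close>.\<close>

definition tensor_relators ::
  "('r, 'k) ring_scheme \<Rightarrow> ('a, 'l) ring_scheme \<Rightarrow> ('a \<Rightarrow> 'r \<Rightarrow> 'a) \<Rightarrow> ('r, 'b) module \<Rightarrow>
   (('a \<times> 'b) \<Rightarrow>\<^sub>0 int) set" where
  "tensor_relators R A ract B =
     {frag_of (a \<oplus>\<^bsub>A\<^esub> a', b) - frag_of (a, b) - frag_of (a', b) | a a' b.
        a \<in> carrier A \<and> a' \<in> carrier A \<and> b \<in> carrier B} \<union>
     {frag_of (a, b \<oplus>\<^bsub>B\<^esub> b') - frag_of (a, b) - frag_of (a, b') | a b b'.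
        a \<in> carrier A \<and> b \<in> carrier B \<and> b' \<in> carrier B} \<union>
     {frag_of (ract a r, b) - frag_of (a, r \<odot>\<^bsub>B\<^esub> b) | a r b.
        a \<in> carrier A \<and> r \<in> carrier R \<and> b \<in> carrier B}"

text \<open>Extension of scalars \<open>A \<otimes>\<^sub>R B\<close> as a left module over the ring \<open>A\<close>.\<close>

definition extend_scalars ::
  "('r, 'k) ring_scheme \<Rightarrow> ('a, 'l) ring_scheme \<Rightarrow> ('a \<Rightarrow> 'r \<Rightarrow> 'a) \<Rightarrow> ('r, 'b) module \<Rightarrow>
   ('a, (('a \<times> 'b) \<Rightarrow>\<^sub>0 int) set) module" where
  "extend_scalars R A ract B =
    (let F = free_Abelian_group (carrier A \<times> carrier B);
         N = generate F (tensor_relators R A ract B)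
     in \<lparr>carrier = carrier (F Mod N), mult = undefined, one = undefined,
         ring.zero = \<one>\<^bsub>F Mod N\<^esub>, ring.add = mult (F Mod N),
         smult = (\<lambda>c X. N <#>\<^bsub>F\<^esub> (frag_extend (\<lambda>(a, b). frag_of (c \<otimes>\<^bsub>A\<^esub> a, b)) ` X))\<rparr>)"


section \<open>Standard modules\<close>

text \<open>A \<open>W\<close>-module \<open>\<sigma>\<close> is a complex vector space \<open>V\<close> together with an action \<open>\<rho>\<close> of \<open>W\<close>.
  It becomes a module over \<open>S(h) \<rtimes> C[W]\<close> with \<open>h\<close> acting by 0, so a polynomial acts through
  its constant coefficient.\<close>

definition inflate ::
  "'n::finite cherednik_data \<Rightarrow> (complex, 'v) module \<Rightarrow> ('n mtx \<Rightarrow> 'v \<Rightarrow> 'v) \<Rightarrow>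
   ('n mtx \<Rightarrow> 'n sym, 'v) module" where
  "inflate P V \<rho> =
     \<lparr>carrier = carrier V, mult = undefined, one = undefined, ring.zero = \<zero>\<^bsub>V\<^esub>, ring.add = add V,
      smult = (\<lambda>F v. \<Oplus>\<^bsub>V\<^esub>w\<in>refl_grp P. Poly_Mapping.lookup (F w) 0 \<odot>\<^bsub>V\<^esub> \<rho> w v)\<rparr>"

type_synonym ('n, 'v) std = "(('n ch \<times> 'v) \<Rightarrow>\<^sub>0 int) set"

definition standard_module ::
  "'n::{finite,linorder} cherednik_data \<Rightarrow> (complex, 'v) module \<Rightarrow> ('n mtx \<Rightarrow> 'v \<Rightarrow> 'v) \<Rightarrow>
   ('n ch, ('n, 'v) std) module" where
  "standard_module P V \<rho> =
     extend_scalars (sym_smash P) (cherednik P)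
       (\<lambda>a F. a \<otimes>\<^bsub>cherednik P\<^esub> sym_smash_to_ch P F) (inflate P V \<rho>)"


section \<open>Exterior powers\<close>

text \<open>The basis vector \<open>axis I 1\<close> is \<open>y_{i_1} \<and> \<dots> \<and> y_{i_p}\<close>, where \<open>I = {i_1 < \<dots> < i_p}\<close>.\<close>

type_synonym 'n ext = "complex^('n set)"

definition wedge :: "complex^'n::{finite,linorder} \<Rightarrow> 'n ext \<Rightarrow> 'n ext" where
  "wedge y v = (\<Sum>I\<in>UNIV. \<Sum>i\<in>-I.
     (y $ i * v $ I * (-1) ^ card {j\<in>I. j < i}) *s axis (insert i I) 1)"

text \<open>The exponent is the position of \<open>i\<close> in \<open>I\<close>, counted from 1.\<close>

definition contract :: "complex^'n::{finite,linorder} \<Rightarrow> 'n ext \<Rightarrow> 'n ext" where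
  "contract x v = (\<Sum>I\<in>UNIV. \<Sum>i\<in>I.
     (2 * (-1) ^ card {j\<in>I. j \<le> i} * x $ i * v $ I) *s axis (I - {i}) 1)"

definition ext_act :: "'n::{finite,linorder} mtx \<Rightarrow> 'n ext \<Rightarrow> 'n ext" where
  "ext_act g v = (\<Sum>I\<in>UNIV.
     v $ I *s foldr (\<lambda>i. wedge (g *v axis i 1)) (sorted_list_of_set I) (axis {} 1))"

definition ext_power :: "nat \<Rightarrow> (complex, 'n::finite ext) module" where
  "ext_power k = \<lparr>carrier = {v. \<forall>I. v $ I \<noteq> 0 \<longrightarrow> card I = k}, mult = undefined, one = undefined,
     ring.zero = 0, ring.add = (+), smult = (*s)\<rparr>"

definition ext_alg :: "(complex, 'n::finite ext) module" where
  "ext_alg = \<lparr>carrier = UNIV, mult = undefined, one = undefined,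
     ring.zero = 0, ring.add = (+), smult = (*s)\<rparr>"

text \<open>The standard module of the \<open>k\<close>-th exterior power of \<open>h*\<close>; for \<open>k = 0\<close> this is \<open>M(triv)\<close>.\<close>

definition std_ext_dual ::
  "'n::{finite,linorder} cherednik_data \<Rightarrow> nat \<Rightarrow> ('n ch, ('n, 'n ext) std) module" where
  "std_ext_dual P k = standard_module P (ext_power k) (\<lambda>w. ext_act (contragredient w))"


section \<open>The Clifford algebra, its spinor module, and the double cover\<close>

definition type_ring :: "'a::ring_1 ring" where
  "type_ring = \<lparr>carrier = UNIV, mult = (*), one = 1, ring.zero = 0, ring.add = (+)\<rparr>"

definition clifford_relators :: "'n::finite tens set" where
  "clifford_relators =
     (let x = (\<lambda>i. tens_x (axis i 1)); y = (\<lambda>i. tens_y (axis i 1)) in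
      {x i * x j + x j * x i | i j. True} \<union>
      {y i * y j + y j * y i | i j. True} \<union>
      {x i * y j + y j * x i + scal (if i = j then 2 else 0) | i j. True})"

type_synonym 'n cliff = "'n tens set"

definition clifford :: "'n::finite cliff ring" where
  "clifford = type_ring Quot (Idl\<^bsub>type_ring\<^esub> clifford_relators)"

definition cl_class :: "'n::finite tens \<Rightarrow> 'n cliff" where
  "cl_class t = (Idl\<^bsub>type_ring\<^esub> clifford_relators) +>\<^bsub>type_ring\<^esub> t"

definition spin_tens :: "'n::{finite,linorder} tens \<Rightarrow> 'n ext \<Rightarrow> 'n ext" where
  "spin_tens t v = (\<Sum>u\<in>Poly_Mapping.keys t. Poly_Mapping.lookup t u *s
     foldr (case_sum (\<lambda>i. wedge (axis i 1)) (\<lambda>i. contract (axis i 1))) u v)"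

text \<open>The action of an element of the Clifford algebra, i.e. of a coset, on the spinor module; all
  representatives act in the same way.\<close>

definition spin :: "'n::{finite,linorder} cliff \<Rightarrow> 'n ext \<Rightarrow> 'n ext" where
  "spin X v = the_elem ((\<lambda>t. spin_tens t v) ` X)"

definition mu_tens :: "'n::finite cherednik_data \<Rightarrow> 'n mtx \<Rightarrow> 'n tens" where
  "mu_tens P s = (let r = csqrt (det s) in
     scal ((r - 1 / r) / (2 * pairing (alpha_vee P s) (alpha P s))) *
       tens_x (alpha P s) * tens_y (alpha_vee P s) + scal r)"

definition mu :: "'n::finite cherednik_data \<Rightarrow> 'n mtx \<Rightarrow> 'n cliff" where
  "mu P s = cl_class (mu_tens P s)"

definition neg_mu :: "'n::finite cherednik_data \<Rightarrow> 'n mtx \<Rightarrow> 'n cliff" where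
  "neg_mu P s = cl_class (- mu_tens P s)"

definition W_tilde :: "'n::finite cherednik_data \<Rightarrow> 'n cliff monoid" where
  "W_tilde P = (units_of clifford)\<lparr>carrier := generate (units_of clifford)
     (mu P ` reflections (refl_grp P) \<union> neg_mu P ` reflections (refl_grp P))\<rparr>"

text \<open>The homomorphism from the double cover to \<open>W\<close>; it is determined by its values on the generators.\<close>

definition is_covering :: "'n::finite cherednik_data \<Rightarrow> ('n cliff \<Rightarrow> 'n mtx) \<Rightarrow> bool" where
  "is_covering P p \<longleftrightarrow> p \<in> hom (W_tilde P) (GLn\<lparr>carrier := refl_grp P\<rparr>) \<and>
     (\<forall>s\<in>reflections (refl_grp P). p (mu P s) = s \<and> p (neg_mu P s) = s)"

text \<open>The scalar by which an element of the double cover acts on the line spanned by \<open>axis {} 1\<close>, the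
  exterior power of degree 0.\<close>

definition chi :: "'n::{finite,linorder} cliff \<Rightarrow> complex" where
  "chi X = spin X (axis {} 1) $ {}"


section \<open>Dirac cohomology\<close>

text \<open>\<open>M \<otimes> S\<close> over the complex numbers: the family \<open>t\<close> stands for the sum of the \<open>t I \<otimes> axis I 1\<close>.\<close>

definition spinor_tensor ::
  "'n::{finite,linorder} cherednik_data \<Rightarrow> ('n ch, 'm) module \<Rightarrow> (complex, 'n set \<Rightarrow> 'm) module" where
  "spinor_tensor P M =
     \<lparr>carrier = {t. \<forall>I. t I \<in> carrier M}, mult = undefined, one = undefined,
      ring.zero = (\<lambda>I. \<zero>\<^bsub>M\<^esub>), ring.add = (\<lambda>t t' I. t I \<oplus>\<^bsub>M\<^esub> t' I),
      smult = (\<lambda>z t I. ch_scal P z \<odot>\<^bsub>M\<^esub> t I)\<rparr>"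

text \<open>The action of \<open>a \<otimes> X \<in> H \<otimes> C(V)\<close>.\<close>

definition tensor_op ::
  "'n::{finite,linorder} cherednik_data \<Rightarrow> ('n ch, 'm) module \<Rightarrow> 'n ch \<Rightarrow> 'n cliff \<Rightarrow>
   ('n set \<Rightarrow> 'm) \<Rightarrow> ('n set \<Rightarrow> 'm)" where
  "tensor_op P M a X t =
     (\<lambda>J. \<Oplus>\<^bsub>M\<^esub>I\<in>UNIV. ch_scal P (spin X (axis I 1) $ J) \<odot>\<^bsub>M\<^esub> (a \<odot>\<^bsub>M\<^esub> t I))"

definition dirac ::
  "'n::{finite,linorder} cherednik_data \<Rightarrow> ('n ch, 'm) module \<Rightarrow> ('n set \<Rightarrow> 'm) \<Rightarrow> ('n set \<Rightarrow> 'm)" where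
  "dirac P M t = (\<Oplus>\<^bsub>spinor_tensor P M\<^esub>i\<in>UNIV.
     tensor_op P M (ch_x P (axis i 1)) (cl_class (tens_y (axis i 1))) t \<oplus>\<^bsub>spinor_tensor P M\<^esub>
     tensor_op P M (ch_y P (axis i 1)) (cl_class (tens_x (axis i 1))) t)"

definition dirac_kernel ::
  "'n::{finite,linorder} cherednik_data \<Rightarrow> ('n ch, 'm) module \<Rightarrow> ('n set \<Rightarrow> 'm) set" where
  "dirac_kernel P M =
     {t \<in> carrier (spinor_tensor P M). dirac P M t = \<zero>\<^bsub>spinor_tensor P M\<^esub>}"

definition dirac_boundary ::
  "'n::{finite,linorder} cherednik_data \<Rightarrow> ('n ch, 'm) module \<Rightarrow> ('n set \<Rightarrow> 'm) set" where
  "dirac_boundary P M = dirac_kernel P M \<inter> dirac P M ` carrier (spinor_tensor P M)"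

text \<open>The operator induced by \<open>f\<close> on cosets of the boundaries.\<close>

definition coset_op ::
  "'n::{finite,linorder} cherednik_data \<Rightarrow> ('n ch, 'm) module \<Rightarrow> (('n set \<Rightarrow> 'm) \<Rightarrow> ('n set \<Rightarrow> 'm)) \<Rightarrow>
   ('n set \<Rightarrow> 'm) set \<Rightarrow> ('n set \<Rightarrow> 'm) set" where
  "coset_op P M f X = dirac_boundary P M <+>\<^bsub>spinor_tensor P M\<^esub> (f ` X)"

definition dirac_cohomology ::
  "'n::{finite,linorder} cherednik_data \<Rightarrow> ('n ch, 'm) module \<Rightarrow> (complex, ('n set \<Rightarrow> 'm) set) module" where
  "dirac_cohomology P M =
     \<lparr>carrier = {dirac_boundary P M +>\<^bsub>spinor_tensor P M\<^esub> t | t. t \<in> dirac_kernel P M},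
      mult = undefined, one = undefined,
      ring.zero = dirac_boundary P M, ring.add = set_add (spinor_tensor P M),
      smult = (\<lambda>z. coset_op P M (\<lambda>t. z \<odot>\<^bsub>spinor_tensor P M\<^esub> t))\<rparr>"

definition dirac_cohomology_act ::
  "'n::{finite,linorder} cherednik_data \<Rightarrow> ('n cliff \<Rightarrow> 'n mtx) \<Rightarrow> ('n ch, 'm) module \<Rightarrow>
   'n cliff \<Rightarrow> ('n set \<Rightarrow> 'm) set \<Rightarrow> ('n set \<Rightarrow> 'm) set" where
  "dirac_cohomology_act P p M g = coset_op P M (tensor_op P M (ch_grp P (p g)) g)"

text \<open>Isomorphism of complex representations \<open>(V, \<rho>)\<close> and \<open>(V', \<rho>')\<close> of a group \<open>G\<close>.\<close>

definition rep_isomorphic ::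
  "'g monoid \<Rightarrow> (complex, 'v) module \<Rightarrow> ('g \<Rightarrow> 'v \<Rightarrow> 'v) \<Rightarrow>
   (complex, 'u) module \<Rightarrow> ('g \<Rightarrow> 'u \<Rightarrow> 'u) \<Rightarrow> bool" where
  "rep_isomorphic G V \<rho> V' \<rho>' \<longleftrightarrow>
     (\<exists>f \<in> module_homs (type_ring :: complex ring) V V'.
        bij_betw f (carrier V) (carrier V') \<and>
        (\<forall>g\<in>carrier G. \<forall>v\<in>carrier V. f (\<rho> g v) = \<rho>' g (f v)))"

end

theory Submission
  imports Defs "HOL-Library.Function_Algebras"
begin

text \<open>
  As a vector space, the standard module of the \<open>k\<close>-th exterior power of \<open>h*\<close> is \<open>S(h*) \<otimes> \<Lambda>\<^sup>k\<close>, on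
  which \<open>h\<close> acts by Dunkl operators. The square of the Dirac operator \<open>D\<close> is \<open>-2 (a - \<Omega>)\<close>,
  where \<open>a\<close> is the Euler grading, shifted by the spinor degree, and \<open>\<Omega>\<close> is half the class sum of
  the \<open>c(s) s\<close>. As \<open>\<Omega>\<close> is diagonalizable, only the spaces on which \<open>a\<close> and \<open>\<Omega>\<close> act by the same scalar
  \<open>b\<close> contribute to the cohomology, and there \<open>D\<^sup>2 = 0\<close>.

  On such a space in degree \<open>k\<close>, the Koszul homotopy shows that \<open>D\<close> is exact unless \<open>b\<close> is the
  weight \<open>a\<^sub>k\<close> of \<open>1 \<otimes> \<Lambda>\<^sup>k \<otimes> \<Lambda>\<^sup>n\<close>, and then the whole space is \<open>1 \<otimes> \<Lambda>\<^sup>k \<otimes> \<Lambda>\<^sup>n\<close>, with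
  \<open>D = 0\<close>. By Schur's lemma \<open>a\<^sub>k = \<kappa> k / 2 + a\<^sub>0\<close> with a scalar \<open>\<kappa>\<close>, and \<open>\<kappa> \<noteq> 0\<close> because \<open>L\<close> is
  finite-dimensional, so the \<open>a\<^sub>k\<close> are distinct. Hence for each weight the double complex formed
  by \<open>D\<close> and the resolution has at most one column with cohomology, and the cohomology of \<open>L\<close>
  in weight \<open>a\<^sub>k\<close> is \<open>\<Lambda>\<^sup>k\<close>. The factor \<open>\<Lambda>\<^sup>n\<close> twists the action of the double cover by
  \<open>\<chi> det = \<chi>\<^sup>-\<^sup>1\<close>.
\<close>

section \<open>Complex vector spaces and tensor operators\<close>

text \<open>\<open>D\<close> squares to zero only on a simultaneous eigenspace, so the argument has
  to pass to such subspaces, and the differentials, the projections and the group action must all be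
  shown compatible with them. The parameter \<open>c\<close> is complex-valued, so half the class
  sum is not self-adjoint; it is diagonalizable because, being central, it commutes with its adjoint
  in the group algebra. \<open>D\<close> has no degree either, since it both raises and lowers the
  spinor degree: the columns of the double complex are two-periodic, and the comparison is a zigzag
  chase carried by relations instead of maps. The Koszul homotopy uses ordinary derivatives in place
  of Dunkl operators, because it then scales monomials by a number that the weight determines.
  Standard modules are given as quotients of free abelian groups; they are identified with
  polynomials by straightening words modulo the tensor relations. Weyl groups consist of real
  orthogonal matrices, which lets \<open>h\<close> and \<open>h*\<close> share coordinates and gives
  every reflection determinant -1.\<close>

class cvec = ab_group_add +
  fixes cscale :: "complex \<Rightarrow> 'a \<Rightarrow> 'a" (infixr \<open>*\<^sub>C\<close> 75)
  assumes cscale_add_right: "z *\<^sub>C (x + y) = z *\<^sub>C x + z *\<^sub>C y"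
    and cscale_add_left: "(z + z') *\<^sub>C x = z *\<^sub>C x + z' *\<^sub>C x"
    and cscale_cscale [simp]: "z *\<^sub>C (z' *\<^sub>C x) = (z * z') *\<^sub>C x"
    and cscale_one [simp]: "1 *\<^sub>C x = x"
begin

lemma cscale_zero_left [simp]: "0 *\<^sub>C x = 0"
  using cscale_add_left[of 0 0 x] by simp

lemma cscale_zero_right [simp]: "z *\<^sub>C 0 = 0"
  using cscale_add_right[of z 0 0] by simp

lemma cscale_minus_right [simp]: "z *\<^sub>C (- x) = - (z *\<^sub>C x)"
  using cscale_add_right[of z x "- x"] by (simp add: eq_neg_iff_add_eq_0 add.commute)

lemma cscale_minus_left [simp]: "(- z) *\<^sub>C x = - (z *\<^sub>C x)"
  using cscale_add_left[of z "- z" x] by (simp add: eq_neg_iff_add_eq_0 add.commute)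

lemma cscale_diff_right: "z *\<^sub>C (x - y) = z *\<^sub>C x - z *\<^sub>C y"
  using cscale_add_right[of z x "- y"] by simp

lemma cscale_diff_left: "(z - z') *\<^sub>C x = z *\<^sub>C x - z' *\<^sub>C x"
  using cscale_add_left[of z "- z'" x] by simp

lemma cscale_sum_right: "z *\<^sub>C (\<Sum>i\<in>A. f i) = (\<Sum>i\<in>A. z *\<^sub>C f i)"
  by (induction A rule: infinite_finite_induct) (auto simp: cscale_add_right)

lemma cscale_sum_left: "(\<Sum>i\<in>A. f i) *\<^sub>C x = (\<Sum>i\<in>A. f i *\<^sub>C x)"
  by (induction A rule: infinite_finite_induct) (auto simp: cscale_add_left)

lemma cscale_eq_0_iff [simp]: "z *\<^sub>C x = 0 \<longleftrightarrow> z = 0 \<or> x = 0"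
proof
  assume *: "z *\<^sub>C x = 0"
  show "z = 0 \<or> x = 0"
  proof (cases "z = 0")
    case False
    then have "x = inverse z *\<^sub>C (z *\<^sub>C x)" by simp
    with * show ?thesis by simp
  qed simp
qed auto

end

lemma sum_fun_apply: "(\<Sum>i\<in>A. f i) x = (\<Sum>i\<in>A. f i x)"
  by (induction A rule: infinite_finite_induct) auto

instantiation complex :: cvec
begin
definition cscale_complex :: "complex \<Rightarrow> complex \<Rightarrow> complex" where "cscale_complex = (*)"
instance by standard (simp_all add: cscale_complex_def algebra_simps)
end

instantiation "fun" :: (type, cvec) cvec
begin
definition cscale_fun :: "complex \<Rightarrow> ('a \<Rightarrow> 'b) \<Rightarrow> 'a \<Rightarrow> 'b" where
  "cscale_fun z f = (\<lambda>x. z *\<^sub>C f x)"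
instance by standard (simp_all add: cscale_fun_def fun_eq_iff cscale_add_left cscale_add_right)
end

lemma cscale_fun_apply [simp]: "(z *\<^sub>C f) x = z *\<^sub>C f x"
  by (simp add: cscale_fun_def)

instantiation vec :: (cvec, finite) cvec
begin
definition cscale_vec :: "complex \<Rightarrow> 'a^'b \<Rightarrow> 'a^'b" where
  "cscale_vec z v = (\<chi> i. z *\<^sub>C v $ i)"
instance by standard (simp_all add: cscale_vec_def vec_eq_iff cscale_add_left cscale_add_right)
end

lemma cscale_vec_eq: "z *\<^sub>C (v :: complex^'n) = z *s v"
  by (simp add: cscale_vec_def vec_eq_iff cscale_complex_def)

instantiation poly_mapping :: (type, cvec) cvec
begin
definition cscale_poly_mapping :: "complex \<Rightarrow> ('a \<Rightarrow>\<^sub>0 'b) \<Rightarrow> 'a \<Rightarrow>\<^sub>0 'b" where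
  "cscale_poly_mapping z p = Poly_Mapping.map (cscale z) p"
lemma lookup_cscale_gen: "Poly_Mapping.lookup (z *\<^sub>C p) m = z *\<^sub>C Poly_Mapping.lookup p m"
  unfolding cscale_poly_mapping_def by (simp add: Poly_Mapping.map.rep_eq when_def)
instance
  by standard (rule poly_mapping_eqI; simp add: lookup_cscale_gen lookup_add cscale_add_left cscale_add_right)+
end

lemma lookup_cscale [simp]: "Poly_Mapping.lookup (z *\<^sub>C p) m = z * Poly_Mapping.lookup p m"
  by (simp add: lookup_cscale_gen cscale_complex_def)

lemma scal_mult: "scal z * p = z *\<^sub>C (p :: 'a::monoid_add \<Rightarrow>\<^sub>0 complex)"
  unfolding cscale_poly_mapping_def cscale_complex_def
  by (rule mult_map_scale_conv_mult[symmetric])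

text \<open>Linearity on a whole type. Maps that are linear only on a subspace, such as the
  differentials of the resolution, are treated with explicit membership conditions.\<close>

definition clin :: "('a::cvec \<Rightarrow> 'b::cvec) \<Rightarrow> bool" where
  "clin f \<longleftrightarrow> (\<forall>x y. f (x + y) = f x + f y) \<and> (\<forall>z x. f (z *\<^sub>C x) = z *\<^sub>C f x)"

lemma clinI: "(\<And>x y. f (x + y) = f x + f y) \<Longrightarrow> (\<And>z x. f (z *\<^sub>C x) = z *\<^sub>C f x) \<Longrightarrow> clin f"
  by (simp add: clin_def)

lemma clin_add: "clin f \<Longrightarrow> f (x + y) = f x + f y"
  and clin_scale: "clin f \<Longrightarrow> f (z *\<^sub>C x) = z *\<^sub>C f x"
  by (simp_all add: clin_def)

lemma clin_zero: "clin f \<Longrightarrow> f 0 = 0"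
  using clin_scale[of f 0 0] by simp

lemma clin_minus: "clin f \<Longrightarrow> f (- x) = - f x"
  using clin_scale[of f "- 1" x] by simp

lemma clin_diff: "clin f \<Longrightarrow> f (x - y) = f x - f y"
  using clin_add[of f x "- y"] by (simp add: clin_minus)

lemma clin_sum: "clin f \<Longrightarrow> f (\<Sum>i\<in>A. g i) = (\<Sum>i\<in>A. f (g i))"
  by (induction A rule: infinite_finite_induct) (auto simp: clin_zero clin_add)

lemma clin_id [intro]: "clin (\<lambda>x. x)"
  and clin_0 [intro]: "clin (\<lambda>x. 0)"
  and clin_compose [intro]: "clin f \<Longrightarrow> clin g \<Longrightarrow> clin (\<lambda>x. f (g x))"
  and clin_plus [intro]: "clin h \<Longrightarrow> clin g \<Longrightarrow> clin (\<lambda>x. h x + g x)"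
  and clin_uminus [intro]: "clin h \<Longrightarrow> clin (\<lambda>x. - h x)"
  and clin_minusf [intro]: "clin h \<Longrightarrow> clin g \<Longrightarrow> clin (\<lambda>x. h x - g x)"
  by (auto simp: clin_def cscale_add_right cscale_diff_right)

lemma clin_cscale [intro]: "clin f \<Longrightarrow> clin (\<lambda>x. z *\<^sub>C f x)"
  by (auto simp: clin_def cscale_add_right mult.commute)

lemma clin_sumf [intro]: "(\<And>i. i \<in> A \<Longrightarrow> clin (f i)) \<Longrightarrow> clin (\<lambda>x. \<Sum>i\<in>A. f i x)"
  by (auto simp: clin_def sum.distrib cscale_sum_right)

text \<open>The operator \<open>g \<otimes> X\<close> on \<open>M \<otimes> S\<close>, with the conventions of \<^const>\<open>tensor_op\<close>.\<close>

definition tns :: "('n::finite ext \<Rightarrow> 'n ext) \<Rightarrow> ('m::cvec \<Rightarrow> 'm) \<Rightarrow> ('n set \<Rightarrow> 'm) \<Rightarrow> 'n set \<Rightarrow> 'm" where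
  "tns X g t = (\<lambda>J. \<Sum>I\<in>UNIV. (X (axis I 1) $ J) *\<^sub>C g (t I))"

lemma clin_tns: "clin g \<Longrightarrow> clin (tns X g)"
  unfolding tns_def
  by (auto simp: clin_def fun_eq_iff sum.distrib cscale_sum_right cscale_add_right mult.commute)

lemma ext_expand: "(v :: 'n::finite ext) = (\<Sum>I\<in>UNIV. v $ I *\<^sub>C axis I 1)"
  by (simp add: cscale_vec_eq basis_expansion)

lemma clin_ext_expand: "clin X \<Longrightarrow> X (v :: 'n::finite ext) = (\<Sum>I\<in>UNIV. v $ I *\<^sub>C X (axis I 1))"
  by (subst ext_expand[of v]) (simp add: clin_sum clin_scale)

lemma cscale_vec_nth [simp]: "(z *\<^sub>C v) $ k = z *\<^sub>C (v $ k)"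
  by (simp add: cscale_vec_def)

text \<open>Operators on spinors enter through their matrices in the basis \<open>axis I 1\<close>,
  so this is matrix multiplication; linearity of \<open>g\<close> lets the matrix entries of
  \<open>X'\<close> pass through it.\<close>

lemma tns_tns:
  assumes "clin X" "clin g"
  shows "tns X g (tns X' g' t) = tns (\<lambda>v. X (X' v)) (\<lambda>x. g (g' x)) t"
proof
  fix J
  have *: "X (X' (axis I 1)) $ J = (\<Sum>K\<in>UNIV. X' (axis I 1) $ K * X (axis K 1) $ J)" for I
    using clin_ext_expand[OF assms(1), of "X' (axis I 1)"]
    by (simp add: sum_component cscale_complex_def)
  have "tns X g (tns X' g' t) J =
      (\<Sum>K\<in>UNIV. \<Sum>I\<in>UNIV. (X (axis K 1) $ J * X' (axis I 1) $ K) *\<^sub>C g (g' (t I)))"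
    by (simp add: tns_def clin_sum[OF assms(2)] clin_scale[OF assms(2)] cscale_sum_right)
  also have "\<dots> = (\<Sum>I\<in>UNIV. \<Sum>K\<in>UNIV. (X (axis K 1) $ J * X' (axis I 1) $ K) *\<^sub>C g (g' (t I)))"
    by (rule sum.swap)
  also have "\<dots> = tns (\<lambda>v. X (X' v)) (\<lambda>x. g (g' x)) t J"
    by (simp add: tns_def * cscale_sum_left mult.commute)
  finally show "tns X g (tns X' g' t) J = tns (\<lambda>v. X (X' v)) (\<lambda>x. g (g' x)) t J" .
qed

lemma tns_id: "tns (\<lambda>v. v) g t = (\<lambda>I. g (t I))"
proof
  fix J :: "'a set"
  have "(\<Sum>I\<in>UNIV. (axis I 1 $ J :: complex) *\<^sub>C g (t I)) = (\<Sum>I\<in>UNIV. if I = J then g (t I) else 0)"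
    by (intro sum.cong) (auto simp: axis_def)
  then show "tns (\<lambda>v. v) g t J = g (t J)" by (simp add: tns_def)
qed

lemma tns_add_left: "tns (\<lambda>v. X v + X' v) g t = tns X g t + tns X' g t"
  by (simp add: tns_def fun_eq_iff cscale_add_left sum.distrib)

lemma tns_add_right: "tns X (\<lambda>x. g x + g' x) t = tns X g t + tns X g' t"
  by (simp add: tns_def fun_eq_iff cscale_add_right sum.distrib)

lemma tns_scale_left: "tns (\<lambda>v. z *\<^sub>C X v) g t = z *\<^sub>C tns X g t"
  by (simp add: tns_def fun_eq_iff cscale_sum_right cscale_complex_def)

lemma tns_scale_right: "tns X (\<lambda>x. z *\<^sub>C g x) t = z *\<^sub>C tns X g t"
  by (simp add: tns_def fun_eq_iff cscale_sum_right mult.commute)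

lemma tns_zero_left: "tns (\<lambda>v. 0) g t = 0"
  by (simp add: tns_def fun_eq_iff)

lemma tns_zero_right: "tns X (\<lambda>x. 0) t = 0"
  by (simp add: tns_def fun_eq_iff)

lemma tns_minus_left: "tns (\<lambda>v. - X v) g t = - tns X g t"
  using tns_scale_left[of "-1" X g t] by simp

lemma tns_minus_right: "tns X (\<lambda>x. - g x) t = - tns X g t"
  using tns_scale_right[of X "-1" g t] by simp

lemma tns_diff_right: "tns X (\<lambda>x. g x - g' x) t = tns X g t - tns X g' t"
  using tns_add_right[of X g "\<lambda>x. - g' x" t] by (simp add: tns_minus_right)

lemma tns_sum_left: "tns (\<lambda>v. \<Sum>i\<in>A. X i v) g t = (\<Sum>i\<in>A. tns (X i) g t)"
  by (induction A rule: infinite_finite_induct) (auto simp: tns_zero_left tns_add_left)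

lemma tns_sum_right: "tns X (\<lambda>x. \<Sum>i\<in>A. g i x) t = (\<Sum>i\<in>A. tns X (g i) t)"
  by (induction A rule: infinite_finite_induct) (auto simp: tns_zero_right tns_add_right)


section \<open>Exterior algebra\<close>

text \<open>The sign that sorts a factor \<open>y_i\<close>, put in front of the monomial of
  \<open>I\<close>, into increasing order.\<close>

definition psgn :: "'n::{finite,linorder} \<Rightarrow> 'n set \<Rightarrow> complex" where
  "psgn i I = (-1) ^ card {j\<in>I. j < i}"

lemma psgn_sq [simp]: "psgn i I * psgn i I = 1"
  by (simp add: psgn_def flip: power_mult_distrib)

lemma psgn_sq2: "psgn i I * (z * psgn i I) = z" "z * psgn i I * psgn i I = z"
  using psgn_sq[of i I] by (simp_all add: mult.assoc mult.left_commute[of _ z])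

lemma psgn_insert_self [simp]: "psgn i (insert i I) = psgn i I"
  unfolding psgn_def by (rule arg_cong[where f = "\<lambda>A. (- 1) ^ card A"]) auto

lemma psgn_remove_self [simp]: "psgn i (I - {i}) = psgn i I"
  unfolding psgn_def by (rule arg_cong[where f = "\<lambda>A. (- 1) ^ card A"]) auto

lemma psgn_insert: "j \<notin> I \<Longrightarrow> psgn i (insert j I) = (if j < i then - psgn i I else psgn i I)"
proof -
  assume j: "j \<notin> I"
  have "{k \<in> insert j I. k < i} = (if j < i then insert j {k\<in>I. k < i} else {k\<in>I. k < i})"
    by auto
  with j show ?thesis by (simp add: psgn_def)
qed

lemma psgn_remove: "j \<in> I \<Longrightarrow> psgn i (I - {j}) = (if j < i then - psgn i I else psgn i I)"
  using psgn_insert[of j "I - {j}" i] by (auto simp: insert_absorb split: if_splits)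

lemma clin_wedge: "clin (wedge y)"
  unfolding wedge_def
  by (rule clinI)
    (simp_all add: cscale_vec_eq algebra_simps vec.scale_left_distrib sum.distrib vec.scale_sum_right vec.scale_scale mult.left_commute)

lemma clin_wedge_left: "clin (\<lambda>y. wedge y v)"
  unfolding wedge_def
  by (rule clinI)
    (simp_all add: cscale_vec_eq algebra_simps vec.scale_left_distrib sum.distrib vec.scale_sum_right vec.scale_scale mult.left_commute)

lemma clin_contract: "clin (contract x)"
  unfolding contract_def
  by (rule clinI)
    (simp_all add: cscale_vec_eq algebra_simps vec.scale_left_distrib sum.distrib vec.scale_sum_right vec.scale_scale mult.left_commute)

lemma clin_contract_left: "clin (\<lambda>x. contract x v)"
  unfolding contract_def
  by (rule clinI)
    (simp_all add: cscale_vec_eq algebra_simps vec.scale_left_distrib sum.distrib vec.scale_sum_right vec.scale_scale mult.left_commute)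

text \<open>The common shape of \<open>wedge\<close> and \<open>contract\<close> on basis vectors:
  the two \<open>axis\<close> factors single out one term of the double sum.\<close>

lemma sum_axis_collapse:
  "(\<Sum>I'\<in>UNIV. \<Sum>i'\<in>F I'. (axis i 1 $ i' * (axis I 1 $ I') * c i' I' :: complex) *s G i' I') =
    (if i \<in> F I then c i I *s (G i I :: complex^'m) else 0)"
  for F :: "'k::finite \<Rightarrow> 'n::finite set"
proof -
  have "(\<Sum>I'\<in>UNIV. \<Sum>i'\<in>F I'. (axis i 1 $ i' * (axis I 1 $ I') * c i' I' :: complex) *s G i' I')
     = (\<Sum>I'\<in>UNIV. if I' = I then (\<Sum>i'\<in>F I'. if i' = i then c i' I' *s G i' I' else 0) else 0)"
  proof (intro sum.cong refl)
    fix I'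
    show "(\<Sum>i'\<in>F I'. (axis i 1 $ i' * (axis I 1 $ I') * c i' I' :: complex) *s G i' I') =
        (if I' = I then (\<Sum>i'\<in>F I'. if i' = i then c i' I' *s G i' I' else 0) else 0)"
    proof (cases "I' = I")
      case True
      have "(\<Sum>i'\<in>F I'. (axis i 1 $ i' * (axis I 1 $ I') * c i' I' :: complex) *s G i' I') =
          (\<Sum>i'\<in>F I'. if i' = i then c i' I' *s G i' I' else 0)"
        using True by (intro sum.cong) (auto simp: axis_def)
      with True show ?thesis by simp
    qed (auto simp: axis_def)
  qed
  also have "\<dots> = (if i \<in> F I then c i I *s G i I else 0)"
    by (simp add: sum.delta)
  finally show ?thesis .
qed

lemma wedge_axis:
  "wedge (axis i 1) (axis I 1) = (if i \<in> I then 0 else psgn i I *\<^sub>C axis (insert i I) 1)"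
  unfolding wedge_def psgn_def cscale_vec_eq
  by (subst sum_axis_collapse) auto

lemma contract_axis:
  "contract (axis i 1) (axis I 1) = (if i \<in> I then (- 2 * psgn i I) *\<^sub>C axis (I - {i}) 1 else 0)"
proof -
  \<comment> \<open>The definition counts positions from 1 while \<open>psgn\<close> counts
    predecessors; the extra element turns the factor 2 into -2.\<close>
  have *: "{j\<in>I. j \<le> i} = insert i {j\<in>I. j < i}" if "i \<in> I" using that by auto
  have "contract (axis i 1) (axis I 1) = (\<Sum>I'\<in>UNIV. \<Sum>i'\<in>I'.
     (axis i 1 $ i' * axis I 1 $ I' * (2 * (-1) ^ card {j\<in>I'. j \<le> i'})) *s axis (I' - {i'}) 1)"
    by (simp add: contract_def mult_ac)
  also have "\<dots> = (if i \<in> I then (2 * (-1) ^ card {j\<in>I. j \<le> i}) *s axis (I - {i}) 1 else 0)"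
    by (rule sum_axis_collapse)
  finally show ?thesis
    by (simp add: cscale_vec_eq psgn_def *)
qed

lemma clin_ext_eqI: "clin X \<Longrightarrow> clin X' \<Longrightarrow> (\<And>I. X (axis I 1) = X' (axis I 1)) \<Longrightarrow> X v = X' (v :: 'n::finite ext)"
  by (subst clin_ext_expand[of X], assumption, subst clin_ext_expand[of X'], assumption) simp

lemma vec_expand: "(y :: complex^'n) = (\<Sum>i\<in>UNIV. y $ i *\<^sub>C axis i 1)"
  by (simp add: cscale_vec_eq basis_expansion)

lemma clin_vec_expand: "clin X \<Longrightarrow> X (y :: complex^'n) = (\<Sum>i\<in>UNIV. y $ i *\<^sub>C X (axis i 1))"
  by (subst vec_expand[of y]) (simp add: clin_sum clin_scale)

lemma clin_vec_eqI: "clin X \<Longrightarrow> clin X' \<Longrightarrow> (\<And>i. X (axis i 1) = X' (axis i 1)) \<Longrightarrow> X y = X' (y :: complex^'n)"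
  by (subst clin_vec_expand[of X], assumption, subst clin_vec_expand[of X'], assumption) simp

text \<open>On monomials, inserting the smaller index flips the sign of the larger one and not
  conversely, so exactly one of the two orders picks up a sign. Bilinearity does the rest.\<close>

lemma wedge_anticomm: "wedge y (wedge y' v) = - wedge y' (wedge y v)"
proof -
  have "wedge (axis i 1) (wedge (axis j 1) (axis I 1)) = - wedge (axis j 1) (wedge (axis i 1) (axis I 1))"
    for i j :: 'a and I
  proof -
    have lt: "i < j \<Longrightarrow> (j < i) = False" "j < i \<Longrightarrow> (i < j) = False" by auto
    have ins: "insert i (insert j I) = insert j (insert i I)" by auto
    show ?thesis
      by (cases i j rule: linorder_cases; cases "i \<in> I"; cases "j \<in> I")
        (simp_all add: wedge_axis psgn_insert clin_scale[OF clin_wedge] ins mult.commute[of "psgn i I"]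
          clin_zero[OF clin_wedge] lt)
  qed
  note 1 = this
  note c = clin_compose[OF clin_wedge clin_wedge] and cl = clin_compose[OF clin_wedge clin_wedge_left]
  have 2: "wedge (axis i 1) (wedge (axis j 1) v) = - wedge (axis j 1) (wedge (axis i 1) v)" for i j
    by (rule clin_ext_eqI[OF c clin_uminus[OF c] 1])
  have 3: "wedge y (wedge (axis j 1) v) = - wedge (axis j 1) (wedge y v)" for j
    by (rule clin_vec_eqI[OF clin_wedge_left clin_uminus[OF cl] 2])
  show ?thesis
    by (rule clin_vec_eqI[OF cl clin_uminus[OF clin_wedge_left] 3])
qed

lemma contract_anticomm: "contract y (contract y' v) = - contract y' (contract y v)"
proof -
  have "contract (axis i 1) (contract (axis j 1) (axis I 1)) = - contract (axis j 1) (contract (axis i 1) (axis I 1))"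
    for i j :: 'a and I
  proof -
    have lt: "i < j \<Longrightarrow> (j < i) = False" "j < i \<Longrightarrow> (i < j) = False" by auto
    have rem: "I - {i} - {j} = I - {j} - {i}" by auto
    show ?thesis
      by (cases i j rule: linorder_cases; cases "i \<in> I"; cases "j \<in> I")
        (simp_all add: contract_axis psgn_remove clin_scale[OF clin_contract] clin_minus[OF clin_contract] rem mult.commute[of "psgn i I"]
          clin_zero[OF clin_contract] lt)
  qed
  note 1 = this
  note c = clin_compose[OF clin_contract clin_contract] and cl = clin_compose[OF clin_contract clin_contract_left]
  have 2: "contract (axis i 1) (contract (axis j 1) v) = - contract (axis j 1) (contract (axis i 1) v)" for i j
    by (rule clin_ext_eqI[OF c clin_uminus[OF c] 1])
  have 3: "contract y (contract (axis j 1) v) = - contract (axis j 1) (contract y v)" for j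
    by (rule clin_vec_eqI[OF clin_contract_left clin_uminus[OF cl] 2])
  show ?thesis
    by (rule clin_vec_eqI[OF cl clin_uminus[OF clin_contract_left] 3])
qed

lemma pairing_axis_right [simp]: "pairing y (axis i 1) = y $ i"
  by (auto simp: pairing_def axis_def if_distrib cong: if_cong)

lemma pairing_axis_left [simp]: "pairing (axis i 1) x = x $ i"
  by (auto simp: pairing_def axis_def if_distrib if_distribR cong: if_cong)

lemma pairing_axis: "pairing (axis i 1) (axis j 1) = (if i = j then 1 else 0)"
  by (simp only: pairing_axis_right) (auto simp: axis_def)

lemma clin_pairing_left: "clin (\<lambda>y. pairing y x)"
  by (rule clinI) (simp_all add: pairing_def algebra_simps sum.distrib cscale_complex_def sum_distrib_left)

lemma clin_pairing_right: "clin (\<lambda>x. pairing y x)"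
  by (rule clinI) (simp_all add: pairing_def algebra_simps sum.distrib cscale_complex_def sum_distrib_left)

text \<open>The mixed Clifford relation with its constant -2. On monomials with \<open>i = j\<close>
  one of the two products vanishes and the other yields the constant; for
  \<open>i \<noteq> j\<close> the two products are opposite.\<close>

lemma contract_wedge: "contract x (wedge y v) = (- 2 * pairing y x) *\<^sub>C v - wedge y (contract x v)"
proof -
  have "contract (axis i 1) (wedge (axis j 1) (axis I 1)) =
      (- 2 * pairing (axis j 1) (axis i 1)) *\<^sub>C axis I 1 - wedge (axis j 1) (contract (axis i 1) (axis I 1))"
    for i j :: 'a and I
  proof (cases "i = j")
    case True
    then show ?thesis
      by (auto simp: wedge_axis contract_axis pairing_axis clin_scale[OF clin_wedge] clin_scale[OF clin_contract]
          clin_minus[OF clin_wedge] clin_zero[OF clin_wedge] clin_zero[OF clin_contract] insert_absorb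
          psgn_sq2)
  next
    case False
    have lt: "i < j \<Longrightarrow> (j < i) = False" "j < i \<Longrightarrow> (i < j) = False" by auto
    from False have "insert j I - {i} = insert j (I - {i})" and a: "axis j (1::complex) $ i = 0"
      by (auto simp: axis_def)
    with False show ?thesis
      by (cases i j rule: linorder_cases; cases "i \<in> I"; cases "j \<in> I")
        (simp_all add: wedge_axis contract_axis pairing_axis clin_scale[OF clin_wedge] clin_scale[OF clin_contract]
          clin_zero[OF clin_wedge] clin_zero[OF clin_contract] clin_minus[OF clin_wedge] clin_minus[OF clin_contract]
          psgn_insert psgn_remove mult.commute[of "psgn i I"] mult.left_commute[of _ 2] mult.assoc lt a)
  qed
  note 1 = this
  have l: "clin (\<lambda>y. (- 2 * pairing y x) *\<^sub>C v)" "clin (\<lambda>x. (- 2 * pairing y x) *\<^sub>C v)" for x y :: "complex^'k::finite" and v :: "'m::cvec"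
    by (auto intro!: clinI simp: clin_add[OF clin_pairing_left] clin_add[OF clin_pairing_right]
        clin_scale[OF clin_pairing_left] clin_scale[OF clin_pairing_right] cscale_complex_def algebra_simps cscale_add_left
        cscale_diff_left)
  have 2: "contract (axis i 1) (wedge (axis j 1) v) =
      (- 2 * pairing (axis j 1) (axis i 1)) *\<^sub>C v - wedge (axis j 1) (contract (axis i 1) v)" for i j
    by (rule clin_ext_eqI[OF clin_compose[OF clin_contract clin_wedge]
          clin_minusf[OF clin_cscale[OF clin_id] clin_compose[OF clin_wedge clin_contract]] 1])
  have 3: "contract x (wedge (axis j 1) v) =
      (- 2 * pairing (axis j 1) x) *\<^sub>C v - wedge (axis j 1) (contract x v)" for j
    by (rule clin_vec_eqI[OF clin_contract_left
          clin_minusf[OF l(2) clin_compose[OF clin_wedge clin_contract_left]] 2])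
  show ?thesis
    by (rule clin_vec_eqI[OF clin_compose[OF clin_contract clin_wedge_left]
          clin_minusf[OF l(1) clin_wedge_left] 3])
qed

section \<open>A double complex with one nonzero cohomology group\<close>

text \<open>The sign \<open>(-1)^j\<close> of a total differential, for groups without
  scalars.\<close>

definition sg :: "nat \<Rightarrow> 'a::ab_group_add \<Rightarrow> 'a" where
  "sg j x = (if even j then x else - x)"

lemma sg_simps [simp]: "sg j 0 = 0" "sg j (sg j x) = x" "sg (Suc j) x = - sg j x"
  "sg j (- x) = - sg j x" "sg j x = 0 \<longleftrightarrow> x = 0"
  by (auto simp: sg_def)

lemma sg_add: "sg j (x + y) = sg j x + sg j y"
  by (auto simp: sg_def)

text \<open>\<open>(K j, D)\<close> are two-periodic complexes, exact except for \<open>j = k\<close>, and \<open>dl\<close> resolves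
  the cokernel of \<open>K 1 \<rightarrow> K 0\<close>. The cohomology of \<open>D\<close> on this cokernel is then that of \<open>K k\<close>.\<close>

locale resolved_complex =
  fixes K :: "nat \<Rightarrow> 'a::ab_group_add set" and D :: "'a \<Rightarrow> 'a" and dl :: "nat \<Rightarrow> 'a \<Rightarrow> 'a"
    and n k :: nat and V :: "'v::ab_group_add set" and \<iota> :: "'v \<Rightarrow> 'a"
  assumes K0: "0 \<in> K j"
    and Kadd: "x \<in> K j \<Longrightarrow> y \<in> K j \<Longrightarrow> x + y \<in> K j"
    and Kneg: "x \<in> K j \<Longrightarrow> - x \<in> K j"
    and DK: "x \<in> K j \<Longrightarrow> D x \<in> K j"
    and Dadd: "D (x + y) = D x + D y"
    and dlK: "x \<in> K (Suc j) \<Longrightarrow> dl j x \<in> K j"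
    and dladd: "x \<in> K (Suc j) \<Longrightarrow> y \<in> K (Suc j) \<Longrightarrow> dl j (x + y) = dl j x + dl j y"
    and DD: "x \<in> K j \<Longrightarrow> D (D x) = 0"
    and Ddl: "x \<in> K (Suc j) \<Longrightarrow> D (dl j x) = dl j (D x)"
    and dldl: "x \<in> K (Suc (Suc j)) \<Longrightarrow> dl j (dl (Suc j) x) = 0"
    and dl_exact: "x \<in> K (Suc j) \<Longrightarrow> dl j x = 0 \<Longrightarrow> \<exists>u\<in>K (Suc (Suc j)). x = dl (Suc j) u"
    and Kn: "j > n \<Longrightarrow> x \<in> K j \<Longrightarrow> x = 0"
    and V0: "0 \<in> V" and Vadd: "v \<in> V \<Longrightarrow> v' \<in> V \<Longrightarrow> v + v' \<in> V"
    and \<iota>K: "v \<in> V \<Longrightarrow> \<iota> v \<in> K k" and D\<iota>: "v \<in> V \<Longrightarrow> D (\<iota> v) = 0"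
    and \<iota>add: "\<iota> (v + v') = \<iota> v + \<iota> v'"
    and D_exact: "j \<noteq> k \<Longrightarrow> x \<in> K j \<Longrightarrow> D x = 0 \<Longrightarrow> \<exists>u\<in>K j. x = D u"
    and D_exact_k: "x \<in> K k \<Longrightarrow> D x = 0 \<Longrightarrow> \<exists>v\<in>V. \<exists>u\<in>K k. x = D u + \<iota> v"
    and \<iota>_inj: "v \<in> V \<Longrightarrow> u \<in> K k \<Longrightarrow> \<iota> v = D u \<Longrightarrow> v = 0"
begin

lemma D0 [simp]: "D 0 = 0" using Dadd[of 0 0] by simp
lemma Dneg [simp]: "D (- x) = - D x" using Dadd[of x "- x"] by (simp add: eq_neg_iff_add_eq_0 add.commute)
lemma dl0 [simp]: "dl j 0 = 0" using dladd[OF K0 K0, of j] by simp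
lemma dlneg: "x \<in> K (Suc j) \<Longrightarrow> dl j (- x) = - dl j x"
  using dladd[of x j "- x"] Kneg[of x] by (simp add: eq_neg_iff_add_eq_0 add.commute)
lemma Kdiff: "x \<in> K j \<Longrightarrow> y \<in> K j \<Longrightarrow> x - y \<in> K j"
  using Kadd[of x j "- y"] Kneg[of y j] by simp
lemma Ksg: "x \<in> K j \<Longrightarrow> sg i x \<in> K j" by (simp add: sg_def Kneg)
lemma Dsg: "D (sg i x) = sg i (D x)" by (simp add: sg_def)
lemma dlsg: "x \<in> K (Suc j) \<Longrightarrow> dl j (sg i x) = sg i (dl j x)" by (simp add: sg_def dlneg)

text \<open>The total complex. Arbitrary families are in fact finite ones, as the columns beyond
  \<open>n\<close> vanish.\<close>

definition C :: "(nat \<Rightarrow> 'a) set" where "C = {T. \<forall>j. T j \<in> K j}"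

text \<open>The sign makes the mixed terms of the square cancel, as \<open>D\<close> and
  \<open>dl\<close> commute. Since \<open>D\<close> preserves the column and has no degree, an
  element of the total complex fills all columns at once and not just one antidiagonal.\<close>

definition dd :: "(nat \<Rightarrow> 'a) \<Rightarrow> nat \<Rightarrow> 'a" where "dd T j = sg j (D (T j)) + dl j (T (Suc j))"

definition sgl :: "nat \<Rightarrow> 'a \<Rightarrow> nat \<Rightarrow> 'a" where "sgl j x i = (if i = j then x else 0)"

lemma CD: "T \<in> C \<Longrightarrow> T j \<in> K j" by (simp add: C_def)
lemma C0: "0 \<in> C" by (simp add: C_def K0)
lemma Cadd: "T \<in> C \<Longrightarrow> U \<in> C \<Longrightarrow> T + U \<in> C" by (simp add: C_def Kadd)
lemma Cdiff: "T \<in> C \<Longrightarrow> U \<in> C \<Longrightarrow> T - U \<in> C" by (simp add: C_def Kdiff)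
lemma Csgl: "x \<in> K j \<Longrightarrow> sgl j x \<in> C" by (simp add: C_def sgl_def K0)
lemma Cdd: "T \<in> C \<Longrightarrow> dd T \<in> C" by (simp add: C_def dd_def Kadd Ksg DK dlK)

lemma dd0 [simp]: "dd 0 = 0" by (simp add: fun_eq_iff dd_def)
lemma dd_add: "T \<in> C \<Longrightarrow> U \<in> C \<Longrightarrow> dd (T + U) = dd T + dd U"
  by (simp add: fun_eq_iff dd_def CD Dadd dladd sg_add)
lemma dd_diff: "T \<in> C \<Longrightarrow> U \<in> C \<Longrightarrow> dd (T - U) = dd T - dd U"
  using dd_add[of "T - U" U] by (simp add: Cdiff)

lemma dd_dd: "T \<in> C \<Longrightarrow> dd (dd T) = 0"
proof
  fix j assume T: "T \<in> C"
  have "dd (dd T) j = sg j (D (sg j (D (T j)))) + sg j (D (dl j (T (Suc j))))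
      + (dl j (sg (Suc j) (D (T (Suc j)))) + dl j (dl (Suc j) (T (Suc (Suc j)))))"
    unfolding dd_def[of "dd T"] dd_def[of T] Dadd sg_add
    using CD[OF T] by (subst dladd) (auto simp: Ksg DK dlK Kneg)
  also have "\<dots> = 0"
    using CD[OF T] by (simp add: Dsg DD[OF CD[OF T]] Ddl dldl dlneg dlsg DK Ksg)
  finally show "dd (dd T) j = 0 j" by simp
qed

lemma dd_sgl: "dd (sgl j x) i = (if i = j then sg j (D x) else if Suc i = j then dl i x else 0)"
  by (auto simp: dd_def sgl_def)

text \<open>Below column \<open>k\<close> the topmost component of a cycle is a
  \<open>D\<close>-cycle, because nothing above feeds into it; exactness of \<open>D\<close> removes
  it and lowers the bound \<open>m\<close>.\<close>

lemma bounded_exact: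
  assumes "T \<in> C" "dd T = 0" "m \<le> k" "\<And>j. j \<ge> m \<Longrightarrow> T j = 0"
  shows "\<exists>u\<in>C. T = dd u"
  using assms
proof (induction m arbitrary: T)
  case 0
  then have "T = dd 0" by (simp add: fun_eq_iff)
  then show ?case using C0 by blast
next
  case (Suc m)
  have "dd T m = 0" using Suc.prems by simp
  then have "D (T m) = 0" using Suc.prems(4)[of "Suc m"] by (simp add: dd_def)
  then obtain w where w: "w \<in> K m" "T m = D w"
    using D_exact[of m "T m"] CD[OF Suc.prems(1)] Suc.prems(3) by auto
  define T' where "T' = T - dd (sgl m (sg m w))"
  have s: "sgl m (sg m w) \<in> C" using w by (simp add: Csgl Ksg)
  have "\<exists>u\<in>C. T' = dd u"
  proof (rule Suc.IH)
    show "T' \<in> C" unfolding T'_def by (intro Cdiff Suc.prems Cdd s)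
    show "dd T' = 0" unfolding T'_def using Suc.prems s by (simp add: dd_diff Cdd dd_dd zero_fun_def)
    show "m \<le> k" using Suc.prems by simp
    show "T' j = 0" if "j \<ge> m" for j
      using that Suc.prems(4)[of j] w by (cases "j = m") (auto simp: T'_def dd_sgl Dsg)
  qed
  then obtain u where u: "u \<in> C" "T' = dd u" by blast
  then have "T = dd (u + sgl m (sg m w))" using s by (simp add: dd_add T'_def algebra_simps)
  then show ?case using Cadd[OF u(1) s] by blast
qed

text \<open>The mirror image of \<open>bounded_exact\<close>: the lowest component is a
  \<open>dl\<close>-cycle, and exactness of \<open>dl\<close> removes it at the expense of the next
  column. The bound \<open>m \<ge> 1\<close> matters, as \<open>dl\<close> resolves a cokernel in
  column 0. The process ends beyond column \<open>n\<close>.\<close>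

lemma exact_from:
  assumes "T \<in> C" "dd T = 0" "m \<ge> 1" "\<And>j. j < m \<Longrightarrow> T j = 0"
  shows "\<exists>u\<in>C. T = dd u"
  using assms
proof (induction "Suc n - m" arbitrary: T m)
  case 0
  then have "T j = 0" for j using Kn[of j "T j"] CD[OF 0(2), of j] by (cases "j < m") auto
  then have "T = dd 0" by (simp add: fun_eq_iff)
  then show ?case using C0 by blast
next
  case (Suc d)
  then obtain m' where m': "m = Suc m'" by (cases m) auto
  have "dd T m' = 0" using Suc.prems by simp
  then have "dl m' (T m) = 0" using Suc.prems(4)[of m'] m' by (simp add: dd_def)
  then obtain w where w: "w \<in> K (Suc m)" "T m = dl m w"
    using dl_exact[of "T m" m'] CD[OF Suc.prems(1), of m] m' by auto
  define T' where "T' = T - dd (sgl (Suc m) w)"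
  have s: "sgl (Suc m) w \<in> C" using w by (simp add: Csgl)
  have "\<exists>u\<in>C. T' = dd u"
  proof (rule Suc.hyps(1)[of "Suc m"])
    show "d = Suc n - Suc m" using Suc.hyps(2) by simp
    show "T' \<in> C" unfolding T'_def by (intro Cdiff Suc.prems Cdd s)
    show "dd T' = 0" unfolding T'_def using Suc.prems s by (simp add: dd_diff Cdd dd_dd zero_fun_def)
    show "T' j = 0" if "j < Suc m" for j
      using that Suc.prems(4)[of j] w by (cases "j = m") (auto simp: T'_def dd_sgl)
  qed simp
  then obtain u where u: "u \<in> C" "T' = dd u" by blast
  then have "T = dd (u + sgl (Suc m) w)" using s by (simp add: dd_add T'_def algebra_simps)
  then show ?case using Cadd[OF u(1) s] by blast
qed

text \<open>Columns are treated from the far end down to \<open>k + 1\<close>, each by exactness of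
  \<open>D\<close>. The correction in column \<open>m\<close> changes the boundary only in columns
  \<open>m\<close> and \<open>m - 1\<close>, so the columns already treated stay as they
  are.\<close>

lemma kill_above:
  assumes T: "T \<in> C" "dd T = 0"
  shows "\<exists>u\<in>C. \<forall>j>k. T j = dd u j"
proof -
  have "\<exists>u\<in>C. \<forall>j>k + i. T j = dd u j" if "i \<le> n" for i
    using that
  proof (induction i rule: inc_induct)
    case base
    have "\<forall>j>k + n. T j = dd 0 j" using Kn[OF _ CD[OF T(1)]] by simp
    then show ?case using C0 by blast
  next
    case (step i)
    then obtain u where u: "u \<in> C" "\<forall>j>k + Suc i. T j = dd u j" by blast
    define m S where "m = Suc (k + i)" and "S = T - dd u"
    have S: "S \<in> C" "dd S = 0" using T u by (simp_all add: S_def Cdiff Cdd dd_diff dd_dd)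
    have "dd S m = 0" using S by simp
    moreover have "S (Suc m) = 0" using u by (simp add: S_def m_def)
    ultimately have "D (S m) = 0" by (simp add: dd_def)
    then obtain w where w: "w \<in> K m" "S m = D w"
      using D_exact[of m "S m"] CD[OF S(1)] by (auto simp: m_def)
    have s: "sgl m (sg m w) \<in> C" using w by (simp add: Csgl Ksg)
    have "T j = dd (u + sgl m (sg m w)) j" if "j > k + i" for j
    proof (cases "j = m")
      case True
      then show ?thesis using w s u by (simp add: dd_add dd_sgl Dsg S_def algebra_simps)
    next
      case False
      then show ?thesis using that u s by (simp add: dd_add dd_sgl m_def)
    qed
    then show ?case using Cadd[OF u(1) s] by blast
  qed
  from this[of 0] show ?thesis by simp
qed

text \<open>A primitive may be changed by total boundaries. As its own boundary vanishes above
  column \<open>k\<close>, its topmost component there is a \<open>D\<close>-cycle and can be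
  subtracted off.\<close>

lemma bounded_primitive:
  assumes y: "y \<in> C" "\<forall>j>k. dd y j = 0"
  shows "\<exists>y'\<in>C. (\<forall>j>k. y' j = 0) \<and> dd y' = dd y"
proof -
  have "\<exists>y'\<in>C. (\<forall>j>k + i. y' j = 0) \<and> dd y' = dd y" if "i \<le> n" for i
    using that
  proof (induction i rule: inc_induct)
    case base
    have "\<forall>j>k + n. y j = 0" using Kn[OF _ CD[OF y(1)]] by simp
    then show ?case using y by blast
  next
    case (step i)
    then obtain y' where u: "y' \<in> C" "\<forall>j>k + Suc i. y' j = 0" "dd y' = dd y" by blast
    define m where "m = Suc (k + i)"
    have "dd y' m = 0" using u y by (simp add: m_def)
    moreover have "y' (Suc m) = 0" using u by (simp add: m_def)
    ultimately have "D (y' m) = 0" by (simp add: dd_def)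
    then obtain w where w: "w \<in> K m" "y' m = D w"
      using D_exact[of m "y' m"] CD[OF u(1)] by (auto simp: m_def)
    have s: "sgl m (sg m w) \<in> C" using w by (simp add: Csgl Ksg)
    define z where "z = y' - dd (sgl m (sg m w))"
    have "z \<in> C" "dd z = dd y" using u s by (simp_all add: z_def Cdiff Cdd dd_diff dd_dd)
    moreover have "z j = 0" if "j > k + i" for j
    proof (cases "j = m")
      case True
      then show ?thesis using w by (simp add: dd_sgl Dsg z_def)
    next
      case False
      then show ?thesis using that u s by (simp add: dd_sgl m_def z_def)
    qed
    ultimately show ?case by blast
  qed
  from this[of 0] show ?thesis by simp
qed

text \<open>The correspondence between classes of the cokernel and \<open>V\<close>:
  \<open>x\<close> is extended to a total cycle \<open>T\<close> which, up to a boundary, has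
  nothing above column \<open>k\<close> and \<open>\<iota> v\<close> in column \<open>k\<close>. It
  is a relation because \<open>T\<close> involves choices; together, \<open>R_total\<close>,
  \<open>R_surj\<close>, \<open>R_add\<close> and \<open>R_zero_iff\<close> make it an isomorphism
  on cohomology.\<close>

definition R :: "'a \<Rightarrow> 'v \<Rightarrow> bool" where
  "R x v \<longleftrightarrow> v \<in> V \<and> (\<exists>T\<in>C. dd T = 0 \<and> T 0 = x \<and>
     (\<exists>u\<in>C. (\<forall>j>k. T j = dd u j) \<and> T k = dd u k + \<iota> v))"

lemma R_K: "R x v \<Longrightarrow> x \<in> K 0" by (auto simp: R_def CD)
lemma R_V: "R x v \<Longrightarrow> v \<in> V" by (auto simp: R_def)

lemma R_cycle: "R x v \<Longrightarrow> \<exists>y\<in>K 1. D x = dl 0 y"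
proof -
  assume "R x v"
  then obtain T where T: "T \<in> C" "dd T = 0" "T 0 = x" by (auto simp: R_def)
  have "D x + dl 0 (T (Suc 0)) = 0" using fun_cong[OF T(2), of 0] T(3) by (simp add: dd_def sg_def)
  then have "D x = dl 0 (- T (Suc 0))"
    using CD[OF T(1), of "Suc 0"] by (simp add: dlneg eq_neg_iff_add_eq_0)
  then show ?thesis using CD[OF T(1), of "Suc 0"] Kneg by auto
qed

lemma R_total:
  assumes x: "x \<in> K 0" "y \<in> K 1" "D x = dl 0 y"
  shows "\<exists>v. R x v"
proof -
  have "\<exists>f. f 0 = x \<and> (\<forall>j. (f j \<in> K j \<and> (\<exists>z\<in>K (Suc j). D (f j) = dl j z)) \<and>
      sg j (D (f j)) + dl j (f (Suc j)) = 0)"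
  proof -
    have "\<exists>f. (\<forall>j. (f j \<in> K j \<and> (\<exists>z\<in>K (Suc j). D (f j) = dl j z) \<and> (j = 0 \<longrightarrow> f j = x)) \<and>
      sg j (D (f j)) + dl j (f (Suc j)) = 0)"
    \<comment> \<open>The invariant that \<open>D (f j)\<close> lies in the image of
      \<open>dl\<close> supplies the next term. It persists because \<open>dl\<close> kills
      \<open>D\<close> of that next term, and \<open>dl\<close> is exact there.\<close>
    proof (rule dependent_nat_choice)
      show "\<exists>y. y \<in> K 0 \<and> (\<exists>z\<in>K (Suc 0). D y = dl 0 z) \<and> ((0::nat) = 0 \<longrightarrow> y = x)"
        using x by auto
    next
      fix a j assume "a \<in> K j \<and> (\<exists>z\<in>K (Suc j). D a = dl j z) \<and> (j = 0 \<longrightarrow> a = x)"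
      then obtain z where a: "a \<in> K j" and z: "z \<in> K (Suc j)" "D a = dl j z" by blast
      define b where "b = - sg j z"
      have b: "b \<in> K (Suc j)" using z by (simp add: b_def Kneg Ksg)
      have ab: "sg j (D a) + dl j b = 0"
        using z by (simp add: b_def dlneg dlsg Ksg)
      have "dl j (D z) = 0" using Ddl[OF z(1)] z(2) DD[OF a] by simp
      then have "dl j (D b) = 0" using z by (simp add: b_def dlneg Dsg dlsg Ksg DK)
      then have "\<exists>w\<in>K (Suc (Suc j)). D b = dl (Suc j) w" using dl_exact[OF DK[OF b]] by blast
      with b ab show "\<exists>b. (b \<in> K (Suc j) \<and> (\<exists>z\<in>K (Suc (Suc j)). D b = dl (Suc j) z) \<and> (Suc j = 0 \<longrightarrow> b = x)) \<and>
          sg j (D a) + dl j b = 0" by auto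
    qed
    then show ?thesis by blast
  qed
  then obtain T where T: "T 0 = x" "\<And>j. T j \<in> K j" "\<And>j. sg j (D (T j)) + dl j (T (Suc j)) = 0"
    by blast
  have TC: "T \<in> C" "dd T = 0" using T by (auto simp: C_def dd_def fun_eq_iff)
  obtain u where u: "u \<in> C" "\<forall>j>k. T j = dd u j" using kill_above[OF TC] by blast
  \<comment> \<open>With everything above column \<open>k\<close> removed, the component in column
    \<open>k\<close> is a \<open>D\<close>-cycle, to which the description of its cohomology by
    \<open>V\<close> applies.\<close>
  define S where "S = T - dd u"
  have S: "S \<in> C" "dd S = 0" using TC u by (simp_all add: S_def Cdiff Cdd dd_diff dd_dd)
  have "dd S k = 0" using S by simp
  moreover have "S (Suc k) = 0" using u by (simp add: S_def)
  ultimately have "D (S k) = 0" by (simp add: dd_def)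
  then obtain v w where v: "v \<in> V" "w \<in> K k" "S k = D w + \<iota> v"
    using D_exact_k[of "S k"] CD[OF S(1)] by blast
  have s: "sgl k (sg k w) \<in> C" using v by (simp add: Csgl Ksg)
  have "T j = dd (u + sgl k (sg k w)) j" if "j > k" for j
    using that u s by (simp add: dd_add dd_sgl)
  moreover have "T k = dd (u + sgl k (sg k w)) k + \<iota> v"
    using v u s by (simp add: dd_add dd_sgl Dsg S_def algebra_simps)
  ultimately have "R x v" using v T TC Cadd[OF u(1) s] unfolding R_def by blast
  then show ?thesis ..
qed

text \<open>The zigzag starts from \<open>\<iota> v\<close> in column \<open>k\<close> and descends:
  \<open>dl\<close> of the last component is a \<open>D\<close>-cycle in a column below
  \<open>k\<close>, hence a \<open>D\<close>-boundary there.\<close>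

lemma R_surj:
  assumes v: "v \<in> V"
  shows "\<exists>x. R x v"
proof -
  have "\<exists>T\<in>C. (\<forall>j>k. T j = 0) \<and> T k = \<iota> v \<and> (\<forall>j\<ge>i. dd T j = 0)" if "i \<le> k" for i
    using that
  proof (induction i rule: inc_induct)
    case base
    have "sgl k (\<iota> v) \<in> C" using v by (simp add: Csgl \<iota>K)
    moreover have "\<forall>j>k. sgl k (\<iota> v) j = 0" "sgl k (\<iota> v) k = \<iota> v" by (auto simp: sgl_def)
    moreover have "\<forall>j\<ge>k. dd (sgl k (\<iota> v)) j = 0" using v by (auto simp: dd_sgl D\<iota>)
    ultimately show ?case by blast
  next
    case (step i)
    then obtain T where T: "T \<in> C" "\<forall>j>k. T j = 0" "T k = \<iota> v" "\<forall>j\<ge>Suc i. dd T j = 0" by blast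
    have "dd T (Suc i) = 0" using T by simp
    then have "sg (Suc i) (D (T (Suc i))) = - dl (Suc i) (T (Suc (Suc i)))"
      by (simp add: dd_def eq_neg_iff_add_eq_0)
    then have "D (T (Suc i)) = sg i (dl (Suc i) (T (Suc (Suc i))))"
      by (auto simp: sg_def split: if_splits)
    then have "D (dl i (T (Suc i))) = 0"
      using CD[OF T(1), of "Suc i"] CD[OF T(1), of "Suc (Suc i)"] by (simp add: Ddl dlsg dlK dldl)
    then obtain w where w: "w \<in> K i" "dl i (T (Suc i)) = D w"
      using D_exact[of i "dl i (T (Suc i))"] CD[OF T(1), of "Suc i"] dlK step.hyps by auto
    define T' where "T' = (\<lambda>j. if j = i then - sg i w else T j)"
    have "T' \<in> C" using T w by (simp add: C_def T'_def Kneg Ksg)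
    moreover have "\<forall>j>k. T' j = 0" "T' k = \<iota> v" using T step.hyps by (auto simp: T'_def)
    moreover have "dd T' j = 0" if "j \<ge> i" for j
    proof (cases "j = i")
      case True
      then show ?thesis using w by (simp add: dd_def T'_def Dsg)
    next
      case False
      then have "dd T' j = dd T j" using that by (simp add: dd_def T'_def)
      then show ?thesis using False that T by simp
    qed
    ultimately show ?case by blast
  qed
  from this[of 0] obtain T where T: "T \<in> C" "\<forall>j>k. T j = 0" "T k = \<iota> v" "dd T = 0"
    by (auto simp: fun_eq_iff)
  have "R (T 0) v" unfolding R_def
    by (intro conjI bexI[OF _ T(1)] bexI[OF _ C0]) (use T v in auto)
  then show ?thesis ..
qed

lemma R_add:
  assumes "R x v" "R y v'"
  shows "R (x + y) (v + v')"
proof -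
  from assms obtain T u T' u' where
    T: "T \<in> C" "dd T = 0" "T 0 = x" "u \<in> C" "\<forall>j>k. T j = dd u j" "T k = dd u k + \<iota> v" and
    T': "T' \<in> C" "dd T' = 0" "T' 0 = y" "u' \<in> C" "\<forall>j>k. T' j = dd u' j" "T' k = dd u' k + \<iota> v'"
    unfolding R_def by blast
  have "T + T' \<in> C" "dd (T + T') = 0" "(T + T') 0 = x + y" "u + u' \<in> C"
    "\<forall>j>k. (T + T') j = dd (u + u') j" "(T + T') k = dd (u + u') k + \<iota> (v + v')"
    using T T' by (auto simp: dd_add Cadd \<iota>add)
  then show ?thesis unfolding R_def using assms R_V Vadd by blast
qed

text \<open>If \<open>v = 0\<close>, then \<open>T\<close> is, up to a boundary, supported below
  column \<open>k\<close> and so itself a boundary. Conversely, a trivial \<open>x\<close> makes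
  \<open>T - dd u\<close> a total boundary; a primitive supported in columns up to \<open>k\<close>
  then exhibits \<open>\<iota> v\<close> as a \<open>D\<close>-boundary.\<close>

lemma R_zero_iff:
  assumes "R x v"
  shows "v = 0 \<longleftrightarrow> (\<exists>u0\<in>K 0. \<exists>u1\<in>K 1. x = D u0 + dl 0 u1)"
proof
  from assms obtain T u where
    T: "T \<in> C" "dd T = 0" "T 0 = x" and u: "u \<in> C" "\<forall>j>k. T j = dd u j" "T k = dd u k + \<iota> v"
    unfolding R_def by blast
  {
    assume "v = 0"
    then have i0: "\<iota> v = 0" using \<iota>add[of 0 0] by simp
    define S where "S = T - dd u"
    have S: "S \<in> C" "dd S = 0" using T u by (simp_all add: S_def Cdiff Cdd dd_diff dd_dd)
    have "S j = 0" if "j \<ge> k" for j using that u i0 by (cases "j = k") (auto simp: S_def)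
    then obtain w where w: "w \<in> C" "S = dd w" using bounded_exact[OF S order_refl] by blast
    then have "T = dd (u + w)" using u by (simp add: dd_add S_def algebra_simps)
    then have "x = D ((u + w) 0) + dl 0 ((u + w) 1)" using T by (simp add: dd_def sg_def)
    then show "\<exists>u0\<in>K 0. \<exists>u1\<in>K 1. x = D u0 + dl 0 u1"
      using CD[OF Cadd[OF u(1) w(1)]] by blast
  next
    assume "\<exists>u0\<in>K 0. \<exists>u1\<in>K 1. x = D u0 + dl 0 u1"
    then obtain u0 u1 where x: "u0 \<in> K 0" "u1 \<in> K 1" "x = D u0 + dl 0 u1" by blast
    define w where "w = sgl 0 u0 + sgl 1 u1"
    have w: "w \<in> C" using x by (simp add: w_def Cadd Csgl)
    have "(T - dd w) 0 = 0" using T x by (simp add: w_def dd_def sgl_def sg_def)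
    moreover have S: "T - dd w \<in> C" "dd (T - dd w) = 0"
      using T w by (simp_all add: Cdiff Cdd dd_diff dd_dd)
    ultimately obtain w' where w': "w' \<in> C" "T - dd w = dd w'"
      using exact_from[OF S, of 1] by auto
    define y where "y = w + w' - u"
    have y: "y \<in> C" "dd y = T - dd u" using w w' u
      by (simp_all add: y_def Cadd Cdiff dd_add dd_diff algebra_simps)
    have "\<forall>j>k. dd y j = 0" using u y by simp
    then obtain y' where y': "y' \<in> C" "\<forall>j>k. y' j = 0" "dd y' = dd y"
      using bounded_primitive[OF y(1)] by blast
    have "\<iota> v = dd y' k" using y y' u by simp
    also have "\<dots> = D (sg k (y' k))" using y'(2) by (simp add: dd_def Dsg)
    finally show "v = 0" using \<iota>_inj[OF R_V[OF assms]] CD[OF y'(1)] Ksg by blast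
  }
qed

text \<open>Naturality. Two instances matter later: scalar multiplication and the action of group
  elements.\<close>

lemma R_map:
  assumes "R x v"
    and g: "\<And>j x. x \<in> K j \<Longrightarrow> g x \<in> K j" "\<And>x y. g (x + y) = g x + g y"
      "\<And>j x. x \<in> K j \<Longrightarrow> D (g x) = g (D x)" "\<And>j x. x \<in> K (Suc j) \<Longrightarrow> dl j (g x) = g (dl j x)"
    and h: "h v \<in> V" "\<iota> (h v) = g (\<iota> v)"
  shows "R (g x) (h v)"
proof -
  from assms obtain T u where
    T: "T \<in> C" "dd T = 0" "T 0 = x" and u: "u \<in> C" "\<forall>j>k. T j = dd u j" "T k = dd u k + \<iota> v"
    unfolding R_def by blast
  have g0: "g 0 = 0" using g(2)[of 0 0] by simp
  have gneg: "g (- x) = - g x" for x using g(2)[of x "- x"] g0 by (simp add: eq_neg_iff_add_eq_0 add.commute)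
  have gdd: "dd (\<lambda>j. g (U j)) j = g (dd U j)" if "U \<in> C" for U j
    using g(2) g(3)[OF CD[OF that]] g(4)[OF CD[OF that]] by (simp add: dd_def sg_def gneg)
  have "(\<lambda>j. g (T j)) \<in> C" "(\<lambda>j. g (u j)) \<in> C" using T u g by (auto simp: C_def)
  moreover have "dd (\<lambda>j. g (T j)) = 0" using gdd[OF T(1)] T g0 by (simp add: fun_eq_iff)
  moreover have "\<forall>j>k. g (T j) = dd (\<lambda>j. g (u j)) j" "g (T k) = dd (\<lambda>j. g (u j)) k + \<iota> (h v)"
    using u gdd[OF u(1)] g h by auto
  ultimately show ?thesis
    unfolding R_def using T(3) h(1)
    by (intro conjI bexI[of _ "\<lambda>j. g (T j)"] bexI[of _ "\<lambda>j. g (u j)"]) auto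
qed

end

lemma cvec_double_eq_0: "x + x = 0 \<Longrightarrow> x = (0 :: 'a::cvec)"
proof -
  assume "x + x = 0"
  then have "(1 / 2) *\<^sub>C (x + x) = 0" by simp
  then show "x = 0" by (simp add: cscale_add_right flip: cscale_add_left)
qed

lemma cvec_eq_uminus: "x = - x \<Longrightarrow> x = (0 :: 'a::cvec)"
  by (rule cvec_double_eq_0) (metis add.right_inverse)

lemma sorted_list_of_set_Min:
  "finite I \<Longrightarrow> m \<in> I \<Longrightarrow> (\<And>j. j \<in> I \<Longrightarrow> m \<le> j) \<Longrightarrow>
    sorted_list_of_set I = m # sorted_list_of_set (I - {m})"
  by (metis Min_eqI empty_iff sorted_list_of_set_nonempty)

text \<open>An exterior algebra identity for arbitrary anticommuting operators. For
  \<open>Z i = wedge (g *v axis i 1)\<close> it expresses that \<open>ext_act g\<close> is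
  multiplicative.\<close>

lemma foldr_anticommuting:
  fixes Z :: "'n::{finite,linorder} \<Rightarrow> 'a::cvec \<Rightarrow> 'a"
  assumes lin: "\<And>i. clin (Z i)" and anti: "\<And>i j v. Z i (Z j v) = - Z j (Z i v)"
  shows "Z i (foldr Z (sorted_list_of_set I) u) =
    (if i \<in> I then 0 else psgn i I *\<^sub>C foldr Z (sorted_list_of_set (insert i I)) u)"
proof (induction "card I" arbitrary: I rule: less_induct)
  case less
  have sq: "Z i (Z i v) = 0" for v using anti[of i i v] by (rule cvec_eq_uminus)
  show ?case
  proof (cases "I = {}")
    case True
    then show ?thesis by (simp add: psgn_def)
  next
    case False
    define m I' where "m = Min I" and "I' = I - {m}"
    have m: "m \<in> I" "\<And>j. j \<in> I \<Longrightarrow> m \<le> j" using False by (auto simp: m_def)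
    have F: "foldr Z (sorted_list_of_set I) u = Z m (foldr Z (sorted_list_of_set I') u)"
      by (subst sorted_list_of_set_Min[of I m]) (use m in \<open>auto simp: I'_def\<close>)
    consider "i = m" | "i < m" | "m < i" by fastforce
    then show ?thesis
    proof cases
      case 1
      then show ?thesis using m F sq by simp
    next
      case 2
      then have i: "i \<notin> I" using m(2)[of i] by auto
      have "{j \<in> I. j < i} = {}" using 2 m(2) by fastforce
      then have p: "psgn i I = 1" by (simp only: psgn_def card.empty power_0)
      have "sorted_list_of_set (insert i I) = i # sorted_list_of_set (insert i I - {i})"
        by (rule sorted_list_of_set_Min) (use 2 m(2) in fastforce)+
      then show ?thesis using i p by simp
    next
      \<comment> \<open>Passing the minimum costs a sign, and so does the removal of the minimum
        from \<open>I\<close> in \<open>psgn\<close>.\<close>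
      case 3
      have "card I' < card I" unfolding I'_def by (rule card_Diff1_less[OF finite m(1)])
      then have IH: "Z i (foldr Z (sorted_list_of_set I') u) =
          (if i \<in> I' then 0 else psgn i I' *\<^sub>C foldr Z (sorted_list_of_set (insert i I')) u)"
        by (rule less)
      have p: "psgn i I' = - psgn i I" using 3 m by (simp add: I'_def psgn_remove)
      have "sorted_list_of_set (insert i I) = m # sorted_list_of_set (insert i I - {m})"
        by (rule sorted_list_of_set_Min) (use 3 m in auto)
      moreover have "insert i I - {m} = insert i I'" using 3 by (auto simp: I'_def)
      ultimately have "foldr Z (sorted_list_of_set (insert i I)) u =
          Z m (foldr Z (sorted_list_of_set (insert i I')) u)" by simp
      moreover have "i \<in> I \<longleftrightarrow> i \<in> I'" using 3 by (auto simp: I'_def)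
      ultimately show ?thesis
        unfolding F anti[of i m] IH using p
        by (simp add: clin_scale[OF lin] clin_minus[OF lin] clin_zero[OF lin]
            del: sorted_list_of_set.sorted_key_list_of_set_insert_remove
              sorted_list_of_set.sorted_key_list_of_set_insert)
    qed
  qed
qed

lemma axis_eq_foldr_wedge:
  "axis I 1 = foldr (\<lambda>i. wedge (axis i 1)) (sorted_list_of_set I) (axis {} 1)"
proof (induction "card I" arbitrary: I rule: less_induct)
  case less
  show ?case
  proof (cases "I = {}")
    case False
    define m I' where "m = Min I" and "I' = I - {m}"
    have m: "m \<in> I" "\<And>j. j \<in> I \<Longrightarrow> m \<le> j" using False by (auto simp: m_def)
    have "{j \<in> I'. j < m} = {}" using m(2) by (fastforce simp: I'_def)
    then have p: "psgn m I' = 1" unfolding psgn_def by (simp only: card.empty power_0)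
    have "card I' < card I" unfolding I'_def by (rule card_Diff1_less[OF finite m(1)])
    then have IH: "axis I' 1 = foldr (\<lambda>i. wedge (axis i 1)) (sorted_list_of_set I') (axis {} 1)"
      by (rule less)
    have "sorted_list_of_set I = m # sorted_list_of_set I'"
      unfolding I'_def by (rule sorted_list_of_set_Min) (use m in auto)
    then have "foldr (\<lambda>i. wedge (axis i 1)) (sorted_list_of_set I) (axis {} 1) = wedge (axis m 1) (axis I' 1)"
      by (simp flip: IH)
    then show ?thesis using m p by (simp add: wedge_axis I'_def insert_absorb)
  qed simp
qed

text \<open>Monomials are iterated wedges, so the exterior algebra is generated from its unit by
  wedging with basis vectors.\<close>

lemma ext_induct [case_names unit wedge add scale]:
  fixes v :: "'n::{finite,linorder} ext"
  assumes unit: "Q (axis {} 1)" and w: "\<And>i v. Q v \<Longrightarrow> Q (wedge (axis i 1) v)"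
    and add: "\<And>v v'. Q v \<Longrightarrow> Q v' \<Longrightarrow> Q (v + v')" and sc: "\<And>z v. Q v \<Longrightarrow> Q (z *\<^sub>C v)"
  shows "Q v"
proof -
  have f: "Q (foldr (\<lambda>i. wedge (axis i 1)) l (axis {} 1))" for l
    by (induction l) (auto intro: unit w)
  have "Q (\<Sum>I\<in>A. v $ I *\<^sub>C axis I 1)" if "finite A" for A
    using that
  proof induction
    case empty
    show ?case using sc[OF unit, of 0] by simp
  next
    case (insert I A)
    then show ?case using f by (simp add: add sc axis_eq_foldr_wedge[of I])
  qed
  then show ?thesis by (subst ext_expand) simp
qed

section \<open>Functoriality of the exterior algebra\<close>

lemma clin_ext_act: "clin (ext_act g)"
  unfolding ext_act_def
  by (rule clinI)
    (simp_all add: cscale_vec_eq algebra_simps vec.scale_left_distrib sum.distrib vec.scale_sum_right vec.scale_scale)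

lemma ext_act_axis:
  "ext_act g (axis I 1) = foldr (\<lambda>i. wedge (g *v axis i 1)) (sorted_list_of_set I) (axis {} 1)"
proof -
  have "ext_act g (axis I 1) = (\<Sum>I'\<in>UNIV. if I' = I then
      foldr (\<lambda>i. wedge (g *v axis i 1)) (sorted_list_of_set I') (axis {} 1) else 0)"
    unfolding ext_act_def by (intro sum.cong) (auto simp: axis_def)
  then show ?thesis by simp
qed

lemma ext_act_unit [simp]: "ext_act g (axis {} 1) = axis {} 1"
  by (simp add: ext_act_axis)

lemma clin_matrix_vector: "clin (\<lambda>y. (g :: complex^'n^'m) *v y)"
  by (rule clinI) (simp_all add: matrix_vector_right_distrib cscale_vec_eq vec.scale)

lemma ext_act_wedge: "ext_act g (wedge y v) = wedge (g *v y) (ext_act g v)"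
proof -
  have 1: "ext_act g (wedge (axis i 1) (axis I 1)) = wedge (g *v axis i 1) (ext_act g (axis I 1))" for i I
    unfolding wedge_axis ext_act_axis
    by (subst foldr_anticommuting[of "\<lambda>i. wedge (g *v axis i 1)"])
      (auto simp: clin_wedge intro: wedge_anticomm clin_zero[OF clin_ext_act]
         simp: clin_scale[OF clin_ext_act] ext_act_axis)
  have 2: "ext_act g (wedge (axis i 1) v) = wedge (g *v axis i 1) (ext_act g v)" for i
    by (rule clin_ext_eqI[OF clin_compose[OF clin_ext_act clin_wedge] clin_compose[OF clin_wedge clin_ext_act] 1])
  show ?thesis
    by (rule clin_vec_eqI[OF clin_compose[OF clin_ext_act clin_wedge_left]
          clin_compose[OF clin_wedge_left clin_matrix_vector] 2])
qed

lemma ext_act_mult: "ext_act (g ** h) v = ext_act g (ext_act h v)"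
  by (induction v rule: ext_induct)
    (simp_all add: ext_act_wedge clin_add[OF clin_ext_act] clin_scale[OF clin_ext_act] matrix_vector_mul_assoc)

lemma ext_act_one: "ext_act (mat 1) v = v"
  by (induction v rule: ext_induct)
    (simp_all add: ext_act_wedge clin_add[OF clin_ext_act] clin_scale[OF clin_ext_act])

lemma contract_unit [simp]: "contract x (axis {} 1) = 0"
  by (rule clin_vec_eqI[OF clin_contract_left clin_0]) (simp add: contract_axis)

text \<open>The assumption says that \<open>x\<close> is the transpose of \<open>g\<close> applied
  to \<open>x'\<close>. A contraction is determined by its commutation with wedges and by killing
  the unit.\<close>

lemma ext_act_contract:
  assumes "\<And>y. pairing (g *v y) x' = pairing y x"
  shows "ext_act g (contract x v) = contract x' (ext_act g v)"
proof (induction v rule: ext_induct)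
  case unit
  show ?case by (simp add: clin_zero[OF clin_ext_act])
next
  case (wedge i v)
  then show ?case
    by (simp only: contract_wedge ext_act_wedge clin_diff[OF clin_ext_act] clin_scale[OF clin_ext_act] assms)
qed (simp_all add: clin_add[OF clin_contract] clin_add[OF clin_ext_act]
       clin_scale[OF clin_contract] clin_scale[OF clin_ext_act])

text \<open>A rank one change of the identity acts on the exterior algebra without terms of higher
  order, because wedging twice with \<open>b\<close> gives zero. The factor 1/2 undoes the
  normalization of \<open>contract\<close>.\<close>

lemma ext_act_reflection:
  assumes s: "\<And>y. s *v y = y - pairing y a *\<^sub>C b"
  shows "ext_act s v = v + (1 / 2) *\<^sub>C wedge b (contract a v)"
proof (induction v rule: ext_induct)
  case unit
  show ?case by (simp add: clin_zero[OF clin_wedge])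
next
  case (wedge i v)
  have bb: "wedge b (wedge b u) = 0" for u
    using wedge_anticomm[of b b u] by (rule cvec_eq_uminus)
  have "ext_act s (wedge (axis i 1) v) =
      wedge (axis i 1) (v + (1 / 2) *\<^sub>C wedge b (contract a v)) -
      pairing (axis i 1) a *\<^sub>C wedge b (v + (1 / 2) *\<^sub>C wedge b (contract a v))"
    unfolding ext_act_wedge wedge s by (simp add: clin_diff[OF clin_wedge_left] clin_scale[OF clin_wedge_left])
  also have "\<dots> = wedge (axis i 1) v + (1 / 2) *\<^sub>C wedge (axis i 1) (wedge b (contract a v))
      - pairing (axis i 1) a *\<^sub>C wedge b v"
    by (simp add: clin_add[OF clin_wedge] clin_scale[OF clin_wedge] bb)
  also have "\<dots> = wedge (axis i 1) v + (1 / 2) *\<^sub>C wedge b (contract a (wedge (axis i 1) v))"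
    unfolding contract_wedge
    by (simp add: clin_diff[OF clin_wedge] clin_scale[OF clin_wedge] wedge_anticomm[of "axis i 1" b]
        cscale_diff_right clin_minus[OF clin_wedge])
  finally show ?case .
next
  case (add v v')
  then show ?case
    by (simp add: clin_add[OF clin_ext_act] clin_add[OF clin_wedge] clin_add[OF clin_contract] cscale_add_right)
next
  case (scale z v)
  then show ?case
    by (simp add: clin_scale[OF clin_ext_act] clin_scale[OF clin_wedge] clin_scale[OF clin_contract]
        cscale_add_right)
qed

text \<open>The source of both places where a reflection emerges from Clifford products: the action
  of \<open>mu\<close> on spinors, and the class sum in the square of the Dirac operator.\<close>

lemma contract_wedge_reflection:
  assumes s: "\<And>y. s *v y = y - pairing y a *\<^sub>C b" and ba: "pairing b a = 2"
  shows "contract a (wedge b v) = (- 2) *\<^sub>C (v + ext_act s v)"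
proof -
  have "(- 2 * 2) *\<^sub>C v = (- 2) *\<^sub>C v + (- 2) *\<^sub>C v"
    unfolding cscale_add_left[symmetric] by simp
  moreover have "(- 2) *\<^sub>C (v + (v + (1 / 2) *\<^sub>C w)) = ((- 2) *\<^sub>C v + (- 2) *\<^sub>C v) - w" for w :: "'a ext"
    by (simp only: cscale_add_right cscale_cscale add.assoc) simp
  ultimately show ?thesis
    unfolding contract_wedge ba ext_act_reflection[OF s] by (simp only:)
qed

section \<open>The grading of the exterior algebra and its top degree\<close>

definition extgr :: "nat \<Rightarrow> 'n::finite ext set" where
  "extgr k = {v. \<forall>I. v $ I \<noteq> 0 \<longrightarrow> card I = k}"

lemma extgr_carrier: "extgr k = carrier (ext_power k)"
  by (simp add: extgr_def ext_power_def)

lemma extgr_zero [simp]: "0 \<in> extgr k" by (simp add: extgr_def)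
lemma extgr_axis: "axis I 1 \<in> extgr (card I)" by (simp add: extgr_def axis_def)
lemma extgr_add: "v \<in> extgr k \<Longrightarrow> w \<in> extgr k \<Longrightarrow> v + w \<in> extgr k"
  unfolding extgr_def by (auto) (metis add.right_neutral)
lemma extgr_scale: "v \<in> extgr k \<Longrightarrow> z *\<^sub>C v \<in> extgr k"
  unfolding extgr_def by (auto simp: cscale_complex_def)
lemma extgr_sum: "(\<And>i. i \<in> A \<Longrightarrow> f i \<in> extgr k) \<Longrightarrow> (\<Sum>i\<in>A. f i) \<in> extgr k"
  by (induction A rule: infinite_finite_induct) (auto intro: extgr_add)

lemma clin_extgr:
  assumes "clin X" "v \<in> extgr k" "\<And>I. card I = k \<Longrightarrow> X (axis I 1) \<in> extgr l"
  shows "X v \<in> extgr l"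
proof -
  have "v $ I *\<^sub>C X (axis I 1) \<in> extgr l" for I
    using assms(2,3) by (cases "v $ I = 0") (auto simp: extgr_def intro!: extgr_scale)
  then show ?thesis unfolding clin_ext_expand[OF assms(1), of v] by (intro extgr_sum)
qed

lemma extgr_wedge: "v \<in> extgr k \<Longrightarrow> wedge y v \<in> extgr (Suc k)"
proof -
  assume v: "v \<in> extgr k"
  have a: "wedge (axis i 1) v \<in> extgr (Suc k)" for i
  proof (rule clin_extgr[OF clin_wedge v])
    fix I :: "'a set" assume "card I = k"
    then show "wedge (axis i 1) (axis I 1) \<in> extgr (Suc k)"
      using extgr_axis[of "insert i I"] by (auto simp: wedge_axis intro!: extgr_scale)
  qed
  show ?thesis
    unfolding clin_vec_expand[OF clin_wedge_left, of y] using a by (intro extgr_sum extgr_scale)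
qed

lemma ext_act_extgr: "v \<in> extgr k \<Longrightarrow> ext_act g v \<in> extgr k"
proof (rule clin_extgr[OF clin_ext_act])
  fix I :: "'a set" assume "card I = k"
  have "foldr (\<lambda>i. wedge (g *v axis i 1)) l (axis {} 1) \<in> extgr (length l)" for l
    using extgr_axis[of "{}"] by (induction l) (auto intro: extgr_wedge)
  then show "ext_act g (axis I 1) \<in> extgr k"
    unfolding ext_act_axis using \<open>card I = k\<close> by (metis finite length_sorted_list_of_set)
qed

text \<open>The number operator, scaled by the -2 of \<open>contract\<close>.\<close>

lemma sum_wedge_contract:
  "(\<Sum>i\<in>UNIV. wedge (axis i 1) (contract (axis i 1) (axis I 1))) = (- 2 * of_nat (card I)) *\<^sub>C axis I 1"
proof -
  have "wedge (axis i 1) (contract (axis i 1) (axis I 1)) = (if i \<in> I then (- 2) *\<^sub>C axis I 1 else 0)" for i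
    by (simp add: contract_axis clin_scale[OF clin_wedge] clin_zero[OF clin_wedge] clin_minus[OF clin_wedge]
        wedge_axis insert_absorb mult.assoc)
  then have "(\<Sum>i\<in>UNIV. wedge (axis i 1) (contract (axis i 1) (axis I 1))) = (\<Sum>i\<in>I. (- 2) *\<^sub>C axis I 1)"
    by (simp add: sum.If_cases)
  also have "\<dots> = (\<Sum>i\<in>I. - 2) *\<^sub>C axis I 1" by (rule cscale_sum_left[symmetric])
  finally show ?thesis by (simp add: mult.commute)
qed

lemma sum_contract_wedge:
  "(\<Sum>i\<in>UNIV. contract (axis i 1) (wedge (axis i 1) (axis I 1))) =
    (- 2 * (of_nat CARD('n::{finite,linorder}) - of_nat (card I))) *\<^sub>C axis (I :: 'n set) 1"
proof -
  have "(\<Sum>i\<in>UNIV. contract (axis i 1) (wedge (axis i 1) (axis I 1))) =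
      (\<Sum>i\<in>(UNIV :: 'n set). (- 2) *\<^sub>C axis I 1) - (\<Sum>i\<in>UNIV. wedge (axis i 1) (contract (axis i 1) (axis I 1)))"
    by (simp add: contract_wedge sum_subtractf)
  also have "(\<Sum>i\<in>(UNIV :: 'n set). (- 2) *\<^sub>C axis I (1 :: complex)) = (\<Sum>i\<in>(UNIV :: 'n set). - 2) *\<^sub>C axis I 1"
    by (rule cscale_sum_left[symmetric])
  finally show ?thesis
    unfolding sum_wedge_contract cscale_diff_left[symmetric] by (simp add: algebra_simps)
qed

text \<open>The determinant of \<open>g\<close>.\<close>

definition top_char :: "'n::{finite,linorder} mtx \<Rightarrow> complex" where
  "top_char g = ext_act g (axis UNIV 1) $ UNIV"

lemma ext_act_top: "ext_act g (axis UNIV 1) = top_char g *\<^sub>C axis UNIV 1"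
proof -
  have "ext_act g (axis UNIV 1) \<in> extgr CARD('a)"
    by (rule ext_act_extgr) (rule extgr_axis)
  then have "ext_act g (axis UNIV 1) $ I = 0" if "I \<noteq> UNIV" for I
    using that card_subset_eq[OF finite subset_UNIV, of I] by (auto simp: extgr_def)
  then show ?thesis
    by (auto simp: vec_eq_iff top_char_def axis_def cscale_complex_def)
qed

lemma top_char_mult: "top_char (g ** h) = top_char g * top_char h"
proof -
  have "ext_act (g ** h) (axis UNIV 1) = (top_char h * top_char g) *\<^sub>C axis UNIV 1"
    unfolding ext_act_mult ext_act_top[of h] clin_scale[OF clin_ext_act] ext_act_top[of g] by simp
  then show ?thesis unfolding top_char_def[of "g ** h"] by (simp add: cscale_complex_def mult.commute)
qed

lemma top_char_one: "top_char (mat 1) = 1"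
  by (simp add: top_char_def ext_act_one)

lemma wedge_top: "wedge y (axis (UNIV :: 'n::{finite,linorder} set) 1) = 0"
  by (rule clin_vec_eqI[OF clin_wedge_left clin_0]) (simp add: wedge_axis)

text \<open>Wedging with \<open>b\<close> kills the top degree, so
  \<open>contract_wedge_reflection\<close> forces the top form to be negated.\<close>

lemma top_char_reflection:
  assumes s: "\<And>y. s *v y = y - pairing y a *\<^sub>C b" and ba: "pairing b a = 2"
  shows "top_char s = - 1"
proof -
  have "contract a (wedge b (axis UNIV 1)) = 0" by (simp add: wedge_top clin_zero[OF clin_contract])
  then have "axis UNIV 1 + ext_act s (axis UNIV 1) = 0"
    unfolding contract_wedge_reflection[OF s ba] by simp
  then have "(axis UNIV 1 + ext_act s (axis UNIV 1)) $ UNIV = 0" by simp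
  then show ?thesis by (simp add: top_char_def eq_neg_iff_add_eq_0 add.commute)
qed


section \<open>Representations of free algebras\<close>

lemma pm_expand: "(p :: 'a \<Rightarrow>\<^sub>0 'b::comm_monoid_add) = (\<Sum>m\<in>Poly_Mapping.keys p. Poly_Mapping.single m (Poly_Mapping.lookup p m))"
proof (rule poly_mapping_eqI)
  fix k
  have "Poly_Mapping.lookup (\<Sum>m\<in>Poly_Mapping.keys p. Poly_Mapping.single m (Poly_Mapping.lookup p m)) k
      = (\<Sum>m\<in>Poly_Mapping.keys p. if m = k then Poly_Mapping.lookup p m else 0)"
    by (simp add: lookup_sum lookup_single when_def)
  then show "Poly_Mapping.lookup p k =
      Poly_Mapping.lookup (\<Sum>m\<in>Poly_Mapping.keys p. Poly_Mapping.single m (Poly_Mapping.lookup p m)) k"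
    by (simp add: in_keys_iff)
qed

lemma pm_induct [case_names single add]:
  fixes p :: "'a \<Rightarrow>\<^sub>0 'b::comm_monoid_add"
  assumes s: "\<And>m c. Q (Poly_Mapping.single m c)" and a: "\<And>p q. Q p \<Longrightarrow> Q q \<Longrightarrow> Q (p + q)"
  shows "Q p"
proof -
  have 0: "Q 0" using s[of undefined 0] by simp
  have "Q (\<Sum>m\<in>A. Poly_Mapping.single m (Poly_Mapping.lookup p m))" if "finite A" for A
    using that by induction (auto simp: 0 intro: s a)
  then show ?thesis by (subst pm_expand) simp
qed

text \<open>The representation of the free algebra in which the letter \<open>l\<close> acts by
  \<open>L l\<close>. It is used twice: with Dunkl operators and multiplications for
  \<open>H\<close>, and with wedges and contractions for the spinors.\<close>

definition word_act :: "('l \<Rightarrow> 'm::cvec \<Rightarrow> 'm) \<Rightarrow> ('l list \<Rightarrow>\<^sub>0 complex) \<Rightarrow> 'm \<Rightarrow> 'm" where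
  "word_act L t v = (\<Sum>u\<in>Poly_Mapping.keys t. Poly_Mapping.lookup t u *\<^sub>C foldr L u v)"

lemma word_act_superset:
  "finite A \<Longrightarrow> Poly_Mapping.keys t \<subseteq> A \<Longrightarrow>
    word_act L t v = (\<Sum>u\<in>A. Poly_Mapping.lookup t u *\<^sub>C foldr L u v)"
  unfolding word_act_def by (rule sum.mono_neutral_left) (auto simp: in_keys_iff)

lemma word_act_add: "word_act L (t + t') v = word_act L t v + word_act L t' v"
proof -
  let ?A = "Poly_Mapping.keys t \<union> Poly_Mapping.keys t'"
  have "Poly_Mapping.keys (t + t') \<subseteq> ?A" by (rule keys_add)
  then show ?thesis
    by (subst (1 2 3) word_act_superset[of ?A]) (auto simp: lookup_add cscale_add_left sum.distrib)
qed

lemma word_act_single: "word_act L (Poly_Mapping.single u c) v = c *\<^sub>C foldr L u v"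
  by (cases "c = 0") (simp_all add: word_act_def)

lemma word_act_zero [simp]: "word_act L 0 v = 0"
  by (simp add: word_act_def)

lemma word_act_sum: "word_act L (\<Sum>i\<in>A. f i) v = (\<Sum>i\<in>A. word_act L (f i) v)"
  by (induction A rule: infinite_finite_induct) (auto simp: word_act_add)

lemma word_act_minus: "word_act L (- t) v = - word_act L t v"
  using word_act_add[of L t "- t" v] by (simp add: eq_neg_iff_add_eq_0 add.commute)

lemma word_act_diff: "word_act L (t - t') v = word_act L t v - word_act L t' v"
  using word_act_add[of L t "- t'" v] by (simp add: word_act_minus)

lemma clin_foldr: "(\<And>l. clin (L l)) \<Longrightarrow> clin (foldr L u)"
  by (induction u) (auto simp: o_def id_def intro: clin_compose)

lemma clin_word_act: "(\<And>l. clin (L l)) \<Longrightarrow> clin (word_act L t)"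
  unfolding word_act_def by (intro clin_sumf clin_cscale clin_foldr)

lemma word_act_mult:
  assumes "\<And>l. clin (L l)"
  shows "word_act L (t * t') v = word_act L t (word_act L t' v)"
proof (induction t rule: pm_induct)
  case (single u c)
  show ?case
  proof (induction t' rule: pm_induct)
    case (single u' c')
    show ?case
      by (simp add: mult_single word_act_single plus_list_def clin_scale[OF clin_foldr[OF assms]])
  qed (simp add: distrib_left word_act_add clin_add[OF clin_word_act[OF assms]])
qed (simp add: distrib_right word_act_add)

lemma word_act_scal: "word_act L (scal c) v = c *\<^sub>C v"
  by (simp add: word_act_single zero_list_def)

lemma word_act_one: "word_act L 1 v = v"
  using word_act_scal[of L 1 v] by simp

lemma word_act_tens_y: "word_act L (tens_y y) v = (\<Sum>i\<in>UNIV. y $ i *\<^sub>C L (Inl i) v)"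
  by (simp add: tens_y_def word_act_sum word_act_single)

lemma word_act_tens_x: "word_act L (tens_x x) v = (\<Sum>i\<in>UNIV. x $ i *\<^sub>C L (Inr i) v)"
  by (simp add: tens_x_def word_act_sum word_act_single)

section \<open>Polynomials\<close>

text \<open>The type of the symmetric algebra of \<open>h\<close> also serves for that of
  \<open>h*\<close>: all group elements will be orthogonal, hence act by the same matrix on both, so
  \<open>sym_y\<close> and \<open>sym_act\<close> can be reused with linear forms \<open>x\<close>
  in place of \<open>y\<close>.\<close>

type_synonym 'n pol = "'n sym"

definition pvar :: "'n \<Rightarrow> 'n pol" where
  "pvar i = Poly_Mapping.single (Poly_Mapping.single i 1) 1"

lemma cscale_single: "z *\<^sub>C Poly_Mapping.single m c = Poly_Mapping.single m (z * c)"
  by (rule poly_mapping_eqI) (simp add: lookup_single when_def)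

lemma cscale_mult_left: "(z *\<^sub>C p) * q = z *\<^sub>C (p * (q :: 'm::monoid_add \<Rightarrow>\<^sub>0 complex))"
  by (simp flip: scal_mult add: mult.assoc)

lemma cscale_mult_right: "p * (z *\<^sub>C q) = z *\<^sub>C (p * (q :: 'm::comm_monoid_add \<Rightarrow>\<^sub>0 complex))"
  by (simp flip: scal_mult add: mult.left_commute)

lemma clin_mult: "clin (\<lambda>p. (q :: 'm::comm_monoid_add \<Rightarrow>\<^sub>0 complex) * p)"
  by (rule clinI) (simp_all add: distrib_left cscale_mult_right)

lemma sym_y_eq: "sym_y v = (\<Sum>i\<in>UNIV. v $ i *\<^sub>C pvar i)"
  by (simp add: sym_y_def pvar_def cscale_single)

lemma clin_sym_y: "clin sym_y"
  by (rule clinI) (simp_all add: sym_y_eq cscale_add_left sum.distrib cscale_sum_right cscale_complex_def)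

lemma sym_y_axis: "sym_y (axis i 1) = pvar i"
proof -
  have "sym_y (axis i 1) = (\<Sum>j\<in>UNIV. if j = i then pvar j else 0)"
    unfolding sym_y_eq by (intro sum.cong) (auto simp: axis_def)
  then show ?thesis by simp
qed

lemma pol_induct [case_names const var add]:
  fixes p :: "'n::finite pol"
  assumes const: "\<And>c. Q (scal c)" and var: "\<And>i p. Q p \<Longrightarrow> Q (pvar i * p)"
    and add: "\<And>p q. Q p \<Longrightarrow> Q q \<Longrightarrow> Q (p + q)"
  shows "Q p"
proof (induction p rule: pm_induct)
  case (single m c)
  show ?case
  proof (induction "\<Sum>i\<in>UNIV. Poly_Mapping.lookup m i" arbitrary: m)
    case 0
    then have "m = 0" by (intro poly_mapping_eqI) simp
    then show ?case by (simp add: const)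
  next
    case (Suc d)
    then obtain i where i: "Poly_Mapping.lookup m i \<noteq> 0"
      by (metis (mono_tags, lifting) nat.distinct(1) sum.neutral)
    define m' where "m' = m - Poly_Mapping.single i 1"
    have m: "m = Poly_Mapping.single i 1 + m'"
      using i by (intro poly_mapping_eqI) (auto simp: m'_def lookup_add lookup_minus lookup_single when_def)
    have "(\<Sum>j\<in>UNIV. Poly_Mapping.lookup m j) = (\<Sum>j\<in>UNIV. (if j = i then 1 else 0) + Poly_Mapping.lookup m' j)"
      by (subst m) (auto intro!: sum.cong simp: lookup_add lookup_single when_def)
    then have "d = (\<Sum>j\<in>UNIV. Poly_Mapping.lookup m' j)"
      using Suc.hyps(2) by (simp add: sum.distrib)
    then have "Q (pvar i * Poly_Mapping.single m' c)" using Suc.hyps(1) var by blast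
    then show ?case by (subst m) (simp add: pvar_def mult_single)
  qed
qed (rule add)

section \<open>Substitution of polynomials and the matrix action\<close>

definition psubst :: "('n::finite \<Rightarrow> 'n pol) \<Rightarrow> 'n pol \<Rightarrow> 'n pol" where
  "psubst h f = (\<Sum>m\<in>Poly_Mapping.keys f. Poly_Mapping.lookup f m *\<^sub>C (\<Prod>i\<in>UNIV. h i ^ Poly_Mapping.lookup m i))"

lemma sym_act_eq: "sym_act g = psubst (\<lambda>i. sym_y (g *v axis i 1))"
  by (simp add: fun_eq_iff sym_act_def psubst_def scal_mult)

lemma psubst_superset:
  "finite A \<Longrightarrow> Poly_Mapping.keys f \<subseteq> A \<Longrightarrow>
    psubst h f = (\<Sum>m\<in>A. Poly_Mapping.lookup f m *\<^sub>C (\<Prod>i\<in>UNIV. h i ^ Poly_Mapping.lookup m i))"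
  unfolding psubst_def by (rule sum.mono_neutral_left) (auto simp: in_keys_iff)

lemma psubst_single: "psubst h (Poly_Mapping.single m c) = c *\<^sub>C (\<Prod>i\<in>UNIV. h i ^ Poly_Mapping.lookup m i)"
  by (cases "c = 0") (simp_all add: psubst_def)

lemma psubst_add: "psubst h (f + g) = psubst h f + psubst h g"
proof -
  let ?A = "Poly_Mapping.keys f \<union> Poly_Mapping.keys g"
  have "Poly_Mapping.keys (f + g) \<subseteq> ?A" by (rule keys_add)
  then show ?thesis
    by (subst (1 2 3) psubst_superset[of ?A]) (auto simp: lookup_add cscale_add_left sum.distrib)
qed

lemma psubst_mult: "psubst h (f * g) = psubst h f * psubst h g"
proof (induction f rule: pm_induct)
  case (single m c)
  show ?case
  proof (induction g rule: pm_induct)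
    case (single m' c')
    show ?case
      by (simp add: mult_single psubst_single lookup_add power_add prod.distrib cscale_mult_left cscale_mult_right mult.commute)
  qed (simp add: distrib_left psubst_add)
qed (simp add: distrib_right psubst_add)

lemma psubst_scal: "psubst h (scal c) = scal c"
  by (simp add: psubst_single) (simp flip: scal_mult)

lemma clin_psubst: "clin (psubst h)"
  by (rule clinI) (simp_all add: psubst_add psubst_mult psubst_scal flip: scal_mult)

lemma psubst_pvar: "psubst h (pvar i) = h i"
proof -
  have "(\<Prod>j\<in>UNIV. h j ^ Poly_Mapping.lookup (Poly_Mapping.single i 1) j) = (\<Prod>j\<in>UNIV. if j = i then h j else 1)"
    by (intro prod.cong) (auto simp: lookup_single when_def)
  then show ?thesis by (simp add: pvar_def psubst_single)
qed

lemma clin_sym_act: "clin (sym_act g)"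
  by (simp add: sym_act_eq clin_psubst)

lemma sym_act_times: "sym_act g (p * q) = sym_act g p * sym_act g q"
  by (simp add: sym_act_eq psubst_mult)

lemma sym_act_scal [simp]: "sym_act g (scal c) = scal c"
  by (simp add: sym_act_eq psubst_scal)

lemma sym_act_sym_y: "sym_act g (sym_y x) = sym_y (g *v x)"
proof (rule clin_vec_eqI[OF clin_compose[OF clin_sym_act clin_sym_y] clin_compose[OF clin_sym_y clin_matrix_vector]])
  show "sym_act g (sym_y (axis i 1)) = sym_y (g *v axis i 1)" for i
    by (simp add: sym_y_axis sym_act_eq psubst_pvar)
qed

lemma sym_act_mult: "sym_act (g ** h) p = sym_act g (sym_act h p)"
  by (induction p rule: pol_induct)
    (simp_all add: sym_act_times sym_act_sym_y clin_add[OF clin_sym_act] matrix_vector_mul_assoc flip: sym_y_axis)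

lemma sym_act_one: "sym_act (mat 1) p = p"
  by (induction p rule: pol_induct)
    (simp_all add: sym_act_times sym_act_sym_y clin_add[OF clin_sym_act] flip: sym_y_axis)

text \<open>The truncated subtraction of exponents is harmless, since the coefficient vanishes when
  the variable \<open>i\<close> does not occur.\<close>

definition pd :: "'n \<Rightarrow> 'n pol \<Rightarrow> 'n pol" where
  "pd i f = (\<Sum>m\<in>Poly_Mapping.keys f.
     Poly_Mapping.single (m - Poly_Mapping.single i 1) (of_nat (Poly_Mapping.lookup m i) * Poly_Mapping.lookup f m))"

lemma pd_superset:
  "finite A \<Longrightarrow> Poly_Mapping.keys f \<subseteq> A \<Longrightarrow> pd i f = (\<Sum>m\<in>A.
     Poly_Mapping.single (m - Poly_Mapping.single i 1) (of_nat (Poly_Mapping.lookup m i) * Poly_Mapping.lookup f m))"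
  unfolding pd_def by (rule sum.mono_neutral_left) (auto simp: in_keys_iff)

lemma pd_add: "pd i (f + g) = pd i f + pd i g"
proof -
  let ?A = "Poly_Mapping.keys f \<union> Poly_Mapping.keys g"
  have "Poly_Mapping.keys (f + g) \<subseteq> ?A" by (rule keys_add)
  then show ?thesis
    by (subst (1 2 3) pd_superset[of ?A]) (auto simp: lookup_add distrib_left single_add sum.distrib)
qed

lemma pd_single: "pd i (Poly_Mapping.single m c) =
    Poly_Mapping.single (m - Poly_Mapping.single i 1) (of_nat (Poly_Mapping.lookup m i) * c)"
  by (cases "c = 0") (simp_all add: pd_def)

lemma pd_scal [simp]: "pd i (scal c) = 0"
  by (simp add: pd_single)

lemma clin_pd: "clin (pd i)"
proof (rule clinI)
  show "pd i (z *\<^sub>C p) = z *\<^sub>C pd i p" for z p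
    by (induction p rule: pm_induct) (simp_all add: cscale_single pd_single pd_add cscale_add_right mult_ac)
qed (rule pd_add)

lemma pd_pvar_mult: "pd i (pvar j * f) = (if i = j then f else 0) + pvar j * pd i f"
proof (induction f rule: pm_induct)
  case (single m c)
  have *: "pd i (pvar j * Poly_Mapping.single m c) = Poly_Mapping.single (Poly_Mapping.single j 1 + m - Poly_Mapping.single i 1)
      (of_nat ((if i = j then 1 else 0) + Poly_Mapping.lookup m i) * c)"
    by (simp add: pvar_def mult_single pd_single lookup_add lookup_single when_def)
  have **: "pvar j * pd i (Poly_Mapping.single m c) = Poly_Mapping.single (Poly_Mapping.single j 1 + (m - Poly_Mapping.single i 1))
      (of_nat (Poly_Mapping.lookup m i) * c)"
    by (simp add: pvar_def mult_single pd_single)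
  show ?case
  proof (cases "Poly_Mapping.lookup m i = 0")
    case True
    then show ?thesis unfolding * ** by simp
  next
    case False
    then have "Poly_Mapping.single j 1 + m - Poly_Mapping.single i 1 = Poly_Mapping.single j 1 + (m - Poly_Mapping.single i 1)"
      by (intro poly_mapping_eqI) (auto simp: lookup_add lookup_minus lookup_single when_def)
    moreover have "Poly_Mapping.single j 1 + m - Poly_Mapping.single j 1 = m"
      by simp
    ultimately show ?thesis unfolding * **
      by (auto simp: distrib_right single_add)
  qed
qed (simp add: pd_add distrib_left)

definition pdv :: "complex^'n::finite \<Rightarrow> 'n pol \<Rightarrow> 'n pol" where
  "pdv y f = (\<Sum>i\<in>UNIV. y $ i *\<^sub>C pd i f)"

lemma clin_pdv: "clin (pdv y)"
  unfolding pdv_def by (intro clin_sumf clin_cscale clin_pd)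

lemma clin_pdv_left: "clin (\<lambda>y. pdv y f)"
  by (rule clinI) (simp_all add: pdv_def cscale_add_left sum.distrib cscale_sum_right cscale_complex_def)

lemma pdv_scal [simp]: "pdv y (scal c) = 0"
  by (simp add: pdv_def)

lemma pdv_axis: "pdv (axis i 1) f = pd i f"
proof -
  have "pdv (axis i 1) f = (\<Sum>j\<in>UNIV. if j = i then pd j f else 0)"
    unfolding pdv_def by (intro sum.cong) (auto simp: axis_def)
  then show ?thesis by simp
qed

lemma clin_sym_y_mult: "clin (\<lambda>x. sym_y x * f)"
  by (rule clinI) (simp_all add: clin_add[OF clin_sym_y] clin_scale[OF clin_sym_y] distrib_right cscale_mult_left)

lemma pdv_sym_y_mult: "pdv y (sym_y x * f) = pairing y x *\<^sub>C f + sym_y x * pdv y f"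
proof -
  have l: "clin (\<lambda>x. pairing y x *\<^sub>C f)" "clin (\<lambda>y. pairing y x *\<^sub>C f)" for x y :: "complex^'a" and f :: "'a pol"
    by (auto intro!: clinI simp: clin_add[OF clin_pairing_left] clin_add[OF clin_pairing_right]
        clin_scale[OF clin_pairing_left] clin_scale[OF clin_pairing_right] cscale_complex_def cscale_add_left)
  have 1: "pdv (axis i 1) (sym_y (axis j 1) * f) = pairing (axis i 1) (axis j 1) *\<^sub>C f + sym_y (axis j 1) * pdv (axis i 1) f"
    for i j
    unfolding pdv_axis sym_y_axis pd_pvar_mult pairing_axis by simp
  have 2: "pdv y (sym_y (axis j 1) * f) = pairing y (axis j 1) *\<^sub>C f + sym_y (axis j 1) * pdv y f" for j
    by (rule clin_vec_eqI[OF clin_pdv_left clin_plus[OF l(2) clin_compose[OF clin_mult clin_pdv_left]] 1])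
  show ?thesis
    by (rule clin_vec_eqI[OF clin_compose[OF clin_pdv clin_sym_y_mult] clin_plus[OF l(1) clin_sym_y_mult] 2])
qed

lemma lookup_sum_pvar_pd:
  "Poly_Mapping.lookup (\<Sum>i\<in>UNIV. pvar i * pd i f) m =
    of_nat (\<Sum>i\<in>UNIV. Poly_Mapping.lookup m i) * Poly_Mapping.lookup f (m :: 'n::finite \<Rightarrow>\<^sub>0 nat)"
proof (induction f rule: pm_induct)
  case (single m' c)
  have "pvar i * pd i (Poly_Mapping.single m' c) = Poly_Mapping.single m' (of_nat (Poly_Mapping.lookup m' i) * c)" for i
  proof (cases "Poly_Mapping.lookup m' i = 0")
    case True
    then show ?thesis by (simp add: pd_single)
  next
    case False
    then have "Poly_Mapping.single i 1 + (m' - Poly_Mapping.single i 1) = m'"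
      by (intro poly_mapping_eqI) (auto simp: lookup_add lookup_minus lookup_single when_def)
    then show ?thesis by (simp add: pd_single pvar_def mult_single)
  qed
  then show ?case by (simp add: lookup_sum lookup_single when_def sum_distrib_right)
next
  case (add p q)
  then show ?case by (simp add: pd_add distrib_left sum.distrib lookup_add)
qed

declare plus_fun_apply [simp del] zero_fun_apply [simp del] minus_apply [simp del] uminus_apply [simp del]
  cscale_fun_apply [simp del]

lemmas fun_apply = plus_fun_apply zero_fun_apply minus_apply uminus_apply cscale_fun_apply

section \<open>Dunkl operators\<close>

lemma single_sum: "Poly_Mapping.single k (\<Sum>i\<in>A. f i) = (\<Sum>i\<in>A. Poly_Mapping.single k (f i))"
  by (induction A rule: infinite_finite_induct) (simp_all add: single_add)

lemma single_one_eq_iff: "Poly_Mapping.single x (Suc 0) = Poly_Mapping.single i (Suc 0) \<longleftrightarrow> x = i"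
  by (metis keys_single nat.distinct(1) singleton_inject)

lemma mult_axis_nth: "((w :: 'a::semiring_1^'n^'m) *v axis i 1) $ j = w $ j $ i"
  by (simp add: matrix_vector_mult_def axis_def if_distrib cong: if_cong)

lemma pairing_transpose: "pairing (g *v y) x = pairing y (transpose g *v x)"
proof -
  have "pairing (g *v y) x = (\<Sum>i\<in>UNIV. \<Sum>j\<in>UNIV. g $ i $ j * y $ j * x $ i)"
    by (simp add: pairing_def matrix_vector_mult_def sum_distrib_right)
  also have "\<dots> = (\<Sum>j\<in>UNIV. \<Sum>i\<in>UNIV. g $ i $ j * y $ j * x $ i)"
    by (rule sum.swap)
  finally show ?thesis
    by (simp add: pairing_def matrix_vector_mult_def transpose_def sum_distrib_left mult_ac)
qed

lemma pairing_commute: "pairing y x = pairing x y"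
  by (simp add: pairing_def mult.commute)

lemma sum_axis_pairing: "clin B \<Longrightarrow> (\<Sum>i\<in>UNIV. pairing (axis i 1) x *\<^sub>C B (axis i 1)) = B x"
  by (simp add: clin_vec_expand[of B x])

text \<open>Elements \<open>f\<close> of \<open>S(h*) \<otimes> \<Lambda>\<close>: the coefficient of \<open>axis J 1\<close> is the polynomial \<open>f J\<close>.\<close>

type_synonym 'n cvect = "complex^'n"
type_synonym 'n pext = "'n set \<Rightarrow> 'n pol"

definition xmul :: "complex^'n::finite \<Rightarrow> 'n pext \<Rightarrow> 'n pext" where
  "xmul x f = (\<lambda>J. sym_y x * f J)"

definition emb :: "'n::finite ext \<Rightarrow> 'n pext" where
  "emb v = (\<lambda>J. scal (v $ J))"

definition wact :: "'n::{finite,linorder} mtx \<Rightarrow> 'n pext \<Rightarrow> 'n pext" where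
  "wact w = tns (ext_act w) (sym_act w)"

lemma clin_xmul: "clin (xmul x)"
  by (rule clinI) (simp_all add: xmul_def fun_eq_iff fun_apply distrib_left cscale_mult_right)

lemma clin_xmul_left: "clin (\<lambda>x. xmul x f)"
  by (rule clinI) (simp_all add: xmul_def fun_eq_iff fun_apply clin_add[OF clin_sym_y_mult] clin_scale[OF clin_sym_y_mult])

lemma xmul_commute: "xmul x (xmul x' f) = xmul x' (xmul x f)"
  by (simp add: xmul_def mult.left_commute)

lemma clin_emb: "clin emb"
  by (rule clinI) (simp_all add: emb_def fun_eq_iff fun_apply single_add cscale_single cscale_complex_def)

lemma clin_wact: "clin (wact w)"
  unfolding wact_def by (rule clin_tns[OF clin_sym_act])

text \<open>Operators are compared along this rule: their values on constants and their commutation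
  with multiplication by \<open>x_i\<close> determine them.\<close>

lemma pext_induct [case_names emb xmul add]:
  fixes f :: "'n::finite pext"
  assumes emb: "\<And>v. Q (emb v)" and x: "\<And>i f. Q f \<Longrightarrow> Q (xmul (axis i 1) f)"
    and add: "\<And>f g. Q f \<Longrightarrow> Q g \<Longrightarrow> Q (f + g)"
  shows "Q f"
proof -
  have s: "Q (\<lambda>J'. if J' = J then p else 0)" for J :: "'n set" and p
  proof (induction p rule: pol_induct)
    case (const c)
    have "(\<lambda>J'. if J' = J then scal c else 0) = emb (c *\<^sub>C axis J 1)"
      by (auto simp: emb_def fun_eq_iff fun_apply axis_def cscale_complex_def)
    then show ?case by (simp add: emb)
  next
    case (var i p)
    have "(\<lambda>J'. if J' = J then pvar i * p else 0) = xmul (axis i 1) (\<lambda>J'. if J' = J then p else 0)"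
      by (auto simp: xmul_def fun_eq_iff fun_apply sym_y_axis)
    then show ?case using x[OF var] by simp
  next
    case (add p q)
    have "(\<lambda>J'. if J' = J then p + q else 0) = (\<lambda>J'. if J' = J then p else 0) + (\<lambda>J'. if J' = J then q else 0)"
      by (auto simp: fun_eq_iff fun_apply)
    then show ?case using assms(3)[OF add] by simp
  qed
  have "Q (\<Sum>J\<in>A. (\<lambda>J'. if J' = J then f J else 0))" if "finite A" for A
    using that
  proof induction
    case empty
    show ?case using emb[of 0] by (simp only: clin_zero[OF clin_emb] sum.empty)
  next
    case (insert J A)
    then show ?case using add[OF s] by simp
  qed
  from this[of UNIV] have "Q (\<Sum>J\<in>UNIV. (\<lambda>J'. if J' = J then f J else 0))" by simp
  moreover have "(\<Sum>J\<in>UNIV. (\<lambda>J'. if J' = J then f J else 0)) = f"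
    by (simp add: fun_eq_iff fun_apply sum_fun_apply)
  ultimately show ?thesis by simp
qed

lemma tns_xmul: "tns X g (xmul x f) = tns X (\<lambda>p. g (sym_y x * p)) f"
  by (simp add: tns_def xmul_def)

lemma xmul_tns: "tns X (\<lambda>p. sym_y x * g p) f = xmul x (tns X g f)"
  by (simp add: tns_def xmul_def sum_distrib_left cscale_mult_right)

lemma wact_xmul: "wact w (xmul x f) = xmul (w *v x) (wact w f)"
  by (simp add: wact_def tns_xmul sym_act_times sym_act_sym_y xmul_tns)

lemma wact_mult: "wact (g ** h) f = wact g (wact h f)"
  by (simp add: wact_def tns_tns[OF clin_ext_act clin_sym_act] ext_act_mult[abs_def] sym_act_mult[abs_def])

lemma wact_one: "wact (mat 1) f = f"
  by (simp add: wact_def ext_act_one[abs_def] sym_act_one[abs_def] tns_id)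

lemma wact_emb: "wact w (emb v) = emb (ext_act w v)"
proof
  fix J
  have "(\<Sum>I\<in>UNIV. (ext_act w (axis I 1) $ J) *\<^sub>C scal (v $ I)) = scal (\<Sum>I\<in>UNIV. v $ I * ext_act w (axis I 1) $ J)"
    unfolding cscale_single single_sum by (simp add: mult.commute)
  also have "(\<Sum>I\<in>UNIV. v $ I * ext_act w (axis I 1) $ J) = ext_act w v $ J"
    by (subst (2) clin_ext_expand[OF clin_ext_act]) (simp add: sum_component cscale_complex_def)
  finally show "wact w (emb v) J = emb (ext_act w v) J"
    by (simp add: wact_def tns_def emb_def)
qed

text \<open>\<open>al s\<close> and \<open>gm s\<close> are a root and its coroot, scaled to pair to
  2. \<open>schur\<close> expresses that the sum of the \<open>c s (1 - s)\<close> commutes with a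
  group acting irreducibly on \<open>h\<close>; within the locale, irreducibility is present only in
  this form, and \<open>\<kappa>\<close> governs the dependence of all weights on the exterior
  degree.\<close>

locale refl_rep =
  fixes W Rf :: "'n::{finite,linorder} mtx set" and c :: "'n mtx \<Rightarrow> complex"
    and al gm :: "'n mtx \<Rightarrow> 'n cvect" and \<kappa> :: complex
  assumes finW: "finite W" and W1: "mat 1 \<in> W"
    and Wm: "w \<in> W \<Longrightarrow> w' \<in> W \<Longrightarrow> w ** w' \<in> W" and Wt: "w \<in> W \<Longrightarrow> transpose w \<in> W"
    and Wo: "w \<in> W \<Longrightarrow> w ** transpose w = mat 1"
    and RfW: "Rf \<subseteq> W" and Rfc: "w \<in> W \<Longrightarrow> s \<in> Rf \<Longrightarrow> w ** s ** transpose w \<in> Rf"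
    and cc: "w \<in> W \<Longrightarrow> s \<in> Rf \<Longrightarrow> c (w ** s ** transpose w) = c s"
    and sref: "s \<in> Rf \<Longrightarrow> s *v y = y - pairing y (al s) *\<^sub>C gm s"
    and galg: "s \<in> Rf \<Longrightarrow> pairing (gm s) (al s) = 2"
    and schur: "(\<Sum>s\<in>Rf. c s *\<^sub>C (y - s *v y)) = \<kappa> *\<^sub>C y"
begin

lemma finRf: "finite Rf"
  using RfW finW by (rule finite_subset)

lemma Wo': "w \<in> W \<Longrightarrow> transpose w ** w = mat 1"
  using Wo matrix_left_right_inverse by blast

lemma pairing_W: "w \<in> W \<Longrightarrow> pairing (w *v y) (w *v x) = pairing y x"
  by (simp add: pairing_transpose matrix_vector_mul_assoc Wo')

lemma refl_sq: "s \<in> Rf \<Longrightarrow> s *v (s *v y) = y"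
proof -
  assume s: "s \<in> Rf"
  have "pairing (s *v y) (al s) = - pairing y (al s)"
    by (simp add: sref[OF s] clin_diff[OF clin_pairing_left] clin_scale[OF clin_pairing_left] galg[OF s] cscale_complex_def)
  then have "s *v (s *v y) = s *v y + pairing y (al s) *\<^sub>C gm s"
    by (simp add: sref[OF s, of "s *v y"])
  also have "\<dots> = y" by (simp add: sref[OF s, of y])
  finally show ?thesis .
qed

lemma refl_mult_self: "s \<in> Rf \<Longrightarrow> s ** s = mat 1"
  by (simp add: matrix_eq refl_sq flip: matrix_vector_mul_assoc)

lemma refl_transpose: "s \<in> Rf \<Longrightarrow> transpose s = s"
proof -
  assume s: "s \<in> Rf"
  then have "transpose s = transpose s ** (s ** s)" by (simp add: refl_mult_self)
  also have "\<dots> = (transpose s ** s) ** s" by (rule matrix_mul_assoc)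
  also have "transpose s ** s = mat 1" using s RfW by (intro Wo') auto
  finally show ?thesis by simp
qed

lemma W_cancel: "w \<in> W \<Longrightarrow> transpose w ** (w ** x) = x" "w \<in> W \<Longrightarrow> w ** (transpose w ** x) = x"
  by (simp_all add: matrix_mul_assoc Wo Wo')

lemma pairing_refl: "s \<in> Rf \<Longrightarrow> pairing (s *v y) x = pairing y (s *v x)"
  by (simp add: pairing_transpose refl_transpose)

text \<open>Up to sign, twice the factor that accompanies \<open>c s\<close> and \<open>s\<close> in
  the relation for \<open>[y, x]\<close>. Expressed by \<open>s\<close> alone, it is visibly
  independent of the scaling of roots and coroots.\<close>

definition bt :: "'n mtx \<Rightarrow> 'n cvect \<Rightarrow> 'n cvect \<Rightarrow> complex" where
  "bt s y x = pairing (y - s *v y) x"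

lemma bt_eq: "s \<in> Rf \<Longrightarrow> bt s y x = pairing y (al s) * pairing (gm s) x"
  by (simp add: bt_def sref clin_scale[OF clin_pairing_left] cscale_complex_def)

lemma bt_sym: "s \<in> Rf \<Longrightarrow> bt s y x = bt s x y"
  by (simp add: bt_def clin_diff[OF clin_pairing_left] pairing_refl[of s y] pairing_commute[of y])

lemma bt_conj: "w \<in> W \<Longrightarrow> bt (w ** s ** transpose w) (w *v y) (w *v x) = bt s y x"
proof -
  assume w: "w \<in> W"
  have "w *v y - (w ** s ** transpose w) *v (w *v y) = w *v (y - s *v y)"
    using w by (simp add: matrix_vector_mul_assoc Wo' clin_diff[OF clin_matrix_vector] flip: matrix_mul_assoc)
  then show ?thesis using w by (simp add: bt_def pairing_W)
qed

lemma sum_conj: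
  assumes "w \<in> W"
  shows "(\<Sum>s\<in>Rf. h (w ** s ** transpose w)) = (\<Sum>s\<in>Rf. h s)"
proof (rule sum.reindex_bij_witness[of _ "\<lambda>s. transpose w ** s ** w" "\<lambda>s. w ** s ** transpose w"])
  fix s assume s: "s \<in> Rf"
  show "transpose w ** (w ** s ** transpose w) ** w = s"
    using assms by (simp add: W_cancel Wo Wo' flip: matrix_mul_assoc)
  show "w ** (transpose w ** s ** w) ** transpose w = s"
    using assms by (simp add: W_cancel Wo Wo' flip: matrix_mul_assoc)
  show "w ** s ** transpose w \<in> Rf" using assms s by (rule Rfc)
  show "transpose w ** s ** w \<in> Rf" using Rfc[OF Wt[OF assms] s] by simp
qed simp

text \<open>The tensor formed by the sum of the \<open>y_i \<otimes> y_i\<close> is fixed by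
  orthogonal matrices. This is why \<open>euler\<close> and the Dirac operator commute with the
  group.\<close>

lemma sum_orth:
  assumes "w \<in> W" and B: "\<And>x. clin (\<lambda>y. B y x)" "\<And>y. clin (\<lambda>x. B y x)"
  shows "(\<Sum>i\<in>UNIV. B (w *v axis i 1) (w *v axis i 1)) = (\<Sum>i\<in>UNIV. B (axis i 1) (axis i 1))"
proof -
  have d: "(\<Sum>i\<in>UNIV. (w *v axis i 1) $ j * (w *v axis i 1) $ k) = (if j = k then 1 else 0)" for j k
  proof -
    have "(\<Sum>i\<in>UNIV. (w *v axis i 1) $ j * (w *v axis i 1) $ k) = (w ** transpose w) $ j $ k"
      by (simp add: matrix_matrix_mult_def transpose_def mult_axis_nth)
    then show ?thesis using Wo[OF assms(1)] by (simp add: mat_def)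
  qed
  have "B (w *v axis i 1) (w *v axis i 1) =
      (\<Sum>j\<in>UNIV. \<Sum>k\<in>UNIV. ((w *v axis i 1) $ j * (w *v axis i 1) $ k) *\<^sub>C B (axis j 1) (axis k 1))" for i
    by (subst clin_vec_expand[OF B(1)], subst clin_vec_expand[OF B(2)]) (simp add: cscale_sum_right)
  then have "(\<Sum>i\<in>UNIV. B (w *v axis i 1) (w *v axis i 1)) =
      (\<Sum>i\<in>UNIV. \<Sum>j\<in>UNIV. \<Sum>k\<in>UNIV. ((w *v axis i 1) $ j * (w *v axis i 1) $ k) *\<^sub>C B (axis j 1) (axis k 1))"
    by simp
  also have "\<dots> = (\<Sum>j\<in>UNIV. \<Sum>k\<in>UNIV. \<Sum>i\<in>UNIV. ((w *v axis i 1) $ j * (w *v axis i 1) $ k) *\<^sub>C B (axis j 1) (axis k 1))"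
    by (subst sum.swap, rule sum.cong[OF refl], rule sum.swap)
  also have "\<dots> = (\<Sum>j\<in>UNIV. \<Sum>k\<in>UNIV. (if j = k then 1 else 0) *\<^sub>C B (axis j 1) (axis k 1))"
    by (simp only: d flip: cscale_sum_left)
  also have "\<dots> = (\<Sum>j\<in>UNIV. \<Sum>k\<in>UNIV. if k = j then B (axis j 1) (axis k 1) else 0)"
    by (intro sum.cong) auto
  finally show ?thesis by simp
qed

text \<open>The divided difference (Demazure operator) \<open>(f - s f) / gm s\<close>, where
  \<open>gm s\<close> is read as the linear form defining the reflecting hyperplane. The quotient is
  unique because polynomials form an integral domain; \<open>qd_eq\<close> provides its
  existence.\<close>

definition qd :: "'n mtx \<Rightarrow> 'n pol \<Rightarrow> 'n pol" where
  "qd s f = (THE q. sym_y (gm s) * q = f - sym_act s f)"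

lemma sym_y_gm_nonzero: "s \<in> Rf \<Longrightarrow> sym_y (gm s) \<noteq> 0"
proof
  assume s: "s \<in> Rf" and 0: "sym_y (gm s) = 0"
  have "gm s $ i = Poly_Mapping.lookup (sym_y (gm s)) (Poly_Mapping.single i 1)" for i
    by (simp add: sym_y_def lookup_sum lookup_single when_def single_one_eq_iff)
  then have "gm s = 0" using 0 by (simp add: vec_eq_iff)
  then show False using galg[OF s] by (simp add: clin_zero[OF clin_pairing_left])
qed

lemma qd_unique: "s \<in> Rf \<Longrightarrow> sym_y (gm s) * q = f - sym_act s f \<Longrightarrow> qd s f = q"
  unfolding qd_def
proof (rule the_equality)
  fix q' assume "s \<in> Rf" "sym_y (gm s) * q = f - sym_act s f" "sym_y (gm s) * q' = f - sym_act s f"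
  then have "sym_y (gm s) * q' = sym_y (gm s) * q" by simp
  then show "q' = q" using sym_y_gm_nonzero[OF \<open>s \<in> Rf\<close>] by (simp only: mult_cancel_left) simp
qed

lemma refl_expand: "s \<in> Rf \<Longrightarrow> sym_y (s *v x) = sym_y x - pairing x (al s) *\<^sub>C sym_y (gm s)"
  by (simp add: sref clin_diff[OF clin_sym_y] clin_scale[OF clin_sym_y])

lemma qd_step:
  "s \<in> Rf \<Longrightarrow> sym_y (gm s) * q = f - sym_act s f \<Longrightarrow>
    sym_y (gm s) * (sym_y x * q + pairing x (al s) *\<^sub>C sym_act s f) = sym_y x * f - sym_act s (sym_y x * f)"
proof -
  assume s: "s \<in> Rf" and q: "sym_y (gm s) * q = f - sym_act s f"
  have "sym_y (gm s) * (sym_y x * q + pairing x (al s) *\<^sub>C sym_act s f) =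
      sym_y x * (sym_y (gm s) * q) + pairing x (al s) *\<^sub>C (sym_y (gm s) * sym_act s f)"
    by (simp add: distrib_left cscale_mult_right mult.left_commute)
  also have "\<dots> = sym_y x * f - sym_act s (sym_y x * f)"
    using s by (simp add: q sym_act_times sym_act_sym_y refl_expand right_diff_distrib left_diff_distrib cscale_mult_left)
  finally show ?thesis .
qed

lemma qd_eq: "s \<in> Rf \<Longrightarrow> sym_y (gm s) * qd s f = f - sym_act s f"
proof -
  assume s: "s \<in> Rf"
  have "\<exists>q. sym_y (gm s) * q = f - sym_act s f"
  proof (induction f rule: pol_induct)
    case (const c)
    show ?case by (intro exI[of _ 0]) simp
  next
    case (var i p)
    then show ?case using qd_step[OF s] unfolding sym_y_axis[symmetric] by blast
  next
    case (add p q)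
    then obtain a b where "sym_y (gm s) * a = p - sym_act s p" "sym_y (gm s) * b = q - sym_act s q" by blast
    then have "sym_y (gm s) * (a + b) = (p + q) - sym_act s (p + q)"
      by (simp add: distrib_left clin_add[OF clin_sym_act])
    then show ?case by blast
  qed
  then obtain q where q: "sym_y (gm s) * q = f - sym_act s f" by blast
  with qd_unique[OF s q] show ?thesis by simp
qed

lemma clin_qd: "s \<in> Rf \<Longrightarrow> clin (qd s)"
  by (rule clinI; rule qd_unique)
    (simp_all add: distrib_left cscale_mult_right qd_eq clin_add[OF clin_sym_act] clin_scale[OF clin_sym_act] cscale_diff_right)

lemma qd_sym_y_mult: "s \<in> Rf \<Longrightarrow> qd s (sym_y x * f) = sym_y x * qd s f + pairing x (al s) *\<^sub>C sym_act s f"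
  by (rule qd_unique) (simp_all add: qd_step qd_eq)

lemma qd_scal: "s \<in> Rf \<Longrightarrow> qd s (scal z) = 0"
  by (rule qd_unique) simp_all

definition pdE :: "'n cvect \<Rightarrow> 'n pext \<Rightarrow> 'n pext" where
  "pdE y f = (\<lambda>J. pdv y (f J))"

text \<open>The reflection also acts on the exterior coefficients, as in a standard module with
  nontrivial \<open>\<sigma>\<close>. The factor 1/2 matches \<open>bt s y x / 2\<close> in the
  relations of \<open>H\<close>.\<close>

definition dunkl :: "'n cvect \<Rightarrow> 'n pext \<Rightarrow> 'n pext" where
  "dunkl y f = pdE y f - (1 / 2) *\<^sub>C (\<Sum>s\<in>Rf. (c s * pairing y (gm s)) *\<^sub>C tns (ext_act s) (qd s) f)"

lemma clin_pdE: "clin (pdE y)"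
  by (rule clinI) (simp_all add: pdE_def fun_eq_iff fun_apply clin_add[OF clin_pdv] clin_scale[OF clin_pdv])

lemma clin_pdE_left: "clin (\<lambda>y. pdE y f)"
  by (rule clinI) (simp_all add: pdE_def fun_eq_iff fun_apply clin_add[OF clin_pdv_left] clin_scale[OF clin_pdv_left])

lemma clin_dunkl: "clin (dunkl y)"
  unfolding dunkl_def by (intro clin_minusf clin_pdE clin_cscale clin_sumf clin_tns clin_qd)

lemma clin_dunkl_left: "clin (\<lambda>y. dunkl y f)"
proof -
  have "clin (\<lambda>y. (c s * pairing y (gm s)) *\<^sub>C g)" for s and g :: "'n pext"
    by (rule clinI) (simp_all add: clin_add[OF clin_pairing_left] clin_scale[OF clin_pairing_left]
        cscale_complex_def algebra_simps cscale_add_left)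
  then show ?thesis
    unfolding dunkl_def by (intro clin_minusf clin_pdE_left clin_cscale clin_sumf)
qed

lemma pdE_xmul: "pdE y (xmul x f) = pairing y x *\<^sub>C f + xmul x (pdE y f)"
  by (simp add: pdE_def xmul_def fun_eq_iff fun_apply pdv_sym_y_mult)

text \<open>The defining commutation relation of \<open>H\<close>. The group elements appear because
  the divided difference satisfies a twisted Leibniz rule.\<close>

lemma dunkl_xmul:
  "dunkl y (xmul x f) = xmul x (dunkl y f) + pairing y x *\<^sub>C f
     - (1 / 2) *\<^sub>C (\<Sum>s\<in>Rf. (c s * bt s y x) *\<^sub>C wact s f)"
proof -
  have Q: "tns (ext_act s) (qd s) (xmul x f) = xmul x (tns (ext_act s) (qd s) f) + pairing x (al s) *\<^sub>C wact s f"
    if "s \<in> Rf" for s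
    using that by (simp add: tns_xmul qd_sym_y_mult tns_add_right tns_scale_right xmul_tns wact_def)
  have b: "bt s y x = pairing y (gm s) * pairing x (al s)" if "s \<in> Rf" for s
    using bt_sym[OF that, of y x] bt_eq[OF that, of x y] by (simp add: pairing_commute[of y "gm s"])
  have "(\<Sum>s\<in>Rf. (c s * pairing y (gm s)) *\<^sub>C tns (ext_act s) (qd s) (xmul x f)) =
      (\<Sum>s\<in>Rf. (c s * pairing y (gm s)) *\<^sub>C xmul x (tns (ext_act s) (qd s) f)) +
      (\<Sum>s\<in>Rf. (c s * bt s y x) *\<^sub>C wact s f)"
    unfolding sum.distrib[symmetric]
    by (intro sum.cong refl) (simp add: Q b cscale_add_right mult_ac)
  then show ?thesis
    by (simp add: dunkl_def pdE_xmul clin_diff[OF clin_xmul] clin_scale[OF clin_xmul] clin_sum[OF clin_xmul]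
        cscale_add_right)
qed

lemma dunkl_emb [simp]: "dunkl y (emb v) = 0"
  by (simp add: dunkl_def pdE_def emb_def fun_eq_iff fun_apply sum_fun_apply tns_def qd_scal cong: sum.cong)

lemma wact_sum_conj:
  assumes "w \<in> W"
  shows "(\<Sum>s\<in>Rf. (c s * h s) *\<^sub>C wact w (wact s f)) = (\<Sum>s\<in>Rf. (c s * h (transpose w ** s ** w)) *\<^sub>C wact s (wact w f))"
proof -
  have "(\<Sum>s\<in>Rf. (c s * h (transpose w ** s ** w)) *\<^sub>C wact s (wact w f)) =
      (\<Sum>s\<in>Rf. (c (w ** s ** transpose w) * h (transpose w ** (w ** s ** transpose w) ** w)) *\<^sub>C
        wact (w ** s ** transpose w) (wact w f))"
    by (rule sum_conj[OF assms, symmetric])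
  also have "\<dots> = (\<Sum>s\<in>Rf. (c s * h s) *\<^sub>C wact w (wact s f))"
  proof (intro sum.cong refl)
    fix s assume s: "s \<in> Rf"
    have "transpose w ** (w ** s ** transpose w) ** w = s" "w ** s ** transpose w ** w = w ** s"
      using assms by (simp_all add: W_cancel Wo Wo' flip: matrix_mul_assoc)
    then show "(c (w ** s ** transpose w) * h (transpose w ** (w ** s ** transpose w) ** w)) *\<^sub>C
        wact (w ** s ** transpose w) (wact w f) = (c s * h s) *\<^sub>C wact w (wact s f)"
      using cc[OF assms s] by (simp flip: wact_mult)
  qed
  finally show ?thesis by simp
qed

lemma bt_conj': "w \<in> W \<Longrightarrow> bt (transpose w ** s ** w) y x = bt s (w *v y) (w *v x)"
  using bt_conj[of w "transpose w ** s ** w" y x] by (simp add: W_cancel Wo flip: matrix_mul_assoc)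

lemma wact_dunkl: "w \<in> W \<Longrightarrow> wact w (dunkl y f) = dunkl (w *v y) (wact w f)"
proof (induction f rule: pext_induct)
  case (emb v)
  then show ?case by (simp only: wact_emb dunkl_emb clin_zero[OF clin_wact])
next
  case (xmul i f)
  then show ?case
    by (simp add: dunkl_xmul wact_xmul clin_add[OF clin_wact] clin_diff[OF clin_wact] clin_scale[OF clin_wact]
        clin_sum[OF clin_wact] wact_sum_conj bt_conj' pairing_W del: pairing_axis_right pairing_axis_left)
next
  case (add f g)
  then show ?case by (simp add: clin_add[OF clin_wact] clin_add[OF clin_dunkl])
qed

lemma dunkl_commute: "dunkl y (dunkl y' f) = dunkl y' (dunkl y f)"
proof (induction f rule: pext_induct)
  case (emb v)
  show ?case by (simp only: dunkl_emb clin_zero[OF clin_dunkl])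
next
  case (xmul i f)
  let ?x = "axis i 1 :: 'n cvect"
  \<comment> \<open>The terms that are not visibly symmetric in \<open>y\<close> and
    \<open>y'\<close>. Moving \<open>s\<close> past a Dunkl operator leaves a correction
    proportional to \<open>pairing y (al s) * pairing y' (al s)\<close>, which is symmetric as
    well.\<close>
  define F where "F y y' s = bt s y ?x *\<^sub>C wact s (dunkl y' f) + bt s y' ?x *\<^sub>C dunkl y (wact s f)" for y y' s
  have F: "F y y' s = F y' y s" if s: "s \<in> Rf" for s
  proof -
    have 1: "wact s (dunkl y f) = dunkl y (wact s f) - pairing y (al s) *\<^sub>C dunkl (gm s) (wact s f)" for y
      using s RfW by (subst wact_dunkl) (auto simp: sref clin_diff[OF clin_dunkl_left] clin_scale[OF clin_dunkl_left])
    show ?thesis using s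
      by (simp add: F_def 1 bt_eq cscale_diff_right mult_ac)
  qed
  have 2: "dunkl y (dunkl y' (xmul ?x f)) = xmul ?x (dunkl y (dunkl y' f)) + pairing y ?x *\<^sub>C dunkl y' f
      + pairing y' ?x *\<^sub>C dunkl y f - (1 / 2) *\<^sub>C (\<Sum>s\<in>Rf. c s *\<^sub>C F y y' s)" for y y'
  proof -
    have "(\<Sum>s\<in>Rf. c s *\<^sub>C F y y' s) =
        (\<Sum>s\<in>Rf. (c s * bt s y ?x) *\<^sub>C wact s (dunkl y' f)) + (\<Sum>s\<in>Rf. (c s * bt s y' ?x) *\<^sub>C dunkl y (wact s f))"
      by (simp add: F_def cscale_add_right sum.distrib)
    then show ?thesis
      by (simp add: dunkl_xmul clin_add[OF clin_dunkl] clin_diff[OF clin_dunkl] clin_scale[OF clin_dunkl]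
        clin_sum[OF clin_dunkl] cscale_add_right algebra_simps)
  qed
  have "(\<Sum>s\<in>Rf. c s *\<^sub>C F y y' s) = (\<Sum>s\<in>Rf. c s *\<^sub>C F y' y s)"
    by (intro sum.cong refl) (simp add: F)
  then show ?case unfolding 2 xmul by (simp add: algebra_simps)
next
  case (add f g)
  then show ?case by (simp add: clin_add[OF clin_dunkl])
qed


section \<open>The Euler element\<close>

text \<open>The grading element. Its reflection term is chosen to cancel the one in
  \<open>[y, x]\<close>, so that the commutator with \<open>x\<close> is \<open>x\<close> itself and
  the one with \<open>y\<close> is \<open>- y\<close>.\<close>

definition euler :: "'n pext \<Rightarrow> 'n pext" where
  "euler f = (\<Sum>i\<in>UNIV. xmul (axis i 1) (dunkl (axis i 1) f)) - (1 / 2) *\<^sub>C (\<Sum>s\<in>Rf. c s *\<^sub>C wact s f)"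

lemma clin_euler: "clin euler"
  unfolding euler_def
  by (intro clin_minusf clin_sumf clin_cscale clin_wact clin_compose[OF clin_xmul clin_dunkl])

lemma sum_bt_left: "s \<in> Rf \<Longrightarrow> clin B \<Longrightarrow> (\<Sum>i\<in>UNIV. bt s (axis i 1) x *\<^sub>C B (axis i 1)) = B (x - s *v x)"
  using sum_axis_pairing[of B "x - s *v x"] by (simp add: bt_sym[of s _ x]) (simp add: bt_def pairing_commute)

lemma euler_xmul: "euler (xmul x f) = xmul x (euler f) + xmul x f"
proof -
  have "(\<Sum>i\<in>UNIV. xmul (axis i 1) (dunkl (axis i 1) (xmul x f))) =
     (\<Sum>i\<in>UNIV. xmul x (xmul (axis i 1) (dunkl (axis i 1) f))) + (\<Sum>i\<in>UNIV. pairing (axis i 1) x *\<^sub>C xmul (axis i 1) f)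
     - (1 / 2) *\<^sub>C (\<Sum>i\<in>UNIV. \<Sum>s\<in>Rf. (c s * bt s (axis i 1) x) *\<^sub>C xmul (axis i 1) (wact s f))"
    by (simp only: dunkl_xmul clin_add[OF clin_xmul] clin_diff[OF clin_xmul] clin_scale[OF clin_xmul]
        clin_sum[OF clin_xmul] sum.distrib sum_subtractf cscale_sum_right xmul_commute[of x])
  also have "(\<Sum>i\<in>UNIV. pairing (axis i 1) x *\<^sub>C xmul (axis i 1) f) = xmul x f"
    by (rule sum_axis_pairing[OF clin_xmul_left])
  also have "(\<Sum>i\<in>UNIV. \<Sum>s\<in>Rf. (c s * bt s (axis i 1) x) *\<^sub>C xmul (axis i 1) (wact s f)) =
      (\<Sum>s\<in>Rf. c s *\<^sub>C xmul (x - s *v x) (wact s f))"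
    by (subst sum.swap) (intro sum.cong refl, simp add: sum_bt_left[OF _ clin_xmul_left, symmetric] cscale_sum_right)
  finally have 1: "(\<Sum>i\<in>UNIV. xmul (axis i 1) (dunkl (axis i 1) (xmul x f))) =
     (\<Sum>i\<in>UNIV. xmul x (xmul (axis i 1) (dunkl (axis i 1) f))) + xmul x f
     - (1 / 2) *\<^sub>C (\<Sum>s\<in>Rf. c s *\<^sub>C xmul (x - s *v x) (wact s f))" .
  have "(\<Sum>s\<in>Rf. c s *\<^sub>C xmul (x - s *v x) (wact s f)) + (\<Sum>s\<in>Rf. c s *\<^sub>C wact s (xmul x f)) =
      (\<Sum>s\<in>Rf. c s *\<^sub>C xmul x (wact s f))"
    unfolding sum.distrib[symmetric]
    by (intro sum.cong refl) (simp add: wact_xmul clin_diff[OF clin_xmul_left] cscale_diff_right)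
  then have "(1 / 2) *\<^sub>C (\<Sum>s\<in>Rf. c s *\<^sub>C xmul (x - s *v x) (wact s f)) + (1 / 2) *\<^sub>C (\<Sum>s\<in>Rf. c s *\<^sub>C wact s (xmul x f)) =
      (1 / 2) *\<^sub>C (\<Sum>s\<in>Rf. c s *\<^sub>C xmul x (wact s f))"
    unfolding cscale_add_right[symmetric] by simp
  then show ?thesis
    unfolding euler_def 1
    by (simp add: clin_diff[OF clin_xmul] clin_scale[OF clin_xmul] clin_sum[OF clin_xmul]) (simp add: algebra_simps)
qed

text \<open>Commutativity of the Dunkl operators is what lets \<open>y\<close> pass the second
  factor in the sum of the \<open>x_i y_i\<close>.\<close>

lemma euler_dunkl: "euler (dunkl y f) = dunkl y (euler f) - dunkl y f"
proof -
  have 1: "dunkl y (\<Sum>i\<in>UNIV. xmul (axis i 1) (dunkl (axis i 1) f)) =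
     (\<Sum>i\<in>UNIV. xmul (axis i 1) (dunkl (axis i 1) (dunkl y f))) + dunkl y f
     - (1 / 2) *\<^sub>C (\<Sum>s\<in>Rf. c s *\<^sub>C wact s (dunkl (y - s *v y) f))"
  proof -
    have "dunkl y (\<Sum>i\<in>UNIV. xmul (axis i 1) (dunkl (axis i 1) f)) =
     (\<Sum>i\<in>UNIV. xmul (axis i 1) (dunkl (axis i 1) (dunkl y f))) + (\<Sum>i\<in>UNIV. pairing y (axis i 1) *\<^sub>C dunkl (axis i 1) f)
     - (1 / 2) *\<^sub>C (\<Sum>i\<in>UNIV. \<Sum>s\<in>Rf. (c s * bt s y (axis i 1)) *\<^sub>C wact s (dunkl (axis i 1) f))"
      by (simp only: dunkl_xmul clin_sum[OF clin_dunkl] sum.distrib sum_subtractf cscale_sum_right dunkl_commute[of y])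
    also have "(\<Sum>i\<in>UNIV. pairing y (axis i 1) *\<^sub>C dunkl (axis i 1) f) = dunkl y f"
      unfolding pairing_commute[of y] by (rule sum_axis_pairing[OF clin_dunkl_left])
    also have "(\<Sum>i\<in>UNIV. \<Sum>s\<in>Rf. (c s * bt s y (axis i 1)) *\<^sub>C wact s (dunkl (axis i 1) f)) =
        (\<Sum>s\<in>Rf. c s *\<^sub>C wact s (dunkl (y - s *v y) f))"
      by (subst sum.swap)
        (intro sum.cong refl, simp add: sum_bt_left[OF _ clin_compose[OF clin_wact clin_dunkl_left], symmetric]
          cscale_sum_right bt_sym[of _ y])
    finally show ?thesis .
  qed
  have 2: "(\<Sum>s\<in>Rf. c s *\<^sub>C wact s (dunkl (y - s *v y) f)) + (\<Sum>s\<in>Rf. c s *\<^sub>C dunkl y (wact s f)) =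
      (\<Sum>s\<in>Rf. c s *\<^sub>C wact s (dunkl y f))"
    unfolding sum.distrib[symmetric]
  proof (intro sum.cong refl)
    fix s assume s: "s \<in> Rf"
    have "wact s (dunkl (s *v y) f) = dunkl y (wact s f)"
      using s RfW by (subst wact_dunkl) (auto simp: refl_sq)
    then show "c s *\<^sub>C wact s (dunkl (y - s *v y) f) + c s *\<^sub>C dunkl y (wact s f) = c s *\<^sub>C wact s (dunkl y f)"
      by (simp add: clin_diff[OF clin_dunkl_left] clin_diff[OF clin_wact] cscale_diff_right)
  qed
  then have "(1 / 2) *\<^sub>C (\<Sum>s\<in>Rf. c s *\<^sub>C wact s (dunkl (y - s *v y) f)) + (1 / 2) *\<^sub>C (\<Sum>s\<in>Rf. c s *\<^sub>C dunkl y (wact s f)) =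
      (1 / 2) *\<^sub>C (\<Sum>s\<in>Rf. c s *\<^sub>C wact s (dunkl y f))"
    unfolding cscale_add_right[symmetric] by simp
  moreover have "dunkl y (\<Sum>s\<in>Rf. c s *\<^sub>C wact s f) = (\<Sum>s\<in>Rf. c s *\<^sub>C dunkl y (wact s f))"
    by (simp add: clin_sum[OF clin_dunkl] clin_scale[OF clin_dunkl])
  ultimately show ?thesis
    unfolding euler_def[of f] clin_diff[OF clin_dunkl] 1 clin_scale[OF clin_dunkl] euler_def[of "dunkl y f"]
    by (simp add: algebra_simps)
qed

lemma euler_wact: "w \<in> W \<Longrightarrow> euler (wact w f) = wact w (euler f)"
proof -
  assume w: "w \<in> W"
  have "(\<Sum>i\<in>UNIV. xmul (axis i 1) (dunkl (axis i 1) (wact w f))) =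
      (\<Sum>i\<in>UNIV. xmul (w *v axis i 1) (dunkl (w *v axis i 1) (wact w f)))"
    by (rule sum_orth[OF w, symmetric]) (auto intro: clin_xmul_left clin_compose[OF clin_xmul clin_dunkl_left])
  also have "\<dots> = (\<Sum>i\<in>UNIV. wact w (xmul (axis i 1) (dunkl (axis i 1) f)))"
    using w by (simp add: wact_xmul wact_dunkl)
  finally show ?thesis
    using wact_sum_conj[OF w, of "\<lambda>_. 1" f]
    by (simp add: euler_def clin_diff[OF clin_wact] clin_scale[OF clin_wact] clin_sum[OF clin_wact])
qed

section \<open>The weights of the Euler element\<close>

definition Nc :: complex where "Nc = (\<Sum>s\<in>Rf. c s)"

text \<open>By \<open>ext_act_reflection\<close>, the map \<open>1 - s\<close> on the exterior
  algebra is the derivation that extends \<open>1 - s\<close> on \<open>h\<close>. Hence the sum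
  weighted by \<open>c\<close> is the derivation extending the scalar \<open>\<kappa>\<close>, which
  is \<open>\<kappa> * j\<close> in degree \<open>j\<close>.\<close>

lemma sum_refl_ext:
  "v \<in> extgr j \<Longrightarrow> (\<Sum>s\<in>Rf. c s *\<^sub>C ext_act s v) = (Nc - \<kappa> * of_nat j) *\<^sub>C v"
proof -
  assume v: "v \<in> extgr j"
  \<comment> \<open>The derivation induced by \<open>1 - s\<close>, expanded over the basis; the
    factor 2 and the sign come from the normalization of \<open>contract\<close>.\<close>
  have s: "2 *\<^sub>C (v - ext_act s v) = - (\<Sum>i\<in>UNIV. wedge (axis i 1 - s *v axis i 1) (contract (axis i 1) v))"
    if "s \<in> Rf" for s
  proof -
    have "(\<Sum>i\<in>UNIV. wedge (axis i 1 - s *v axis i 1) (contract (axis i 1) v)) =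
        (\<Sum>i\<in>UNIV. pairing (axis i 1) (al s) *\<^sub>C wedge (gm s) (contract (axis i 1) v))"
      using that by (simp add: sref clin_scale[OF clin_wedge_left])
    also have "\<dots> = wedge (gm s) (contract (al s) v)"
      by (rule sum_axis_pairing[OF clin_compose[OF clin_wedge clin_contract_left]])
    finally show ?thesis using that by (simp add: ext_act_reflection[OF sref])
  qed
  have n: "(\<Sum>i\<in>UNIV. wedge (axis i 1) (contract (axis i 1) v)) = (- 2 * of_nat j) *\<^sub>C v"
  proof -
    have "(\<Sum>i\<in>UNIV. wedge (axis i 1) (contract (axis i 1) v)) =
       (\<Sum>I\<in>UNIV. v $ I *\<^sub>C (\<Sum>i\<in>UNIV. wedge (axis i 1) (contract (axis i 1) (axis I 1))))"
      by (rule clin_ext_expand[OF clin_sumf[OF clin_compose[OF clin_wedge clin_contract]]])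
    also have "\<dots> = (\<Sum>I\<in>UNIV. (- 2 * of_nat j) *\<^sub>C (v $ I *\<^sub>C axis I 1))"
      unfolding sum_wedge_contract
    proof (intro sum.cong refl)
      fix I
      show "v $ I *\<^sub>C (- 2 * of_nat (card I)) *\<^sub>C axis I 1 = (- 2 * of_nat j) *\<^sub>C v $ I *\<^sub>C (axis I 1 :: 'n ext)"
        using v by (cases "v $ I = 0") (auto simp: extgr_def mult_ac)
    qed
    also have "\<dots> = (- 2 * of_nat j) *\<^sub>C v"
      unfolding cscale_sum_right[symmetric] by (simp flip: ext_expand)
    finally show ?thesis .
  qed
  have "2 *\<^sub>C (\<Sum>s\<in>Rf. c s *\<^sub>C (v - ext_act s v)) = (\<Sum>s\<in>Rf. c s *\<^sub>C (2 *\<^sub>C (v - ext_act s v)))"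
    by (simp add: cscale_sum_right mult.commute)
  also have "\<dots> = - (\<Sum>s\<in>Rf. \<Sum>i\<in>UNIV. wedge (c s *\<^sub>C (axis i 1 - s *v axis i 1)) (contract (axis i 1) v))"
    by (simp add: s cscale_sum_right clin_scale[OF clin_wedge_left] sum_negf)
  also have "(\<Sum>s\<in>Rf. \<Sum>i\<in>UNIV. wedge (c s *\<^sub>C (axis i 1 - s *v axis i 1)) (contract (axis i 1) v)) =
      (\<Sum>i\<in>UNIV. wedge (\<Sum>s\<in>Rf. c s *\<^sub>C (axis i 1 - s *v axis i 1)) (contract (axis i 1) v))"
    by (subst sum.swap) (simp add: clin_sum[OF clin_wedge_left])
  also have "\<dots> = \<kappa> *\<^sub>C ((- 2 * of_nat j) *\<^sub>C v)"
    by (simp only: schur clin_scale[OF clin_wedge_left] n flip: cscale_sum_right)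
  finally have "(1 / 2) *\<^sub>C (2 *\<^sub>C (\<Sum>s\<in>Rf. c s *\<^sub>C (v - ext_act s v))) = (1 / 2) *\<^sub>C (- (\<kappa> *\<^sub>C ((- 2 * of_nat j) *\<^sub>C v)))"
    by simp
  then have "(\<Sum>s\<in>Rf. c s *\<^sub>C (v - ext_act s v)) = (\<kappa> * of_nat j) *\<^sub>C v"
    by simp
  then show ?thesis
    by (simp add: cscale_diff_right sum_subtractf Nc_def cscale_diff_left algebra_simps flip: cscale_sum_left)
qed

definition mdeg :: "('n \<Rightarrow>\<^sub>0 nat) \<Rightarrow> nat" where
  "mdeg m = (\<Sum>i\<in>UNIV. Poly_Mapping.lookup m i)"

text \<open>Polynomial degree plus the scalar by which -1/2 times the class sum acts on constants of
  exterior degree \<open>j\<close>.\<close>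

definition ewt :: "nat \<Rightarrow> ('n \<Rightarrow>\<^sub>0 nat) \<Rightarrow> complex" where
  "ewt j m = of_nat (mdeg m) - Nc / 2 + \<kappa> * of_nat j / 2"

lemma lookup_pvar_mult:
  "Poly_Mapping.lookup (pvar i * p) m =
    (if Poly_Mapping.lookup m i = 0 then 0 else Poly_Mapping.lookup p (m - Poly_Mapping.single i 1))"
proof (induction p rule: pm_induct)
  case (single m' c)
  have "Poly_Mapping.single i 1 + m' = m \<longleftrightarrow> Poly_Mapping.lookup m i \<noteq> 0 \<and> m' = m - Poly_Mapping.single i 1"
  proof
    assume "Poly_Mapping.lookup m i \<noteq> 0 \<and> m' = m - Poly_Mapping.single i 1"
    then show "Poly_Mapping.single i 1 + m' = m"
      by (intro poly_mapping_eqI) (auto simp: lookup_add lookup_minus lookup_single when_def)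
  qed (auto simp: lookup_add)
  then show ?case by (auto simp: pvar_def mult_single lookup_single when_def)
qed (simp add: distrib_left lookup_add)

lemma mdeg_remove: "Poly_Mapping.lookup m i \<noteq> 0 \<Longrightarrow> mdeg m = Suc (mdeg (m - Poly_Mapping.single i 1))"
proof -
  assume a: "Poly_Mapping.lookup m i \<noteq> 0"
  have "mdeg m = (\<Sum>j\<in>UNIV. (if j = i then 1 else 0) + Poly_Mapping.lookup (m - Poly_Mapping.single i 1) j)"
    unfolding mdeg_def using a by (intro sum.cong) (auto simp: lookup_minus lookup_single when_def)
  then show ?thesis by (simp add: sum.distrib mdeg_def)
qed

text \<open>Multiplication by \<open>x_i\<close> raises \<open>euler\<close> by one, so its values
  on constants fix it on all monomials. In particular it is diagonal, although single Dunkl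
  operators mix monomials.\<close>

lemma euler_lookup: "Poly_Mapping.lookup (euler f J) m = ewt (card J) m * Poly_Mapping.lookup (f J) m"
proof (induction f arbitrary: m rule: pext_induct)
  case (emb v)
  have "euler (emb v) = - (1 / 2) *\<^sub>C (\<Sum>s\<in>Rf. c s *\<^sub>C wact s (emb v))"
    by (simp add: euler_def clin_zero[OF clin_xmul])
  also have "(\<Sum>s\<in>Rf. c s *\<^sub>C wact s (emb v)) = emb (\<Sum>s\<in>Rf. c s *\<^sub>C ext_act s v)"
    by (simp add: wact_emb clin_sum[OF clin_emb] clin_scale[OF clin_emb])
  also have "(\<Sum>s\<in>Rf. c s *\<^sub>C ext_act s v) = (\<Sum>I\<in>UNIV. v $ I *\<^sub>C (\<Sum>s\<in>Rf. c s *\<^sub>C ext_act s (axis I 1)))"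
    by (rule clin_ext_expand[OF clin_sumf[OF clin_cscale[OF clin_ext_act]]])
  also have "\<dots> = (\<Sum>I\<in>UNIV. (v $ I * (Nc - \<kappa> * of_nat (card I))) *\<^sub>C axis I 1)"
    by (simp add: sum_refl_ext[OF extgr_axis])
  also have "\<dots> = (\<chi> I. v $ I * (Nc - \<kappa> * of_nat (card I)))"
    using ext_expand[of "\<chi> I. v $ I * (Nc - \<kappa> * of_nat (card I))"] by simp
  finally have "Poly_Mapping.lookup (euler (emb v) J) m =
      ((- (1 / 2) * (v $ J * (Nc - \<kappa> * of_nat (card J)))) when m = 0)"
    by (simp add: fun_apply emb_def lookup_single when_def)
  moreover have "mdeg 0 = 0" by (simp add: mdeg_def)
  ultimately show ?case by (auto simp: emb_def lookup_single when_def ewt_def field_simps)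
next
  case (xmul i f)
  show ?case
    unfolding euler_xmul
    by (auto simp: fun_apply xmul_def sym_y_axis lookup_add lookup_pvar_mult xmul ewt_def mdeg_remove algebra_simps)
next
  case (add f g)
  then show ?case unfolding clin_add[OF clin_euler] by (simp add: fun_apply lookup_add distrib_left)
qed

end

section \<open>The Dirac operator\<close>

context refl_rep
begin

text \<open>The action of the double cover with the scalar \<open>chi\<close> removed, which makes
  it an action of the group itself.\<close>

definition wS :: "'n mtx \<Rightarrow> ('n set \<Rightarrow> 'n pext) \<Rightarrow> 'n set \<Rightarrow> 'n pext" where
  "wS w = tns (ext_act w) (wact w)"

definition kx :: "('n set \<Rightarrow> 'n pext) \<Rightarrow> 'n set \<Rightarrow> 'n pext" where
  "kx t = (\<Sum>i\<in>UNIV. tns (wedge (axis i 1)) (xmul (axis i 1)) t)"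

text \<open>The operators \<open>Y\<close> are a parameter because two families are inserted: Dunkl
  operators for \<open>D\<close>, plain derivatives for the Koszul homotopy.\<close>

definition ky :: "('n cvect \<Rightarrow> 'n pext \<Rightarrow> 'n pext) \<Rightarrow> ('n set \<Rightarrow> 'n pext) \<Rightarrow> 'n set \<Rightarrow> 'n pext" where
  "ky Y t = (\<Sum>i\<in>UNIV. tns (contract (axis i 1)) (Y (axis i 1)) t)"

definition dirac_op :: "('n set \<Rightarrow> 'n pext) \<Rightarrow> 'n set \<Rightarrow> 'n pext" where
  "dirac_op t = kx t + ky dunkl t"

definition Om :: "('n set \<Rightarrow> 'n pext) \<Rightarrow> 'n set \<Rightarrow> 'n pext" where
  "Om t = (1 / 2) *\<^sub>C (\<Sum>s\<in>Rf. c s *\<^sub>C wS s t)"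

lemma clin_wS: "clin (wS w)"
  unfolding wS_def by (rule clin_tns[OF clin_wact])

lemma clin_kx: "clin kx"
  unfolding kx_def by (intro clin_sumf clin_tns clin_xmul)

lemma clin_ky: "(\<And>y. clin (Y y)) \<Longrightarrow> clin (ky Y)"
  unfolding ky_def by (intro clin_sumf clin_tns)

lemma clin_dirac: "clin dirac_op"
  unfolding dirac_op_def by (intro clin_plus clin_kx clin_ky clin_dunkl)

lemma clin_Om: "clin Om"
  unfolding Om_def by (intro clin_cscale clin_sumf clin_wS)

lemma wS_mult: "wS (g ** h) t = wS g (wS h t)"
  by (simp add: wS_def tns_tns[OF clin_ext_act clin_wact] ext_act_mult[abs_def] wact_mult[abs_def])

lemma wS_one: "wS (mat 1) t = t"
  by (simp add: wS_def ext_act_one[abs_def] wact_one[abs_def] tns_id)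

lemma kx_kx: "kx (kx t) = 0"
proof (rule cvec_eq_uminus)
  let ?A = "\<lambda>i j. tns (\<lambda>v. wedge (axis i 1) (wedge (axis j 1) v)) (\<lambda>f. xmul (axis i 1) (xmul (axis j 1) f)) t"
  have "kx (kx t) = (\<Sum>i\<in>UNIV. \<Sum>j\<in>UNIV. ?A i j)"
    by (simp add: kx_def clin_sum[OF clin_tns[OF clin_xmul]] tns_tns[OF clin_wedge clin_xmul])
  also have "\<dots> = (\<Sum>j\<in>UNIV. \<Sum>i\<in>UNIV. ?A i j)" by (rule sum.swap)
  also have "\<dots> = - (\<Sum>j\<in>UNIV. \<Sum>i\<in>UNIV. ?A j i)"
  proof -
    have "?A i j = - ?A j i" for i j
      by (subst wedge_anticomm, subst xmul_commute) (rule tns_minus_left)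
    then show ?thesis unfolding sum_negf[symmetric] by (intro sum.cong refl)
  qed
  also have "(\<Sum>j\<in>UNIV. \<Sum>i\<in>UNIV. ?A j i) = kx (kx t)"
    by (simp add: kx_def clin_sum[OF clin_tns[OF clin_xmul]] tns_tns[OF clin_wedge clin_xmul])
  finally show "kx (kx t) = - kx (kx t)" .
qed

lemma ky_ky: "ky dunkl (ky dunkl t) = 0"
proof (rule cvec_eq_uminus)
  let ?A = "\<lambda>i j. tns (\<lambda>v. contract (axis i 1) (contract (axis j 1) v)) (\<lambda>f. dunkl (axis i 1) (dunkl (axis j 1) f)) t"
  have "ky dunkl (ky dunkl t) = (\<Sum>i\<in>UNIV. \<Sum>j\<in>UNIV. ?A i j)"
    by (simp add: ky_def clin_sum[OF clin_tns[OF clin_dunkl]] tns_tns[OF clin_contract clin_dunkl])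
  also have "\<dots> = (\<Sum>j\<in>UNIV. \<Sum>i\<in>UNIV. ?A i j)" by (rule sum.swap)
  also have "\<dots> = - (\<Sum>j\<in>UNIV. \<Sum>i\<in>UNIV. ?A j i)"
  proof -
    have "?A i j = - ?A j i" for i j
      by (subst contract_anticomm, subst dunkl_commute) (rule tns_minus_left)
    then show ?thesis unfolding sum_negf[symmetric] by (intro sum.cong refl)
  qed
  also have "(\<Sum>j\<in>UNIV. \<Sum>i\<in>UNIV. ?A j i) = ky dunkl (ky dunkl t)"
    by (simp add: ky_def clin_sum[OF clin_tns[OF clin_dunkl]] tns_tns[OF clin_contract clin_dunkl])
  finally show "ky dunkl (ky dunkl t) = - ky dunkl (ky dunkl t)" .
qed

text \<open>Exchanging wedge and contraction leaves the diagonal terms plus terms with the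
  commutator of \<open>Y\<close> and \<open>x\<close> only. This commutator is scalar for
  derivatives and involves reflections for Dunkl operators.\<close>

lemma kx_ky:
  assumes Y: "\<And>y. clin (Y y)"
  shows "kx (ky Y t) + ky Y (kx t) =
    (- 2) *\<^sub>C tns (\<lambda>v. v) (\<lambda>f. \<Sum>i\<in>UNIV. xmul (axis i 1) (Y (axis i 1) f)) t +
    (\<Sum>i\<in>UNIV. \<Sum>j\<in>UNIV. tns (\<lambda>v. contract (axis j 1) (wedge (axis i 1) v))
       (\<lambda>f. Y (axis j 1) (xmul (axis i 1) f) - xmul (axis i 1) (Y (axis j 1) f)) t)"
proof -
  let ?CW = "\<lambda>i j v. contract (axis j 1) (wedge (axis i 1) v) :: 'n ext"
  let ?xy = "\<lambda>i j f. xmul (axis i 1) (Y (axis j 1) f)"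
  let ?yx = "\<lambda>i j f. Y (axis j 1) (xmul (axis i 1) f)"
  have wc: "wedge (axis i 1) (contract (axis j 1) v) = (if j = i then (- 2) *\<^sub>C v else 0) + - ?CW i j v"
    for i j and v :: "'n ext"
    unfolding contract_wedge pairing_axis by auto
  have 1: "tns (\<lambda>v. wedge (axis i 1) (contract (axis j 1) v)) (?xy i j) t =
      (if j = i then (- 2) *\<^sub>C tns (\<lambda>v. v) (?xy i i) t else 0) - tns (?CW i j) (?xy i j) t" for i j
    unfolding wc tns_add_left tns_minus_left
    by (cases "j = i") (simp_all only: simp_thms if_True if_False tns_scale_left tns_zero_left diff_conv_add_uminus)
  have "kx (ky Y t) = (\<Sum>i\<in>UNIV. \<Sum>j\<in>UNIV. tns (\<lambda>v. wedge (axis i 1) (contract (axis j 1) v)) (?xy i j) t)"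
    by (simp add: kx_def ky_def clin_sum[OF clin_tns[OF clin_xmul]] tns_tns[OF clin_wedge clin_xmul])
  also have "\<dots> = (\<Sum>i\<in>UNIV. (- 2) *\<^sub>C tns (\<lambda>v. v) (?xy i i) t) - (\<Sum>i\<in>UNIV. \<Sum>j\<in>UNIV. tns (?CW i j) (?xy i j) t)"
    unfolding 1 sum_subtractf by (simp add: sum.delta del: cscale_minus_left)
  also have "(\<Sum>i\<in>UNIV. (- 2) *\<^sub>C tns (\<lambda>v. v) (?xy i i) t) = (- 2) *\<^sub>C tns (\<lambda>v. v) (\<lambda>f. \<Sum>i\<in>UNIV. ?xy i i f) t"
    unfolding cscale_sum_right[symmetric] tns_sum_right ..
  finally have a: "kx (ky Y t) = (- 2) *\<^sub>C tns (\<lambda>v. v) (\<lambda>f. \<Sum>i\<in>UNIV. ?xy i i f) t -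
    (\<Sum>i\<in>UNIV. \<Sum>j\<in>UNIV. tns (?CW i j) (?xy i j) t)" .
  have "ky Y (kx t) = (\<Sum>j\<in>UNIV. \<Sum>i\<in>UNIV. tns (?CW i j) (?yx i j) t)"
    by (simp add: kx_def ky_def clin_sum[OF clin_tns[OF Y]] tns_tns[OF clin_contract Y])
  also have "\<dots> = (\<Sum>i\<in>UNIV. \<Sum>j\<in>UNIV. tns (?CW i j) (?yx i j) t)" by (rule sum.swap)
  finally show ?thesis
    unfolding a tns_diff_right sum_subtractf by simp
qed

lemma tns_number:
  "tns (\<lambda>v. \<Sum>i\<in>UNIV. contract (axis i 1) (wedge (axis i 1) v)) (\<lambda>f. f) t =
    (\<lambda>I. (- 2 * (of_nat CARD('n) - of_nat (card I))) *\<^sub>C t I)" for t :: "'n set \<Rightarrow> 'n pext"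
proof
  fix J :: "'n set"
  have "tns (\<lambda>v. \<Sum>i\<in>UNIV. contract (axis i 1) (wedge (axis i 1) v)) (\<lambda>f. f) t J =
      (\<Sum>I\<in>UNIV. if I = J then (- 2 * (of_nat CARD('n) - of_nat (card I))) *\<^sub>C t I else 0)"
    unfolding tns_def sum_contract_wedge
    by (intro sum.cong) (auto simp: axis_def cscale_complex_def)
  then show "tns (\<lambda>v. \<Sum>i\<in>UNIV. contract (axis i 1) (wedge (axis i 1) v)) (\<lambda>f. f) t J =
      (- 2 * (of_nat CARD('n) - of_nat (card J))) *\<^sub>C t J" by (simp add: sum.delta)
qed

lemma sum_pairing_diag:
  "(\<Sum>i\<in>UNIV. \<Sum>j\<in>UNIV. tns (\<lambda>v. contract (axis j 1) (wedge (axis i 1) v)) (\<lambda>f. pairing (axis j 1) (axis i 1) *\<^sub>C f) t) =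
    (\<lambda>I. (- 2 * (of_nat CARD('n) - of_nat (card I))) *\<^sub>C t I)" for t :: "'n set \<Rightarrow> 'n pext"
proof -
  have 1: "tns (\<lambda>v. contract (axis j 1) (wedge (axis i 1) v)) (\<lambda>f. pairing (axis j 1) (axis i 1) *\<^sub>C f) t =
    (if j = i then tns (\<lambda>v. contract (axis i 1) (wedge (axis i 1) v)) (\<lambda>f. f) t else 0)" for i j
    unfolding tns_scale_right pairing_axis by simp
  show ?thesis
    unfolding 1 tns_number[symmetric] tns_sum_left by simp
qed

lemma kx_ky_pd:
  "kx (ky pdE t) + ky pdE (kx t) =
    (- 2) *\<^sub>C tns (\<lambda>v. v) (\<lambda>f. \<Sum>i\<in>UNIV. xmul (axis i 1) (pdE (axis i 1) f)) t +
    (\<lambda>I. (- 2 * (of_nat CARD('n) - of_nat (card I))) *\<^sub>C t I)"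
  unfolding kx_ky[OF clin_pdE] pdE_xmul add_diff_cancel_right' sum_pairing_diag ..

lemma dirac_sq:
  "dirac_op (dirac_op t) = (- 2) *\<^sub>C (\<lambda>I. euler (t I)) +
    (\<lambda>I. (- 2 * (of_nat CARD('n) - of_nat (card I))) *\<^sub>C t I) + 2 *\<^sub>C Om t"
proof -
  let ?CW = "\<lambda>i j v. contract (axis j 1) (wedge (axis i 1) v) :: 'n ext"
  have com: "dunkl (axis j 1) (xmul (axis i 1) f) - xmul (axis i 1) (dunkl (axis j 1) f) =
      pairing (axis j 1) (axis i 1) *\<^sub>C f + - ((1 / 2) *\<^sub>C (\<Sum>s\<in>Rf. (c s * bt s (axis j 1) (axis i 1)) *\<^sub>C wact s f))" for i j f
    unfolding dunkl_xmul by simp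
  \<comment> \<open>Summed against the Clifford products, the form \<open>bt s\<close> collapses to
    contraction by the root after wedging with the coroot. Of the resulting
    \<open>-2 (1 + s)\<close>, the part 1 completes \<open>euler\<close> and the part
    \<open>s\<close> becomes \<open>Om\<close>.\<close>
  have s1: "(\<Sum>i\<in>UNIV. \<Sum>j\<in>UNIV. bt s (axis j 1) (axis i 1) *\<^sub>C ?CW i j v) = (- 2) *\<^sub>C v + (- 2) *\<^sub>C ext_act s v"
    if s: "s \<in> Rf" for s v
  proof -
    have "(\<Sum>i\<in>UNIV. \<Sum>j\<in>UNIV. bt s (axis j 1) (axis i 1) *\<^sub>C ?CW i j v) =
        (\<Sum>j\<in>UNIV. \<Sum>i\<in>UNIV. bt s (axis j 1) (axis i 1) *\<^sub>C ?CW i j v)"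
      by (rule sum.swap)
    also have "\<dots> = (\<Sum>j\<in>UNIV. \<Sum>i\<in>UNIV. bt s (axis i 1) (axis j 1) *\<^sub>C ?CW i j v)"
      by (intro sum.cong refl arg_cong2[where f = cscale] bt_sym[OF s])
    also have "\<dots> = (\<Sum>j\<in>UNIV. contract (axis j 1) (wedge (axis j 1 - s *v axis j 1) v))"
      by (simp only: sum_bt_left[OF s clin_compose[OF clin_contract clin_wedge_left]])
    also have "\<dots> = (\<Sum>j\<in>UNIV. pairing (axis j 1) (al s) *\<^sub>C contract (axis j 1) (wedge (gm s) v))"
      by (simp add: sref[OF s] clin_scale[OF clin_wedge_left] clin_scale[OF clin_contract])
    also have "\<dots> = contract (al s) (wedge (gm s) v)"
      by (rule sum_axis_pairing[OF clin_contract_left])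
    finally show ?thesis unfolding contract_wedge_reflection[OF sref[OF s] galg[OF s]] cscale_add_right .
  qed
  have "(\<Sum>i\<in>UNIV. \<Sum>j\<in>UNIV. tns (?CW i j) (\<lambda>f. \<Sum>s\<in>Rf. (c s * bt s (axis j 1) (axis i 1)) *\<^sub>C wact s f) t) =
      (\<Sum>i\<in>UNIV. \<Sum>s\<in>Rf. \<Sum>j\<in>UNIV. (c s * bt s (axis j 1) (axis i 1)) *\<^sub>C tns (?CW i j) (wact s) t)"
    unfolding tns_sum_right tns_scale_right by (rule sum.cong[OF refl], rule sum.swap)
  also have "\<dots> = (\<Sum>s\<in>Rf. \<Sum>i\<in>UNIV. \<Sum>j\<in>UNIV. (c s * bt s (axis j 1) (axis i 1)) *\<^sub>C tns (?CW i j) (wact s) t)"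
    by (rule sum.swap)
  also have "\<dots> = (\<Sum>s\<in>Rf. c s *\<^sub>C tns (\<lambda>v. \<Sum>i\<in>UNIV. \<Sum>j\<in>UNIV. bt s (axis j 1) (axis i 1) *\<^sub>C ?CW i j v) (wact s) t)"
    by (simp add: tns_sum_left tns_scale_left cscale_sum_right)
  also have "\<dots> = (\<Sum>s\<in>Rf. c s *\<^sub>C ((- 2) *\<^sub>C tns (\<lambda>v. v) (wact s) t + (- 2) *\<^sub>C wS s t))"
    by (intro sum.cong refl) (simp only: s1 tns_add_left tns_scale_left wS_def)
  also have "\<dots> = (- 2) *\<^sub>C (\<Sum>s\<in>Rf. c s *\<^sub>C tns (\<lambda>v. v) (wact s) t) + (- 4) *\<^sub>C Om t"
    unfolding Om_def cscale_add_right sum.distrib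
    by (simp add: cscale_sum_right mult.commute)
  finally have 2: "(\<Sum>i\<in>UNIV. \<Sum>j\<in>UNIV. tns (?CW i j) (\<lambda>f. \<Sum>s\<in>Rf. (c s * bt s (axis j 1) (axis i 1)) *\<^sub>C wact s f) t) =
    (- 2) *\<^sub>C (\<Sum>s\<in>Rf. c s *\<^sub>C tns (\<lambda>v. v) (wact s) t) + (- 4) *\<^sub>C Om t" .
  have "dirac_op (dirac_op t) = kx (ky dunkl t) + ky dunkl (kx t)"
    unfolding dirac_op_def clin_add[OF clin_kx] clin_add[OF clin_ky[OF clin_dunkl]]
    by (simp add: kx_kx ky_ky)
  also have "\<dots> = (- 2) *\<^sub>C tns (\<lambda>v. v) (\<lambda>f. \<Sum>i\<in>UNIV. xmul (axis i 1) (dunkl (axis i 1) f)) t +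
     (\<lambda>I. (- 2 * (of_nat CARD('n) - of_nat (card I))) *\<^sub>C t I) -
     (1 / 2) *\<^sub>C (\<Sum>i\<in>UNIV. \<Sum>j\<in>UNIV. tns (?CW i j) (\<lambda>f. \<Sum>s\<in>Rf. (c s * bt s (axis j 1) (axis i 1)) *\<^sub>C wact s f) t)"
    unfolding kx_ky[OF clin_dunkl] com tns_add_right tns_minus_right sum.distrib sum_pairing_diag sum_negf
    unfolding tns_scale_right cscale_sum_right[symmetric] by simp
  also have "\<dots> = (- 2) *\<^sub>C (tns (\<lambda>v. v) (\<lambda>f. \<Sum>i\<in>UNIV. xmul (axis i 1) (dunkl (axis i 1) f)) t -
       (1 / 2) *\<^sub>C (\<Sum>s\<in>Rf. c s *\<^sub>C tns (\<lambda>v. v) (wact s) t)) +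
     (\<lambda>I. (- 2 * (of_nat CARD('n) - of_nat (card I))) *\<^sub>C t I) + 2 *\<^sub>C Om t"
    unfolding 2 cscale_diff_right cscale_add_right by simp
  also have "tns (\<lambda>v. v) (\<lambda>f. \<Sum>i\<in>UNIV. xmul (axis i 1) (dunkl (axis i 1) f)) t -
       (1 / 2) *\<^sub>C (\<Sum>s\<in>Rf. c s *\<^sub>C tns (\<lambda>v. v) (wact s) t) = tns (\<lambda>v. v) euler t"
    unfolding euler_def tns_diff_right tns_scale_right tns_sum_right ..
  finally show ?thesis unfolding tns_id .
qed

section \<open>Equivariance of the Dirac operator\<close>

lemma wS_kx: "w \<in> W \<Longrightarrow> wS w (kx t) = kx (wS w t)"
proof -
  assume w: "w \<in> W"
  have "wS w (kx t) = (\<Sum>i\<in>UNIV. tns (\<lambda>v. wedge (w *v axis i 1) (ext_act w v)) (\<lambda>f. xmul (w *v axis i 1) (wact w f)) t)"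
    by (simp add: kx_def clin_sum[OF clin_wS]) (simp add: wS_def tns_tns[OF clin_ext_act clin_wact] ext_act_wedge wact_xmul)
  also have "\<dots> = (\<Sum>i\<in>UNIV. tns (\<lambda>v. wedge (axis i 1) (ext_act w v)) (\<lambda>f. xmul (axis i 1) (wact w f)) t)"
    by (rule sum_orth[OF w, of "\<lambda>y x. tns (\<lambda>v. wedge y (ext_act w v)) (\<lambda>f. xmul x (wact w f)) t"])
      (auto intro!: clinI simp: clin_add[OF clin_wedge_left] clin_scale[OF clin_wedge_left] tns_add_left tns_scale_left
        clin_add[OF clin_xmul_left] clin_scale[OF clin_xmul_left] tns_add_right tns_scale_right)
  also have "\<dots> = kx (wS w t)"
    by (simp add: kx_def wS_def tns_tns[OF clin_wedge clin_xmul])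
  finally show ?thesis .
qed

lemma wS_ky:
  assumes w: "w \<in> W" and Y: "\<And>y. clin (Y y)" and Yl: "\<And>f. clin (\<lambda>y. Y y f)"
    and wY: "\<And>y f. wact w (Y y f) = Y (w *v y) (wact w f)"
  shows "wS w (ky Y t) = ky Y (wS w t)"
proof -
  have "wS w (ky Y t) = (\<Sum>i\<in>UNIV. tns (\<lambda>v. contract (w *v axis i 1) (ext_act w v)) (\<lambda>f. Y (w *v axis i 1) (wact w f)) t)"
    by (simp add: ky_def clin_sum[OF clin_wS])
      (simp add: wS_def tns_tns[OF clin_ext_act clin_wact] ext_act_contract[OF pairing_W[OF w]] wY)
  also have "\<dots> = (\<Sum>i\<in>UNIV. tns (\<lambda>v. contract (axis i 1) (ext_act w v)) (\<lambda>f. Y (axis i 1) (wact w f)) t)"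
    by (rule sum_orth[OF w, of "\<lambda>y x. tns (\<lambda>v. contract y (ext_act w v)) (\<lambda>f. Y x (wact w f)) t"])
      (auto intro!: clinI simp: clin_add[OF clin_contract_left] clin_scale[OF clin_contract_left] tns_add_left tns_scale_left
        clin_add[OF Yl] clin_scale[OF Yl] tns_add_right tns_scale_right)
  also have "\<dots> = ky Y (wS w t)"
    by (simp add: ky_def wS_def tns_tns[OF clin_contract Y])
  finally show ?thesis .
qed

lemma wact_pdE: "w \<in> W \<Longrightarrow> wact w (pdE y f) = pdE (w *v y) (wact w f)"
proof (induction f rule: pext_induct)
  case (emb v)
  have "pdE y (emb v) = 0" for y and v :: "'n ext" by (simp add: pdE_def emb_def fun_eq_iff fun_apply)
  then show ?case by (simp only: wact_emb clin_zero[OF clin_wact])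
next
  case (xmul i f)
  then show ?case
    by (simp add: pdE_xmul wact_xmul clin_add[OF clin_wact] clin_scale[OF clin_wact] pairing_W
        del: pairing_axis_right pairing_axis_left)
next
  case (add f g)
  then show ?case by (simp add: clin_add[OF clin_wact] clin_add[OF clin_pdE])
qed

lemma wS_dirac: "w \<in> W \<Longrightarrow> wS w (dirac_op t) = dirac_op (wS w t)"
  unfolding dirac_op_def clin_add[OF clin_wS]
  by (simp add: wS_kx wS_ky[OF _ clin_dunkl clin_dunkl_left wact_dunkl])

lemma wS_ky_pd: "w \<in> W \<Longrightarrow> wS w (ky pdE t) = ky pdE (wS w t)"
  by (simp add: wS_ky[OF _ clin_pdE clin_pdE_left wact_pdE])

lemma wS_Om: "w \<in> W \<Longrightarrow> wS w (Om t) = Om (wS w t)"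
proof -
  assume w: "w \<in> W"
  have "(\<Sum>s\<in>Rf. c s *\<^sub>C wS s (wS w t)) = (\<Sum>s\<in>Rf. c (w ** s ** transpose w) *\<^sub>C wS (w ** s ** transpose w) (wS w t))"
    by (rule sum_conj[OF w, symmetric])
  also have "\<dots> = (\<Sum>s\<in>Rf. c s *\<^sub>C wS w (wS s t))"
  proof (intro sum.cong refl)
    fix s assume s: "s \<in> Rf"
    have "w ** s ** transpose w ** w = w ** s" using w by (simp add: Wo' flip: matrix_mul_assoc)
    then show "c (w ** s ** transpose w) *\<^sub>C wS (w ** s ** transpose w) (wS w t) = c s *\<^sub>C wS w (wS s t)"
      by (simp only: cc[OF w s] wS_mult[symmetric])
  qed
  finally show ?thesis by (simp add: Om_def clin_scale[OF clin_wS] clin_sum[OF clin_wS])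
qed

lemma Om_commute:
  assumes "clin F" "\<And>w t. w \<in> W \<Longrightarrow> wS w (F t) = F (wS w t)"
  shows "Om (F t) = F (Om t)"
  using assms(2) RfW by (auto simp: Om_def clin_scale[OF assms(1)] clin_sum[OF assms(1)] intro!: sum.cong arg_cong[where f="cscale _"])


section \<open>Weight spaces\<close>

text \<open>\<open>D\<close> raises or lowers polynomial and spinor degree together, so it preserves
  the difference of \<open>euler\<close> and \<open>card I\<close>. The shift by
  \<open>CARD('n)\<close> absorbs the constant in \<open>dirac_sq\<close> and leaves
  \<open>D\<^sup>2 = -2 (b - Om)\<close>.\<close>

definition WT :: "complex \<Rightarrow> ('n set \<Rightarrow> 'n pext) set" where
  "WT b = {t. \<forall>I. euler (t I) = (b - of_nat CARD('n) + of_nat (card I)) *\<^sub>C t I}"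

text \<open>The polynomial model of the standard module of the exterior power of degree
  \<open>j\<close>; \<open>YE j\<close> is its tensor product with the spinors.\<close>

definition Ej :: "nat \<Rightarrow> 'n pext set" where "Ej j = {f. \<forall>J. card J \<noteq> j \<longrightarrow> f J = 0}"

definition YE :: "nat \<Rightarrow> ('n set \<Rightarrow> 'n pext) set" where "YE j = {t. \<forall>I. t I \<in> Ej j}"

lemma Ej_zero: "0 \<in> Ej j" by (simp add: Ej_def fun_apply)
lemma Ej_add: "f \<in> Ej j \<Longrightarrow> g \<in> Ej j \<Longrightarrow> f + g \<in> Ej j" by (simp add: Ej_def fun_apply)
lemma Ej_scale: "f \<in> Ej j \<Longrightarrow> z *\<^sub>C f \<in> Ej j" by (simp add: Ej_def fun_apply)
lemma Ej_minus: "f \<in> Ej j \<Longrightarrow> - f \<in> Ej j" by (simp add: Ej_def fun_apply)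
lemma Ej_diff: "f \<in> Ej j \<Longrightarrow> g \<in> Ej j \<Longrightarrow> f - g \<in> Ej j" by (simp add: Ej_def fun_apply)
lemma Ej_sum: "(\<And>i. i \<in> A \<Longrightarrow> f i \<in> Ej j) \<Longrightarrow> (\<Sum>i\<in>A. f i) \<in> Ej j"
  by (induction A rule: infinite_finite_induct) (auto intro: Ej_add Ej_zero)
lemma Ej_emb: "v \<in> extgr j \<Longrightarrow> emb v \<in> Ej j" by (auto simp: Ej_def emb_def extgr_def) (metis single_zero)
lemma Ej_xmul: "f \<in> Ej j \<Longrightarrow> xmul x f \<in> Ej j" by (simp add: Ej_def xmul_def)
lemma Ej_pdE: "f \<in> Ej j \<Longrightarrow> pdE x f \<in> Ej j" by (simp add: Ej_def pdE_def clin_zero[OF clin_pdv])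

lemma Ej_tns: "f \<in> Ej j \<Longrightarrow> clin g \<Longrightarrow> tns (ext_act w) g f \<in> Ej j"
  unfolding Ej_def
proof safe
  fix J :: "'n set" assume f: "\<forall>J. card J \<noteq> j \<longrightarrow> f J = 0" and g: "clin g" and J: "card J \<noteq> j"
  have "(ext_act w (axis I 1) $ J) *\<^sub>C g (f I) = 0" for I
    using f J g ext_act_extgr[OF extgr_axis, of w I] by (cases "card I = j") (auto simp: extgr_def clin_zero)
  then show "tns (ext_act w) g f J = 0" by (simp add: tns_def del: cscale_eq_0_iff)
qed

lemma Ej_wact: "f \<in> Ej j \<Longrightarrow> wact w f \<in> Ej j"
  unfolding wact_def by (rule Ej_tns[OF _ clin_sym_act])

lemma Ej_dunkl: "f \<in> Ej j \<Longrightarrow> dunkl y f \<in> Ej j"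
  unfolding dunkl_def by (intro Ej_diff Ej_pdE Ej_scale Ej_sum Ej_tns clin_qd)

lemma YE_tns: "t \<in> YE j \<Longrightarrow> (\<And>f. f \<in> Ej j \<Longrightarrow> g f \<in> Ej j) \<Longrightarrow> tns X g t \<in> YE j"
  by (auto simp: YE_def tns_def intro!: Ej_sum Ej_scale)

lemma YE_zero: "0 \<in> YE j" by (simp add: YE_def fun_apply Ej_zero)
lemma YE_add: "t \<in> YE j \<Longrightarrow> u \<in> YE j \<Longrightarrow> t + u \<in> YE j" by (simp add: YE_def fun_apply Ej_add)
lemma YE_diff: "t \<in> YE j \<Longrightarrow> u \<in> YE j \<Longrightarrow> t - u \<in> YE j" by (simp add: YE_def fun_apply Ej_diff)
lemma YE_scale: "t \<in> YE j \<Longrightarrow> z *\<^sub>C t \<in> YE j" by (simp add: YE_def fun_apply Ej_scale)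
lemma YE_sum: "(\<And>i. i \<in> A \<Longrightarrow> f i \<in> YE j) \<Longrightarrow> (\<Sum>i\<in>A. f i) \<in> YE j"
  by (induction A rule: infinite_finite_induct) (auto intro: YE_add YE_zero)
lemma YE_wS: "t \<in> YE j \<Longrightarrow> wS w t \<in> YE j" unfolding wS_def by (intro YE_tns Ej_wact)
lemma YE_kx: "t \<in> YE j \<Longrightarrow> kx t \<in> YE j" unfolding kx_def by (intro YE_sum YE_tns Ej_xmul)
lemma YE_ky: "t \<in> YE j \<Longrightarrow> ky dunkl t \<in> YE j" unfolding ky_def by (intro YE_sum YE_tns Ej_dunkl)
lemma YE_ky_pd: "t \<in> YE j \<Longrightarrow> ky pdE t \<in> YE j" unfolding ky_def by (intro YE_sum YE_tns Ej_pdE)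
lemma YE_dirac: "t \<in> YE j \<Longrightarrow> dirac_op t \<in> YE j" unfolding dirac_op_def by (intro YE_add YE_kx YE_ky)

lemma WT_zero: "0 \<in> WT b" by (simp add: WT_def fun_apply clin_zero[OF clin_euler])
lemma WT_add: "t \<in> WT b \<Longrightarrow> u \<in> WT b \<Longrightarrow> t + u \<in> WT b"
  by (simp add: WT_def fun_apply clin_add[OF clin_euler] cscale_add_right)
lemma WT_scale: "t \<in> WT b \<Longrightarrow> z *\<^sub>C t \<in> WT b"
  by (simp add: WT_def fun_apply clin_scale[OF clin_euler] mult.commute)
lemma WT_diff: "t \<in> WT b \<Longrightarrow> u \<in> WT b \<Longrightarrow> t - u \<in> WT b"
  by (simp add: WT_def fun_apply clin_diff[OF clin_euler] cscale_diff_right)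
lemma WT_sum: "(\<And>i. i \<in> A \<Longrightarrow> f i \<in> WT b) \<Longrightarrow> (\<Sum>i\<in>A. f i) \<in> WT b"
  by (induction A rule: infinite_finite_induct) (auto intro: WT_add WT_zero)

text \<open>\<open>k\<close> is the common shift of the Euler weight and of the spinor degree: 1 for
  \<open>kx\<close>, -1 for \<open>ky\<close>, 0 for group elements.\<close>

lemma WT_tns:
  assumes t: "t \<in> WT b" and g: "clin g" "\<And>f. euler (g f) = g (euler f) + k *\<^sub>C g f"
    and X: "\<And>I J. X (axis I 1) $ J \<noteq> 0 \<Longrightarrow> of_nat (card J) = of_nat (card I) + k"
  shows "tns X g t \<in> WT b"
  unfolding WT_def
proof safe
  fix J
  have "euler ((X (axis I 1) $ J) *\<^sub>C g (t I)) =
      (b - of_nat CARD('n) + of_nat (card J)) *\<^sub>C ((X (axis I 1) $ J) *\<^sub>C g (t I))" for I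
  proof (cases "X (axis I 1) $ J = 0")
    case True
    then show ?thesis by (simp add: clin_zero[OF clin_euler])
  next
    case False
    then have J: "of_nat (card J) = of_nat (card I) + k" by (rule X)
    have "euler (t I) = (b - of_nat CARD('n) + of_nat (card I)) *\<^sub>C t I" using t by (simp add: WT_def)
    then have "euler (g (t I)) = (b - of_nat CARD('n) + of_nat (card I)) *\<^sub>C g (t I) + k *\<^sub>C g (t I)"
      by (simp add: g(2) clin_scale[OF g(1)])
    also have "\<dots> = (b - of_nat CARD('n) + of_nat (card J)) *\<^sub>C g (t I)"
      unfolding cscale_add_left[symmetric] J by (simp add: add.assoc)
    finally show ?thesis by (simp add: clin_scale[OF clin_euler] mult.commute)
  qed
  then show "euler (tns X g t J) = (b - of_nat CARD('n) + of_nat (card J)) *\<^sub>C tns X g t J"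
    by (simp add: tns_def clin_sum[OF clin_euler] cscale_sum_right)
qed

lemma wedge_axis_card:
  "wedge (axis i 1) (axis I 1) $ J \<noteq> 0 \<Longrightarrow> (of_nat (card J) :: complex) = of_nat (card I) + 1"
proof -
  assume a: "wedge (axis i 1) (axis I 1) $ J \<noteq> 0"
  have i: "i \<notin> I"
  proof
    assume "i \<in> I"
    then have "wedge (axis i 1) (axis I 1) = 0" by (simp add: wedge_axis)
    with a show False by simp
  qed
  then have c: "wedge (axis i 1) (axis I 1) = psgn i I *\<^sub>C axis (insert i I) 1" by (simp only: wedge_axis if_False)
  have "axis (insert i I) (1::complex) $ J \<noteq> 0" using a unfolding c by auto
  then have "J = insert i I" unfolding axis_def by (cases "J = insert i I") auto
  then show ?thesis using i by simp
qed

lemma WT_kx: "t \<in> WT b \<Longrightarrow> kx t \<in> WT b"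
  unfolding kx_def
  by (intro WT_sum WT_tns[where k = 1] wedge_axis_card) (auto simp: clin_xmul euler_xmul)

lemma contract_axis_card:
  "contract (axis i 1) (axis I 1) $ J \<noteq> 0 \<Longrightarrow> (of_nat (card J) :: complex) = of_nat (card I) + - 1"
proof -
  assume a: "contract (axis i 1) (axis I 1) $ J \<noteq> 0"
  have i: "i \<in> I"
  proof (rule ccontr)
    assume "i \<notin> I"
    then have "contract (axis i 1) (axis I 1) = 0" by (simp add: contract_axis)
    with a show False by simp
  qed
  then have c: "contract (axis i 1) (axis I 1) = (- 2 * psgn i I) *\<^sub>C axis (I - {i}) 1" by (simp only: contract_axis if_True)
  have "axis (I - {i}) (1::complex) $ J \<noteq> 0" using a unfolding c by auto
  then have "J = I - {i}" unfolding axis_def by (cases "J = I - {i}") auto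
  then have "card I = Suc (card J)" using card.remove[of I i] i by simp
  then show ?thesis by simp
qed

lemma WT_ky:
  assumes "t \<in> WT b" "\<And>y. clin (Y y)" "\<And>y f. euler (Y y f) = Y y (euler f) - Y y f"
  shows "ky Y t \<in> WT b"
  unfolding ky_def
  by (intro WT_sum WT_tns[where k = "- 1"] assms(1,2) contract_axis_card) (auto simp: assms(3))

lemma WT_dirac: "t \<in> WT b \<Longrightarrow> dirac_op t \<in> WT b"
  unfolding dirac_op_def by (intro WT_add WT_kx WT_ky clin_dunkl euler_dunkl)

lemma WT_wS: "w \<in> W \<Longrightarrow> t \<in> WT b \<Longrightarrow> wS w t \<in> WT b"
  unfolding wS_def
proof (rule WT_tns[where k = 0])
  fix I J assume "ext_act w (axis I 1) $ J \<noteq> 0"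
  then show "(of_nat (card J) :: complex) = of_nat (card I) + 0"
    using ext_act_extgr[OF extgr_axis, of w I] by (auto simp: extgr_def)
qed (auto simp: clin_wact euler_wact)

lemma lookup_pd: "Poly_Mapping.lookup (pd i p) m =
    of_nat (Suc (Poly_Mapping.lookup m i)) * Poly_Mapping.lookup p (Poly_Mapping.single i 1 + m)"
proof (induction p rule: pm_induct)
  case (single m' z)
  show ?case
  proof (cases "Poly_Mapping.lookup m' i = 0")
    case True
    then have "m' \<noteq> Poly_Mapping.single i 1 + m" by (auto simp: lookup_add)
    then show ?thesis using True by (simp add: pd_single lookup_single when_def)
  next
    case False
    then have m': "m' = Poly_Mapping.single i 1 + (m' - Poly_Mapping.single i 1)"
      by (intro poly_mapping_eqI) (auto simp: lookup_add lookup_minus lookup_single when_def)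
    have "m' - Poly_Mapping.single i 1 = m \<longleftrightarrow> m' = Poly_Mapping.single i 1 + m"
      by (subst (2) m') auto
    then show ?thesis by (auto simp: pd_single lookup_single when_def lookup_add)
  qed
qed (simp add: pd_add lookup_add distrib_left)

lemma mdeg_single_add: "mdeg (Poly_Mapping.single i 1 + m) = Suc (mdeg m)"
proof -
  have "mdeg (Poly_Mapping.single i 1 + m) = (\<Sum>j\<in>UNIV. (if j = i then 1 else 0) + Poly_Mapping.lookup m j)"
    unfolding mdeg_def by (intro sum.cong) (auto simp: lookup_add lookup_single when_def)
  then show ?thesis by (simp add: sum.distrib mdeg_def)
qed

lemma lookup_pdE: "Poly_Mapping.lookup (pdE y f J) m = (\<Sum>i\<in>UNIV. y $ i *
    (of_nat (Suc (Poly_Mapping.lookup m i)) * Poly_Mapping.lookup (f J) (Poly_Mapping.single i 1 + m)))"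
  by (simp only: pdE_def pdv_def lookup_sum lookup_cscale lookup_pd)

text \<open>Plain derivatives do not come from \<open>H\<close>, but \<open>euler\<close> is
  diagonal, and for fixed \<open>J\<close> its eigenvalue depends only on the degree, which a
  derivative lowers by one.\<close>

lemma euler_pdE: "euler (pdE y f) = pdE y (euler f) - pdE y f"
proof
  fix J
  have "euler (pdE y f) J = pdE y (euler f) J - pdE y f J"
  proof (rule poly_mapping_eqI)
    fix m
    show "Poly_Mapping.lookup (euler (pdE y f) J) m = Poly_Mapping.lookup (pdE y (euler f) J - pdE y f J) m"
      unfolding lookup_minus lookup_pdE euler_lookup sum_distrib_left sum_subtractf[symmetric] ewt_def mdeg_single_add
      by (intro sum.cong refl) (simp add: field_simps)
  qed
  then show "euler (pdE y f) J = (pdE y (euler f) - pdE y f) J" by (simp add: fun_apply)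
qed

lemma WT_ky_pd: "t \<in> WT b \<Longrightarrow> ky pdE t \<in> WT b"
  by (intro WT_ky clin_pdE euler_pdE)

text \<open>The part of the weight space on which \<open>D\<close> squares to zero, by
  \<open>dirac_dirac_WT\<close>.\<close>

definition Kb :: "complex \<Rightarrow> nat \<Rightarrow> ('n set \<Rightarrow> 'n pext) set" where
  "Kb b j = {t \<in> YE j \<inter> WT b. Om t = b *\<^sub>C t}"

lemma Kb_zero: "0 \<in> Kb b j"
  by (simp add: Kb_def YE_zero WT_zero clin_zero[OF clin_Om])
lemma Kb_add: "t \<in> Kb b j \<Longrightarrow> u \<in> Kb b j \<Longrightarrow> t + u \<in> Kb b j"
  by (simp add: Kb_def YE_add WT_add clin_add[OF clin_Om] cscale_add_right)
lemma Kb_scale: "t \<in> Kb b j \<Longrightarrow> z *\<^sub>C t \<in> Kb b j"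
  by (simp add: Kb_def YE_scale WT_scale clin_scale[OF clin_Om] mult.commute)
lemma Kb_diff: "t \<in> Kb b j \<Longrightarrow> u \<in> Kb b j \<Longrightarrow> t - u \<in> Kb b j"
  by (simp add: Kb_def YE_diff WT_diff clin_diff[OF clin_Om] cscale_diff_right)
lemma Kb_wS: "w \<in> W \<Longrightarrow> t \<in> Kb b j \<Longrightarrow> wS w t \<in> Kb b j"
  by (simp add: Kb_def YE_wS WT_wS clin_scale[OF clin_wS] flip: wS_Om)
lemma Kb_dirac: "t \<in> Kb b j \<Longrightarrow> dirac_op t \<in> Kb b j"
  by (simp add: Kb_def YE_dirac WT_dirac Om_commute[OF clin_dirac wS_dirac] clin_scale[OF clin_dirac])
lemma Kb_ky_pd: "t \<in> Kb b j \<Longrightarrow> ky pdE t \<in> Kb b j"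
  by (simp add: Kb_def YE_ky_pd WT_ky_pd Om_commute[OF clin_ky[OF clin_pdE] wS_ky_pd] clin_scale[OF clin_ky[OF clin_pdE]])

lemma dirac_dirac_WT: "t \<in> WT b \<Longrightarrow> dirac_op (dirac_op t) = (- 2) *\<^sub>C (b *\<^sub>C t - Om t)"
proof
  fix I assume t: "t \<in> WT b"
  have "dirac_op (dirac_op t) I = (- 2 * (b - of_nat CARD('n) + of_nat (card I))) *\<^sub>C t I +
     (- 2 * (of_nat CARD('n) - of_nat (card I))) *\<^sub>C t I + 2 *\<^sub>C Om t I"
  proof -
    have e: "euler (t I) = (b - of_nat CARD('n) + of_nat (card I)) *\<^sub>C t I" using t by (simp add: WT_def)
    show ?thesis unfolding dirac_sq fun_apply e cscale_cscale ..
  qed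
  also have "\<dots> = ((- 2) *\<^sub>C (b *\<^sub>C t - Om t)) I"
  proof -
    have "- 2 * (b - of_nat CARD('n) + of_nat (card I)) + - 2 * (of_nat CARD('n) - of_nat (card I)) = - 2 * b"
      by (simp add: algebra_simps)
    then show ?thesis unfolding cscale_add_left[symmetric] by (simp only: fun_apply cscale_diff_right) simp
  qed
  finally show "dirac_op (dirac_op t) I = ((- 2) *\<^sub>C (b *\<^sub>C t - Om t)) I" .
qed

lemma dirac_dirac: "t \<in> Kb b j \<Longrightarrow> dirac_op (dirac_op t) = 0"
  by (auto simp: Kb_def dirac_dirac_WT)

text \<open>The weight of constants with top spinor: \<open>ewt j 0\<close>, as the two shifts in
  \<open>WT\<close> cancel for \<open>I = UNIV\<close>.\<close>

definition aw :: "nat \<Rightarrow> complex" where "aw j = \<kappa> * of_nat j / 2 - Nc / 2"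

text \<open>On a weight space the Koszul degree \<open>mdeg m + n - card I\<close> is the same for
  all monomials that occur. This is what makes the anticommutator of \<open>kx\<close> with the
  plain derivatives a scalar, a multiple of \<open>b - aw j\<close>.\<close>

lemma WT_lookup:
  "t \<in> WT b \<Longrightarrow> t \<in> YE j \<Longrightarrow> Poly_Mapping.lookup (t I J) m \<noteq> 0 \<Longrightarrow>
    card J = j \<and> of_nat (mdeg m) + of_nat CARD('n) - of_nat (card I) = b - aw j"
proof -
  assume t: "t \<in> WT b" "t \<in> YE j" and l: "Poly_Mapping.lookup (t I J) m \<noteq> 0"
  have j: "card J = j" using t(2) l by (cases "card J = j") (auto simp: YE_def Ej_def)
  have "Poly_Mapping.lookup (euler (t I) J) m = (b - of_nat CARD('n) + of_nat (card I)) * Poly_Mapping.lookup (t I J) m"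
    using t(1) by (simp add: WT_def fun_apply)
  with l have "ewt j m = b - of_nat CARD('n) + of_nat (card I)" by (simp add: euler_lookup j)
  then show ?thesis using j by (simp add: ewt_def aw_def algebra_simps)
qed

lemma homotopy:
  assumes t: "t \<in> WT b" "t \<in> YE j"
  shows "kx (ky pdE t) + ky pdE (kx t) = (- 2 * (b - aw j)) *\<^sub>C t"
proof (intro ext poly_mapping_eqI)
  fix I J m
  have "Poly_Mapping.lookup ((kx (ky pdE t) + ky pdE (kx t)) I J) m =
      - 2 * (of_nat (mdeg m) + of_nat CARD('n) - of_nat (card I)) * Poly_Mapping.lookup (t I J) m"
  proof -
    have "(\<Sum>i\<in>UNIV. xmul (axis i 1) (pdE (axis i 1) (t I))) J = (\<Sum>i\<in>UNIV. pvar i * pd i (t I J))"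
      by (simp add: sum_fun_apply xmul_def sym_y_axis pdE_def pdv_axis)
    then show ?thesis
      unfolding kx_ky_pd tns_id by (simp add: fun_apply lookup_add lookup_minus lookup_sum_pvar_pd mdeg_def algebra_simps)
  qed
  also have "\<dots> = - 2 * (b - aw j) * Poly_Mapping.lookup (t I J) m"
    using WT_lookup[OF t, of I J m] by (cases "Poly_Mapping.lookup (t I J) m = 0") auto
  finally show "Poly_Mapping.lookup ((kx (ky pdE t) + ky pdE (kx t)) I J) m =
      Poly_Mapping.lookup (((- 2 * (b - aw j)) *\<^sub>C t) I J) m" by (simp add: fun_apply)
qed

text \<open>Contraction lowers the spinor degree by one, whatever operators \<open>Y\<close>
  accompany it.\<close>

lemma ky_lower:
  assumes "\<And>y. clin (Y y)" "\<And>I. card I \<ge> Suc q \<Longrightarrow> t I = 0" "card I \<ge> q"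
  shows "ky Y t I = 0"
proof -
  have "(contract (axis i 1) (axis K 1) $ I) *\<^sub>C Y (axis i 1) (t K) = 0" for i K
  proof (cases "contract (axis i 1) (axis K 1) $ I = 0")
    case False
    then have "(of_nat (card I) :: complex) = of_nat (card K) + - 1" by (rule contract_axis_card)
    then have "(of_nat (card K) :: complex) = of_nat (Suc (card I))" by simp
    then have "card K = Suc (card I)" by (simp only: of_nat_eq_iff)
    then show ?thesis using assms by (simp add: clin_zero)
  qed simp
  then show ?thesis by (simp add: ky_def tns_def sum_fun_apply del: cscale_eq_0_iff)
qed

text \<open>\<open>ky pdE\<close> is a contracting homotopy for \<open>kx\<close>; for the Dirac operator the homotopy
  relation only holds up to a term lowering the degree in the spinors.\<close>

lemma dirac_exact:
  assumes "b \<noteq> aw j" "t \<in> Kb b j" "dirac_op t = 0"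
  shows "\<exists>u\<in>Kb b j. t = dirac_op u"
proof -
  define l where "l = - 2 * (b - aw j)"
  have l: "l \<noteq> 0" using assms by (simp add: l_def)
  \<comment> \<open>\<open>q\<close> bounds the spinor degrees that occur in \<open>t\<close>; each
    round lowers it by one.\<close>
  have "\<exists>u\<in>Kb b j. t = dirac_op u" if "t \<in> Kb b j" "dirac_op t = 0" "\<And>I. card I \<ge> q \<Longrightarrow> t I = 0" for q t
    using that
  proof (induction q arbitrary: t)
    case 0
    then have "t = dirac_op 0" by (simp add: clin_zero[OF clin_dirac] fun_eq_iff fun_apply)
    then show ?case using Kb_zero by blast
  next
    case (Suc q)
    define u where "u = (1 / l) *\<^sub>C ky pdE t"
    define t' where "t' = t - dirac_op u"
    have u: "u \<in> Kb b j" unfolding u_def by (intro Kb_scale Kb_ky_pd Suc.prems)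
    have h: "kx (ky pdE t) + ky pdE (kx t) = l *\<^sub>C t"
      unfolding l_def using Suc.prems(1) by (intro homotopy) (auto simp: Kb_def)
    have kt: "kx t = - ky dunkl t" using Suc.prems(2) by (simp add: dirac_op_def eq_neg_iff_add_eq_0)
    \<comment> \<open>\<open>kx t\<close> is traded for \<open>- ky dunkl t\<close>, so both error
      terms consist of two contractions and sit strictly lower in spinor degree.\<close>
    have "dirac_op (ky pdE t) = l *\<^sub>C t + (ky pdE (ky dunkl t) + ky dunkl (ky pdE t))"
      using h unfolding dirac_op_def kt clin_minus[OF clin_ky[OF clin_pdE]] by (simp add: algebra_simps)
    then have "dirac_op u = t + (1 / l) *\<^sub>C (ky pdE (ky dunkl t) + ky dunkl (ky pdE t))"
      unfolding u_def clin_scale[OF clin_dirac] using l by (simp add: cscale_add_right)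
    then have t': "t' = - ((1 / l) *\<^sub>C (ky pdE (ky dunkl t) + ky dunkl (ky pdE t)))" by (simp add: t'_def)
    have "t' I = 0" if I: "card I \<ge> q" for I
    proof -
      have "ky dunkl t K = 0" "ky pdE t K = 0" if "card K \<ge> q" for K
        using ky_lower[OF clin_dunkl Suc.prems(3) that] ky_lower[OF clin_pdE Suc.prems(3) that] by auto
      then have "ky pdE (ky dunkl t) I = 0" "ky dunkl (ky pdE t) I = 0"
        by (auto intro: ky_lower[OF clin_pdE _ I] ky_lower[OF clin_dunkl _ I])
      then show ?thesis by (simp add: t' fun_apply)
    qed
    moreover have "t' \<in> Kb b j" "dirac_op t' = 0"
      using Suc.prems u by (auto simp: t'_def clin_diff[OF clin_dirac] dirac_dirac intro: Kb_diff Kb_dirac)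
    ultimately obtain w where "w \<in> Kb b j" "t' = dirac_op w" using Suc.IH by blast
    then have "t = dirac_op (w + u)" by (simp add: t'_def clin_add[OF clin_dirac] algebra_simps)
    then show ?case using Kb_add[OF \<open>w \<in> Kb b j\<close> u] by blast
  qed
  from this[of t "Suc CARD('n)"] assms show ?thesis
    using card_mono[OF finite subset_UNIV] by (metis Suc_n_not_le_n order_trans)
qed

text \<open>Constants tensored with the top spinor. They are cycles, since wedges vanish on the top
  spinor and Dunkl operators on constants.\<close>

definition inc :: "'n ext \<Rightarrow> 'n set \<Rightarrow> 'n pext" where
  "inc v = (\<lambda>I. if I = UNIV then emb v else 0)"

lemma inc_add: "inc (v + v') = inc v + inc v'"
  by (auto simp: inc_def fun_eq_iff fun_apply clin_add[OF clin_emb])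

lemma inc_scale: "inc (z *\<^sub>C v) = z *\<^sub>C inc v"
  by (auto simp: inc_def fun_eq_iff fun_apply clin_scale[OF clin_emb])

lemma tns_inc: "clin g \<Longrightarrow> tns X g (inc v) = (\<lambda>J. (X (axis UNIV 1) $ J) *\<^sub>C g (emb v))"
proof
  fix J assume g: "clin g"
  have "tns X g (inc v) J = (\<Sum>I\<in>(UNIV :: 'n set set). if I = UNIV then (X (axis UNIV 1) $ J) *\<^sub>C g (emb v) else 0)"
    unfolding tns_def by (intro sum.cong) (auto simp: inc_def clin_zero[OF g])
  then show "tns X g (inc v) J = (X (axis UNIV 1) $ J) *\<^sub>C g (emb v)" by simp
qed

lemma dirac_inc: "dirac_op (inc v) = 0"
proof -
  have "tns (wedge (axis i 1)) (xmul (axis i 1)) (inc v) = 0" for i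
    by (simp add: tns_inc[OF clin_xmul] wedge_top fun_eq_iff fun_apply)
  moreover have "tns (contract (axis i 1)) (dunkl (axis i 1)) (inc v) = 0" for i
    by (simp add: tns_inc[OF clin_dunkl] fun_eq_iff fun_apply)
  ultimately show ?thesis by (simp add: dirac_op_def kx_def ky_def)
qed

lemma wS_inc: "wS w (inc v) = inc (top_char w *\<^sub>C ext_act w v)"
  unfolding wS_def tns_inc[OF clin_wact] ext_act_top wact_emb
  by (auto simp: fun_eq_iff inc_def axis_def cscale_complex_def clin_scale[OF clin_emb])

text \<open>The Euler weight and the eigenvalue of \<open>Om\<close> agree because every reflection
  acts by -1 on the top spinor, which turns half the class sum into the reflection term of
  \<open>euler\<close>.\<close>

lemma inc_Kb: "v \<in> extgr j \<Longrightarrow> inc v \<in> Kb (aw j) j"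
proof -
  assume v: "v \<in> extgr j"
  have e: "euler (emb v) = aw j *\<^sub>C emb v"
  proof (intro ext poly_mapping_eqI)
    fix J m
    show "Poly_Mapping.lookup (euler (emb v) J) m = Poly_Mapping.lookup ((aw j *\<^sub>C emb v) J) m"
      using v by (cases "v $ J = 0")
        (auto simp: euler_lookup fun_apply emb_def lookup_single when_def extgr_def aw_def ewt_def mdeg_def)
  qed
  have "top_char s = - 1" if "s \<in> Rf" for s
    by (rule top_char_reflection[OF sref galg]) (use that in auto)
  then have "Om (inc v) = - ((1 / 2) *\<^sub>C inc (\<Sum>s\<in>Rf. c s *\<^sub>C ext_act s v))"
    unfolding Om_def wS_inc
    by (simp add: inc_scale clin_sum[OF clinI[of inc, OF inc_add inc_scale]] clin_minus[OF clinI[of inc, OF inc_add inc_scale]] sum_negf)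
  also have "\<dots> = aw j *\<^sub>C inc v"
  proof -
    have "- ((1 / 2) * (Nc - \<kappa> * of_nat j)) = aw j" by (simp add: aw_def field_simps)
    then show ?thesis
      unfolding sum_refl_ext[OF v] inc_scale by (metis cscale_cscale cscale_minus_left)
  qed
  finally show ?thesis
    using e v by (auto simp: Kb_def YE_def WT_def inc_def Ej_emb Ej_zero clin_zero[OF clin_euler])
qed

text \<open>At this weight the Koszul degree is zero. As the sum of a polynomial degree and of
  \<open>n - card I\<close>, both nonnegative, it vanishes only termwise.\<close>

lemma WT_aw:
  assumes t: "t \<in> WT (aw j)" "t \<in> YE j"
  shows "\<exists>v\<in>extgr j. t = inc v"
proof -
  define v where "v = (\<chi> J. Poly_Mapping.lookup (t UNIV J) 0)"
  have l: "card J = j \<and> I = UNIV \<and> m = 0" if "Poly_Mapping.lookup (t I J) m \<noteq> 0" for I J m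
  proof -
    have "card J = j" and e: "(of_nat (mdeg m) + of_nat CARD('n) - of_nat (card I) :: complex) = 0"
      using WT_lookup[OF t that] by auto
    have "(of_nat (mdeg m + CARD('n)) :: complex) = of_nat (card I)" using e by simp
    then have "mdeg m + CARD('n) = card I" by (simp only: of_nat_eq_iff)
    moreover have "card I \<le> CARD('n)" by (rule card_mono) auto
    ultimately have "mdeg m = 0" "card I = CARD('n)" by auto
    then have "m = 0" "I = UNIV"
      by (auto simp: mdeg_def intro!: poly_mapping_eqI) (metis UNIV_I card_subset_eq finite subset_UNIV)
    then show ?thesis using \<open>card J = j\<close> by simp
  qed
  have "t = inc v"
  proof (intro ext poly_mapping_eqI)
    fix I J m
    show "Poly_Mapping.lookup (t I J) m = Poly_Mapping.lookup (inc v I J) m"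
    proof (cases "I = UNIV \<and> m = 0")
      case False
      then have "Poly_Mapping.lookup (t I J) m = 0" using l[of I J m] by blast
      then show ?thesis using False by (auto simp: inc_def emb_def lookup_single when_def fun_apply)
    qed (auto simp: inc_def emb_def v_def)
  qed
  moreover have "v \<in> extgr j" using l by (auto simp: extgr_def v_def)
  ultimately show ?thesis by blast
qed

end

text \<open>More vectors than coordinates are dependent: one coordinate \<open>w0\<close> is
  eliminated with a pivot vector \<open>v j\<close>. Only values on \<open>A\<close> are compared,
  as elements of the group algebra matter only on the group.\<close>

lemma linear_dependence:
  assumes "finite A"
  shows "\<exists>l :: nat \<Rightarrow> complex. (\<exists>i\<le>card A. l i \<noteq> 0) \<and> (\<forall>w\<in>A. (\<Sum>i\<le>card A. l i * v i w) = 0)"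
  using assms
proof (induction A arbitrary: v)
  case empty
  show ?case by (intro exI[of _ "\<lambda>_. 1"]) simp
next
  case (insert w0 A)
  let ?m = "card A"
  have card: "card (insert w0 A) = Suc ?m" using insert by simp
  show ?case
  proof (cases "\<forall>i\<le>Suc ?m. v i w0 = 0")
    case True
    from insert.IH[of v] obtain l i where
      l: "i \<le> ?m" "l i \<noteq> 0" "\<forall>w\<in>A. (\<Sum>i\<le>?m. l i * v i w) = 0" by blast
    define l' where "l' = (\<lambda>k. if k \<le> ?m then l k else 0)"
    have "(\<Sum>i\<le>Suc ?m. l' i * v i w) = (\<Sum>i\<le>?m. l i * v i w)" for w
      by (simp add: l'_def)
    then have "\<forall>w\<in>insert w0 A. (\<Sum>i\<le>Suc ?m. l' i * v i w) = 0"
      using l(3) True by (auto simp: l'_def)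
    moreover have "\<exists>i\<le>Suc ?m. l' i \<noteq> 0" using l by (intro exI[of _ i]) (simp add: l'_def)
    ultimately show ?thesis unfolding card by blast
  next
    case False
    then obtain j where j: "j \<le> Suc ?m" "v j w0 \<noteq> 0" by blast
    \<comment> \<open>\<open>sk\<close> enumerates the indices other than the pivot
      \<open>j\<close>; the \<open>r i\<close> are the elimination factors.\<close>
    define sk where "sk i = (if i < j then i else Suc i)" for i
    define r where "r i = v (sk i) w0 / v j w0" for i
    from insert.IH[of "\<lambda>i w. v (sk i) w - r i * v j w"] obtain l i where
      l: "i \<le> ?m" "l i \<noteq> 0" "\<forall>w\<in>A. (\<Sum>i\<le>?m. l i * (v (sk i) w - r i * v j w)) = 0" by blast
    define l' where "l' k = (if k = j then - (\<Sum>i\<le>?m. l i * r i) else l (if k < j then k else k - 1))" for k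
    have sk: "l' (sk i) = l i" "sk i \<noteq> j" for i by (auto simp: l'_def sk_def)
    have "bij_betw sk {..?m} ({..Suc ?m} - {j})"
    proof (rule bij_betw_byWitness[where f' = "\<lambda>k. if k < j then k else k - 1"])
      show "\<forall>a\<in>{..?m}. (if sk a < j then sk a else sk a - 1) = a" by (simp add: sk_def)
      show "\<forall>a'\<in>{..Suc ?m} - {j}. sk (if a' < j then a' else a' - 1) = a'"
      proof
        fix a' assume "a' \<in> {..Suc ?m} - {j}"
        then have "a' < j \<or> j < a'" by auto
        then show "sk (if a' < j then a' else a' - 1) = a'" unfolding sk_def by (elim disjE) simp_all
      qed
      show "sk ` {..?m} \<subseteq> {..Suc ?m} - {j}"
      proof (rule image_subsetI)
        fix i assume "i \<in> {..?m}"
        then show "sk i \<in> {..Suc ?m} - {j}" by (cases "i < j") (simp_all add: sk_def)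
      qed
      show "(\<lambda>k. if k < j then k else k - 1) ` ({..Suc ?m} - {j}) \<subseteq> {..?m}"
      proof
        fix x assume "x \<in> (\<lambda>k. if k < j then k else k - 1) ` ({..Suc ?m} - {j})"
        then obtain k where "k \<le> Suc ?m" "k \<noteq> j" "x = (if k < j then k else k - 1)" by blast
        then show "x \<in> {..?m}" using j(1) by (cases "k < j") auto
      qed
    qed
    then have "(\<Sum>k\<in>{..Suc ?m} - {j}. l' k * v k w) = (\<Sum>i\<le>?m. l i * v (sk i) w)" for w
      by (subst sum.reindex_bij_betw[symmetric, of sk]) (simp_all add: sk)
    then have s: "(\<Sum>k\<le>Suc ?m. l' k * v k w) = (\<Sum>i\<le>?m. l i * (v (sk i) w - r i * v j w))" for w
    proof -
      have "(\<Sum>k\<le>Suc ?m. l' k * v k w) = l' j * v j w + (\<Sum>k\<in>{..Suc ?m} - {j}. l' k * v k w)"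
        using j(1) by (intro sum.remove) auto
      also have "l' j * v j w = - (\<Sum>i\<le>?m. l i * r i * v j w)"
        by (simp add: l'_def sum_distrib_right)
      finally show ?thesis
        unfolding \<open>(\<Sum>k\<in>{..Suc ?m} - {j}. l' k * v k w) = (\<Sum>i\<le>?m. l i * v (sk i) w)\<close>
        by (simp add: right_diff_distrib sum_subtractf mult.assoc)
    qed
    have "(\<Sum>i\<le>?m. l i * (v (sk i) w0 - r i * v j w0)) = 0"
      using j by (simp add: r_def)
    then have "\<forall>w\<in>insert w0 A. (\<Sum>k\<le>Suc ?m. l' k * v k w) = 0" using l(3) s by simp
    moreover have "sk i \<le> Suc ?m" using l(1) by (simp add: sk_def)
    moreover have "l' (sk i) \<noteq> 0" using l(2) by (simp add: sk)
    ultimately show ?thesis unfolding card by blast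
  qed
qed

context refl_rep
begin

section \<open>Spectral projections of the class sum\<close>

text \<open>Left multiplication by half the class sum in the group algebra; the argument is
  \<open>s ** w\<close> because \<open>s\<close> is an involution. \<open>OLc\<close>, with
  conjugated parameters, is its adjoint for \<open>ip\<close>.\<close>

definition OL :: "('n mtx \<Rightarrow> complex) \<Rightarrow> 'n mtx \<Rightarrow> complex" where
  "OL e w = (1 / 2) * (\<Sum>s\<in>Rf. c s * e (s ** w))"

definition OLc :: "('n mtx \<Rightarrow> complex) \<Rightarrow> 'n mtx \<Rightarrow> complex" where
  "OLc e w = (1 / 2) * (\<Sum>s\<in>Rf. cnj (c s) * e (s ** w))"

definition ip :: "('n mtx \<Rightarrow> complex) \<Rightarrow> ('n mtx \<Rightarrow> complex) \<Rightarrow> complex" where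
  "ip f g = (\<Sum>w\<in>W. f w * cnj (g w))"

lemma sum_left_mult: "s \<in> Rf \<Longrightarrow> (\<Sum>w\<in>W. h (s ** w)) = (\<Sum>w\<in>W. h w)"
proof -
  assume s: "s \<in> Rf"
  then have W: "s \<in> W" using RfW by auto
  show ?thesis
    by (rule sum.reindex_bij_witness[of _ "\<lambda>w. s ** w" "\<lambda>w. s ** w"])
      (simp_all add: matrix_mul_assoc refl_mult_self s Wm W)
qed

lemma ip_OL: "ip (OL f) g = ip f (OLc g)"
proof -
  have "ip (OL f) g = (1 / 2) * (\<Sum>s\<in>Rf. \<Sum>w\<in>W. c s * f (s ** w) * cnj (g w))"
    unfolding ip_def OL_def by (subst sum.swap) (simp add: sum_distrib_left sum_distrib_right mult.assoc)
  also have "(\<Sum>s\<in>Rf. \<Sum>w\<in>W. c s * f (s ** w) * cnj (g w)) = (\<Sum>s\<in>Rf. \<Sum>w\<in>W. c s * f w * cnj (g (s ** w)))"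
  proof (rule sum.cong[OF refl])
    fix s assume s: "s \<in> Rf"
    show "(\<Sum>w\<in>W. c s * f (s ** w) * cnj (g w)) = (\<Sum>w\<in>W. c s * f w * cnj (g (s ** w)))"
      using sum_left_mult[OF s, of "\<lambda>w. c s * f w * cnj (g (s ** w))"] s
      by (simp add: matrix_mul_assoc refl_mult_self)
  qed
  also have "(1 / 2) * \<dots> = ip f (OLc g)"
    unfolding ip_def OLc_def by (subst sum.swap) (simp add: sum_distrib_left mult_ac)
  finally show ?thesis .
qed

text \<open>Normality: \<open>c\<close> is constant on conjugacy classes, so the class sum is
  central in the group algebra.\<close>

lemma OL_OLc: "OL (OLc f) w = OLc (OL f) w"
proof -
  have 1: "(\<Sum>s\<in>Rf. c s * f (s ** (s' ** w))) = (\<Sum>s\<in>Rf. c s * f (s' ** (s ** w)))" if s': "s' \<in> Rf" for s'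
  proof -
    have W: "s' \<in> W" using s' RfW by auto
    have "(\<Sum>s\<in>Rf. c s * f (s ** (s' ** w))) =
        (\<Sum>s\<in>Rf. c (s' ** s ** transpose s') * f (s' ** s ** transpose s' ** (s' ** w)))"
      by (rule sum_conj[OF W, symmetric])
    also have "\<dots> = (\<Sum>s\<in>Rf. c s * f (s' ** (s ** w)))"
    proof (intro sum.cong refl)
      fix s assume s: "s \<in> Rf"
      have "s' ** s ** transpose s' ** (s' ** w) = s' ** (s ** w)"
        by (simp add: W_cancel[OF W] flip: matrix_mul_assoc)
      then show "c (s' ** s ** transpose s') * f (s' ** s ** transpose s' ** (s' ** w)) = c s * f (s' ** (s ** w))"
        by (simp only: cc[OF W s])
    qed
    finally show ?thesis .
  qed
  have "OL (OLc f) w = (1 / 4) * (\<Sum>s\<in>Rf. \<Sum>s'\<in>Rf. c s * cnj (c s') * f (s' ** (s ** w)))"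
    by (simp add: OL_def OLc_def sum_distrib_left mult_ac)
  also have "\<dots> = (1 / 4) * (\<Sum>s'\<in>Rf. cnj (c s') * (\<Sum>s\<in>Rf. c s * f (s' ** (s ** w))))"
    by (subst sum.swap) (simp add: sum_distrib_left mult_ac)
  also have "\<dots> = (1 / 4) * (\<Sum>s'\<in>Rf. cnj (c s') * (\<Sum>s\<in>Rf. c s * f (s ** (s' ** w))))"
    by (simp add: 1)
  also have "\<dots> = OLc (OL f) w"
    by (simp add: OL_def OLc_def sum_distrib_left mult_ac)
  finally show ?thesis .
qed

lemma ip_self: "ip f f = 0 \<Longrightarrow> w \<in> W \<Longrightarrow> f w = 0"
proof -
  assume a: "ip f f = 0" "w \<in> W"
  have "ip f f = of_real (\<Sum>w\<in>W. (cmod (f w))\<^sup>2)"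
    unfolding ip_def complex_norm_square of_real_sum by simp
  with a(1) have "(\<Sum>w\<in>W. (cmod (f w))\<^sup>2) = 0" by (simp only: of_real_eq_0_iff)
  then have "(cmod (f w))\<^sup>2 = 0" using a(2) finW by (subst (asm) sum_nonneg_eq_0_iff) auto
  then show ?thesis by simp
qed

lemma ip_zero: "(\<And>w. w \<in> W \<Longrightarrow> f w = 0) \<Longrightarrow> ip f g = 0" "(\<And>w. w \<in> W \<Longrightarrow> g w = 0) \<Longrightarrow> ip f g = 0"
  by (simp_all add: ip_def)

definition TL :: "complex \<Rightarrow> ('n mtx \<Rightarrow> complex) \<Rightarrow> 'n mtx \<Rightarrow> complex" where
  "TL b e w = b * e w - OL e w"

definition TLc :: "complex \<Rightarrow> ('n mtx \<Rightarrow> complex) \<Rightarrow> 'n mtx \<Rightarrow> complex" where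
  "TLc b e w = cnj b * e w - OLc e w"

lemma ip_TL: "ip (TL b f) g = ip f (TLc b g)"
proof -
  have "ip (TL b f) g = b * ip f g - ip (OL f) g"
    by (simp add: ip_def TL_def algebra_simps sum_subtractf sum_distrib_left)
  also have "\<dots> = ip f (TLc b g)"
    unfolding ip_OL by (simp add: ip_def TLc_def algebra_simps sum_subtractf sum_distrib_left)
  finally show ?thesis .
qed

lemma ip_TLc: "ip (TLc b f) g = ip f (TL b g)"
proof -
  have cnj_ip: "cnj (ip f g) = ip g f" for f g by (simp add: ip_def mult.commute)
  have "cnj (ip (TLc b f) g) = cnj (ip f (TL b g))" unfolding cnj_ip by (rule ip_TL[symmetric])
  then show ?thesis by simp
qed

lemma OL_lin: "OL (\<lambda>w. x * f w - g w) w = x * OL f w - OL g w"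
  and OLc_lin: "OLc (\<lambda>w. x * f w - g w) w = x * OLc f w - OLc g w"
  by (simp_all add: OL_def OLc_def right_diff_distrib sum_subtractf sum_distrib_left mult_ac)

lemma TL_TLc: "TL b (TLc b f) = TLc b (TL b f)"
proof
  fix w
  have e1: "TL b (TLc b f) w = b * (cnj b * f w - OLc f w) - (cnj b * OL f w - OL (OLc f) w)"
    unfolding TL_def TLc_def[abs_def] OL_lin ..
  have e2: "TLc b (TL b f) w = cnj b * (b * f w - OL f w) - (b * OLc f w - OLc (OL f) w)"
    unfolding TLc_def TL_def[abs_def] OLc_lin ..
  show "TL b (TLc b f) w = TLc b (TL b f) w"
    unfolding e1 e2 OL_OLc by (simp add: algebra_simps)
qed

text \<open>A normal operator \<open>T\<close> has no nilpotent part. If \<open>T\<close> kills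
  \<open>T u\<close>, so does its adjoint, since the two have equal norms on every vector; pairing
  with \<open>u\<close> then gives \<open>T u = 0\<close>.\<close>

lemma TL_reduced:
  assumes "\<And>w. w \<in> W \<Longrightarrow> TL b (TL b u) w = 0" "w \<in> W"
  shows "TL b u w = 0"
proof -
  have "ip (TLc b (TL b u)) (TLc b (TL b u)) = ip (TL b u) (TLc b (TL b (TL b u)))"
    unfolding ip_TLc TL_TLc ..
  also have "\<dots> = ip (TL b (TL b u)) (TL b (TL b u))" by (rule ip_TL[symmetric])
  also have "\<dots> = 0" using assms by (intro ip_zero) auto
  finally have "TLc b (TL b u) w = 0" if "w \<in> W" for w using ip_self that by blast
  then have "ip u (TLc b (TL b u)) = 0" by (rule ip_zero(2))
  then have "ip (TL b u) (TL b u) = 0" by (simp add: ip_TL)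
  then show ?thesis using ip_self assms(2) by blast
qed

lemma TL_cong: "(\<And>w. w \<in> W \<Longrightarrow> u w = u' w) \<Longrightarrow> w \<in> W \<Longrightarrow> TL b u w = TL b u' w"
  using RfW Wm by (auto simp: TL_def OL_def intro!: sum.cong)

lemma clin_TL: "clin (TL b)"
  by (rule clinI) (simp_all add: TL_def OL_def fun_eq_iff fun_apply cscale_complex_def algebra_simps sum.distrib sum_distrib_left)

lemma TL_power_reduced:
  "(\<And>w. w \<in> W \<Longrightarrow> (TL b ^^ i) u w = 0) \<Longrightarrow> w \<in> W \<Longrightarrow> TL b u w = 0"
proof (induction i arbitrary: u w)
  case 0
  then show ?case using TL_cong[of u "\<lambda>_. 0" w] by (simp add: TL_def OL_def)
next
  case (Suc i)
  have "TL b (TL b u) w = 0" if "w \<in> W" for w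
    using Suc.IH[of "TL b u"] Suc.prems(1) that by (simp add: funpow_swap1)
  then show ?case using TL_reduced Suc.prems(2) by blast
qed

definition delta1 :: "'n mtx \<Rightarrow> complex" where "delta1 w = (if w = mat 1 then 1 else 0)"

text \<open>The unit of the group algebra splits into an eigenvector \<open>e\<close> of the class
  sum and an image under \<open>TL b\<close>. Let \<open>i0\<close> be the lowest power in a linear
  relation between the powers of \<open>TL b\<close> on \<open>delta1\<close>. Dividing by it gives
  \<open>y\<close> with nonzero constant term, and \<open>TL b y = 0\<close> as there is no
  nilpotent part; \<open>e\<close> is \<open>y\<close> rescaled.\<close>

lemma TL_splitting:
  "\<exists>e g. \<forall>w\<in>W. TL b e w = 0 \<and> delta1 w - e w = TL b g w"
proof -
  let ?M = "card W" and ?v = "\<lambda>i. (TL b ^^ i) delta1"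
  have clin_pow: "clin (TL b ^^ i)" for i
  proof (induction i)
    case 0
    show ?case by (simp add: clin_def)
  next
    case (Suc i)
    show ?case using clin_compose[OF clin_TL Suc] by (simp add: o_def)
  qed
  obtain l where l: "\<exists>i\<le>?M. l i \<noteq> 0" "\<forall>w\<in>W. (\<Sum>i\<le>?M. l i * ?v i w) = 0"
    using linear_dependence[OF finW, of ?v] by blast
  define i0 where "i0 = (LEAST i. i \<le> ?M \<and> l i \<noteq> 0)"
  have i0: "i0 \<le> ?M" "l i0 \<noteq> 0" using LeastI_ex[OF l(1)] by (simp_all add: i0_def)
  have low: "l i = 0" if "i < i0" for i
    using not_less_Least[of i "\<lambda>i. i \<le> ?M \<and> l i \<noteq> 0"] that i0 by (auto simp: i0_def)
  define y where "y = (\<Sum>i\<in>{i0..?M}. l i *\<^sub>C ?v (i - i0))"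
  define q where "q = (\<Sum>i\<in>{Suc i0..?M}. l i *\<^sub>C ?v (i - Suc i0))"
  have "(TL b ^^ i0) y w = (\<Sum>i\<le>?M. l i * ?v i w)" for w
  proof -
    have "(TL b ^^ i0) y w = (\<Sum>i\<in>{i0..?M}. l i * ?v i w)"
      unfolding y_def clin_sum[OF clin_pow] clin_scale[OF clin_pow] sum_fun_apply
      by (intro sum.cong refl) (simp add: fun_apply cscale_complex_def flip: funpow_add o_apply[of "TL b ^^ _"])
    also have "\<dots> = (\<Sum>i\<le>?M. l i * ?v i w)"
      by (rule sum.mono_neutral_left) (auto simp: low)
    finally show ?thesis .
  qed
  then have Ty: "TL b y w = 0" if "w \<in> W" for w
    using TL_power_reduced[of i0 b y w] l(2) that by simp
  have "TL b q = (\<Sum>i\<in>{Suc i0..?M}. l i *\<^sub>C ?v (i - i0))"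
    unfolding q_def clin_sum[OF clin_TL] clin_scale[OF clin_TL]
  proof (intro sum.cong refl)
    fix i assume "i \<in> {Suc i0..?M}"
    then have "i - i0 = Suc (i - Suc i0)" by auto
    then show "l i *\<^sub>C TL b ((TL b ^^ (i - Suc i0)) delta1) = l i *\<^sub>C (TL b ^^ (i - i0)) delta1" by simp
  qed
  then have y: "y = l i0 *\<^sub>C delta1 + TL b q"
    unfolding y_def using i0 by (simp add: sum.atLeast_Suc_atMost)
  have "TL b ((1 / l i0) *\<^sub>C y) w = 0" if "w \<in> W" for w
    using Ty[OF that] by (simp add: clin_scale[OF clin_TL] fun_apply cscale_complex_def)
  moreover have "delta1 w - ((1 / l i0) *\<^sub>C y) w = TL b ((- 1 / l i0) *\<^sub>C q) w" for w
    unfolding clin_scale[OF clin_TL] y using i0 by (simp add: fun_apply cscale_complex_def field_simps)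
  ultimately show ?thesis by blast
qed

section \<open>The group algebra acting on spinor-valued polynomials\<close>

definition ga :: "('n mtx \<Rightarrow> complex) \<Rightarrow> ('n set \<Rightarrow> 'n pext) \<Rightarrow> 'n set \<Rightarrow> 'n pext" where
  "ga e t = (\<Sum>w\<in>W. e w *\<^sub>C wS w t)"

lemma clin_ga: "clin (ga e)"
  unfolding ga_def by (intro clin_sumf clin_cscale clin_wS)

lemma ga_cong: "(\<And>w. w \<in> W \<Longrightarrow> e w = e' w) \<Longrightarrow> ga e t = ga e' t"
  by (simp add: ga_def)

lemma ga_delta1: "ga delta1 t = t"
proof -
  have "ga delta1 t = (\<Sum>w\<in>W. if w = mat 1 then t else 0)"
    unfolding ga_def delta1_def by (intro sum.cong) (auto simp: wS_one)
  then show ?thesis using W1 finW by (simp add: sum.delta)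
qed

lemma Om_ga: "Om (ga e t) = ga (OL e) t"
proof -
  have "Om (ga e t) = (1 / 2) *\<^sub>C (\<Sum>s\<in>Rf. \<Sum>w\<in>W. (c s * e w) *\<^sub>C wS (s ** w) t)"
    by (simp add: Om_def ga_def clin_sum[OF clin_wS] clin_scale[OF clin_wS] wS_mult cscale_sum_right)
  also have "(\<Sum>s\<in>Rf. \<Sum>w\<in>W. (c s * e w) *\<^sub>C wS (s ** w) t) = (\<Sum>s\<in>Rf. \<Sum>w\<in>W. (c s * e (s ** w)) *\<^sub>C wS w t)"
  proof (rule sum.cong[OF refl])
    fix s assume s: "s \<in> Rf"
    show "(\<Sum>w\<in>W. (c s * e w) *\<^sub>C wS (s ** w) t) = (\<Sum>w\<in>W. (c s * e (s ** w)) *\<^sub>C wS w t)"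
      using sum_left_mult[OF s, of "\<lambda>w. (c s * e (s ** w)) *\<^sub>C wS w t"] s
      by (simp add: matrix_mul_assoc refl_mult_self)
  qed
  also have "(1 / 2) *\<^sub>C \<dots> = ga (OL e) t"
    unfolding ga_def OL_def by (subst sum.swap) (simp add: cscale_sum_right cscale_sum_left sum_distrib_left)
  finally show ?thesis .
qed

lemma ga_Om: "ga e (Om t) = Om (ga e t)"
  unfolding ga_def by (simp add: clin_sum[OF clin_Om] clin_scale[OF clin_Om] wS_Om cong: sum.cong)

lemma ga_TL: "ga (TL b e) t = b *\<^sub>C ga e t - Om (ga e t)"
  unfolding Om_ga by (simp add: ga_def TL_def cscale_diff_left sum_subtractf cscale_sum_right)

definition split_pair :: "complex \<Rightarrow> ('n mtx \<Rightarrow> complex) \<times> ('n mtx \<Rightarrow> complex)" where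
  "split_pair b = (SOME (e, g). \<forall>w\<in>W. TL b e w = 0 \<and> delta1 w - e w = TL b g w)"

lemma split_pair:
  assumes "w \<in> W"
  shows "TL b (fst (split_pair b)) w = 0"
    "delta1 w - fst (split_pair b) w = TL b (snd (split_pair b)) w"
proof -
  have "\<exists>p. case p of (e, g) \<Rightarrow> \<forall>w\<in>W. TL b e w = 0 \<and> delta1 w - e w = TL b g w"
    using TL_splitting by auto
  then have "case split_pair b of (e, g) \<Rightarrow> \<forall>w\<in>W. TL b e w = 0 \<and> delta1 w - e w = TL b g w"
    unfolding split_pair_def by (rule someI_ex)
  then show "TL b (fst (split_pair b)) w = 0"
    "delta1 w - fst (split_pair b) w = TL b (snd (split_pair b)) w"
    using assms by (auto split: prod.splits)
qed

text \<open>\<open>eb b\<close> is the projection onto the \<open>b\<close>-eigenspace of \<open>Om\<close>.\<close>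

definition eb :: "complex \<Rightarrow> ('n set \<Rightarrow> 'n pext) \<Rightarrow> 'n set \<Rightarrow> 'n pext" where
  "eb b = ga (fst (split_pair b))"

lemma clin_eb: "clin (eb b)"
  unfolding eb_def by (rule clin_ga)

lemma Om_eb: "Om (eb b t) = b *\<^sub>C eb b t"
proof -
  have "ga (TL b (fst (split_pair b))) t = ga (\<lambda>_. 0) t" by (rule ga_cong) (rule split_pair)
  then have "b *\<^sub>C eb b t - Om (eb b t) = 0" by (simp add: ga_TL eb_def) (simp add: ga_def)
  then show ?thesis by simp
qed

lemma eb_diff: "t - eb b t = ga (snd (split_pair b)) (b *\<^sub>C t - Om t)"
proof -
  have "t - eb b t = ga (\<lambda>w. delta1 w - fst (split_pair b) w) t"
    by (subst ga_delta1[of t, symmetric]) (simp add: eb_def ga_def cscale_diff_left sum_subtractf)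
  also have "\<dots> = ga (TL b (snd (split_pair b))) t" by (rule ga_cong) (rule split_pair)
  finally show ?thesis by (simp add: ga_TL clin_diff[OF clin_ga] clin_scale[OF clin_ga] ga_Om)
qed

lemma eb_fix: "Om t = b *\<^sub>C t \<Longrightarrow> eb b t = t"
  using eb_diff[of t b] by (simp add: clin_zero[OF clin_ga])

text \<open>The construction does not exhibit the element behind \<open>eb b\<close> as central.
  Instead, \<open>t\<close> is split into an eigenvector and an element of the image of
  \<open>b - Om\<close>. Both kinds are respected by \<open>wS w\<close>, and \<open>eb b\<close> is
  the identity on the first and zero on the second.\<close>

lemma wS_eb: "w \<in> W \<Longrightarrow> wS w (eb b t) = eb b (wS w t)"
proof -
  assume w: "w \<in> W"
  define g where "g = ga (snd (split_pair b)) t"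
  have t: "t = eb b t + (b *\<^sub>C g - Om g)"
    using eb_diff[of t b] by (simp add: g_def clin_diff[OF clin_ga] clin_scale[OF clin_ga] ga_Om algebra_simps)
  have 0: "eb b (b *\<^sub>C x - Om x) = 0" for x
    using Om_eb[of b x] by (simp add: eb_def clin_diff[OF clin_ga] clin_scale[OF clin_ga] ga_Om)
  have "eb b (wS w t) = eb b (wS w (eb b t)) + eb b (b *\<^sub>C wS w g - Om (wS w g))"
    by (subst t) (simp only: clin_add[OF clin_wS] clin_diff[OF clin_wS] clin_scale[OF clin_wS] wS_Om[OF w] clin_add[OF clin_eb])
  also have "\<dots> = wS w (eb b t)"
    unfolding 0 using w by (simp add: eb_fix Om_eb clin_scale[OF clin_wS] flip: wS_Om)
  finally show ?thesis by simp
qed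

text \<open>\<open>F\<close> is linear only on \<open>YE j\<close>, which is the situation of the
  maps of the resolution; hence the partial sums are kept inside \<open>YE j\<close> along the
  induction.\<close>

lemma ga_commute:
  assumes F: "\<And>t u. t \<in> YE j \<Longrightarrow> u \<in> YE j \<Longrightarrow> F (t + u) = F t + F u"
    "\<And>z t. t \<in> YE j \<Longrightarrow> F (z *\<^sub>C t) = z *\<^sub>C F t"
    "\<And>w t. w \<in> W \<Longrightarrow> t \<in> YE j \<Longrightarrow> F (wS w t) = wS w (F t)"
    and t: "t \<in> YE j"
  shows "F (ga e t) = ga e (F t)"
proof -
  have 0: "F 0 = 0" using F(2)[OF t, of 0] by simp
  have "F (\<Sum>w\<in>A. e w *\<^sub>C wS w t) = (\<Sum>w\<in>A. e w *\<^sub>C wS w (F t)) \<and> (\<Sum>w\<in>A. e w *\<^sub>C wS w t) \<in> YE j"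
    if "finite A" "A \<subseteq> W" for A
    using that by induction (auto simp: 0 F t YE_zero YE_wS YE_scale YE_add)
  then show ?thesis using finW by (simp add: ga_def)
qed

lemma ga_YE: "t \<in> YE j \<Longrightarrow> ga e t \<in> YE j"
  unfolding ga_def by (intro YE_sum YE_scale YE_wS)

lemma ga_WT: "t \<in> WT b \<Longrightarrow> ga e t \<in> WT b"
  unfolding ga_def by (intro WT_sum WT_scale WT_wS)

lemma eb_Kb: "t \<in> WT b \<Longrightarrow> t \<in> YE j \<Longrightarrow> eb b t \<in> Kb b j"
  by (simp add: Kb_def Om_eb) (simp add: eb_def ga_YE ga_WT)


section \<open>Weight components\<close>

text \<open>The weight of a single monomial. By \<open>WT_iff\<close>, weight spaces are spanned by
  monomials, so that projections onto them are truncations.\<close>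

definition wt :: "'n set \<Rightarrow> 'n set \<Rightarrow> ('n \<Rightarrow>\<^sub>0 nat) \<Rightarrow> complex" where
  "wt I J m = ewt (card J) m + of_nat CARD('n) - of_nat (card I)"

lemma WT_iff: "t \<in> WT b \<longleftrightarrow> (\<forall>I J m. Poly_Mapping.lookup (t I J) m \<noteq> 0 \<longrightarrow> wt I J m = b)"
proof
  assume t: "t \<in> WT b"
  show "\<forall>I J m. Poly_Mapping.lookup (t I J) m \<noteq> 0 \<longrightarrow> wt I J m = b"
  proof (intro allI impI)
    fix I J m assume l: "Poly_Mapping.lookup (t I J) m \<noteq> 0"
    have "Poly_Mapping.lookup (euler (t I) J) m = (b - of_nat CARD('n) + of_nat (card I)) * Poly_Mapping.lookup (t I J) m"
      using t by (simp add: WT_def fun_apply)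
    with l show "wt I J m = b" by (simp add: euler_lookup wt_def)
  qed
next
  assume a: "\<forall>I J m. Poly_Mapping.lookup (t I J) m \<noteq> 0 \<longrightarrow> wt I J m = b"
  have "Poly_Mapping.lookup (euler (t I) J) m = Poly_Mapping.lookup (((b - of_nat CARD('n) + of_nat (card I)) *\<^sub>C t I) J) m" for I J m
  proof (cases "Poly_Mapping.lookup (t I J) m = 0")
    case False
    then have "wt I J m = b" using a by blast
    then have "ewt (card J) m = b - of_nat CARD('n) + of_nat (card I)" by (auto simp: wt_def)
    then show ?thesis by (simp add: euler_lookup fun_apply)
  qed (simp add: euler_lookup fun_apply)
  then show "t \<in> WT b" unfolding WT_def by (blast intro: poly_mapping_eqI)
qed

definition prj :: "complex \<Rightarrow> ('n set \<Rightarrow> 'n pext) \<Rightarrow> 'n set \<Rightarrow> 'n pext" where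
  "prj b t = (\<lambda>I J. Poly_Mapping.mapp (\<lambda>m z. if wt I J m = b then z else 0) (t I J))"

lemma lookup_prj: "Poly_Mapping.lookup (prj b t I J) m = (if wt I J m = b then Poly_Mapping.lookup (t I J) m else 0)"
  by (auto simp: prj_def lookup_mapp when_def in_keys_iff)

lemma prj_eqI: "(\<And>I J m. Poly_Mapping.lookup (t I J) m = Poly_Mapping.lookup (u I J) m) \<Longrightarrow> t = (u :: 'n set \<Rightarrow> 'n pext)"
  by (intro ext poly_mapping_eqI)

lemma clin_prj: "clin (prj b)"
  by (rule clinI; rule prj_eqI) (simp_all add: lookup_prj fun_apply lookup_add)

lemma prj_WT: "prj b t \<in> WT b"
  by (simp add: WT_iff lookup_prj)

lemma prj_YE: "t \<in> YE j \<Longrightarrow> prj b t \<in> YE j"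
  by (auto simp: YE_def Ej_def prj_def intro!: poly_mapping_eqI simp: lookup_mapp)

lemma prj_WT_eq: "t \<in> WT b \<Longrightarrow> prj b' t = (if b' = b then t else 0)"
  by (rule prj_eqI) (auto simp: lookup_prj WT_iff fun_apply)

definition wts :: "('n set \<Rightarrow> 'n pext) \<Rightarrow> complex set" where
  "wts t = (\<lambda>(I, J, m). wt I J m) ` (SIGMA I:UNIV. SIGMA J:UNIV. Poly_Mapping.keys (t I J))"

lemma finite_wts: "finite (wts t)"
  unfolding wts_def by (intro finite_imageI finite_SigmaI) auto

lemma prj_sum: "(\<Sum>b\<in>wts t. prj b t) = t"
proof (rule prj_eqI)
  fix I J m
  have "wt I J m \<in> wts t" if "Poly_Mapping.lookup (t I J) m \<noteq> 0"
    using that unfolding wts_def by (intro image_eqI[of _ _ "(I, J, m)"]) (auto simp: in_keys_iff)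
  then have "Poly_Mapping.lookup (t I J) m = (\<Sum>b\<in>wts t. if b = wt I J m then Poly_Mapping.lookup (t I J) m else 0)"
    using finite_wts by (auto simp: sum.delta)
  also have "\<dots> = Poly_Mapping.lookup ((\<Sum>b\<in>wts t. prj b t) I J) m"
    by (simp add: sum_fun_apply lookup_sum lookup_prj eq_commute)
  finally show "Poly_Mapping.lookup ((\<Sum>b\<in>wts t. prj b t) I J) m = Poly_Mapping.lookup (t I J) m" by simp
qed

lemma prj_outside: "b \<notin> wts t \<Longrightarrow> prj b t = 0"
  by (rule prj_eqI) (force simp: lookup_prj fun_apply wts_def in_keys_iff)

lemma prj_commute:
  assumes F: "\<And>t u. t \<in> YE j \<Longrightarrow> u \<in> YE j \<Longrightarrow> F (t + u) = F t + F u"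
    "\<And>b t. t \<in> YE j \<Longrightarrow> t \<in> WT b \<Longrightarrow> F t \<in> WT b"
    and t: "t \<in> YE j"
  shows "prj b (F t) = F (prj b t)"
proof -
  have 0: "F 0 = 0" using F(1)[OF YE_zero YE_zero] by simp
  have "F (\<Sum>b'\<in>A. prj b' t) = (\<Sum>b'\<in>A. F (prj b' t)) \<and> (\<Sum>b'\<in>A. prj b' t) \<in> YE j" if "finite A" for A
    using that by induction (auto simp: 0 F t YE_zero YE_add prj_YE)
  from this[OF finite_wts[of t]] have "prj b (F t) = (\<Sum>b'\<in>wts t. prj b (F (prj b' t)))"
    by (simp add: prj_sum clin_sum[OF clin_prj])
  also have "\<dots> = (\<Sum>b'\<in>wts t. if b' = b then F (prj b' t) else 0)"
    using prj_WT_eq[OF F(2)[OF prj_YE[OF t] prj_WT], of b] by (intro sum.cong) auto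
  also have "\<dots> = F (prj b t)"
    using finite_wts prj_outside[of b t] 0 by (auto simp: sum.delta)
  finally show ?thesis .
qed

lemma prj_dirac: "prj b (dirac_op t) = dirac_op (prj b t)"
proof -
  have "dirac_op t = (\<Sum>b'\<in>wts t. dirac_op (prj b' t))"
    by (subst prj_sum[of t, symmetric]) (rule clin_sum[OF clin_dirac])
  then have "prj b (dirac_op t) = (\<Sum>b'\<in>wts t. prj b (dirac_op (prj b' t)))"
    by (simp add: clin_sum[OF clin_prj])
  also have "\<dots> = (\<Sum>b'\<in>wts t. if b' = b then dirac_op (prj b' t) else 0)"
    using prj_WT_eq[OF WT_dirac[OF prj_WT], of b] by (intro sum.cong) auto
  also have "\<dots> = dirac_op (prj b t)"
    using finite_wts prj_outside[of b t] clin_zero[OF clin_dirac] by (auto simp: sum.delta)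
  finally show ?thesis .
qed

lemma prj_wS: "w \<in> W \<Longrightarrow> prj b (wS w t) = wS w (prj b t)"
proof -
  assume w: "w \<in> W"
  have "wS w t = (\<Sum>b'\<in>wts t. wS w (prj b' t))"
    by (subst prj_sum[of t, symmetric]) (rule clin_sum[OF clin_wS])
  then have "prj b (wS w t) = (\<Sum>b'\<in>wts t. prj b (wS w (prj b' t)))"
    by (simp add: clin_sum[OF clin_prj])
  also have "\<dots> = (\<Sum>b'\<in>wts t. if b' = b then wS w (prj b' t) else 0)"
    using prj_WT_eq[OF WT_wS[OF w prj_WT], of b] by (intro sum.cong) auto
  also have "\<dots> = wS w (prj b t)"
    using finite_wts prj_outside[of b t] clin_zero[OF clin_wS] by (auto simp: sum.delta)
  finally show ?thesis .
qed

end

section \<open>Smash products and the action of the Cherednik algebra\<close>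

lemma matrix_inv_orthogonal: "w ** transpose w = mat 1 \<Longrightarrow> matrix_inv w = transpose (w :: complex^'n^'n)"
proof -
  assume w: "w ** transpose w = mat 1"
  then have w': "transpose w ** w = mat 1" using matrix_left_right_inverse by blast
  have "w ** matrix_inv w = mat 1 \<and> matrix_inv w ** w = mat 1"
    unfolding matrix_inv_def by (rule someI[of _ "transpose w"]) (use w w' in auto)
  then have "transpose w ** (w ** matrix_inv w) = transpose w" by simp
  then show ?thesis by (simp add: matrix_mul_assoc w')
qed

lemma contragredient_orthogonal: "w ** transpose w = mat 1 \<Longrightarrow> contragredient w = w"
  by (simp add: contragredient_def matrix_inv_orthogonal)

definition tsubst :: "('l \<Rightarrow> 'l list \<Rightarrow>\<^sub>0 complex) \<Rightarrow> ('l list \<Rightarrow>\<^sub>0 complex) \<Rightarrow> 'l list \<Rightarrow>\<^sub>0 complex" where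
  "tsubst h t = (\<Sum>u\<in>Poly_Mapping.keys t. scal (Poly_Mapping.lookup t u) * prod_list (map h u))"

lemma tsubst_superset:
  "finite A \<Longrightarrow> Poly_Mapping.keys t \<subseteq> A \<Longrightarrow>
    tsubst h t = (\<Sum>u\<in>A. scal (Poly_Mapping.lookup t u) * prod_list (map h u))"
  unfolding tsubst_def by (rule sum.mono_neutral_left) (auto simp: in_keys_iff)

lemma tsubst_add: "tsubst h (t + t') = tsubst h t + tsubst h t'"
proof -
  let ?A = "Poly_Mapping.keys t \<union> Poly_Mapping.keys t'"
  have "Poly_Mapping.keys (t + t') \<subseteq> ?A" by (rule keys_add)
  then show ?thesis
    by (subst (1 2 3) tsubst_superset[of ?A]) (auto simp: lookup_add single_add distrib_right sum.distrib)
qed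

lemma tsubst_single: "tsubst h (Poly_Mapping.single u c) = scal c * prod_list (map h u)"
  by (cases "c = 0") (simp_all add: tsubst_def)

lemma scal_times_scal: "scal a * scal b = (scal (a * b) :: 'l list \<Rightarrow>\<^sub>0 complex)"
  by (simp add: mult_single)

lemma scal_central: "scal z * t = t * (scal z :: 'l list \<Rightarrow>\<^sub>0 complex)"
  by (induction t rule: pm_induct) (simp_all add: mult_single distrib_left distrib_right mult.commute)

lemma tsubst_mult: "tsubst h (t * t') = tsubst h t * tsubst h t'"
proof (induction t rule: pm_induct)
  case (single u c)
  show ?case
  proof (induction t' rule: pm_induct)
    case (single u' c')
    have "scal (c * c') * (prod_list (map h u) * prod_list (map h u')) =
        scal c * (scal c' * prod_list (map h u)) * prod_list (map h u')"
      by (simp only: mult.assoc flip: scal_times_scal)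
    also have "scal c' * prod_list (map h u) = prod_list (map h u) * scal c'" by (rule scal_central)
    finally show ?case by (simp add: mult_single tsubst_single plus_list_def mult.assoc)
  qed (simp add: distrib_left tsubst_add)
qed (simp add: distrib_right tsubst_add)

lemma tsubst_scal [simp]: "tsubst h (scal c) = scal c"
  by (simp add: tsubst_single zero_list_def)

lemma tsubst_one [simp]: "tsubst h 1 = 1"
  using tsubst_scal[of h 1] by simp

lemma tens_induct [case_names scal var add]:
  fixes t :: "'n::finite tens"
  assumes scal: "\<And>c. Q (scal c)" and var: "\<And>l t. Q t \<Longrightarrow> Q (Poly_Mapping.single [l] 1 * t)"
    and add: "\<And>p q. Q p \<Longrightarrow> Q q \<Longrightarrow> Q (p + q)"
  shows "Q t"
proof (induction t rule: pm_induct)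
  case (single u c)
  show ?case
  proof (induction u)
    case Nil
    show ?case using scal[of c] by (simp add: zero_list_def)
  next
    case (Cons a u)
    have "Poly_Mapping.single (a # u) c = Poly_Mapping.single [a] 1 * Poly_Mapping.single u c"
      by (simp add: mult_single plus_list_def)
    then show ?case using var[OF Cons] by simp
  qed
qed (rule add)

lemma tens_act_eq: "tens_act g = tsubst (case_sum (\<lambda>i. tens_y (g *v axis i 1)) (\<lambda>i. tens_x (contragredient g *v axis i 1)))"
  by (simp add: fun_eq_iff tens_act_def tsubst_def)

lemma tens_y_axis: "tens_y (axis i 1) = Poly_Mapping.single [Inl i] 1"
proof -
  have "tens_y (axis i 1) = (\<Sum>j\<in>UNIV. if j = i then Poly_Mapping.single [Inl j] 1 else 0)"
    unfolding tens_y_def by (intro sum.cong) (auto simp: axis_def)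
  then show ?thesis by simp
qed

lemma tens_x_axis: "tens_x (axis i 1) = Poly_Mapping.single [Inr i] 1"
proof -
  have "tens_x (axis i 1) = (\<Sum>j\<in>UNIV. if j = i then Poly_Mapping.single [Inr j] 1 else 0)"
    unfolding tens_x_def by (intro sum.cong) (auto simp: axis_def)
  then show ?thesis by simp
qed

lemma clin_tens_y: "clin tens_y"
  by (rule clinI) (simp_all add: tens_y_def single_add sum.distrib cscale_sum_right cscale_single cscale_complex_def)

lemma clin_tens_x: "clin tens_x"
  by (rule clinI) (simp_all add: tens_x_def single_add sum.distrib cscale_sum_right cscale_single cscale_complex_def)

lemma clin_tens_act: "clin (tens_act g)"
  by (rule clinI) (simp_all add: tens_act_eq tsubst_add tsubst_mult flip: scal_mult)

lemma tens_act_mult: "tens_act g (t * t') = tens_act g t * tens_act g t'"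
  by (simp add: tens_act_eq tsubst_mult)

lemma tens_act_scal [simp]: "tens_act g (scal z) = scal z"
  by (simp add: tens_act_eq)

lemma tens_act_1 [simp]: "tens_act g 1 = 1"
  by (simp add: tens_act_eq)

lemma tens_act_tens_y: "tens_act g (tens_y y) = tens_y (g *v y)"
proof (rule clin_vec_eqI[OF clin_compose[OF clin_tens_act clin_tens_y] clin_compose[OF clin_tens_y clin_matrix_vector]])
  show "tens_act g (tens_y (axis i 1)) = tens_y (g *v axis i 1)" for i
    by (subst (1) tens_y_axis) (simp add: tens_act_eq tsubst_single)
qed

lemma tens_act_tens_x: "tens_act g (tens_x y) = tens_x (contragredient g *v y)"
proof (rule clin_vec_eqI[OF clin_compose[OF clin_tens_act clin_tens_x] clin_compose[OF clin_tens_x clin_matrix_vector]])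
  show "tens_act g (tens_x (axis i 1)) = tens_x (contragredient g *v axis i 1)" for i
    by (subst (1) tens_x_axis) (simp add: tens_act_eq tsubst_single)
qed

lemma single_letter: "Poly_Mapping.single [l] 1 = (case l of Inl i \<Rightarrow> tens_y (axis i 1) | Inr i \<Rightarrow> tens_x (axis i 1))"
  by (simp add: tens_y_axis tens_x_axis split: sum.split)

section \<open>The smash product as a ring\<close>

context refl_rep
begin

lemma contragredient_W: "w \<in> W \<Longrightarrow> contragredient w = w"
  by (rule contragredient_orthogonal) (rule Wo)

lemma tens_act_comp: "g \<in> W \<Longrightarrow> h \<in> W \<Longrightarrow> tens_act (g ** h) t = tens_act g (tens_act h t)"
  by (induction t rule: tens_induct)
    (auto simp: single_letter tens_act_mult tens_act_tens_y tens_act_tens_x contragredient_W Wm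
      clin_add[OF clin_tens_act] matrix_vector_mul_assoc split: sum.split)

lemma tens_act_id: "tens_act (mat 1) t = (t :: 'n tens)"
  using contragredient_W[OF W1] by (induction t rule: tens_induct)
    (auto simp: single_letter tens_act_mult tens_act_tens_y tens_act_tens_x
      clin_add[OF clin_tens_act] split: sum.split)

lemma smash_carrier: "f \<in> carrier (smash W act) \<longleftrightarrow> (\<forall>w. w \<notin> W \<longrightarrow> f w = 0)"
  by (simp add: smash_def)

text \<open>The second group element is determined by the first, as group elements are orthogonal;
  this turns the sum over pairs into one over the group.\<close>

lemma smash_mult:
  "(f \<otimes>\<^bsub>smash W act\<^esub> g) w = (if w \<in> W then \<Sum>u\<in>W. f u * act u (g (transpose u ** w)) else 0)"
proof (cases "w \<in> W")
  case True
  have "(\<Sum>(u, v)\<in>{(u, v) \<in> W \<times> W. u ** v = w}. f u * act u (g v)) = (\<Sum>u\<in>W. f u * act u (g (transpose u ** w)))"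
  proof (rule sum.reindex_bij_witness[of _ "\<lambda>u. (u, transpose u ** w)" fst])
    fix p assume "p \<in> {(u, v) \<in> W \<times> W. u ** v = w}"
    then show "(fst p, transpose (fst p) ** w) = p" "fst p \<in> W"
      "f (fst p) * act (fst p) (g (transpose (fst p) ** w)) = (case p of (u, v) \<Rightarrow> f u * act u (g v))"
      by (auto simp: W_cancel)
  next
    fix u assume "u \<in> W"
    then show "(u, transpose u ** w) \<in> {(u, v) \<in> W \<times> W. u ** v = w}"
      using True by (simp add: W_cancel Wm Wt)
  qed auto
  then show ?thesis using True by (simp add: smash_def)
next
  case False
  then have "(\<Sum>(u, v)\<in>{(u, v) \<in> W \<times> W. u ** v = w}. f u * act u (g v)) = 0"
    by (intro sum.neutral) (use Wm in auto)
  then show ?thesis using False by (simp add: smash_def)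
qed

lemma smash_add: "(f \<oplus>\<^bsub>smash W act\<^esub> g) w = f w + g w"
  by (simp add: smash_def)

lemma sum_translate: "g \<in> W \<Longrightarrow> (\<Sum>v\<in>W. h (g ** v)) = (\<Sum>u\<in>W. h u)"
  by (rule sum.reindex_bij_witness[of _ "\<lambda>v. transpose g ** v" "\<lambda>v. g ** v"])
    (auto simp: W_cancel Wm Wt)

lemma smash_ring:
  fixes act :: "'n mtx \<Rightarrow> 'a::ring_1 \<Rightarrow> 'a"
  assumes add: "\<And>w a b. w \<in> W \<Longrightarrow> act w (a + b) = act w a + act w b"
    and mult: "\<And>w a b. w \<in> W \<Longrightarrow> act w (a * b) = act w a * act w b"
    and one: "\<And>w. w \<in> W \<Longrightarrow> act w 1 = 1"
    and comp: "\<And>u v a. u \<in> W \<Longrightarrow> v \<in> W \<Longrightarrow> act (u ** v) a = act u (act v a)"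
    and id: "\<And>a. act (mat 1) a = a"
  shows "ring (smash W act)"
proof (rule ringI)
  have act0: "act w 0 = 0" if "w \<in> W" for w using add[OF that, of 0 0] by simp
  have act_sum: "act w (\<Sum>i\<in>A. h i) = (\<Sum>i\<in>A. act w (h i))" if "w \<in> W" for w h and A :: "'n mtx set"
    by (induction A rule: infinite_finite_induct) (auto simp: act0 add that)
  show "abelian_group (smash W act)"
  proof (rule abelian_groupI)
    fix x assume "x \<in> carrier (smash W act)"
    then show "\<exists>y\<in>carrier (smash W act). y \<oplus>\<^bsub>smash W act\<^esub> x = \<zero>\<^bsub>smash W act\<^esub>"
      by (intro bexI[of _ "\<lambda>w. - x w"]) (auto simp: smash_def)
  qed (auto simp: smash_def fun_eq_iff add_ac)
  show "Group.monoid (smash W act)"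
  proof (rule monoidI)
    fix f g h assume "f \<in> carrier (smash W act)" "g \<in> carrier (smash W act)" "h \<in> carrier (smash W act)"
    show "f \<otimes>\<^bsub>smash W act\<^esub> g \<otimes>\<^bsub>smash W act\<^esub> h = f \<otimes>\<^bsub>smash W act\<^esub> (g \<otimes>\<^bsub>smash W act\<^esub> h)"
    proof
      fix w
      show "(f \<otimes>\<^bsub>smash W act\<^esub> g \<otimes>\<^bsub>smash W act\<^esub> h) w = (f \<otimes>\<^bsub>smash W act\<^esub> (g \<otimes>\<^bsub>smash W act\<^esub> h)) w"
      proof (cases "w \<in> W")
        case w: True
        have "(f \<otimes>\<^bsub>smash W act\<^esub> g \<otimes>\<^bsub>smash W act\<^esub> h) w =
            (\<Sum>u\<in>W. \<Sum>a\<in>W. f a * act a (g (transpose a ** u)) * act u (h (transpose u ** w)))"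
          using w by (simp add: smash_mult sum_distrib_right)
        also have "\<dots> = (\<Sum>a\<in>W. \<Sum>u\<in>W. f a * act a (g (transpose a ** u)) * act u (h (transpose u ** w)))"
          by (rule sum.swap)
        also have "\<dots> = (\<Sum>a\<in>W. \<Sum>v\<in>W. f a * act a (g v) * act a (act v (h (transpose v ** (transpose a ** w)))))"
        proof (rule sum.cong[OF refl])
          fix a assume a: "a \<in> W"
          have "(\<Sum>u\<in>W. f a * act a (g (transpose a ** u)) * act u (h (transpose u ** w))) =
              (\<Sum>v\<in>W. f a * act a (g (transpose a ** (a ** v))) * act (a ** v) (h (transpose (a ** v) ** w)))"
            by (rule sum_translate[OF a, symmetric])
          also have "\<dots> = (\<Sum>v\<in>W. f a * act a (g v) * act a (act v (h (transpose v ** (transpose a ** w)))))"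
            using a by (intro sum.cong refl) (simp add: W_cancel comp matrix_transpose_mul flip: matrix_mul_assoc)
          finally show "(\<Sum>u\<in>W. f a * act a (g (transpose a ** u)) * act u (h (transpose u ** w))) =
            (\<Sum>v\<in>W. f a * act a (g v) * act a (act v (h (transpose v ** (transpose a ** w)))))" .
        qed
        also have "\<dots> = (f \<otimes>\<^bsub>smash W act\<^esub> (g \<otimes>\<^bsub>smash W act\<^esub> h)) w"
          using w by (simp add: smash_mult act_sum mult sum_distrib_left mult.assoc Wm Wt cong: sum.cong)
        finally show ?thesis .
      qed (simp add: smash_mult)
    qed
  next
    fix f assume f: "f \<in> carrier (smash W act)"
    have one': "\<one>\<^bsub>smash W act\<^esub> = (\<lambda>w. if w = mat 1 then 1 else 0)" by (simp add: smash_def)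
    show "\<one>\<^bsub>smash W act\<^esub> \<otimes>\<^bsub>smash W act\<^esub> f = f"
    proof
      fix w
      have "(\<Sum>u\<in>W. (if u = mat 1 then 1 else 0) * act u (f (transpose u ** w))) =
          (\<Sum>u\<in>W. if u = mat 1 then f w else 0)"
        by (intro sum.cong) (auto simp: id transpose_mat)
      then show "(\<one>\<^bsub>smash W act\<^esub> \<otimes>\<^bsub>smash W act\<^esub> f) w = f w"
        using f W1 finW by (simp add: smash_mult smash_carrier one')
    qed
    show "f \<otimes>\<^bsub>smash W act\<^esub> \<one>\<^bsub>smash W act\<^esub> = f"
    proof
      fix w
      show "(f \<otimes>\<^bsub>smash W act\<^esub> \<one>\<^bsub>smash W act\<^esub>) w = f w"
      proof (cases "w \<in> W")
        case w: True
        have "transpose u ** w = mat 1 \<longleftrightarrow> u = w" if "u \<in> W" for u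
          using W_cancel(2)[OF that, of w] Wo'[OF w] by (metis matrix_mul_rid)
        then have "(\<Sum>u\<in>W. f u * act u (if transpose u ** w = mat 1 then 1 else 0)) =
            (\<Sum>u\<in>W. if u = w then f u else 0)"
          by (intro sum.cong) (auto simp: one act0)
        then show ?thesis using w finW by (simp add: smash_mult one')
      qed (use f in \<open>simp add: smash_mult smash_carrier\<close>)
    qed
  qed (use W1 in \<open>auto simp: smash_carrier smash_mult\<close>, auto simp: smash_def)
qed (auto simp: fun_eq_iff smash_mult smash_add add distrib_left distrib_right sum.distrib)

end

text \<open>\<open>btP\<close> rewrites the structure constants of \<open>H\<close> in terms of
  \<open>s\<close> alone; the factor 1/2 reflects that a root pairs with its coroot to 2.\<close>

locale cherednik_rep = refl_rep +
  fixes P :: "'a cherednik_data"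
  assumes grpP: "refl_grp P = W" and RfP: "reflections W = Rf" and parP: "param P = c"
    and btP: "s \<in> Rf \<Longrightarrow> pairing y (alpha P s) * pairing (alpha_vee P s) x /
      pairing (alpha_vee P s) (alpha P s) = bt s y x / 2"
begin

abbreviation TS where "TS \<equiv> smash W tens_act"
abbreviation H where "H \<equiv> cherednik P"
abbreviation I0 where "I0 \<equiv> Idl\<^bsub>TS\<^esub> (cherednik_relators P)"
abbreviation cl where "cl \<equiv> ch_class P"

lemma TS_ring: "ring TS"
  by (rule smash_ring) (auto simp: clin_add[OF clin_tens_act] tens_act_mult tens_act_comp tens_act_id)

definition letter :: "'a + 'a \<Rightarrow> 'a pext \<Rightarrow> 'a pext" where
  "letter = case_sum (\<lambda>i. dunkl (axis i 1)) (\<lambda>i. xmul (axis i 1))"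

lemma clin_letter: "clin (letter l)"
  by (cases l) (auto simp: letter_def clin_dunkl clin_xmul)

abbreviation wd where "wd \<equiv> word_act letter"

lemma wd_y: "wd (tens_y y) f = dunkl y f"
  by (simp add: word_act_tens_y letter_def) (simp add: clin_vec_expand[OF clin_dunkl_left, of y])

lemma wd_x: "wd (tens_x x) f = xmul x f"
  by (simp add: word_act_tens_x letter_def) (simp add: clin_vec_expand[OF clin_xmul_left, of x])

lemma clin_wd: "clin (wd t)"
  by (rule clin_word_act[OF clin_letter])

lemma wd_mult: "wd (t * t') f = wd t (wd t' f)"
  by (rule word_act_mult[OF clin_letter])

lemma wact_wd: "w \<in> W \<Longrightarrow> wact w (wd t f) = wd (tens_act w t) (wact w f)"
proof (induction t arbitrary: f rule: tens_induct)
  case (scal c)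
  then show ?case by (simp add: word_act_scal clin_scale[OF clin_wact])
next
  case (var l t)
  then show ?case
    by (cases l) (simp_all add: single_letter wd_mult tens_act_mult tens_act_tens_y tens_act_tens_x wd_y wd_x
        wact_dunkl wact_xmul contragredient_W)
next
  case (add p q)
  then show ?case by (simp add: word_act_add clin_add[OF clin_wact] clin_add[OF clin_tens_act])
qed

definition sact :: "('a mtx \<Rightarrow> 'a tens) \<Rightarrow> 'a pext \<Rightarrow> 'a pext" where
  "sact F f = (\<Sum>w\<in>W. wd (F w) (wact w f))"

lemma clin_sact: "clin (sact F)"
  unfolding sact_def by (intro clin_sumf clin_compose[OF clin_wd clin_wact])

lemma sact_add: "sact (F \<oplus>\<^bsub>TS\<^esub> G) f = sact F f + sact G f"
  by (simp add: sact_def smash_add word_act_add sum.distrib)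

lemma sact_mult: "sact (F \<otimes>\<^bsub>TS\<^esub> G) f = sact F (sact G f)"
proof -
  have "sact (F \<otimes>\<^bsub>TS\<^esub> G) f = (\<Sum>w\<in>W. \<Sum>u\<in>W. wd (F u) (wd (tens_act u (G (transpose u ** w))) (wact w f)))"
    unfolding sact_def smash_mult by (simp add: word_act_sum wd_mult)
  also have "\<dots> = (\<Sum>u\<in>W. \<Sum>w\<in>W. wd (F u) (wd (tens_act u (G (transpose u ** w))) (wact w f)))"
    by (rule sum.swap)
  also have "\<dots> = (\<Sum>u\<in>W. \<Sum>v\<in>W. wd (F u) (wact u (wd (G v) (wact v f))))"
  proof (rule sum.cong[OF refl])
    fix u assume u: "u \<in> W"
    have "(\<Sum>w\<in>W. wd (F u) (wd (tens_act u (G (transpose u ** w))) (wact w f))) =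
        (\<Sum>v\<in>W. wd (F u) (wd (tens_act u (G (transpose u ** (u ** v)))) (wact (u ** v) f)))"
      by (rule sum_translate[OF u, symmetric])
    also have "\<dots> = (\<Sum>v\<in>W. wd (F u) (wact u (wd (G v) (wact v f))))"
      by (simp add: W_cancel[OF u] wact_wd[OF u] wact_mult)
    finally show "(\<Sum>w\<in>W. wd (F u) (wd (tens_act u (G (transpose u ** w))) (wact w f))) =
      (\<Sum>v\<in>W. wd (F u) (wact u (wd (G v) (wact v f))))" .
  qed
  also have "\<dots> = sact F (sact G f)"
    by (simp add: sact_def clin_sum[OF clin_wd] clin_sum[OF clin_wact])
  finally show ?thesis .
qed

lemma sact_single:
  assumes "w \<in> W"
  shows "sact (\<lambda>u. if u = w then t else 0) f = wd t (wact w f)"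
proof -
  have "sact (\<lambda>u. if u = w then t else 0) f = (\<Sum>u\<in>W. if u = w then wd t (wact u f) else 0)"
    unfolding sact_def by (intro sum.cong) auto
  then show ?thesis using assms finW by simp
qed

lemma sact_at_one: "sact (at_one t) f = wd t f"
  unfolding at_one_def by (simp add: sact_single[OF W1] wact_one)

lemma sact_grp: "w \<in> W \<Longrightarrow> sact (\<lambda>u. if u = w then 1 else 0) f = wact w f"
  by (simp add: sact_single word_act_one)

lemma at_one_carrier: "at_one t \<in> carrier TS"
  using W1 by (auto simp: smash_carrier at_one_def)

lemma single_carrier: "w \<in> W \<Longrightarrow> (\<lambda>u. if u = w then t else 0) \<in> carrier TS"
  by (auto simp: smash_carrier)

definition refl_sum :: "('a mtx \<Rightarrow> complex) \<Rightarrow> 'a mtx \<Rightarrow> 'a tens" where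
  "refl_sum z = (\<lambda>w. if w \<in> Rf then scal (z w) else 0)"

lemma refl_sum_carrier: "refl_sum z \<in> carrier TS"
  using RfW by (auto simp: smash_carrier refl_sum_def)

lemma sact_refl_sum: "sact (refl_sum z) f = (\<Sum>s\<in>Rf. z s *\<^sub>C wact s f)"
proof -
  have "sact (refl_sum z) f = (\<Sum>s\<in>W. if s \<in> Rf then z s *\<^sub>C wact s f else 0)"
    unfolding sact_def refl_sum_def by (intro sum.cong) (auto simp: word_act_scal)
  also have "\<dots> = (\<Sum>s\<in>W \<inter> Rf. z s *\<^sub>C wact s f)" using finW by (simp add: sum.inter_restrict)
  also have "W \<inter> Rf = Rf" using RfW by auto
  finally show ?thesis .
qed

lemma relators_eq: "cherednik_relators P =
   {at_one (tens_x x * tens_x x' - tens_x x' * tens_x x) | x x'. True} \<union>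
   {at_one (tens_y y * tens_y y' - tens_y y' * tens_y y) | y y'. True} \<union>
   {at_one (tens_y y * tens_x x - tens_x x * tens_y y - scal (pairing y x))
      \<oplus>\<^bsub>TS\<^esub> refl_sum (\<lambda>s. c s * (bt s y x / 2)) | y x. True}"
proof -
  have "(\<lambda>w. at_one (tens_y y * tens_x x - tens_x x * tens_y y - scal (pairing y x)) w +
           (if w \<in> reflections (refl_grp P)
            then scal (param P w * (pairing y (alpha P w) * pairing (alpha_vee P w) x /
                                    pairing (alpha_vee P w) (alpha P w)))
            else 0)) =
    at_one (tens_y y * tens_x x - tens_x x * tens_y y - scal (pairing y x))
      \<oplus>\<^bsub>TS\<^esub> refl_sum (\<lambda>s. c s * (bt s y x / 2))" for y x
    by (rule ext) (auto simp: smash_add refl_sum_def grpP RfP parP btP)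
  then show ?thesis unfolding cherednik_relators_def by (simp only:)
qed

lemma TS_add_closed: "F \<in> carrier TS \<Longrightarrow> G \<in> carrier TS \<Longrightarrow> F \<oplus>\<^bsub>TS\<^esub> G \<in> carrier TS"
  using ring.ring_simprules(1)[OF TS_ring] .

lemma relators_carrier: "cherednik_relators P \<subseteq> carrier TS"
  unfolding relators_eq by (auto intro!: at_one_carrier TS_add_closed refl_sum_carrier)

text \<open>The annihilator of the polynomial representation. Being an ideal that contains the
  relators, it contains the ideal they generate, which lets the action pass to
  \<open>H\<close>.\<close>

definition Ann :: "('a mtx \<Rightarrow> 'a tens) set" where
  "Ann = {F \<in> carrier TS. \<forall>f. sact F f = 0}"

lemma relators_Ann: "cherednik_relators P \<subseteq> Ann"
  unfolding relators_eq Ann_def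
  by (auto simp: at_one_carrier TS_add_closed refl_sum_carrier sact_at_one sact_add sact_refl_sum
      word_act_diff wd_mult wd_x wd_y xmul_commute[of _ _] dunkl_commute[of _ _] dunkl_xmul word_act_scal
      cscale_sum_right)

lemma ideal_Ann: "ideal Ann TS"
proof (rule idealI[OF TS_ring])
  interpret ring TS by (rule TS_ring)
  have z: "sact \<zero>\<^bsub>TS\<^esub> f = 0" for f using sact_add[of "\<zero>\<^bsub>TS\<^esub>" "\<zero>\<^bsub>TS\<^esub>" f] by simp
  show "subgroup Ann (add_monoid TS)"
  proof (rule add.subgroupI)
    show "Ann \<subseteq> carrier TS" by (auto simp: Ann_def)
    show "Ann \<noteq> {}" using z by (auto simp: Ann_def intro!: exI[of _ "\<zero>\<^bsub>TS\<^esub>"])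
    fix F G assume F: "F \<in> Ann" and G: "G \<in> Ann"
    show "F \<oplus>\<^bsub>TS\<^esub> G \<in> Ann" using F G by (auto simp: Ann_def sact_add)
    have "sact (\<ominus>\<^bsub>TS\<^esub> F) f = 0" for f
      using sact_add[of "\<ominus>\<^bsub>TS\<^esub> F" F f] F by (simp add: Ann_def l_neg z)
    then show "\<ominus>\<^bsub>TS\<^esub> F \<in> Ann" using F by (auto simp: Ann_def)
  qed
qed (auto simp: Ann_def sact_mult ring.ring_simprules(5)[OF TS_ring] clin_zero[OF clin_sact])

lemma ideal_I0: "ideal I0 TS"
  by (rule ring.genideal_ideal[OF TS_ring relators_carrier])

lemma I0_Ann: "I0 \<subseteq> Ann"
  by (rule ring.genideal_minimal[OF TS_ring ideal_Ann relators_Ann])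

section \<open>The Cherednik algebra and its polynomial representation\<close>

lemma H_eq: "H = TS Quot I0" by (simp add: cherednik_def grpP)
lemma cl_eq: "cl F = I0 +>\<^bsub>TS\<^esub> F" by (simp add: ch_class_def grpP)

lemma H_ring: "ring H"
  unfolding H_eq by (rule ideal.quotient_is_ring[OF ideal_I0])

lemma carrier_H: "carrier H = cl ` carrier TS"
  unfolding H_eq by (auto simp: FactRing_def A_RCOSETS_def' cl_eq)

lemma cl_closed [simp]: "F \<in> carrier TS \<Longrightarrow> cl F \<in> carrier H"
  by (simp add: carrier_H)

lemma cl_add: "F \<in> carrier TS \<Longrightarrow> G \<in> carrier TS \<Longrightarrow> cl (F \<oplus>\<^bsub>TS\<^esub> G) = cl F \<oplus>\<^bsub>H\<^esub> cl G"
  using ring_hom_add[OF ideal.rcos_ring_hom[OF ideal_I0]] by (simp add: H_eq cl_eq)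

lemma cl_mult: "F \<in> carrier TS \<Longrightarrow> G \<in> carrier TS \<Longrightarrow> cl (F \<otimes>\<^bsub>TS\<^esub> G) = cl F \<otimes>\<^bsub>H\<^esub> cl G"
  using ring_hom_mult[OF ideal.rcos_ring_hom[OF ideal_I0]] by (simp add: H_eq cl_eq)

lemma cl_one: "\<one>\<^bsub>H\<^esub> = cl (at_one 1)"
proof -
  have "at_one 1 = \<one>\<^bsub>TS\<^esub>" by (simp add: at_one_def smash_def)
  then show ?thesis using ring_hom_one[OF ideal.rcos_ring_hom[OF ideal_I0]] by (simp add: H_eq cl_eq)
qed

lemma mem_cl: "F \<in> carrier TS \<Longrightarrow> F \<in> cl F"
proof -
  assume F: "F \<in> carrier TS"
  interpret ideal I0 TS by (rule ideal_I0)
  show ?thesis unfolding cl_eq by (rule a_rcos_self[OF F])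
qed

text \<open>An arbitrary representative of the class acts; by \<open>I0_Ann\<close> all of them act
  alike.\<close>

definition rho :: "'a ch \<Rightarrow> 'a pext \<Rightarrow> 'a pext" where
  "rho X f = sact (SOME F. F \<in> X) f"

lemma rho_cl: "F \<in> carrier TS \<Longrightarrow> rho (cl F) f = sact F f"
proof -
  assume F: "F \<in> carrier TS"
  have "sact G f = sact F f" if "G \<in> cl F" for G
  proof -
    from that obtain i where "i \<in> I0" "G = i \<oplus>\<^bsub>TS\<^esub> F" unfolding cl_eq by (auto simp: a_r_coset_def')
    then show ?thesis using I0_Ann by (auto simp: sact_add Ann_def)
  qed
  then show ?thesis unfolding rho_def using someI[of "\<lambda>G. G \<in> cl F", OF mem_cl[OF F]] by blast
qed

lemma rho_add: "a \<in> carrier H \<Longrightarrow> b \<in> carrier H \<Longrightarrow> rho (a \<oplus>\<^bsub>H\<^esub> b) f = rho a f + rho b f"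
  by (auto simp: carrier_H rho_cl sact_add TS_add_closed simp flip: cl_add)

lemma rho_mult: "a \<in> carrier H \<Longrightarrow> b \<in> carrier H \<Longrightarrow> rho (a \<otimes>\<^bsub>H\<^esub> b) f = rho a (rho b f)"
  by (auto simp: carrier_H rho_cl sact_mult ring.ring_simprules(5)[OF TS_ring] simp flip: cl_mult)

lemma rho_one: "rho \<one>\<^bsub>H\<^esub> f = f"
  by (simp add: cl_one rho_cl at_one_carrier sact_at_one word_act_one)

lemma clin_rho: "a \<in> carrier H \<Longrightarrow> clin (rho a)"
proof -
  assume "a \<in> carrier H"
  then obtain F where F: "F \<in> carrier TS" "a = cl F" by (auto simp: carrier_H)
  then have "rho a = sact F" by (simp add: fun_eq_iff rho_cl)
  then show ?thesis by (simp add: clin_sact)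
qed

lemma Ej_wd: "f \<in> Ej k \<Longrightarrow> wd t f \<in> Ej k"
proof (induction t arbitrary: f rule: tens_induct)
  case (scal c)
  then show ?case by (simp add: word_act_scal Ej_scale)
next
  case (var l t)
  then show ?case
    by (cases l) (simp_all add: single_letter wd_mult wd_y wd_x Ej_dunkl Ej_xmul)
next
  case (add p q)
  then show ?case by (simp add: word_act_add Ej_add)
qed

lemma Ej_rho: "a \<in> carrier H \<Longrightarrow> f \<in> Ej k \<Longrightarrow> rho a f \<in> Ej k"
  by (auto simp: carrier_H rho_cl sact_def intro!: Ej_sum Ej_wd Ej_wact)

lemma ch_closed: "ch_x P v \<in> carrier H" "ch_y P v \<in> carrier H" "ch_scal P z \<in> carrier H"
    "w \<in> W \<Longrightarrow> ch_grp P w \<in> carrier H"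
  by (simp_all add: ch_x_def ch_y_def ch_scal_def ch_grp_def at_one_carrier single_carrier)

lemma rho_ch: "rho (ch_x P v) f = xmul v f" "rho (ch_y P v) f = dunkl v f" "rho (ch_scal P z) f = z *\<^sub>C f"
    "w \<in> W \<Longrightarrow> rho (ch_grp P w) f = wact w f"
  by (simp_all add: ch_x_def ch_y_def ch_scal_def ch_grp_def at_one_carrier single_carrier rho_cl sact_at_one
      wd_x wd_y word_act_scal sact_grp)

end

section \<open>Standard modules\<close>

lemma abelian_group_ext_power: "abelian_group (ext_power k :: (complex, 'n::finite ext) module)"
proof (rule abelian_groupI)
  fix v :: "'n ext" assume v: "v \<in> carrier (ext_power k)"
  then show "\<exists>y\<in>carrier (ext_power k). y \<oplus>\<^bsub>ext_power k\<^esub> v = \<zero>\<^bsub>ext_power k\<^esub>"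
    by (intro bexI[of _ "- v"]) (auto simp: ext_power_def)
qed (auto simp: ext_power_def add_ac, metis add.right_neutral)

lemma ext_power_simps:
  "v \<oplus>\<^bsub>ext_power k\<^esub> w = v + w" "\<zero>\<^bsub>ext_power k\<^esub> = 0" "z \<odot>\<^bsub>ext_power k\<^esub> v = z *\<^sub>C v"
  by (simp_all add: ext_power_def cscale_vec_eq)

lemma finsum_ext_power:
  assumes "finite A" "\<And>i. i \<in> A \<Longrightarrow> f i \<in> extgr k"
  shows "finsum (ext_power k) f A = (\<Sum>i\<in>A. f i)"
proof -
  interpret abelian_group "ext_power k :: (complex, 'b ext) module" by (rule abelian_group_ext_power)
  show ?thesis using assms
    by (induction A) (auto simp: ext_power_simps finsum_insert extgr_carrier Pi_def)
qed

lemma frag_of_int_expand: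
  fixes g :: "'b \<Rightarrow> 'c::cvec"
  assumes "finite A" "Poly_Mapping.keys q \<subseteq> A"
  shows "(\<Sum>p\<in>Poly_Mapping.keys q. of_int (Poly_Mapping.lookup q p) *\<^sub>C g p) =
    (\<Sum>p\<in>A. of_int (Poly_Mapping.lookup q p) *\<^sub>C g p)"
  using assms by (intro sum.mono_neutral_left) (auto simp: in_keys_iff)

text \<open>A further factor \<open>X j\<close> is absorbed at its own place in a fixed ordering.
  This lets ordered products of commuting elements of \<open>H\<close> behave like
  monomials.\<close>

lemma foldr_commuting_insert:
  fixes X :: "'i \<Rightarrow> 'x \<Rightarrow> 'x" and m m' :: "'i \<Rightarrow> nat"
  assumes closed: "\<And>i z. z \<in> C \<Longrightarrow> X i z \<in> C" and comm: "\<And>i j z. z \<in> C \<Longrightarrow> X i (X j z) = X j (X i z)"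
    and z: "z \<in> C" and "distinct l" "j \<in> set l"
    and m: "m' j = Suc (m j)" "\<And>i. i \<noteq> j \<Longrightarrow> m' i = m i"
  shows "X j (foldr (\<lambda>i. X i ^^ m i) l z) = foldr (\<lambda>i. X i ^^ m' i) l z"
  using assms(4,5)
proof (induction l)
  case (Cons i l)
  have pc: "(X i ^^ n) z \<in> C" if "z \<in> C" for z n i using that by (induction n) (auto intro: closed)
  have fc: "foldr (\<lambda>i. X i ^^ m i) l z \<in> C" for l using z pc by (induction l) auto
  have pcomm: "X j ((X i ^^ n) z) = (X i ^^ n) (X j z)" if "z \<in> C" for z n
    using that pc by (induction n) (auto simp: comm)
  show ?case
  proof (cases "i = j")
    case True
    have "foldr (\<lambda>i. X i ^^ m i) l z = foldr (\<lambda>i. X i ^^ m' i) l z"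
    proof (intro foldr_cong refl)
      fix a x assume "x \<in> set l"
      then have "x \<noteq> j" using Cons.prems True by auto
      then show "(X x ^^ m x) a = (X x ^^ m' x) a" by (simp add: m(2))
    qed
    then show ?thesis using True m(1) by simp
  next
    case False
    then have "X j (foldr (\<lambda>i. X i ^^ m i) l z) = foldr (\<lambda>i. X i ^^ m' i) l z"
      using Cons by auto
    then show ?thesis using False m(2)[of i] pcomm[OF fc] by simp
  qed
qed simp

context cherednik_rep
begin

lemma Ej_induct [consumes 1, case_names emb xmul add]:
  assumes f: "f \<in> Ej k" and emb: "\<And>v. v \<in> extgr k \<Longrightarrow> Q (emb v)"
    and x: "\<And>i f. f \<in> Ej k \<Longrightarrow> Q f \<Longrightarrow> Q (xmul (axis i 1) f)"
    and add: "\<And>f g. f \<in> Ej k \<Longrightarrow> g \<in> Ej k \<Longrightarrow> Q f \<Longrightarrow> Q g \<Longrightarrow> Q (f + g)"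
  shows "Q f"
proof -
  define r where "r f = (\<lambda>J. if card J = k then f J else 0)" for f :: "'a pext"
  have rE: "r f \<in> Ej k" for f by (simp add: Ej_def r_def)
  have "Q (r f)" for f
  proof (induction f rule: pext_induct)
    case (emb v)
    have "r (emb v) = emb (\<chi> J. if card J = k then v $ J else 0)"
      by (auto simp: r_def fun_eq_iff emb_def)
    moreover have "(\<chi> J. if card J = k then v $ J else 0) \<in> extgr k" by (simp add: extgr_def)
    ultimately show ?case using assms(2) by metis
  next
    case (xmul i f)
    have "r (xmul (axis i 1) f) = xmul (axis i 1) (r f)" by (auto simp: r_def fun_eq_iff xmul_def)
    then show ?case using x[OF rE xmul] by simp
  next
    case (add f g)
    have "r (f + g) = r f + r g" by (auto simp: r_def fun_eq_iff fun_apply)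
    then show ?case using assms(4)[OF rE rE add] by simp
  qed
  moreover have "r f = f" using f by (auto simp: r_def Ej_def fun_eq_iff)
  ultimately show ?thesis by metis
qed

definition infl :: "nat \<Rightarrow> ('a mtx \<Rightarrow> 'a sym, 'a ext) module" where
  "infl k = inflate P (ext_power k) (\<lambda>w. ext_act (contragredient w))"

abbreviation SS where "SS \<equiv> smash W sym_act"

lemma infl_simps: "carrier (infl k) = extgr k" "v \<oplus>\<^bsub>infl k\<^esub> w = v + w"
  by (simp_all add: infl_def inflate_def extgr_carrier ext_power_simps)

lemma infl_smult:
  assumes v: "v \<in> extgr k"
  shows "F \<odot>\<^bsub>infl k\<^esub> v = (\<Sum>w\<in>W. Poly_Mapping.lookup (F w) 0 *\<^sub>C ext_act w v)"
proof -
  have "F \<odot>\<^bsub>infl k\<^esub> v = finsum (ext_power k) (\<lambda>w. Poly_Mapping.lookup (F w) 0 *\<^sub>C ext_act (contragredient w) v) W"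
    by (simp add: infl_def inflate_def grpP ext_power_simps)
  also have "\<dots> = (\<Sum>w\<in>W. Poly_Mapping.lookup (F w) 0 *\<^sub>C ext_act (contragredient w) v)"
    using finW v by (intro finsum_ext_power extgr_scale ext_act_extgr)
  finally show ?thesis by (simp add: contragredient_W)
qed

lemma infl_smult_closed: "v \<in> extgr k \<Longrightarrow> F \<odot>\<^bsub>infl k\<^esub> v \<in> extgr k"
  by (simp add: infl_smult extgr_sum extgr_scale ext_act_extgr)

definition ssc :: "('a mtx \<Rightarrow> 'a sym) \<Rightarrow> 'a mtx \<Rightarrow> 'a tens" where
  "ssc F = (\<lambda>w. sym_to_tens (F w))"

lemma ssc_carrier: "F \<in> carrier SS \<Longrightarrow> ssc F \<in> carrier TS"
  by (simp add: smash_carrier ssc_def sym_to_tens_def)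

lemma ssc_closed: "F \<in> carrier SS \<Longrightarrow> sym_smash_to_ch P F \<in> carrier H"
  unfolding sym_smash_to_ch_def using ssc_carrier[of F] by (simp add: ssc_def)

text \<open>Constants are singular vectors: Dunkl operators kill them, so a polynomial in the
  \<open>y_i\<close> acts through its constant coefficient, as \<open>inflate\<close>
  prescribes.\<close>

lemma rho_ssc:
  assumes F: "F \<in> carrier SS" and v: "v \<in> extgr k"
  shows "rho (sym_smash_to_ch P F) (emb v) = emb (F \<odot>\<^bsub>infl k\<^esub> v)"
proof -
  have pw: "wd (tens_y y ^ n) (emb v) = (if n = 0 then emb v else 0)" for y n v
    by (cases n) (simp_all add: word_act_one power_Suc2 wd_mult wd_y clin_zero[OF clin_wd] del: power_Suc)
  have pl: "wd (prod_list (map (\<lambda>i. tens_y (axis i 1) ^ Poly_Mapping.lookup m i) l)) (emb v) =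
      (if \<forall>i\<in>set l. Poly_Mapping.lookup m i = 0 then emb v else 0)" for m l v
    by (induction l) (auto simp: word_act_one wd_mult pw clin_zero[OF clin_wd])
  have "wd (sym_to_tens f) (emb v) = Poly_Mapping.lookup f 0 *\<^sub>C emb v" for f v
  proof -
    have "wd (sym_to_tens f) (emb v) = (\<Sum>m\<in>Poly_Mapping.keys f. Poly_Mapping.lookup f m *\<^sub>C
        (if \<forall>i. Poly_Mapping.lookup m i = 0 then emb v else 0))"
      by (simp add: sym_to_tens_def word_act_sum wd_mult pl word_act_scal)
    also have "\<dots> = (\<Sum>m\<in>Poly_Mapping.keys f. if m = 0 then Poly_Mapping.lookup f m *\<^sub>C emb v else 0)"
      by (intro sum.cong) (auto simp: poly_mapping_eq_iff fun_eq_iff)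
    finally show ?thesis by (auto simp: in_keys_iff)
  qed
  then have "sact (ssc F) (emb v) = (\<Sum>w\<in>W. Poly_Mapping.lookup (F w) 0 *\<^sub>C emb (ext_act w v))"
    by (simp add: sact_def ssc_def wact_emb)
  also have "\<dots> = emb (F \<odot>\<^bsub>infl k\<^esub> v)"
    by (simp add: infl_smult[OF v] clin_sum[OF clin_emb] clin_scale[OF clin_emb])
  finally show ?thesis
    using rho_cl[OF ssc_carrier[OF F]] by (simp add: sym_smash_to_ch_def ssc_def)
qed

section \<open>The standard module as a quotient of a free abelian group\<close>

definition FF :: "nat \<Rightarrow> (('a ch \<times> 'a ext) \<Rightarrow>\<^sub>0 int) monoid" where
  "FF k = free_Abelian_group (carrier H \<times> extgr k)"

definition rels :: "nat \<Rightarrow> (('a ch \<times> 'a ext) \<Rightarrow>\<^sub>0 int) set" where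
  "rels k = tensor_relators SS H (\<lambda>a F. a \<otimes>\<^bsub>H\<^esub> sym_smash_to_ch P F) (infl k)"

definition NN :: "nat \<Rightarrow> (('a ch \<times> 'a ext) \<Rightarrow>\<^sub>0 int) set" where
  "NN k = generate (FF k) (rels k)"

lemma FF_simps [simp]: "q \<in> carrier (FF k) \<longleftrightarrow> Poly_Mapping.keys q \<subseteq> carrier H \<times> extgr k"
  "\<one>\<^bsub>FF k\<^esub> = 0" "q \<otimes>\<^bsub>FF k\<^esub> q' = q + q'"
  by (simp_all add: FF_def)

lemma FF_inv: "q \<in> carrier (FF k) \<Longrightarrow> inv\<^bsub>FF k\<^esub> q = - q"
  by (simp add: FF_def)

lemma FF_comm_group: "comm_group (FF k)"
  unfolding FF_def by (rule abelian_free_Abelian_group)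

lemma FF_group: "group (FF k)"
  using FF_comm_group by (rule comm_group.axioms(2))

lemma FF_frag: "a \<in> carrier H \<Longrightarrow> v \<in> extgr k \<Longrightarrow> frag_of (a, v) \<in> carrier (FF k)"
  by (simp add: keys_frag_of)

lemma FF_diff: "q \<in> carrier (FF k) \<Longrightarrow> q' \<in> carrier (FF k) \<Longrightarrow> q - q' \<in> carrier (FF k)"
  using keys_diff[of q q'] by auto

lemma FF_add: "q \<in> carrier (FF k) \<Longrightarrow> q' \<in> carrier (FF k) \<Longrightarrow> q + q' \<in> carrier (FF k)"
  using keys_add[of q q'] by auto

lemma rels_cases:
  assumes "q \<in> rels k"
  obtains a a' b where "a \<in> carrier H" "a' \<in> carrier H" "b \<in> extgr k"
      "q = frag_of (a \<oplus>\<^bsub>H\<^esub> a', b) - frag_of (a, b) - frag_of (a', b)"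
  | a b b' where "a \<in> carrier H" "b \<in> extgr k" "b' \<in> extgr k"
      "q = frag_of (a, b + b') - frag_of (a, b) - frag_of (a, b')"
  | a F b where "a \<in> carrier H" "F \<in> carrier SS" "b \<in> extgr k"
      "q = frag_of (a \<otimes>\<^bsub>H\<^esub> sym_smash_to_ch P F, b) - frag_of (a, F \<odot>\<^bsub>infl k\<^esub> b)"
  using assms unfolding rels_def tensor_relators_def infl_simps by blast

lemma rels_FF: "rels k \<subseteq> carrier (FF k)"
proof
  interpret H: ring H by (rule H_ring)
  fix q assume "q \<in> rels k"
  then show "q \<in> carrier (FF k)"
    by (cases rule: rels_cases) (simp_all only:, (intro FF_diff FF_frag; simp add: extgr_add infl_smult_closed ssc_closed)+)
qed

lemma subgroup_NN: "subgroup (NN k) (FF k)"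
  unfolding NN_def by (rule group.generate_is_subgroup[OF FF_group rels_FF])

lemma NN_FF: "q \<in> NN k \<Longrightarrow> q \<in> carrier (FF k)"
  using subgroup.subset[OF subgroup_NN] by blast

lemma NN_zero: "0 \<in> NN k"
  using subgroup.one_closed[OF subgroup_NN, of k] by simp

lemma NN_add: "q \<in> NN k \<Longrightarrow> q' \<in> NN k \<Longrightarrow> q + q' \<in> NN k"
  using subgroup.m_closed[OF subgroup_NN, of q k q'] by simp

lemma NN_minus: "q \<in> NN k \<Longrightarrow> - q \<in> NN k"
  using subgroup.m_inv_closed[OF subgroup_NN, of q k] FF_inv[OF NN_FF, of q k] by simp

lemma NN_rels: "q \<in> rels k \<Longrightarrow> q \<in> NN k"
  unfolding NN_def by (rule generate.incl)

lemma NN_rel1: "a \<in> carrier H \<Longrightarrow> a' \<in> carrier H \<Longrightarrow> b \<in> extgr k \<Longrightarrow>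
    frag_of (a \<oplus>\<^bsub>H\<^esub> a', b) - frag_of (a, b) - frag_of (a', b) \<in> NN k"
  and NN_rel2: "a \<in> carrier H \<Longrightarrow> b \<in> extgr k \<Longrightarrow> b' \<in> extgr k \<Longrightarrow>
    frag_of (a, b + b') - frag_of (a, b) - frag_of (a, b') \<in> NN k"
  and NN_rel3: "a \<in> carrier H \<Longrightarrow> F \<in> carrier SS \<Longrightarrow> b \<in> extgr k \<Longrightarrow>
    frag_of (a \<otimes>\<^bsub>H\<^esub> sym_smash_to_ch P F, b) - frag_of (a, F \<odot>\<^bsub>infl k\<^esub> b) \<in> NN k"
  by (rule NN_rels, unfold rels_def tensor_relators_def infl_simps, blast)+

lemma NN_induct [consumes 1, case_names zero rel minus add]:
  assumes "q \<in> NN k" and "Q 0" and "\<And>q. q \<in> rels k \<Longrightarrow> Q q"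
    and "\<And>q. q \<in> NN k \<Longrightarrow> Q q \<Longrightarrow> Q (- q)" and "\<And>q q'. q \<in> NN k \<Longrightarrow> q' \<in> NN k \<Longrightarrow> Q q \<Longrightarrow> Q q' \<Longrightarrow> Q (q + q')"
  shows "Q q"
  using assms(1) unfolding NN_def
proof (induction rule: generate.induct)
  case one
  then show ?case using assms(2) by simp
next
  case (incl h)
  then show ?case by (rule assms(3))
next
  case (inv h)
  then have "Q (- h)" using assms(3,4) NN_rels by blast
  then show ?case using rels_FF[of k] FF_inv[of h k] inv by auto
next
  case (eng h1 h2)
  then show ?case using assms(5) unfolding NN_def by simp
qed

text \<open>The map that sends \<open>a \<otimes> v\<close> to \<open>a\<close> applied to the
  constant \<open>v\<close>, before passage to the quotient. It turns out to have kernel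
  \<open>NN k\<close> and image \<open>Ej k\<close>.\<close>

definition theta :: "(('a ch \<times> 'a ext) \<Rightarrow>\<^sub>0 int) \<Rightarrow> 'a pext" where
  "theta q = (\<Sum>p\<in>Poly_Mapping.keys q. of_int (Poly_Mapping.lookup q p) *\<^sub>C rho (fst p) (emb (snd p)))"

lemma theta_frag [simp]: "theta (frag_of (a, v)) = rho a (emb v)"
  by (simp add: theta_def keys_frag_of)

lemma theta_add: "theta (q + q') = theta q + theta q'"
proof -
  let ?A = "Poly_Mapping.keys q \<union> Poly_Mapping.keys q'"
  have "Poly_Mapping.keys (q + q') \<subseteq> ?A" by (rule keys_add)
  then show ?thesis unfolding theta_def
    by (subst (1 2 3) frag_of_int_expand[of ?A]) (auto simp: lookup_add cscale_add_left sum.distrib)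
qed

lemma theta_zero [simp]: "theta 0 = 0"
  by (simp add: theta_def)

lemma theta_minus: "theta (- q) = - theta q"
  using theta_add[of q "- q"] by (simp add: eq_neg_iff_add_eq_0 add.commute)

lemma theta_diff: "theta (q - q') = theta q - theta q'"
  using theta_add[of q "- q'"] by (simp add: theta_minus)

lemma theta_NN: "q \<in> NN k \<Longrightarrow> theta q = 0"
proof (induction rule: NN_induct)
  case (rel q)
  then show ?case
  proof (cases rule: rels_cases)
    case (1 a a' b)
    then show ?thesis by (simp add: theta_diff rho_add)
  next
    case (2 a b b')
    then show ?thesis by (simp add: theta_diff clin_add[OF clin_emb] clin_add[OF clin_rho])
  next
    case (3 a F b)
    then show ?thesis by (simp add: theta_diff rho_mult ssc_closed rho_ssc)
  qed
qed (simp_all add: theta_minus theta_add)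

definition mulL :: "'a ch \<Rightarrow> (('a ch \<times> 'a ext) \<Rightarrow>\<^sub>0 int) \<Rightarrow> ('a ch \<times> 'a ext) \<Rightarrow>\<^sub>0 int" where
  "mulL a = frag_extend (\<lambda>(b, v). frag_of (a \<otimes>\<^bsub>H\<^esub> b, v))"

lemma mulL_frag [simp]: "mulL a (frag_of (b, v)) = frag_of (a \<otimes>\<^bsub>H\<^esub> b, v)"
  by (simp add: mulL_def)

lemma mulL_add: "mulL a (q + q') = mulL a q + mulL a q'"
  by (simp add: mulL_def frag_extend_add)

lemma mulL_diff: "mulL a (q - q') = mulL a q - mulL a q'"
  by (simp add: mulL_def frag_extend_diff)

lemma mulL_zero [simp]: "mulL a 0 = 0"
  by (simp add: mulL_def)

lemma mulL_minus: "mulL a (- q) = - mulL a q"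
  using mulL_diff[of a 0 q] by simp

lemma mulL_sum: "mulL a (\<Sum>i\<in>A. f i) = (\<Sum>i\<in>A. mulL a (f i))"
  by (induction A rule: infinite_finite_induct) (auto simp: mulL_add)

lemma FF_induct [consumes 1, case_names zero frag diff]:
  assumes "q \<in> carrier (FF k)" "Q 0" "\<And>a v. a \<in> carrier H \<Longrightarrow> v \<in> extgr k \<Longrightarrow> Q (frag_of (a, v))"
    "\<And>q q'. q \<in> carrier (FF k) \<Longrightarrow> q' \<in> carrier (FF k) \<Longrightarrow> Q q \<Longrightarrow> Q q' \<Longrightarrow> Q (q - q')"
  shows "Q q"
proof -
  have "Poly_Mapping.keys q \<subseteq> carrier H \<times> extgr k" using assms(1) by simp
  then have "Q q \<and> q \<in> carrier (FF k)"
    by (induction rule: frag_induction) (use assms(2-4) FF_diff in \<open>auto simp: keys_frag_of simp del: FF_simps(1)\<close>, auto simp: keys_frag_of)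
  then show ?thesis ..
qed

lemma mulL_FF: "a \<in> carrier H \<Longrightarrow> q \<in> carrier (FF k) \<Longrightarrow> mulL a q \<in> carrier (FF k)"
proof -
  interpret H: ring H by (rule H_ring)
  assume a: "a \<in> carrier H" and "q \<in> carrier (FF k)"
  from this(2) show ?thesis
  proof (induction rule: FF_induct)
    case (diff q q')
    then show ?case unfolding mulL_diff by (intro FF_diff)
  qed (use a in \<open>simp_all add: keys_frag_of\<close>)
qed

end

context cherednik_rep
begin

section \<open>Normal forms modulo the tensor relations\<close>

definition eqv :: "nat \<Rightarrow> (('a ch \<times> 'a ext) \<Rightarrow>\<^sub>0 int) \<Rightarrow> (('a ch \<times> 'a ext) \<Rightarrow>\<^sub>0 int) \<Rightarrow> bool" where
  "eqv k q q' \<longleftrightarrow> q - q' \<in> NN k"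

lemma eqv_refl [simp]: "eqv k q q" by (simp add: eqv_def NN_zero)
lemma eqv_sym: "eqv k q q' \<Longrightarrow> eqv k q' q" unfolding eqv_def using NN_minus[of "q - q'" k] by simp
lemma eqv_trans [trans]: "eqv k q q' \<Longrightarrow> eqv k q' q'' \<Longrightarrow> eqv k q q''"
  unfolding eqv_def using NN_add[of "q - q'" k "q' - q''"] by simp
lemma eqv_add: "eqv k q q' \<Longrightarrow> eqv k r r' \<Longrightarrow> eqv k (q + r) (q' + r')"
  unfolding eqv_def using NN_add[of "q - q'" k "r - r'"] by (simp add: algebra_simps)
lemma eqv_diff: "eqv k q q' \<Longrightarrow> eqv k r r' \<Longrightarrow> eqv k (q - r) (q' - r')"
  using eqv_add[of k q q' "- r" "- r'"] NN_minus[of "r - r'" k] by (simp add: eqv_def)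
lemma eqv_sum: "(\<And>i. i \<in> A \<Longrightarrow> eqv k (f i) (g i)) \<Longrightarrow> eqv k (\<Sum>i\<in>A. f i) (\<Sum>i\<in>A. g i)"
  by (induction A rule: infinite_finite_induct) (auto intro: eqv_add)

lemma mulL_mult: "a \<in> carrier H \<Longrightarrow> b \<in> carrier H \<Longrightarrow> q \<in> carrier (FF k) \<Longrightarrow> mulL (a \<otimes>\<^bsub>H\<^esub> b) q = mulL a (mulL b q)"
proof -
  interpret H: ring H by (rule H_ring)
  assume a: "a \<in> carrier H" "b \<in> carrier H" and "q \<in> carrier (FF k)"
  from this(3) show ?thesis
    by (induction rule: FF_induct) (use a in \<open>simp_all add: mulL_diff H.m_assoc\<close>)
qed

lemma mulL_plus: "a \<in> carrier H \<Longrightarrow> b \<in> carrier H \<Longrightarrow> q \<in> carrier (FF k) \<Longrightarrow>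
    eqv k (mulL (a \<oplus>\<^bsub>H\<^esub> b) q) (mulL a q + mulL b q)"
proof -
  interpret H: ring H by (rule H_ring)
  assume a: "a \<in> carrier H" "b \<in> carrier H" and "q \<in> carrier (FF k)"
  from this(3) show ?thesis
  proof (induction rule: FF_induct)
    case zero
    then show ?case by simp
  next
    case (frag d v)
    then show ?case using a NN_rel1[of "a \<otimes>\<^bsub>H\<^esub> d" "b \<otimes>\<^bsub>H\<^esub> d" v k]
      by (simp add: eqv_def H.l_distr diff_diff_eq)
  next
    case (diff q q')
    then show ?case using eqv_diff[OF diff(3,4)] by (simp add: mulL_diff algebra_simps)
  qed
qed

lemma theta_mulL: "a \<in> carrier H \<Longrightarrow> q \<in> carrier (FF k) \<Longrightarrow> theta (mulL a q) = rho a (theta q)"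
proof -
  assume a: "a \<in> carrier H" and "q \<in> carrier (FF k)"
  from this(2) show ?thesis
    by (induction rule: FF_induct)
      (use a in \<open>simp_all add: mulL_diff theta_diff rho_mult clin_zero[OF clin_rho] clin_diff[OF clin_rho]\<close>)
qed

lemma mulL_NN: "a \<in> carrier H \<Longrightarrow> q \<in> NN k \<Longrightarrow> mulL a q \<in> NN k"
proof -
  interpret H: ring H by (rule H_ring)
  assume a: "a \<in> carrier H" and "q \<in> NN k"
  from this(2) show ?thesis
  proof (induction rule: NN_induct)
    case (rel q)
    then show ?case
    proof (cases rule: rels_cases)
      case (1 b b' v)
      then show ?thesis using a NN_rel1[of "a \<otimes>\<^bsub>H\<^esub> b" "a \<otimes>\<^bsub>H\<^esub> b'" v k] by (simp add: mulL_diff H.r_distr)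
    next
      case (2 b v v')
      then show ?thesis using a NN_rel2[of "a \<otimes>\<^bsub>H\<^esub> b" v k v'] by (simp add: mulL_diff)
    next
      case (3 b F v)
      then show ?thesis using a NN_rel3[of "a \<otimes>\<^bsub>H\<^esub> b" F v k] by (simp add: mulL_diff H.m_assoc ssc_closed)
    qed
  qed (simp_all add: NN_zero mulL_minus NN_minus mulL_add NN_add)
qed

lemma eqv_mulL: "a \<in> carrier H \<Longrightarrow> eqv k q q' \<Longrightarrow> eqv k (mulL a q) (mulL a q')"
  unfolding eqv_def using mulL_NN[of a "q - q'" k] by (simp add: mulL_diff)

definition sgl :: "'a mtx \<Rightarrow> 'b::zero \<Rightarrow> 'a mtx \<Rightarrow> 'b" where "sgl w t = (\<lambda>u. if u = w then t else 0)"

lemma at_one_sgl: "at_one t = sgl (mat 1) t" by (simp add: at_one_def sgl_def)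

lemma sgl_carrier: "w \<in> W \<Longrightarrow> sgl w t \<in> carrier TS" by (auto simp: sgl_def smash_carrier)

lemma sgl_mult: "w \<in> W \<Longrightarrow> v \<in> W \<Longrightarrow> sgl w t \<otimes>\<^bsub>TS\<^esub> sgl v t' = sgl (w ** v) (t * tens_act w t')"
proof
  fix x assume w: "w \<in> W" and v: "v \<in> W"
  show "(sgl w t \<otimes>\<^bsub>TS\<^esub> sgl v t') x = sgl (w ** v) (t * tens_act w t') x"
  proof (cases "x \<in> W")
    case True
    have "(\<Sum>u\<in>W. sgl w t u * tens_act u (sgl v t' (transpose u ** x))) =
        (\<Sum>u\<in>W. if u = w then t * tens_act w (sgl v t' (transpose w ** x)) else 0)"
      by (intro sum.cong) (auto simp: sgl_def)
    moreover have "transpose w ** x = v \<longleftrightarrow> x = w ** v" using w W_cancel by metis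
    ultimately show ?thesis using True w finW
      by (simp add: smash_mult sgl_def clin_zero[OF clin_tens_act] sum.delta)
  next
    case False
    then have "x \<noteq> w ** v" using Wm[OF w v] by auto
    with False show ?thesis by (simp add: smash_mult sgl_def)
  qed
qed

lemma at_one_times_sgl: "w \<in> W \<Longrightarrow> at_one t \<otimes>\<^bsub>TS\<^esub> sgl w 1 = sgl w t"
  by (simp add: at_one_sgl sgl_mult W1)

lemma at_one_mult: "at_one t \<otimes>\<^bsub>TS\<^esub> at_one t' = at_one (t * t')"
  by (simp add: at_one_sgl sgl_mult[OF W1 W1] tens_act_id)

lemma at_one_add: "at_one t \<oplus>\<^bsub>TS\<^esub> at_one t' = at_one (t + t')"
  by (rule ext) (simp add: smash_add at_one_def)

lemma cl_I0: "r \<in> I0 \<Longrightarrow> cl r = \<zero>\<^bsub>H\<^esub>"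
proof -
  assume r: "r \<in> I0"
  interpret ideal I0 TS by (rule ideal_I0)
  show ?thesis unfolding cl_eq H_eq using a_rcos_const[OF r] by (simp add: FactRing_def)
qed

lemma ch_scal_zero: "ch_scal P 0 = \<zero>\<^bsub>H\<^esub>"
proof -
  have "\<zero>\<^bsub>TS\<^esub> = at_one (scal 0)" by (simp add: smash_def at_one_def fun_eq_iff)
  then show ?thesis unfolding ch_scal_def using cl_I0[OF additive_subgroup.zero_closed[OF ideal.axioms(1)[OF ideal_I0]]] by (simp only:)
qed

lemma cl_relator: "r \<in> cherednik_relators P \<Longrightarrow> cl r = \<zero>\<^bsub>H\<^esub>"
  by (rule cl_I0) (use ring.genideal_self[OF TS_ring relators_carrier] in auto)

lemma ch_x_commute: "ch_x P v \<otimes>\<^bsub>H\<^esub> ch_x P v' = ch_x P v' \<otimes>\<^bsub>H\<^esub> ch_x P v"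
proof -
  interpret H: ring H by (rule H_ring)
  have r: "at_one (tens_x v * tens_x v' - tens_x v' * tens_x v) \<in> cherednik_relators P"
    unfolding relators_eq by blast
  have "ch_x P v \<otimes>\<^bsub>H\<^esub> ch_x P v' = cl (at_one (tens_x v * tens_x v'))"
    by (simp add: ch_x_def at_one_carrier at_one_mult flip: cl_mult)
  also have "at_one (tens_x v * tens_x v') =
      at_one (tens_x v * tens_x v' - tens_x v' * tens_x v) \<oplus>\<^bsub>TS\<^esub> at_one (tens_x v' * tens_x v)"
    by (simp add: at_one_add)
  also have "cl \<dots> = \<zero>\<^bsub>H\<^esub> \<oplus>\<^bsub>H\<^esub> cl (at_one (tens_x v' * tens_x v))"
    by (simp only: cl_add at_one_carrier cl_relator[OF r])
  also have "\<dots> = ch_x P v' \<otimes>\<^bsub>H\<^esub> ch_x P v"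
    by (simp add: ch_x_def at_one_carrier at_one_mult flip: cl_mult)
  finally show ?thesis .
qed

definition xmon :: "('a \<Rightarrow>\<^sub>0 nat) \<Rightarrow> 'a ch" where
  "xmon m = foldr (\<lambda>i. ((\<otimes>\<^bsub>H\<^esub>) (ch_x P (axis i 1))) ^^ Poly_Mapping.lookup m i) (sorted_list_of_set UNIV) \<one>\<^bsub>H\<^esub>"

lemma xmon_zero: "xmon 0 = \<one>\<^bsub>H\<^esub>"
proof -
  have "foldr (\<lambda>i z. z) l z = z" for l :: "'a list" and z :: "'a ch" by (induction l) auto
  then show ?thesis by (simp add: xmon_def id_def)
qed

lemma xmon_closed: "xmon m \<in> carrier H"
proof -
  interpret H: ring H by (rule H_ring)
  have "((\<otimes>\<^bsub>H\<^esub>) (ch_x P (axis i 1)) ^^ n) z \<in> carrier H" if "z \<in> carrier H" for i n z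
    using that by (induction n) (auto simp: ch_closed)
  then have "foldr (\<lambda>i. ((\<otimes>\<^bsub>H\<^esub>) (ch_x P (axis i 1))) ^^ Poly_Mapping.lookup m i) l \<one>\<^bsub>H\<^esub> \<in> carrier H" for l
    by (induction l) auto
  then show ?thesis by (simp add: xmon_def)
qed

lemma xmon_add: "xmon (Poly_Mapping.single j 1 + m) = ch_x P (axis j 1) \<otimes>\<^bsub>H\<^esub> xmon m"
proof -
  interpret H: ring H by (rule H_ring)
  show ?thesis unfolding xmon_def
  proof (rule foldr_commuting_insert[where C = "carrier H", symmetric])
    fix i j z assume "z \<in> carrier H"
    then show "ch_x P (axis i 1) \<otimes>\<^bsub>H\<^esub> (ch_x P (axis j 1) \<otimes>\<^bsub>H\<^esub> z) = ch_x P (axis j 1) \<otimes>\<^bsub>H\<^esub> (ch_x P (axis i 1) \<otimes>\<^bsub>H\<^esub> z)"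
      by (simp add: ch_closed ch_x_commute flip: H.m_assoc)
  qed (auto simp: ch_closed lookup_add lookup_single)
qed

definition coefv :: "'a pext \<Rightarrow> ('a \<Rightarrow>\<^sub>0 nat) \<Rightarrow> 'a ext" where
  "coefv f m = (\<chi> J. Poly_Mapping.lookup (f J) m)"

definition Keys :: "'a pext \<Rightarrow> ('a \<Rightarrow>\<^sub>0 nat) set" where "Keys f = (\<Union>J. Poly_Mapping.keys (f J))"

lemma finite_Keys: "finite (Keys f)" by (simp add: Keys_def)

lemma coefv_outside: "m \<notin> Keys f \<Longrightarrow> coefv f m = 0"
  by (auto simp: Keys_def coefv_def vec_eq_iff in_keys_iff)

lemma coefv_extgr: "f \<in> Ej k \<Longrightarrow> coefv f m \<in> extgr k"
  by (auto simp: Ej_def extgr_def coefv_def)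

text \<open>The inverse of \<open>theta\<close>: the coefficient vector of each monomial is placed
  behind the corresponding ordered product of the \<open>x_i\<close>. It is additive only modulo
  \<open>NN k\<close>.\<close>

definition psi :: "'a pext \<Rightarrow> ('a ch \<times> 'a ext) \<Rightarrow>\<^sub>0 int" where
  "psi f = (\<Sum>m\<in>Keys f. frag_of (xmon m, coefv f m))"

lemma FF_sum: "(\<And>i. i \<in> A \<Longrightarrow> f i \<in> carrier (FF k)) \<Longrightarrow> (\<Sum>i\<in>A. f i) \<in> carrier (FF k)"
proof (induction A rule: infinite_finite_induct)
  case (insert x A)
  then show ?case using FF_add[of "f x" k "\<Sum>i\<in>A. f i"] by simp
qed simp_all

lemma psi_FF: "f \<in> Ej k \<Longrightarrow> psi f \<in> carrier (FF k)"
  unfolding psi_def by (intro FF_sum FF_frag xmon_closed coefv_extgr)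

lemma eqv_frag_zero: "a \<in> carrier H \<Longrightarrow> eqv k (frag_of (a, 0)) 0"
  using NN_minus[OF NN_rel2[of a 0 k 0]] by (simp add: eqv_def)

lemma psi_superset:
  assumes "finite A" "Keys f \<subseteq> A"
  shows "eqv k (\<Sum>m\<in>A. frag_of (xmon m, coefv f m)) (psi f)"
proof -
  have "(\<Sum>m\<in>A. frag_of (xmon m, coefv f m)) = psi f + (\<Sum>m\<in>A - Keys f. frag_of (xmon m, coefv f m))"
    using assms by (simp add: psi_def sum.subset_diff add.commute)
  moreover have "eqv k (\<Sum>m\<in>A - Keys f. frag_of (xmon m, coefv f m)) (\<Sum>m\<in>A - Keys f. 0)"
    by (rule eqv_sum) (simp add: coefv_outside eqv_frag_zero xmon_closed)
  ultimately show ?thesis using eqv_add[OF eqv_refl, of k _ 0 "psi f"] by simp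
qed

lemma psi_add:
  assumes f: "f \<in> Ej k" "g \<in> Ej k"
  shows "eqv k (psi (f + g)) (psi f + psi g)"
proof -
  let ?A = "Keys f \<union> Keys g"
  have "Keys (f + g) \<subseteq> ?A"
    using keys_add by (fastforce simp: Keys_def fun_apply)
  then have "eqv k (psi (f + g)) (\<Sum>m\<in>?A. frag_of (xmon m, coefv (f + g) m))"
    by (intro eqv_sym[OF psi_superset]) (simp_all add: finite_Keys)
  also have "eqv k \<dots> (\<Sum>m\<in>?A. frag_of (xmon m, coefv f m) + frag_of (xmon m, coefv g m))"
  proof (rule eqv_sum)
    fix m
    have "coefv (f + g) m = coefv f m + coefv g m" by (simp add: coefv_def vec_eq_iff fun_apply lookup_add)
    then show "eqv k (frag_of (xmon m, coefv (f + g) m)) (frag_of (xmon m, coefv f m) + frag_of (xmon m, coefv g m))"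
      using NN_rel2[OF xmon_closed coefv_extgr[OF f(1)] coefv_extgr[OF f(2)]] by (simp add: eqv_def diff_diff_eq)
  qed
  also have "eqv k \<dots> (psi f + psi g)"
    unfolding sum.distrib by (intro eqv_add psi_superset) (auto simp: finite_Keys)
  finally show ?thesis .
qed

lemma psi_zero [simp]: "psi 0 = 0"
  by (simp add: psi_def Keys_def fun_apply)

lemma psi_emb: "eqv k (psi (emb v)) (frag_of (\<one>\<^bsub>H\<^esub>, v))"
proof -
  have "Keys (emb v) \<subseteq> {0}" by (auto simp: Keys_def emb_def split: if_splits)
  then have "eqv k (psi (emb v)) (\<Sum>m\<in>{0}. frag_of (xmon m, coefv (emb v) m))"
    by (intro eqv_sym[OF psi_superset]) simp_all
  moreover have "coefv (emb v) 0 = v" by (simp add: coefv_def emb_def vec_eq_iff)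
  ultimately show ?thesis by (simp add: xmon_zero)
qed

lemma psi_xmul: "eqv k (psi (xmul (axis j 1) f)) (mulL (ch_x P (axis j 1)) (psi f))"
proof -
  let ?e = "Poly_Mapping.single j (1::nat)"
  have inj: "inj_on ((+) ?e) A" for A by (auto simp: inj_on_def)
  have l: "Poly_Mapping.lookup (xmul (axis j 1) f J) (?e + m) = Poly_Mapping.lookup (f J) m" for J m
  proof -
    have "?e + m - ?e = m" by simp
    then show ?thesis unfolding xmul_def sym_y_axis lookup_pvar_mult by (simp add: lookup_add)
  qed
  have "Keys (xmul (axis j 1) f) \<subseteq> (+) ?e ` Keys f"
  proof
    fix m assume "m \<in> Keys (xmul (axis j 1) f)"
    then obtain J where "Poly_Mapping.lookup (pvar j * f J) m \<noteq> 0"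
      by (auto simp: Keys_def xmul_def sym_y_axis in_keys_iff)
    then have m: "Poly_Mapping.lookup m j \<noteq> 0" "Poly_Mapping.lookup (f J) (m - ?e) \<noteq> 0"
      by (auto simp: lookup_pvar_mult split: if_splits)
    have "m = ?e + (m - ?e)"
      using m(1) by (intro poly_mapping_eqI) (auto simp: lookup_add lookup_minus lookup_single when_def)
    moreover have "m - ?e \<in> Keys f" using m(2) by (auto simp: Keys_def in_keys_iff)
    ultimately show "m \<in> (+) ?e ` Keys f" by blast
  qed
  then have "eqv k (psi (xmul (axis j 1) f)) (\<Sum>m\<in>(+) ?e ` Keys f. frag_of (xmon m, coefv (xmul (axis j 1) f) m))"
    by (intro eqv_sym[OF psi_superset]) (simp_all add: finite_Keys)
  also have "(\<Sum>m\<in>(+) ?e ` Keys f. frag_of (xmon m, coefv (xmul (axis j 1) f) m)) =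
      (\<Sum>m\<in>Keys f. frag_of (ch_x P (axis j 1) \<otimes>\<^bsub>H\<^esub> xmon m, coefv f m))"
    unfolding sum.reindex[OF inj] o_def xmon_add by (simp add: coefv_def l[simplified])
  also have "\<dots> = mulL (ch_x P (axis j 1)) (psi f)"
    by (simp add: psi_def mulL_sum)
  finally show ?thesis .
qed

text \<open>Compatibility of \<open>psi\<close> with \<open>a\<close> at one \<open>f\<close>. Known
  for all \<open>a\<close>, it gives \<open>psi (theta q) = q\<close> modulo relations, hence
  injectivity of \<open>theta\<close>. It is stated for a single \<open>f\<close> because for group
  elements and for the \<open>y_i\<close> it is proved by induction on \<open>f\<close>.\<close>

definition Sp :: "nat \<Rightarrow> 'a ch \<Rightarrow> 'a pext \<Rightarrow> bool" where
  "Sp k a f \<longleftrightarrow> eqv k (psi (rho a f)) (mulL a (psi f))"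

lemma Sp_add: "a \<in> carrier H \<Longrightarrow> b \<in> carrier H \<Longrightarrow> f \<in> Ej k \<Longrightarrow> Sp k a f \<Longrightarrow> Sp k b f \<Longrightarrow> Sp k (a \<oplus>\<^bsub>H\<^esub> b) f"
  unfolding Sp_def rho_add
  by (rule eqv_trans[OF psi_add[OF Ej_rho Ej_rho] eqv_trans[OF eqv_add eqv_sym[OF mulL_plus[OF _ _ psi_FF]]]])

lemma Sp_mult: "a \<in> carrier H \<Longrightarrow> b \<in> carrier H \<Longrightarrow> f \<in> Ej k \<Longrightarrow> Sp k a (rho b f) \<Longrightarrow> Sp k b f \<Longrightarrow> Sp k (a \<otimes>\<^bsub>H\<^esub> b) f"
  unfolding Sp_def by (simp only: rho_mult mulL_mult[OF _ _ psi_FF]) (rule eqv_trans[OF _ eqv_mulL])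

lemma Sp_plus: "a \<in> carrier H \<Longrightarrow> f \<in> Ej k \<Longrightarrow> g \<in> Ej k \<Longrightarrow> Sp k a f \<Longrightarrow> Sp k a g \<Longrightarrow> Sp k a (f + g)"
proof -
  assume a: "a \<in> carrier H" and f: "f \<in> Ej k" "g \<in> Ej k" and s: "Sp k a f" "Sp k a g"
  have "eqv k (psi (rho a (f + g))) (psi (rho a f) + psi (rho a g))"
    using psi_add[OF Ej_rho[OF a f(1)] Ej_rho[OF a f(2)]] by (simp add: clin_add[OF clin_rho[OF a]])
  also have "eqv k \<dots> (mulL a (psi f) + mulL a (psi g))" using s unfolding Sp_def by (rule eqv_add)
  also have "eqv k \<dots> (mulL a (psi (f + g)))"
    using eqv_sym[OF eqv_mulL[OF a psi_add[OF f]]] by (simp add: mulL_add)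
  finally show ?thesis by (simp add: Sp_def)
qed

lemma Sp_x: "Sp k (ch_x P (axis j 1)) f"
  unfolding Sp_def rho_ch by (rule psi_xmul)

text \<open>The induction step on \<open>f\<close>: a straightening rule
  \<open>a x = b a' + r\<close> reduces the claim for \<open>a\<close> at \<open>x f\<close> to
  claims about \<open>b\<close>, \<open>a'\<close> and \<open>r\<close> in which the factor
  \<open>x\<close> is gone.\<close>

lemma Sp_step:
  assumes a: "a \<in> carrier H" "a' \<in> carrier H" "b \<in> carrier H" "r \<in> carrier H" and f: "f \<in> Ej k"
    and eq: "a \<otimes>\<^bsub>H\<^esub> ch_x P (axis j 1) = (b \<otimes>\<^bsub>H\<^esub> a') \<oplus>\<^bsub>H\<^esub> r"
    and s: "Sp k b (rho a' f)" "Sp k a' f" "Sp k r f"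
  shows "Sp k a (xmul (axis j 1) f)"
proof -
  interpret H: ring H by (rule H_ring)
  have "Sp k ((b \<otimes>\<^bsub>H\<^esub> a') \<oplus>\<^bsub>H\<^esub> r) f"
    using a f s by (intro Sp_add Sp_mult) auto
  then have "eqv k (psi (rho (a \<otimes>\<^bsub>H\<^esub> ch_x P (axis j 1)) f)) (mulL (a \<otimes>\<^bsub>H\<^esub> ch_x P (axis j 1)) (psi f))"
    unfolding Sp_def eq .
  then have "eqv k (psi (rho a (xmul (axis j 1) f))) (mulL a (mulL (ch_x P (axis j 1)) (psi f)))"
    by (simp only: rho_mult[OF a(1) ch_closed(1)] rho_ch mulL_mult[OF a(1) ch_closed(1) psi_FF[OF f]])
  also have "eqv k \<dots> (mulL a (psi (xmul (axis j 1) f)))"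
    by (rule eqv_mulL[OF a(1) eqv_sym[OF psi_xmul]])
  finally show ?thesis by (simp add: Sp_def)
qed

text \<open>Closed under sums and products, so that it is enough to find the generators of
  \<open>H\<close> in it.\<close>

definition SH :: "nat \<Rightarrow> 'a ch set" where "SH k = {a \<in> carrier H. \<forall>f\<in>Ej k. Sp k a f}"

lemma SH_add: "a \<in> SH k \<Longrightarrow> b \<in> SH k \<Longrightarrow> a \<oplus>\<^bsub>H\<^esub> b \<in> SH k"
  using ring.ring_simprules(1)[OF H_ring] by (auto simp: SH_def Sp_add)

lemma SH_mult: "a \<in> SH k \<Longrightarrow> b \<in> SH k \<Longrightarrow> a \<otimes>\<^bsub>H\<^esub> b \<in> SH k"
  using ring.ring_simprules(5)[OF H_ring] by (auto simp: SH_def Sp_mult Ej_rho)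

lemma cl_sgl_scal: "F \<in> carrier TS \<Longrightarrow> cl (at_one (scal z)) \<otimes>\<^bsub>H\<^esub> cl F = cl F \<otimes>\<^bsub>H\<^esub> cl (at_one (scal z))"
proof -
  assume F: "F \<in> carrier TS"
  have "at_one (scal z) \<otimes>\<^bsub>TS\<^esub> F = F \<otimes>\<^bsub>TS\<^esub> at_one (scal z)"
  proof
    fix w
    show "(at_one (scal z) \<otimes>\<^bsub>TS\<^esub> F) w = (F \<otimes>\<^bsub>TS\<^esub> at_one (scal z)) w"
    proof (cases "w \<in> W")
      case w: True
      have "(\<Sum>u\<in>W. at_one (scal z) u * tens_act u (F (transpose u ** w))) =
          (\<Sum>u\<in>W. if u = mat 1 then scal z * F w else 0)"
        by (intro sum.cong) (auto simp: at_one_def tens_act_id transpose_mat)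
      moreover have "transpose u ** w = mat 1 \<longleftrightarrow> u = w" if "u \<in> W" for u
        using W_cancel(2)[OF that, of w] Wo'[OF w] by (metis matrix_mul_rid)
      then have "(\<Sum>u\<in>W. F u * tens_act u (at_one (scal z) (transpose u ** w))) =
          (\<Sum>u\<in>W. if u = w then F u * scal z else 0)"
        by (intro sum.cong) (auto simp: at_one_def clin_zero[OF clin_tens_act])
      ultimately show ?thesis using w W1 finW by (simp add: smash_mult scal_central)
    qed (simp add: smash_mult)
  qed
  then show ?thesis using F by (simp add: at_one_carrier flip: cl_mult)
qed

lemma ssc_sgl: "sym_smash_to_ch P (sgl w f) = cl (sgl w (sym_to_tens f))"
proof -
  have "(\<lambda>u. sym_to_tens (sgl w f u)) = sgl w (sym_to_tens f)"
    by (rule ext) (simp add: sgl_def sym_to_tens_def)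
  then show ?thesis by (simp add: sym_smash_to_ch_def)
qed

lemma sgl_SS: "w \<in> W \<Longrightarrow> sgl w f \<in> carrier SS"
  by (auto simp: sgl_def smash_carrier)

lemma infl_sgl: "w \<in> W \<Longrightarrow> v \<in> extgr k \<Longrightarrow> sgl w f \<odot>\<^bsub>infl k\<^esub> v = Poly_Mapping.lookup f 0 *\<^sub>C ext_act w v"
proof -
  assume w: "w \<in> W" and v: "v \<in> extgr k"
  have "sgl w f \<odot>\<^bsub>infl k\<^esub> v = (\<Sum>u\<in>W. if u = w then Poly_Mapping.lookup f 0 *\<^sub>C ext_act u v else 0)"
    unfolding infl_smult[OF v] by (intro sum.cong) (auto simp: sgl_def)
  then show ?thesis using w finW by simp
qed

text \<open>Passage of an element \<open>f w\<close> of the smaller algebra through the tensor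
  sign.\<close>

lemma move_right:
  assumes "a \<in> carrier H" "w \<in> W" "v \<in> extgr k"
  shows "eqv k (frag_of (a \<otimes>\<^bsub>H\<^esub> cl (sgl w (sym_to_tens f)), v)) (frag_of (a, Poly_Mapping.lookup f 0 *\<^sub>C ext_act w v))"
  using NN_rel3[OF assms(1) sgl_SS[OF assms(2)] assms(3), of f] assms(2,3)
  by (simp add: eqv_def ssc_sgl infl_sgl)

lemma sym_to_tens_scal: "sym_to_tens (scal z :: 'a sym) = scal z"
proof (cases "z = 0")
  case False
  have "prod_list (map (\<lambda>i. 1) l) = (1 :: 'a tens)" for l :: "'a list" by (induction l) auto
  then show ?thesis using False by (simp add: sym_to_tens_def)
qed (simp add: sym_to_tens_def)

lemma sym_to_tens_pvar: "sym_to_tens (pvar (i :: 'a)) = tens_y (axis i 1)"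
proof -
  have "prod_list (map (\<lambda>j. tens_y (axis j 1) ^ (if i = j then Suc 0 else 0)) l) =
      (if i \<in> set l then tens_y (axis i 1) else (1 :: 'a tens))" if "distinct l" for l
    using that by (induction l) auto
  then show ?thesis
    by (simp add: sym_to_tens_def pvar_def lookup_single when_def)
qed

lemma scal_SH: "ch_scal P z \<in> SH k"
  unfolding SH_def
proof safe
  interpret H: ring H by (rule H_ring)
  show c: "ch_scal P z \<in> carrier H" by (rule ch_closed)
  fix f assume f: "f \<in> Ej k"
  have "Keys (z *\<^sub>C f) \<subseteq> Keys f" by (auto simp: Keys_def fun_apply in_keys_iff)
  then have "eqv k (psi (z *\<^sub>C f)) (\<Sum>m\<in>Keys f. frag_of (xmon m, coefv (z *\<^sub>C f) m))"
    by (intro eqv_sym[OF psi_superset]) (simp_all add: finite_Keys)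
  also have "eqv k \<dots> (\<Sum>m\<in>Keys f. frag_of (ch_scal P z \<otimes>\<^bsub>H\<^esub> xmon m, coefv f m))"
  proof (rule eqv_sum)
    fix m
    have e: "coefv (z *\<^sub>C f) m = z *\<^sub>C coefv f m"
      by (simp add: coefv_def vec_eq_iff fun_apply cscale_complex_def)
    obtain F where "F \<in> carrier TS" "xmon m = cl F" using xmon_closed[of m] by (auto simp: carrier_H)
    then have "ch_scal P z \<otimes>\<^bsub>H\<^esub> xmon m = xmon m \<otimes>\<^bsub>H\<^esub> cl (sgl (mat 1) (sym_to_tens (scal z)))"
      by (simp add: ch_scal_def cl_sgl_scal sym_to_tens_scal flip: at_one_sgl)
    then show "eqv k (frag_of (xmon m, coefv (z *\<^sub>C f) m)) (frag_of (ch_scal P z \<otimes>\<^bsub>H\<^esub> xmon m, coefv f m))"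
      using eqv_sym[OF move_right[OF xmon_closed[of m] W1 coefv_extgr[OF f, of m], of "scal z"]]
      by (simp add: e ext_act_one)
  qed
  also have "\<dots> = mulL (ch_scal P z) (psi f)" by (simp add: psi_def mulL_sum)
  finally show "Sp k (ch_scal P z) f" by (simp add: Sp_def rho_ch)
qed

lemma x_axis_SH: "ch_x P (axis j 1) \<in> SH k"
  by (simp add: SH_def ch_closed Sp_x)

lemma cl_at_one_SH_sum:
  "finite A \<Longrightarrow> (\<And>i. i \<in> A \<Longrightarrow> cl (at_one (t i)) \<in> SH k) \<Longrightarrow> cl (at_one (\<Sum>i\<in>A. t i)) \<in> SH k"
proof (induction A rule: finite_induct)
  case empty
  then show ?case using scal_SH[of 0 k] by (simp add: ch_scal_def)
next
  case (insert x A)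
  then show ?case using SH_add[of "cl (at_one (t x))" k "cl (at_one (\<Sum>i\<in>A. t i))"]
    by (simp add: at_one_carrier flip: cl_add at_one_add)
qed

lemma cl_at_one_SH_mult: "cl (at_one t) \<in> SH k \<Longrightarrow> cl (at_one t') \<in> SH k \<Longrightarrow> cl (at_one (t * t')) \<in> SH k"
  using SH_mult[of "cl (at_one t)" k "cl (at_one t')"] by (simp add: at_one_carrier at_one_mult flip: cl_mult)

lemma x_SH: "ch_x P v \<in> SH k"
proof -
  have "tens_x v = (\<Sum>i\<in>UNIV. scal (v $ i) * tens_x (axis i 1))"
    by (simp only: scal_mult) (rule clin_vec_expand[OF clin_tens_x])
  then show ?thesis
    unfolding ch_x_def
    using scal_SH[of _ k] x_axis_SH[of _ k] by (simp add: ch_x_def ch_scal_def cl_at_one_SH_sum cl_at_one_SH_mult)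
qed

lemma grp_SH: "w \<in> W \<Longrightarrow> ch_grp P w \<in> SH k"
  unfolding SH_def
proof safe
  interpret H: ring H by (rule H_ring)
  assume w: "w \<in> W"
  show c: "ch_grp P w \<in> carrier H" by (rule ch_closed) (rule w)
  have ch: "ch_grp P w = cl (sgl w 1)" by (simp add: ch_grp_def sgl_def)
  fix f assume "f \<in> Ej k"
  then show "Sp k (ch_grp P w) f"
  proof (induction rule: Ej_induct)
    case (emb v)
    have "eqv k (psi (rho (ch_grp P w) (emb v))) (frag_of (\<one>\<^bsub>H\<^esub>, ext_act w v))"
      unfolding rho_ch(4)[OF w] wact_emb by (rule psi_emb)
    also have "eqv k \<dots> (frag_of (\<one>\<^bsub>H\<^esub> \<otimes>\<^bsub>H\<^esub> ch_grp P w, v))"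
      using eqv_sym[OF move_right[of "\<one>\<^bsub>H\<^esub>" w v k "scal 1"]] w emb sym_to_tens_scal[of 1] by (simp add: ch)
    also have "\<dots> = mulL (ch_grp P w) (frag_of (\<one>\<^bsub>H\<^esub>, v))" using c by simp
    also have "eqv k \<dots> (mulL (ch_grp P w) (psi (emb v)))" by (rule eqv_mulL[OF c eqv_sym[OF psi_emb]])
    finally show ?case by (simp add: Sp_def)
  next
    case (xmul i f)
    have "ch_grp P w \<otimes>\<^bsub>H\<^esub> ch_x P (axis i 1) = cl (sgl w (tens_x (w *v axis i 1)))"
      using w W1 by (simp add: ch ch_x_def at_one_sgl sgl_carrier sgl_mult tens_act_tens_x contragredient_W flip: cl_mult)
    also have "\<dots> = ch_x P (w *v axis i 1) \<otimes>\<^bsub>H\<^esub> ch_grp P w"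
      using w W1 by (simp add: ch ch_x_def at_one_sgl sgl_carrier sgl_mult flip: cl_mult)
    \<comment> \<open>The remainder is written as the zero scalar to fit the shape of
      \<open>Sp_step\<close>.\<close>
    finally have eq: "ch_grp P w \<otimes>\<^bsub>H\<^esub> ch_x P (axis i 1) = (ch_x P (w *v axis i 1) \<otimes>\<^bsub>H\<^esub> ch_grp P w) \<oplus>\<^bsub>H\<^esub> ch_scal P 0"
      using c by (simp add: ch_closed ch_scal_zero)
    show ?case
      by (rule Sp_step[OF c c ch_closed(1) ch_closed(3) xmul(1) eq])
        (use xmul x_SH[of "w *v axis i 1" k] scal_SH[of 0 k] Ej_rho[OF c] in \<open>auto simp: SH_def\<close>)
  next
    case (add f g)
    then show ?case using Sp_plus[OF c] by blast
  qed
qed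

lemma refl_sum_SH: "cl (refl_sum z) \<in> SH k"
proof -
  have "cl (\<lambda>w. if w \<in> A then scal (z w) else 0) \<in> SH k \<and> (\<lambda>w. if w \<in> A then scal (z w) else 0) \<in> carrier TS"
    if "finite A" "A \<subseteq> Rf" for A
    using that
  proof induction
    case empty
    then show ?case using scal_SH[of 0 k] by (simp add: ch_scal_def at_one_def smash_carrier)
  next
    case (insert s A)
    have s: "s \<in> W" using insert RfW by auto
    have e: "(\<lambda>w. if w \<in> insert s A then scal (z w) else 0) =
        (at_one (scal (z s)) \<otimes>\<^bsub>TS\<^esub> sgl s 1) \<oplus>\<^bsub>TS\<^esub> (\<lambda>w. if w \<in> A then scal (z w) else 0 :: 'a tens)"
      unfolding at_one_times_sgl[OF s] using insert s by (auto simp: fun_eq_iff smash_add sgl_def)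
    have c: "at_one (scal (z s)) \<otimes>\<^bsub>TS\<^esub> sgl s 1 \<in> carrier TS"
      by (intro ring.ring_simprules(5)[OF TS_ring] at_one_carrier sgl_carrier s)
    have "cl (at_one (scal (z s)) \<otimes>\<^bsub>TS\<^esub> sgl s 1) \<in> SH k"
      using SH_mult[OF scal_SH[of "z s" k] grp_SH[OF s]] s
      by (simp add: ch_scal_def ch_grp_def cl_mult at_one_carrier sgl_carrier flip: sgl_def)
    then show ?case unfolding e using insert c by (auto simp: cl_add SH_add TS_add_closed)
  qed
  from this[OF finRf] show ?thesis by (simp add: refl_sum_def)
qed

lemma y_SH: "ch_y P (axis i 1) \<in> SH k"
  unfolding SH_def
proof safe
  interpret H: ring H by (rule H_ring)
  interpret T: ring TS by (rule TS_ring)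
  let ?y = "axis i 1 :: 'a cvect"
  show c: "ch_y P ?y \<in> carrier H" by (rule ch_closed)
  fix f assume "f \<in> Ej k"
  then show "Sp k (ch_y P ?y) f"
  proof (induction rule: Ej_induct)
    case (emb v)
    have "mulL (ch_y P ?y) (frag_of (\<one>\<^bsub>H\<^esub>, v)) = frag_of (\<one>\<^bsub>H\<^esub> \<otimes>\<^bsub>H\<^esub> ch_y P ?y, v)" using c by simp
    \<comment> \<open>\<open>y\<close> crosses the tensor sign and acts on \<open>v\<close> by
      zero.\<close>
    also have "eqv k \<dots> (frag_of (\<one>\<^bsub>H\<^esub>, 0))"
      using move_right[of "\<one>\<^bsub>H\<^esub>" "mat 1" v k "pvar i"] W1 emb lookup_pvar_mult[of i 1 0]
      by (simp add: ch_y_def sym_to_tens_pvar at_one_sgl)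
    also have "eqv k \<dots> 0" by (rule eqv_frag_zero) simp
    finally have "eqv k (mulL (ch_y P ?y) (frag_of (\<one>\<^bsub>H\<^esub>, v))) 0" .
    then have "eqv k (mulL (ch_y P ?y) (psi (emb v))) 0"
      using eqv_trans[OF eqv_mulL[OF c psi_emb]] by blast
    then show ?case by (simp add: Sp_def rho_ch eqv_sym)
  next
    case (xmul j f)
    let ?x = "axis j 1 :: 'a cvect"
    let ?r = "at_one (tens_y ?y * tens_x ?x - tens_x ?x * tens_y ?y - scal (pairing ?y ?x)) \<oplus>\<^bsub>TS\<^esub> refl_sum (\<lambda>s. c s * (bt s ?y ?x / 2))"
    let ?m = "refl_sum (\<lambda>s. - (c s * (bt s ?y ?x / 2)))"
    have r: "cl ?r = \<zero>\<^bsub>H\<^esub>" by (rule cl_relator) (unfold relators_eq, blast)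
    have rc: "?r \<in> carrier TS" by (intro TS_add_closed at_one_carrier refl_sum_carrier)
    have sc: "at_one (scal (pairing ?y ?x)) \<oplus>\<^bsub>TS\<^esub> ?m \<in> carrier TS" by (intro TS_add_closed at_one_carrier refl_sum_carrier)
    \<comment> \<open>The relator solved for \<open>y x\<close>: modulo it, \<open>y x\<close> is
      \<open>x y\<close> plus a scalar and a combination of reflections, and for the last two the
      claim is already known.\<close>
    have "at_one (tens_y ?y * tens_x ?x) = ?r \<oplus>\<^bsub>TS\<^esub> (at_one (tens_x ?x * tens_y ?y) \<oplus>\<^bsub>TS\<^esub> (at_one (scal (pairing ?y ?x)) \<oplus>\<^bsub>TS\<^esub> ?m))"
      by (rule ext) (auto simp: smash_add at_one_def refl_sum_def single_uminus)
    then have "cl (at_one (tens_y ?y * tens_x ?x)) = \<zero>\<^bsub>H\<^esub> \<oplus>\<^bsub>H\<^esub> (cl (at_one (tens_x ?x * tens_y ?y)) \<oplus>\<^bsub>H\<^esub> cl (at_one (scal (pairing ?y ?x)) \<oplus>\<^bsub>TS\<^esub> ?m))"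
      by (simp only: cl_add rc sc at_one_carrier TS_add_closed r)
    then have eq: "ch_y P ?y \<otimes>\<^bsub>H\<^esub> ch_x P ?x = (ch_x P ?x \<otimes>\<^bsub>H\<^esub> ch_y P ?y) \<oplus>\<^bsub>H\<^esub> cl (at_one (scal (pairing ?y ?x)) \<oplus>\<^bsub>TS\<^esub> ?m)"
      using sc by (simp add: ch_x_def ch_y_def at_one_carrier at_one_mult flip: cl_mult)
    have "cl (at_one (scal (pairing ?y ?x)) \<oplus>\<^bsub>TS\<^esub> ?m) \<in> SH k"
      using SH_add[OF scal_SH[of "pairing ?y ?x" k] refl_sum_SH] by (simp only: ch_scal_def cl_add at_one_carrier refl_sum_carrier)
    then show ?case
      by (intro Sp_step[OF c c ch_closed(1) _ xmul(1) eq])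
        (use xmul sc Sp_x in \<open>auto simp: SH_def\<close>)
  next
    case (add f g)
    then show ?case using Sp_plus[OF c] by blast
  qed
qed

lemma at_one_SH: "cl (at_one t) \<in> SH k"
proof (induction t rule: tens_induct)
  case (scal z)
  then show ?case using scal_SH[of z k] by (simp add: ch_scal_def)
next
  case (var l t)
  have "cl (at_one (Poly_Mapping.single [l] 1)) \<in> SH k"
    using x_axis_SH y_SH by (cases l) (auto simp: single_letter ch_x_def ch_y_def)
  then show ?case using var cl_at_one_SH_mult by blast
next
  case (add p q)
  then show ?case using SH_add[of "cl (at_one p)" k "cl (at_one q)"] by (simp add: at_one_carrier flip: cl_add at_one_add)
qed

text \<open>Every element is a finite sum of products of a tensor with a group element, so the
  generators suffice.\<close>

lemma carrier_SH: "carrier H \<subseteq> SH k"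
proof
  fix a assume "a \<in> carrier H"
  then obtain F where F: "F \<in> carrier TS" "a = cl F" by (auto simp: carrier_H)
  have "cl (\<lambda>w. if w \<in> A then F w else 0) \<in> SH k \<and> (\<lambda>w. if w \<in> A then F w else 0) \<in> carrier TS"
    if "finite A" "A \<subseteq> W" for A
    using that
  proof induction
    case empty
    then show ?case using scal_SH[of 0 k] by (simp add: ch_scal_def at_one_def smash_carrier)
  next
    case (insert s A)
    have s: "s \<in> W" using insert by auto
    have e: "(\<lambda>w. if w \<in> insert s A then F w else 0) =
        (at_one (F s) \<otimes>\<^bsub>TS\<^esub> sgl s 1) \<oplus>\<^bsub>TS\<^esub> (\<lambda>w. if w \<in> A then F w else 0)"
      unfolding at_one_times_sgl[OF s] using insert s by (auto simp: fun_eq_iff smash_add sgl_def)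
    have c: "at_one (F s) \<otimes>\<^bsub>TS\<^esub> sgl s 1 \<in> carrier TS"
      by (intro ring.ring_simprules(5)[OF TS_ring] at_one_carrier sgl_carrier s)
    have "cl (at_one (F s) \<otimes>\<^bsub>TS\<^esub> sgl s 1) \<in> SH k"
      using SH_mult[OF at_one_SH[of "F s" k] grp_SH[OF s]] s
      by (simp add: ch_grp_def cl_mult at_one_carrier sgl_carrier flip: sgl_def)
    then show ?case unfolding e using insert c by (auto simp: cl_add SH_add TS_add_closed)
  qed
  from this[OF finW] have "cl (\<lambda>w. if w \<in> W then F w else 0) \<in> SH k" by simp
  moreover have "(\<lambda>w. if w \<in> W then F w else 0) = F" using F by (auto simp: smash_carrier fun_eq_iff)
  ultimately show "a \<in> SH k" using F by simp
qed

lemma psi_theta: "q \<in> carrier (FF k) \<Longrightarrow> eqv k (psi (theta q)) q \<and> theta q \<in> Ej k"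
proof (induction rule: FF_induct)
  case zero
  then show ?case by (simp add: Ej_zero)
next
  case (frag a v)
  interpret H: ring H by (rule H_ring)
  have "eqv k (psi (rho a (emb v))) (mulL a (psi (emb v)))"
    using carrier_SH[of k] frag by (auto simp: SH_def Sp_def Ej_emb)
  also have "eqv k \<dots> (mulL a (frag_of (\<one>\<^bsub>H\<^esub>, v)))" by (rule eqv_mulL[OF frag(1) psi_emb])
  finally show ?case using frag by (simp add: Ej_rho Ej_emb)
next
  case (diff q q')
  have "eqv k (psi (theta q - theta q') + psi (theta q')) (psi (theta q))"
    using eqv_sym[OF psi_add[of "theta q - theta q'" k "theta q'"]] diff by (simp add: Ej_diff)
  then have "eqv k (psi (theta q - theta q') + psi (theta q') - psi (theta q')) (psi (theta q) - psi (theta q'))"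
    by (rule eqv_diff) simp
  also have "eqv k \<dots> (q - q')" using diff by (intro eqv_diff) auto
  finally show ?case using diff by (simp add: theta_diff Ej_diff)
qed

lemma theta_injective: "q \<in> carrier (FF k) \<Longrightarrow> theta q = 0 \<Longrightarrow> q \<in> NN k"
  using psi_theta[of q k] NN_minus[of "- q" k] by (auto simp: eqv_def)

lemma theta_surj: "f \<in> Ej k \<Longrightarrow> \<exists>q\<in>carrier (FF k). theta q = f"
proof (induction rule: Ej_induct)
  case (emb v)
  interpret H: ring H by (rule H_ring)
  show ?case using emb by (intro bexI[of _ "frag_of (\<one>\<^bsub>H\<^esub>, v)"]) (simp_all add: rho_one keys_frag_of)
next
  case (xmul i f)
  then obtain q where q: "q \<in> carrier (FF k)" "theta q = f" by blast
  then show ?case using mulL_FF[OF ch_closed(1) q(1)] theta_mulL[OF ch_closed(1) q(1)]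
    by (intro bexI[of _ "mulL (ch_x P (axis i 1)) q"]) (simp_all add: rho_ch)
next
  case (add f g)
  then obtain q q' where "q \<in> carrier (FF k)" "theta q = f" "q' \<in> carrier (FF k)" "theta q' = g" by blast
  then show ?case using FF_add[of q k q'] by (intro bexI[of _ "q + q'"]) (simp_all add: theta_add)
qed

section \<open>Standard modules identified with polynomials\<close>

abbreviation Mstd where "Mstd k \<equiv> std_ext_dual P k"

text \<open>The isomorphism from the standard module to \<open>Ej k\<close>, read off from any
  representative of the coset; \<open>theta_NN\<close> makes it independent of the choice.\<close>

definition Psi :: "('a, 'a ext) std \<Rightarrow> 'a pext" where
  "Psi X = theta (SOME q. q \<in> X)"

lemma Mstd_eq: "Mstd k = extend_scalars SS H (\<lambda>a F. a \<otimes>\<^bsub>H\<^esub> sym_smash_to_ch P F) (infl k)"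
  by (simp add: std_ext_dual_def standard_module_def infl_def grpP)

lemma Mstd_simps:
  "carrier (Mstd k) = (\<lambda>q. NN k #>\<^bsub>FF k\<^esub> q) ` carrier (FF k)"
  "X \<oplus>\<^bsub>Mstd k\<^esub> Y = X <#>\<^bsub>FF k\<^esub> Y"
  "\<zero>\<^bsub>Mstd k\<^esub> = NN k"
  "a \<odot>\<^bsub>Mstd k\<^esub> X = NN k <#>\<^bsub>FF k\<^esub> (mulL a ` X)"
  unfolding Mstd_eq extend_scalars_def Let_def infl_simps FF_def[symmetric] rels_def[symmetric] NN_def[symmetric]
  by (auto simp: FactGroup_def RCOSETS_def mulL_def)

lemma coset_eq: "NN k #>\<^bsub>FF k\<^esub> q = (\<lambda>n. n + q) ` NN k"
  by (auto simp: r_coset_def)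

lemma Psi_coset: "Psi (NN k #>\<^bsub>FF k\<^esub> q) = theta q"
proof -
  have "q \<in> NN k #>\<^bsub>FF k\<^esub> q" unfolding coset_eq using NN_zero by force
  then have "(SOME p. p \<in> NN k #>\<^bsub>FF k\<^esub> q) \<in> NN k #>\<^bsub>FF k\<^esub> q" by (rule someI)
  then obtain n where "n \<in> NN k" "(SOME p. p \<in> NN k #>\<^bsub>FF k\<^esub> q) = n + q" unfolding coset_eq by blast
  then show ?thesis by (simp add: Psi_def theta_add theta_NN)
qed

lemma Psi_bij: "bij_betw Psi (carrier (Mstd k)) (Ej k)"
proof (rule bij_betw_imageI)
  show "inj_on Psi (carrier (Mstd k))"
  proof (rule inj_onI)
    fix X Y assume "X \<in> carrier (Mstd k)" "Y \<in> carrier (Mstd k)" and e: "Psi X = Psi Y"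
    then obtain q q' where q: "q \<in> carrier (FF k)" "X = NN k #>\<^bsub>FF k\<^esub> q" "q' \<in> carrier (FF k)" "Y = NN k #>\<^bsub>FF k\<^esub> q'"
      unfolding Mstd_simps by blast
    then have "theta (q - q') = 0" using e by (simp add: Psi_coset theta_diff)
    then have n: "q - q' \<in> NN k" using theta_injective FF_diff[OF q(1,3)] by blast
    have "NN k #>\<^bsub>FF k\<^esub> q = NN k #>\<^bsub>FF k\<^esub> q'"
      unfolding coset_eq
    proof safe
      fix m assume m: "m \<in> NN k"
      show "m + q \<in> (\<lambda>n. n + q') ` NN k" using NN_add[OF m n] by (intro image_eqI[of _ _ "m + (q - q')"]) auto
      show "m + q' \<in> (\<lambda>n. n + q) ` NN k" using NN_add[OF m NN_minus[OF n]] by (intro image_eqI[of _ _ "m + - (q - q')"]) auto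
    qed
    then show "X = Y" using q by simp
  qed
  show "Psi ` carrier (Mstd k) = Ej k"
    unfolding Mstd_simps image_image Psi_coset using psi_theta theta_surj by blast
qed

lemma Psi_add: "X \<in> carrier (Mstd k) \<Longrightarrow> Y \<in> carrier (Mstd k) \<Longrightarrow>
    X \<oplus>\<^bsub>Mstd k\<^esub> Y \<in> carrier (Mstd k) \<and> Psi (X \<oplus>\<^bsub>Mstd k\<^esub> Y) = Psi X + Psi Y"
proof -
  assume "X \<in> carrier (Mstd k)" "Y \<in> carrier (Mstd k)"
  then obtain q q' where q: "q \<in> carrier (FF k)" "X = NN k #>\<^bsub>FF k\<^esub> q" "q' \<in> carrier (FF k)" "Y = NN k #>\<^bsub>FF k\<^esub> q'"
    unfolding Mstd_simps by blast
  have "normal (NN k) (FF k)" by (rule comm_group.subgroup_imp_normal[OF FF_comm_group subgroup_NN])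
  then have "X \<oplus>\<^bsub>Mstd k\<^esub> Y = NN k #>\<^bsub>FF k\<^esub> (q + q')"
    using normal.rcos_sum[of "NN k" "FF k" q q'] q by (simp add: Mstd_simps)
  then show ?thesis using q FF_add[OF q(1,3)] by (auto simp: Mstd_simps Psi_coset theta_add simp del: FF_simps(1))
qed

lemma Psi_smult: "a \<in> carrier H \<Longrightarrow> X \<in> carrier (Mstd k) \<Longrightarrow>
    a \<odot>\<^bsub>Mstd k\<^esub> X \<in> carrier (Mstd k) \<and> Psi (a \<odot>\<^bsub>Mstd k\<^esub> X) = rho a (Psi X)"
proof -
  assume a: "a \<in> carrier H" and "X \<in> carrier (Mstd k)"
  then obtain q where q: "q \<in> carrier (FF k)" "X = NN k #>\<^bsub>FF k\<^esub> q"
    unfolding Mstd_simps by blast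
  have "a \<odot>\<^bsub>Mstd k\<^esub> X = NN k #>\<^bsub>FF k\<^esub> mulL a q"
  proof -
    have "NN k <#>\<^bsub>FF k\<^esub> (mulL a ` (\<lambda>n. n + q) ` NN k) = (\<lambda>n. n + mulL a q) ` NN k"
    proof (intro equalityI subsetI)
      fix x assume "x \<in> NN k <#>\<^bsub>FF k\<^esub> (mulL a ` (\<lambda>n. n + q) ` NN k)"
      then obtain n m where nm: "n \<in> NN k" "m \<in> NN k" "x = n + mulL a (m + q)"
        by (auto simp: set_mult_def)
      then have "x = (n + mulL a m) + mulL a q" by (simp add: mulL_add add.assoc)
      then show "x \<in> (\<lambda>n. n + mulL a q) ` NN k" using NN_add[OF nm(1) mulL_NN[OF a nm(2)]] by blast
    next
      fix x assume "x \<in> (\<lambda>n. n + mulL a q) ` NN k"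
      then obtain n where n: "n \<in> NN k" "x = n + mulL a (0 + q)" by auto
      then show "x \<in> NN k <#>\<^bsub>FF k\<^esub> (mulL a ` (\<lambda>n. n + q) ` NN k)"
        unfolding set_mult_def FF_simps using NN_zero[of k] by blast
    qed
    then show ?thesis unfolding Mstd_simps q(2) coset_eq .
  qed
  then show ?thesis using q a mulL_FF[OF a q(1)] by (auto simp: Mstd_simps Psi_coset theta_mulL simp del: FF_simps(1))
qed

end

section \<open>Complexified Weyl groups\<close>

abbreviation cmat :: "real^'n^'m \<Rightarrow> complex^'n^'m" where
  "cmat \<equiv> map_matrix complex_of_real"

definition cvec_of :: "real^'n \<Rightarrow> complex^'n" where
  "cvec_of x = (\<chi> i. complex_of_real (x $ i))"

lemma cvec_of_nth [simp]: "cvec_of x $ i = complex_of_real (x $ i)"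
  by (simp add: cvec_of_def)

lemma cvec_of_simps: "cvec_of (x + y) = cvec_of x + cvec_of y" "cvec_of (x - y) = cvec_of x - cvec_of y"
  "cvec_of (- x) = - cvec_of x"
  "cvec_of (r *\<^sub>R x) = complex_of_real r *\<^sub>C cvec_of x" "cvec_of 0 = 0"
  by (simp_all add: vec_eq_iff cscale_complex_def)

lemma cvec_of_axis: "cvec_of (axis i 1) = axis i 1"
  by (simp add: vec_eq_iff axis_def)

lemma cmat_mult: "cmat (A ** B) = cmat A ** cmat (B :: real^'n::finite^'m::finite)"
  by (simp add: vec_eq_iff matrix_matrix_mult_def nth_map_matrix)

lemma cmat_one: "cmat (mat 1) = mat 1"
  by (simp add: vec_eq_iff mat_def nth_map_matrix)

lemma cmat_transpose: "cmat (transpose A) = transpose (cmat A)"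
  by (simp add: vec_eq_iff transpose_def nth_map_matrix)

lemma cmat_mult_cvec_of: "cmat A *v cvec_of x = cvec_of (A *v (x :: real^'n::finite))"
  by (simp add: vec_eq_iff matrix_vector_mult_def nth_map_matrix)

lemma det_cmat: "det (cmat A) = complex_of_real (det (A :: real^'n::finite^'n))"
  by (simp add: det_def nth_map_matrix)

lemma pairing_cvec_of: "pairing (cvec_of x) (cvec_of y) = complex_of_real (x \<bullet> y)"
  by (simp add: pairing_def inner_vec_def)

lemma cvec_of_eq_0_iff: "cvec_of x = 0 \<longleftrightarrow> x = 0"
  by (simp add: vec_eq_iff)

abbreviation rrm :: "real^'n \<Rightarrow> real^'n::finite^'n" where
  "rrm a \<equiv> matrix (root_reflection a)"

lemma linear_root_reflection: "linear (root_reflection a)"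
  by (rule linearI) (simp_all add: root_reflection_def algebra_simps inner_add_left add_divide_distrib)

lemma real_matrix_works: "linear f \<Longrightarrow> matrix f *v x = f (x :: real^'n::finite)"
  using matrix_vector_mul(2)[of f] by metis

lemma rrm_mult: "rrm a *v v = root_reflection a v"
  by (rule real_matrix_works[OF linear_root_reflection])

lemma root_reflection_self: "a \<noteq> 0 \<Longrightarrow> root_reflection a a = - a"
  by (simp add: root_reflection_def scaleR_2)

lemma root_reflection_sq: "a \<noteq> 0 \<Longrightarrow> root_reflection a (root_reflection a v) = v"
  by (simp add: root_reflection_def inner_diff_left algebra_simps flip: scaleR_left_distrib)

lemma cmat_rrm_mult: "cmat (rrm a) *v y = y - (2 * pairing y (cvec_of a) / complex_of_real (a \<bullet> a)) *\<^sub>C cvec_of a"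
proof (rule clin_vec_eqI[of "(*v) (cmat (rrm a))" "\<lambda>y. y - (2 * pairing y (cvec_of a) / complex_of_real (a \<bullet> a)) *\<^sub>C cvec_of a"])
  show "clin ((*v) (cmat (rrm a)))"
    by (rule clinI) (simp_all add: matrix_vector_right_distrib cscale_vec_eq vector_scalar_commute)
  show "clin (\<lambda>y. y - (2 * pairing y (cvec_of a) / complex_of_real (a \<bullet> a)) *\<^sub>C cvec_of a)"
    by (rule clinI) (simp_all add: clin_add[OF clin_pairing_left] clin_scale[OF clin_pairing_left] cscale_complex_def
       cscale_diff_right add_divide_distrib distrib_left cscale_add_left mult.left_commute)
  fix i :: 'a
  have "cmat (rrm a) *v axis i 1 = cmat (rrm a) *v cvec_of (axis i 1)" by (simp add: cvec_of_axis)
  also have "\<dots> = axis i 1 - (2 * pairing (cvec_of (axis i 1)) (cvec_of a) / complex_of_real (a \<bullet> a)) *\<^sub>C cvec_of a"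
    unfolding cmat_mult_cvec_of rrm_mult root_reflection_def by (simp only: cvec_of_simps pairing_cvec_of[symmetric] cvec_of_axis of_real_divide of_real_mult of_real_numeral)
  finally show "cmat (rrm a) *v axis i 1 = axis i 1 - (2 * pairing (axis i 1) (cvec_of a) / complex_of_real (a \<bullet> a)) *\<^sub>C cvec_of a"
    by (simp only: cvec_of_axis)
qed

text \<open>An orthogonal map taking \<open>a\<close> to a multiple of a coordinate vector
  conjugates the reflection to a diagonal matrix with a single -1.\<close>

lemma det_reflection:
  assumes "a \<noteq> (0 :: real^'n::finite)"
  shows "det (rrm a) = -1"
proof -
  obtain k :: 'n where True by blast
  have nrm: "norm a = norm (norm a *\<^sub>R axis k (1 :: real) :: real^'n)" by simp
  obtain f where f: "orthogonal_transformation f" "f a = norm a *\<^sub>R axis k (1 :: real)"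
    using orthogonal_transformation_exists[OF nrm] by blast
  let ?F = "matrix f"
  have F: "orthogonal_matrix ?F" and fl: "linear f" using f(1) by (auto simp: orthogonal_transformation_matrix)
  have fF: "?F *v v = f v" for v using real_matrix_works[OF fl] .
  let ?D = "(\<chi> i j. if i = j then if i = k then -1 else 1 else 0) :: real^'n^'n"
  have "?D *v (?F *v v) = ?F *v (rrm a *v v)" for v
  proof -
    have "f v \<bullet> f a = v \<bullet> a" using f(1) by (simp add: orthogonal_transformation_def)
    then have "v \<bullet> a = norm a * f v $ k" by (simp add: f(2) inner_axis)
    then have *: "?F *v (rrm a *v v) = f v - (2 * f v $ k) *\<^sub>R axis k 1"
      unfolding rrm_mult fF root_reflection_def using assms
      by (simp add: linear_diff[OF fl] linear_scale[OF fl] f(2) dot_square_norm power2_eq_square)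
    have "(?D *v u) $ i = (if i = k then - (u $ i) else u $ i)" for u i
    proof -
      have "(?D *v u) $ i = (\<Sum>j\<in>UNIV. if i = j then (if i = k then - (u $ i) else u $ i) else 0)"
        unfolding matrix_vector_mult_def vec_lambda_beta by (rule sum.cong) auto
      then show ?thesis by simp
    qed
    then show ?thesis unfolding * unfolding fF vec_eq_iff by (simp add: axis_def)
  qed
  then have "?D ** ?F = ?F ** rrm a"
    unfolding matrix_eq matrix_vector_mul_assoc by blast
  then have "det (?D ** ?F) = det (?F ** rrm a)" by (rule arg_cong)
  then have "det ?D * det ?F = det ?F * det (rrm a)" by (simp only: det_mul)
  moreover have "det ?F \<noteq> 0" using det_orthogonal_matrix[OF F] by auto
  moreover have "det ?D = -1"
  proof -
    have "det ?D = (\<Prod>i\<in>UNIV. ?D $ i $ i)" by (rule det_diagonal) simp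
    also have "\<dots> = (\<Prod>i\<in>UNIV. if i = k then -1 else 1)" by simp
    finally show ?thesis by simp
  qed
  ultimately have "det ?F * (det (rrm a) + 1) = 0" by (simp add: distrib_left)
  with \<open>det ?F \<noteq> 0\<close> show ?thesis by simp
qed

text \<open>A rank one perturbation \<open>1 - q r\<^sup>T\<close> of the identity is orthogonal only if \<open>r\<close> is a
  multiple of \<open>q\<close>.\<close>

lemma orthogonal_rank_one:
  fixes R :: "real^'n::finite^'n" and g \<alpha> :: "complex^'n"
  assumes R: "R ** transpose R = mat 1" and "R \<noteq> mat 1"
    and s: "\<And>y. cmat R *v y = y - pairing y \<alpha> *\<^sub>C g"
  obtains q where "q \<noteq> 0" "R = rrm q"
proof -
  define N where "N = (\<lambda>i j. mat 1 $ i $ j - R $ i $ j)"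
  have Nc: "complex_of_real (N i j) = g $ i * \<alpha> $ j" for i j
  proof -
    have "(cmat R *v axis j 1) $ i = axis j 1 $ i - \<alpha> $ j * g $ i" by (simp add: s cscale_complex_def)
    then show ?thesis unfolding mult_axis_nth by (simp add: N_def nth_map_matrix mat_def axis_def split: if_splits)
  qed
  \<comment> \<open>\<open>g\<close> and \<open>\<alpha>\<close> are complex, so rank one is
    recorded by the vanishing of the 2 by 2 minors, which is a statement about the real entries of
    \<open>N\<close>.\<close>
  have Nr: "N i j * N k l = N i l * N k j" for i j k l
  proof -
    have "complex_of_real (N i j * N k l) = complex_of_real (N i l * N k j)" by (simp add: Nc)
    then show ?thesis using of_real_eq_iff by blast
  qed
  \<comment> \<open>Orthogonality of \<open>R = 1 - N\<close>, with the identity cancelled.\<close>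
  have No: "N i j + N j i = (\<Sum>k\<in>UNIV. N i k * N j k)" for i j
  proof -
    have "(\<Sum>k\<in>UNIV. R $ i $ k * R $ j $ k) = mat 1 $ i $ j"
      using R by (simp add: matrix_matrix_mult_def transpose_def vec_eq_iff)
    moreover have "(\<Sum>k\<in>UNIV. N i k * N j k) = (\<Sum>k\<in>UNIV. (if i = k then if j = k then 1 else 0 else 0)
       - (if i = k then R $ j $ k else 0) - (if j = k then R $ i $ k else 0) + R $ i $ k * R $ j $ k)"
      by (rule sum.cong) (auto simp: N_def mat_def algebra_simps)
    ultimately show ?thesis by (simp add: sum.distrib sum_subtractf N_def mat_def)
  qed
  obtain i j where ij: "N i j \<noteq> 0" using \<open>R \<noteq> mat 1\<close> by (force simp: N_def vec_eq_iff)
  define m where "m = N i j"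
  define q :: "real^'n" where "q = (\<chi> k. N k j)"
  define r where "r = (\<lambda>l. N i l)"
  define \<nu> where "\<nu> = ((\<Sum>k\<in>UNIV. r k * r k) - r i) / m"
  have m: "m \<noteq> 0" using ij by (simp add: m_def)
  have N: "N k l = q $ k * r l / m" for k l using Nr[of k l i j] m by (simp add: m_def q_def r_def field_simps)
  have r: "r l = \<nu> * q $ l" for l
  proof -
    have "N l i + r l = (\<Sum>k\<in>UNIV. N l k * r k)" using No[of l i] by (simp add: r_def)
    also have "\<dots> = q $ l / m * (\<Sum>k\<in>UNIV. r k * r k)" by (simp add: N sum_distrib_left mult_ac)
    finally show ?thesis by (simp add: \<nu>_def N) (simp add: algebra_simps diff_divide_distrib)
  qed
  define \<mu> where "\<mu> = \<nu> / m"
  have N': "N k l = \<mu> * q $ k * q $ l" for k l by (simp add: N r \<mu>_def)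
  have qi: "q $ i = m" by (simp add: q_def m_def)
  then have q: "q \<noteq> 0" using m by auto
  have \<mu>0: "\<mu> \<noteq> 0" using m N'[of i j] by (auto simp: m_def)
  \<comment> \<open>The orthogonality relation at one diagonal entry determines the remaining
    scalar.\<close>
  have "2 * N i i = (\<Sum>k\<in>UNIV. N i k * N i k)" using No[of i i] by simp
  also have "\<dots> = \<mu>\<^sup>2 * m\<^sup>2 * (q \<bullet> q)"
    by (simp add: N' qi inner_vec_def sum_distrib_left power2_eq_square mult_ac)
  finally have "\<mu> * (q \<bullet> q) = 2" using \<mu>0 m by (simp add: N' qi power2_eq_square) 
  then have \<mu>: "\<mu> = 2 / (q \<bullet> q)" using q by (simp add: field_simps)
  have "R *v v = root_reflection q v" for v
  proof (rule vec_eq_iff[THEN iffD2], rule allI)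
    fix k
    have "(R *v v) $ k = (\<Sum>l\<in>UNIV. (if k = l then v $ l else 0) - N k l * v $ l)"
      unfolding matrix_vector_mult_def by (auto simp: N_def mat_def algebra_simps intro!: sum.cong)
    also have "\<dots> = v $ k - \<mu> * q $ k * (v \<bullet> q)"
      by (simp add: sum_subtractf N' inner_vec_def sum_distrib_left mult_ac)
    finally show "(R *v v) $ k = root_reflection q v $ k" by (simp add: root_reflection_def \<mu>)
  qed
  then have "R = rrm q" by (simp add: matrix_eq rrm_mult)
  with q show thesis by (rule that)
qed

text \<open>The fixed space is a hyperplane, and \<open>\<alpha>\<close> is nonzero off it, since
  otherwise it would vanish on a spanning set. So \<open>1 - s\<close> and \<open>\<alpha>\<close>
  have the same kernel, and \<open>1 - s\<close> is \<open>\<alpha>\<close> times a vector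
  \<open>g\<close>.\<close>

lemma fix_hyperplane:
  fixes s :: "complex^'n::finite^'n"
  assumes dim: "vec.dim {y. s *v y = y} = CARD('n) - 1"
    and \<alpha>: "\<alpha> \<noteq> 0" "\<And>y. s *v y = y \<Longrightarrow> pairing y \<alpha> = 0"
  obtains g where "\<And>y. s *v y = y - pairing y \<alpha> *\<^sub>C g" "s \<noteq> mat 1"
proof -
  let ?U = "{y. s *v y = y}"
  have sub: "vec.subspace ?U"
    by (auto simp: vec.subspace_def matrix_vector_right_distrib vector_scalar_commute)
  have "?U \<noteq> UNIV" 
  proof
    assume "?U = UNIV"
    then have "vec.dim ?U = CARD('n)" by (simp add: vec_dim_card card_cart_basis)
    then show False using dim by (metis diff_less less_numeral_extra(1) nat_neq_iff zero_less_card_finite)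
  qed
  then obtain y0 where y0: "s *v y0 \<noteq> y0" by blast
  have "vec.dim (insert y0 ?U) = CARD('n)"
    using y0 sub dim by (simp add: vec.dim_insert vec.span_eq_iff[THEN iffD2])
  then have full: "vec.span (insert y0 ?U) = UNIV" using vec.dim_eq_full[of "insert y0 {y. s *v y = y}"] by (simp add: vec.dimension_def card_cart_basis del: vec.dim_insert)
  have dec: "\<exists>k. s *v (y - k *\<^sub>C y0) = y - k *\<^sub>C y0" for y
  proof -
    have "y \<in> vec.span (insert y0 ?U)" using full by simp
    then obtain k where "y - k *s y0 \<in> vec.span ?U" by (auto simp: vec.span_insert)
    then show ?thesis using sub by (auto simp: vec.span_eq_iff[THEN iffD2] cscale_vec_eq)
  qed
  have p0: "pairing y0 \<alpha> \<noteq> 0"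
  proof
    assume p: "pairing y0 \<alpha> = 0"
    have "pairing y \<alpha> = 0" for y
    proof -
      obtain k where "s *v (y - k *\<^sub>C y0) = y - k *\<^sub>C y0" using dec by blast
      then show ?thesis using \<alpha>(2)[of "y - k *\<^sub>C y0"] p
        by (simp add: clin_diff[OF clin_pairing_left] clin_scale[OF clin_pairing_left])
    qed
    then have "\<alpha> $ i = 0" for i using pairing_axis_left[of i \<alpha>] by simp
    then show False using \<alpha>(1) by (simp add: vec_eq_iff)
  qed
  define g where "g = (1 / pairing y0 \<alpha>) *\<^sub>C (y0 - s *v y0)"
  have "s *v y = y - pairing y \<alpha> *\<^sub>C g" for y
  proof -
    obtain k where k: "s *v (y - k *\<^sub>C y0) = y - k *\<^sub>C y0" using dec by blast
    then have "pairing y \<alpha> = k * pairing y0 \<alpha>" using \<alpha>(2)[of "y - k *\<^sub>C y0"]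
      by (simp add: clin_diff[OF clin_pairing_left] clin_scale[OF clin_pairing_left] cscale_complex_def)
    then have "pairing y \<alpha> *\<^sub>C g = k *\<^sub>C (y0 - s *v y0)" using p0 by (simp add: g_def)
    moreover have "s *v y = y - k *\<^sub>C y0 + k *\<^sub>C (s *v y0)"
      using k by (simp add: clin_diff[OF clin_matrix_vector] clin_scale[OF clin_matrix_vector] diff_eq_eq)
    ultimately show ?thesis by (simp add: cscale_diff_right)
  qed
  moreover have "s \<noteq> mat 1" using y0 by auto
  ultimately show thesis by (rule that)
qed

text \<open>Each coordinate vector is projected orthogonally to \<open>q\<close>. The projection is
  fixed by the reflection, so \<open>\<alpha>\<close> vanishes on it, which gives the coordinates of
  \<open>\<alpha>\<close>.\<close>

lemma annihilates_fixed_hyperplane: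
  assumes q: "q \<noteq> 0" and \<alpha>: "\<And>y. cmat (rrm q) *v y = y \<Longrightarrow> pairing y \<alpha> = 0"
  shows "\<exists>k. \<alpha> = k *\<^sub>C cvec_of (q :: real^'n::finite)"
proof (rule exI)
  let ?k = "pairing (cvec_of q) \<alpha> / complex_of_real (q \<bullet> q)"
  show "\<alpha> = ?k *\<^sub>C cvec_of q"
  proof (rule vec_eq_iff[THEN iffD2], rule allI)
    fix i
    let ?z = "axis i 1 - (complex_of_real (q $ i) / complex_of_real (q \<bullet> q)) *\<^sub>C cvec_of q"
    have "pairing ?z (cvec_of q) = 0" using q
      by (simp add: clin_diff[OF clin_pairing_left] clin_scale[OF clin_pairing_left] cscale_complex_def pairing_cvec_of)
    then have "cmat (rrm q) *v ?z = ?z" unfolding cmat_rrm_mult by simp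
    then have "pairing ?z \<alpha> = 0" by (rule \<alpha>)
    then show "\<alpha> $ i = (?k *\<^sub>C cvec_of q) $ i"
      by (simp add: clin_diff[OF clin_pairing_left] clin_scale[OF clin_pairing_left] cscale_complex_def)
  qed
qed

lemma GLn_group: "group (GLn :: 'n::finite mtx monoid)"
proof (rule groupI)
  show "\<exists>y\<in>carrier GLn. y \<otimes>\<^bsub>GLn\<^esub> x = \<one>\<^bsub>GLn\<^esub>" if "x \<in> carrier GLn" for x :: "'n mtx"
    using that by (auto simp: GLn_def invertible_def)
  show "x \<otimes>\<^bsub>GLn\<^esub> y \<in> carrier GLn" if "x \<in> carrier GLn" "y \<in> carrier GLn" for x y :: "'n mtx"
    using that by (simp add: GLn_def invertible_mult)
  show "\<one>\<^bsub>GLn\<^esub> \<in> carrier (GLn :: 'n mtx monoid)"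
    by (auto simp: GLn_def invertible_def intro: exI[of _ "mat 1"])
qed (auto simp: GLn_def matrix_mul_assoc)

section \<open>Weyl groups as finite groups of real orthogonal matrices\<close>

context
  fixes \<Phi> :: "(real^'n::{finite,linorder}) set"
  assumes irr: "irreducible_root_system \<Phi>"
begin

lemma finite_roots: "finite \<Phi>" and span_roots: "span \<Phi> = UNIV" and root_nonzero: "a \<in> \<Phi> \<Longrightarrow> a \<noteq> 0"
  and root_closed: "a \<in> \<Phi> \<Longrightarrow> b \<in> \<Phi> \<Longrightarrow> root_reflection a b \<in> \<Phi>"
  using irr by (auto simp: irreducible_root_system_def root_system_def)

lemma rrm_sq: "a \<in> \<Phi> \<Longrightarrow> cmat (rrm a) ** cmat (rrm a) = mat 1"
proof -
  assume a: "a \<in> \<Phi>"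
  have "rrm a ** rrm a = mat 1"
    unfolding matrix_eq matrix_vector_mul_assoc[symmetric] rrm_mult
    using root_reflection_sq[OF root_nonzero[OF a]] by simp
  then show ?thesis by (metis cmat_mult cmat_one)
qed

lemma rrm_GLn: "a \<in> \<Phi> \<Longrightarrow> cmat (rrm a) \<in> carrier GLn"
  using rrm_sq[of a] by (auto simp: GLn_def invertible_def)

lemma rrm_GLn_inv: "a \<in> \<Phi> \<Longrightarrow> inv\<^bsub>GLn\<^esub> (cmat (rrm a)) = cmat (rrm a)"
  using group.inv_equality[OF GLn_group _ rrm_GLn rrm_GLn, of a a] rrm_sq[of a] by (simp add: GLn_def)

lemma rrm_in_weyl_group: "a \<in> \<Phi> \<Longrightarrow> cmat (rrm a) \<in> weyl_group \<Phi>"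
  unfolding weyl_group_def by (auto intro: generate.incl)

lemma transpose_rrm: "a \<in> \<Phi> \<Longrightarrow> transpose (rrm a) = rrm a"
proof -
  have "x \<bullet> (rrm a *v y) = (rrm a *v x) \<bullet> y" for x y
    by (simp add: rrm_mult root_reflection_def inner_diff_left inner_diff_right inner_commute)
  then have "(transpose (rrm a) *v x) \<bullet> y = (rrm a *v x) \<bullet> y" for x y
    by (metis dot_lmul_matrix transpose_matrix_vector vector_transpose_matrix)
  then have "transpose (rrm a) *v x = rrm a *v x" for x
    by (metis vector_eq_rdot)
  then show ?thesis by (simp add: matrix_eq)
qed

lemma weyl_group_induct [consumes 1, case_names one refl mult]:
  assumes "w \<in> weyl_group \<Phi>" and "Q (mat 1)" and "\<And>a. a \<in> \<Phi> \<Longrightarrow> Q (cmat (rrm a))"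
    and "\<And>g h. g \<in> weyl_group \<Phi> \<Longrightarrow> h \<in> weyl_group \<Phi> \<Longrightarrow> Q g \<Longrightarrow> Q h \<Longrightarrow> Q (g ** h)"
  shows "Q w"
  using assms(1) unfolding weyl_group_def
proof (induction rule: generate.induct)
  case one
  show ?case using assms(2) by (simp add: GLn_def)
next
  case (incl h)
  then show ?case using assms(3) by auto
next
  case (inv h)
  then show ?case using assms(3) rrm_GLn_inv by auto
next
  case (eng h1 h2)
  then show ?case using assms(4) by (simp add: GLn_def weyl_group_def)
qed

lemma weyl_group_mult: "g \<in> weyl_group \<Phi> \<Longrightarrow> h \<in> weyl_group \<Phi> \<Longrightarrow> g ** h \<in> weyl_group \<Phi>"
  unfolding weyl_group_def using generate.eng[of g GLn _ h] by (simp add: GLn_def)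

lemma weyl_group_one: "mat 1 \<in> weyl_group \<Phi>"
  unfolding weyl_group_def using generate.one[of GLn] by (simp add: GLn_def)

lemma weyl_group_transpose: "w \<in> weyl_group \<Phi> \<Longrightarrow> transpose w \<in> weyl_group \<Phi>"
proof (induction rule: weyl_group_induct)
  case one
  then show ?case by (simp add: weyl_group_one)
next
  case (refl a)
  then show ?case by (simp add: rrm_in_weyl_group transpose_rrm flip: cmat_transpose)
next
  case (mult g h)
  then show ?case by (simp add: matrix_transpose_mul weyl_group_mult)
qed

text \<open>Three facts proved together along the generators: reality serves to locate the normal
  vectors of reflections, orthogonality to identify \<open>h\<close> with \<open>h*\<close>, and
  stability of the roots to show finiteness.\<close>

lemma weyl_group_real:
  "w \<in> weyl_group \<Phi> \<Longrightarrow> \<exists>R. w = cmat R \<and> R ** transpose R = mat 1 \<and> (\<forall>x\<in>\<Phi>. R *v x \<in> \<Phi>)"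
proof (induction rule: weyl_group_induct)
  case one
  show ?case by (rule exI[of _ "mat 1"]) (simp add: cmat_one)
next
  case (refl a)
  have "rrm a ** rrm a = mat 1"
    unfolding matrix_eq matrix_vector_mul_assoc[symmetric] rrm_mult
    using root_reflection_sq[OF root_nonzero[OF refl]] by simp
  then show ?case using refl by (intro exI[of _ "rrm a"]) (simp add: transpose_rrm rrm_mult root_closed)
next
  case (mult g h)
  then obtain R S where "g = cmat R" "R ** transpose R = mat 1" "\<forall>x\<in>\<Phi>. R *v x \<in> \<Phi>"
    and "h = cmat S" "S ** transpose S = mat 1" "\<forall>x\<in>\<Phi>. S *v x \<in> \<Phi>" by blast
  moreover have "(R ** S) ** transpose (R ** S) = R ** (S ** transpose S) ** transpose R"
    by (simp add: matrix_transpose_mul matrix_mul_assoc)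
  ultimately show ?case
    by (intro exI[of _ "R ** S"]) (simp add: cmat_mult flip: matrix_vector_mul_assoc)
qed

lemma weyl_group_orthogonal: "w \<in> weyl_group \<Phi> \<Longrightarrow> w ** transpose w = mat 1"
  using weyl_group_real[of w] by (metis cmat_mult cmat_one cmat_transpose)

text \<open>The elements map the finitely many roots to roots, and a matrix is determined by its
  values on them as they span.\<close>

lemma finite_weyl_group: "finite (weyl_group \<Phi>)"
proof -
  let ?S = "{R. \<forall>x\<in>\<Phi>. R *v x \<in> \<Phi>}"
  have inj: "inj_on (\<lambda>R. restrict ((*v) R) \<Phi>) ?S"
  proof (rule inj_onI)
    fix R S assume "R \<in> ?S" "S \<in> ?S" and "restrict ((*v) R) \<Phi> = restrict ((*v) S) \<Phi>"
    then have "R *v x = S *v x" if "x \<in> \<Phi>" for x using that by (metis restrict_apply')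
    then have on: "x \<in> \<Phi> \<Longrightarrow> R *v x = S *v x" for x .
    have "R *v x = S *v x" for x
    proof -
      have "x \<in> span \<Phi>" by (simp add: span_roots)
      then show ?thesis
        by (induction rule: span_induct_alt) (simp_all add: on matrix_vector_right_distrib matrix_vector_mult_scaleR)
    qed
    then show "R = S" by (simp add: matrix_eq)
  qed
  have sub: "(\<lambda>R. restrict ((*v) R) \<Phi>) ` ?S \<subseteq> (\<Phi> \<rightarrow>\<^sub>E \<Phi>)" by auto
  have "finite (\<Phi> \<rightarrow>\<^sub>E \<Phi>)" using finite_roots by (simp add: finite_PiE)
  then have "finite ?S" using finite_imageD[OF finite_subset[OF sub] inj] by simp
  moreover have "weyl_group \<Phi> \<subseteq> cmat ` ?S" using weyl_group_real by blast
  ultimately show ?thesis by (rule finite_surj)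
qed

text \<open>The fixed space of the conjugate is the image of the fixed space under an injective
  map.\<close>

lemma reflections_conj:
  assumes w: "w \<in> weyl_group \<Phi>" and s: "s \<in> reflections (weyl_group \<Phi>)"
  shows "w ** s ** transpose w \<in> reflections (weyl_group \<Phi>)"
proof -
  have tw: "transpose w ** w = mat 1" using weyl_group_orthogonal[OF w] matrix_left_right_inverse by blast
  have "{y. (w ** s ** transpose w) *v y = y} = (*v) w ` {y. s *v y = y}"
  proof (intro Set.set_eqI iffI)
    fix y assume "y \<in> {y. (w ** s ** transpose w) *v y = y}"
    then have y: "w *v (s *v (transpose w *v y)) = y" by (simp add: matrix_vector_mul_assoc matrix_mul_assoc del: transpose_matrix_vector)
    then have "s *v (transpose w *v y) = transpose w *v y"
      by (metis matrix_vector_mul_assoc matrix_vector_mul_lid tw)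
    moreover have "y = w *v (transpose w *v y)"
      by (simp add: matrix_vector_mul_assoc weyl_group_orthogonal[OF w] del: transpose_matrix_vector)
    ultimately show "y \<in> (*v) w ` {y. s *v y = y}" by blast
  next
    fix y assume "y \<in> (*v) w ` {y. s *v y = y}"
    then obtain z where z: "s *v z = z" "y = w *v z" by auto
    have "(w ** s ** transpose w) *v y = w *v (s *v ((transpose w ** w) *v z))"
      by (simp add: z matrix_vector_mul_assoc matrix_mul_assoc)
    then show "y \<in> {y. (w ** s ** transpose w) *v y = y}" by (simp add: tw z)
  qed
  moreover have "vec.dim ((*v) w ` {y. s *v y = y}) = vec.dim {y. s *v y = y}"
  proof (rule vec.dim_image_eq)
    show "Vector_Spaces.linear (*s) (*s) ((*v) w)" by (rule matrix_vector_mul_linear_gen)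
    show "inj_on ((*v) w) (vec.span {y. s *v y = y})"
      by (rule inj_onI) (metis matrix_vector_mul_assoc matrix_vector_mul_lid tw)
  qed
  ultimately show ?thesis using s w unfolding reflections_def
    by (simp add: weyl_group_mult weyl_group_transpose)
qed

end

section \<open>Reflections of a Weyl group and Schur's lemma\<close>

context
  fixes \<Phi> :: "(real^'n::{finite,linorder}) set" and P :: "'n cherednik_data"
  assumes irr: "irreducible_root_system \<Phi>" and grp: "refl_grp P = weyl_group \<Phi>"
    and data: "is_cherednik_data P"
begin

lemma param_conj:
  "w \<in> weyl_group \<Phi> \<Longrightarrow> s \<in> reflections (weyl_group \<Phi>) \<Longrightarrow> param P (w ** s ** transpose w) = param P s"
  using data matrix_inv_orthogonal[OF weyl_group_orthogonal[OF irr, of w]]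
  unfolding is_cherednik_data_def grp by metis

text \<open>Membership in \<open>reflections\<close> speaks only of the fixed space, so the normal
  vector \<open>q\<close> is produced by linear algebra: the matrix is real orthogonal and fixes a
  hyperplane. It is not claimed to be a root.\<close>

lemma reflection_root:
  assumes s: "s \<in> reflections (weyl_group \<Phi>)"
  obtains q k l where "q \<noteq> 0" "s = cmat (rrm q)" "k \<noteq> 0" "alpha P s = k *\<^sub>C cvec_of q"
    "l \<noteq> 0" "alpha_vee P s = l *\<^sub>C cvec_of q"
proof -
  have sW: "s \<in> weyl_group \<Phi>" using s by (simp add: reflections_def)
  have \<alpha>: "alpha P s \<noteq> 0" "\<And>y. s *v y = y \<Longrightarrow> pairing y (alpha P s) = 0"
    and \<alpha>': "alpha_vee P s \<noteq> 0" "\<And>y. s *v y = y \<Longrightarrow> pairing y (alpha_vee P s) = 0"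
    using data s contragredient_orthogonal[OF weyl_group_orthogonal[OF irr sW]]
    unfolding is_cherednik_data_def grp by (auto simp: pairing_commute)
  obtain R where R: "s = cmat R" "R ** transpose R = mat 1" using weyl_group_real[OF irr sW] by blast
  obtain g where g: "\<And>y. s *v y = y - pairing y (alpha P s) *\<^sub>C g" "s \<noteq> mat 1"
    using fix_hyperplane[of s "alpha P s"] \<alpha> s unfolding reflections_def by blast
  have "R \<noteq> mat 1" using g(2) R(1) cmat_one by metis
  then obtain q where q: "q \<noteq> 0" "R = rrm q"
    using orthogonal_rank_one[OF R(2)] g(1) R(1) by metis
  obtain k l where kl: "alpha P s = k *\<^sub>C cvec_of q" "alpha_vee P s = l *\<^sub>C cvec_of q"
    using annihilates_fixed_hyperplane[OF q(1)] \<alpha>(2) \<alpha>'(2) unfolding R(1) q(2) by metis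
  then have "k \<noteq> 0" "l \<noteq> 0" using \<alpha>(1) \<alpha>'(1) by auto
  with kl q R(1) show thesis using that by blast
qed

definition coroot :: "'n mtx \<Rightarrow> 'n cvect" where
  "coroot s = (2 / pairing (alpha_vee P s) (alpha P s)) *\<^sub>C alpha_vee P s"

lemma det_reflection_weyl: "s \<in> reflections (weyl_group \<Phi>) \<Longrightarrow> det s = -1"
  by (metis reflection_root det_cmat det_reflection of_real_1 of_real_minus)

lemma reflection_formula:
  assumes s: "s \<in> reflections (weyl_group \<Phi>)"
  shows "s *v y = y - pairing y (alpha P s) *\<^sub>C coroot s" "pairing (coroot s) (alpha P s) = 2"
    "pairing (alpha_vee P s) (alpha P s) \<noteq> 0"
proof -
  obtain q k l where q: "q \<noteq> 0" "s = cmat (rrm q)" "k \<noteq> 0" "alpha P s = k *\<^sub>C cvec_of q"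
    "l \<noteq> 0" "alpha_vee P s = l *\<^sub>C cvec_of q" by (rule reflection_root[OF s])
  have p: "pairing (alpha_vee P s) (alpha P s) = l * k * complex_of_real (q \<bullet> q)"
    unfolding q(4,6) clin_scale[OF clin_pairing_left] clin_scale[OF clin_pairing_right]
    by (simp add: cscale_complex_def pairing_cvec_of)
  show ne: "pairing (alpha_vee P s) (alpha P s) \<noteq> 0" unfolding p using q(1,3,5) by simp
  then show "pairing (coroot s) (alpha P s) = 2"
    by (simp add: coroot_def clin_scale[OF clin_pairing_left] cscale_complex_def)
  have "pairing y (alpha P s) *\<^sub>C coroot s = (2 * pairing y (cvec_of q) / complex_of_real (q \<bullet> q)) *\<^sub>C cvec_of q"
    unfolding coroot_def p unfolding q(4,6) clin_scale[OF clin_pairing_right]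
    using q(1,3,5) by (simp add: cscale_complex_def mult.commute)
  then show "s *v y = y - pairing y (alpha P s) *\<^sub>C coroot s" using cmat_rrm_mult q(2) by metis
qed

text \<open>Schur's lemma by hand. \<open>C\<close> commutes with the group, so it preserves the
  line on which a root reflection acts by -1, and each root is an eigenvector. Roots that are not
  orthogonal share their eigenvalue, so irreducibility leaves only one; and the roots span.\<close>

lemma root_reflection_scalar:
  "\<exists>\<kappa>. \<forall>y. (\<Sum>s\<in>reflections (weyl_group \<Phi>). param P s *\<^sub>C (y - s *v y)) = \<kappa> *\<^sub>C y"
proof -
  let ?Rf = "reflections (weyl_group \<Phi>)"
  define C where "C = (\<lambda>y :: 'n cvect. \<Sum>s\<in>?Rf. param P s *\<^sub>C (y - s *v y))"
  have clC: "clin C" unfolding C_def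
    by (intro clin_sumf clin_cscale clinI)
      (simp_all add: matrix_vector_right_distrib cscale_vec_eq vector_scalar_commute vec.scale_right_diff_distrib)
  have comm: "C (w *v y) = w *v C y" if w: "w \<in> weyl_group \<Phi>" for w y
  proof -
    have tw: "transpose w ** w = mat 1" using weyl_group_orthogonal[OF irr w] matrix_left_right_inverse by blast
    have wt: "w ** transpose w = mat 1" using weyl_group_orthogonal[OF irr w] .
    have inv: "transpose w ** (w ** s ** transpose w) ** w = s" for s
      using tw by (metis matrix_mul_assoc matrix_mul_lid matrix_mul_rid)
    have inv': "w ** (transpose w ** s ** w) ** transpose w = s" for s
      using wt by (metis matrix_mul_assoc matrix_mul_lid matrix_mul_rid)
    have "C (w *v y) = (\<Sum>s\<in>?Rf. param P (w ** s ** transpose w) *\<^sub>C (w *v y - (w ** s ** transpose w) *v (w *v y)))"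
      unfolding C_def
    proof (rule sum.reindex_bij_witness[where i = "\<lambda>s. w ** s ** transpose w" and j = "\<lambda>s. transpose w ** s ** w"])
      fix s assume s: "s \<in> ?Rf"
      show "w ** (transpose w ** s ** w) ** transpose w = s" by (rule inv')
      show "transpose w ** s ** w \<in> ?Rf"
        using reflections_conj[OF irr weyl_group_transpose[OF irr w] s] by simp
      show "param P (w ** (transpose w ** s ** w) ** transpose w) *\<^sub>C
          (w *v y - (w ** (transpose w ** s ** w) ** transpose w) *v (w *v y)) = param P s *\<^sub>C (w *v y - s *v (w *v y))"
        by (simp only: inv')
      show "transpose w ** (w ** s ** transpose w) ** w = s" by (rule inv)
      show "w ** s ** transpose w \<in> ?Rf" by (rule reflections_conj[OF irr w s])
    qed
    also have "\<dots> = (\<Sum>s\<in>?Rf. param P s *\<^sub>C (w *v (y - s *v y)))"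
    proof (rule sum.cong[OF refl])
      fix s assume s: "s \<in> ?Rf"
      have "(w ** s ** transpose w) *v (w *v y) = w *v (s *v ((transpose w ** w) *v y))"
        by (simp add: matrix_vector_mul_assoc matrix_mul_assoc)
      then show "param P (w ** s ** transpose w) *\<^sub>C (w *v y - (w ** s ** transpose w) *v (w *v y)) =
          param P s *\<^sub>C (w *v (y - s *v y))"
        by (simp add: param_conj[OF w s] tw clin_diff[OF clin_matrix_vector])
    qed
    also have "\<dots> = w *v C y" by (simp add: C_def clin_sum[OF clin_matrix_vector] clin_scale[OF clin_matrix_vector])
    finally show ?thesis .
  qed
  have "\<exists>k. C (cvec_of a) = k *\<^sub>C cvec_of a" if a: "a \<in> \<Phi>" for a
  proof -
    have a0: "a \<noteq> 0" using root_nonzero[OF irr a] .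
    have "cmat (rrm a) *v cvec_of a = - cvec_of a"
      using a0 by (simp add: cmat_mult_cvec_of rrm_mult root_reflection_self flip: cvec_of_simps(3))
    then have "cmat (rrm a) *v C (cvec_of a) = - C (cvec_of a)"
      using comm[OF rrm_in_weyl_group[OF irr a], of "cvec_of a"] by (simp add: clin_minus[OF clC])
    then have "2 *\<^sub>C C (cvec_of a) = (2 * pairing (C (cvec_of a)) (cvec_of a) / complex_of_real (a \<bullet> a)) *\<^sub>C cvec_of a"
      by (simp add: cmat_rrm_mult algebra_simps cscale_add_left[of 1 1, simplified] eq_neg_iff_add_eq_0 neg_eq_iff_add_eq_0)
    then have "(1/2) *\<^sub>C (2 *\<^sub>C C (cvec_of a)) = (1/2) *\<^sub>C ((2 * pairing (C (cvec_of a)) (cvec_of a) / complex_of_real (a \<bullet> a)) *\<^sub>C cvec_of a)"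
      by simp
    then show ?thesis by auto
  qed
  then obtain k where k: "\<And>a. a \<in> \<Phi> \<Longrightarrow> C (cvec_of a) = k a *\<^sub>C cvec_of a" by metis
  \<comment> \<open>\<open>C\<close> of the reflection of \<open>b\<close> in \<open>a\<close> is
    computed in two ways, linearly and through commutation with the reflection; the multiples of
    \<open>a\<close> are compared.\<close>
  have k_eq: "k a = k b" if a: "a \<in> \<Phi>" and b: "b \<in> \<Phi>" and ab: "a \<bullet> b \<noteq> 0" for a b
  proof -
    define t where "t = complex_of_real (2 * (b \<bullet> a) / (a \<bullet> a))"
    have t: "t \<noteq> 0" using ab root_nonzero[OF irr a] by (simp add: t_def inner_commute)
    have r: "cmat (rrm a) *v cvec_of b = cvec_of b - t *\<^sub>C cvec_of a"
      unfolding cmat_mult_cvec_of rrm_mult root_reflection_def cvec_of_simps t_def ..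
    have "C (cmat (rrm a) *v cvec_of b) = k b *\<^sub>C cvec_of b - (t * k a) *\<^sub>C cvec_of a"
      by (simp add: r clin_diff[OF clC] clin_scale[OF clC] k a b)
    moreover have "C (cmat (rrm a) *v cvec_of b) = k b *\<^sub>C cvec_of b - (k b * t) *\<^sub>C cvec_of a"
      unfolding comm[OF rrm_in_weyl_group[OF irr a]] k[OF b] clin_scale[OF clin_matrix_vector] unfolding r by (simp add: cscale_diff_right)
    ultimately have "(t * k a - k b * t) *\<^sub>C cvec_of a = 0" by (simp add: cscale_diff_left)
    then show ?thesis using t root_nonzero[OF irr a] by (simp add: cvec_of_eq_0_iff)
  qed
  have "\<Phi> \<noteq> {}"
  proof
    assume "\<Phi> = {}"
    then have "(UNIV :: (real, 'n) vec set) = {0}" using span_roots[OF irr] by simp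
    then have "axis undefined 1 = (0 :: (real, 'n) vec)" by blast
    then show False by (simp add: axis_eq_0_iff)
  qed
  then obtain a0 where a0: "a0 \<in> \<Phi>" by blast
  have "\<Phi> = {a\<in>\<Phi>. k a = k a0} \<union> {a\<in>\<Phi>. k a \<noteq> k a0}" by auto
  moreover have "\<forall>a\<in>{a\<in>\<Phi>. k a = k a0}. \<forall>b\<in>{a\<in>\<Phi>. k a \<noteq> k a0}. a \<bullet> b = 0" using k_eq by fastforce
  ultimately have "{a\<in>\<Phi>. k a = k a0} = {} \<or> {a\<in>\<Phi>. k a \<noteq> k a0} = {}"
    using irr unfolding irreducible_root_system_def by blast
  then have kc: "k a = k a0" if "a \<in> \<Phi>" for a using that a0 by auto
  have real: "C (cvec_of x) = k a0 *\<^sub>C cvec_of x" for x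
  proof -
    have "x \<in> span \<Phi>" by (simp add: span_roots[OF irr])
    then show ?thesis
    proof (induction rule: span_induct_alt)
      case base
      show ?case by (simp add: cvec_of_simps clin_zero[OF clC])
    next
      case (step r a y)
      then show ?case using k[of a] kc[of a]
        by (simp add: cvec_of_simps clin_add[OF clC] clin_scale[OF clC] cscale_add_right mult.commute)
    qed
  qed
  have "C y = k a0 *\<^sub>C y" for y
    by (rule clin_vec_eqI[OF clC, of "\<lambda>y. k a0 *\<^sub>C y"]) (auto simp: real simp flip: cvec_of_axis)
  then show ?thesis unfolding C_def by blast
qed

lemma cherednik_rep_weyl_group:
  obtains \<kappa> where "cherednik_rep (weyl_group \<Phi>) (reflections (weyl_group \<Phi>)) (param P) (alpha P) coroot \<kappa> P"
proof -
  from root_reflection_scalar obtain \<kappa> where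
    \<kappa>: "\<forall>y. (\<Sum>s\<in>reflections (weyl_group \<Phi>). param P s *\<^sub>C (y - s *v y)) = \<kappa> *\<^sub>C y" ..
  interpret refl_rep "weyl_group \<Phi>" "reflections (weyl_group \<Phi>)" "param P" "alpha P" coroot \<kappa>
    by standard
      (rule finite_weyl_group[OF irr] weyl_group_one[OF irr] weyl_group_mult[OF irr] weyl_group_transpose[OF irr]
        weyl_group_orthogonal[OF irr] reflections_conj[OF irr] param_conj reflection_formula \<kappa>[rule_format]
        | assumption | simp add: reflections_def)+
  have "cherednik_rep (weyl_group \<Phi>) (reflections (weyl_group \<Phi>)) (param P) (alpha P) coroot \<kappa> P"
    by standard (simp_all add: grp bt_eq coroot_def clin_scale[OF clin_pairing_left] cscale_complex_def)
  then show thesis by (rule that)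
qed

end

section \<open>The spinor action of the double cover\<close>

lemma type_ring_simps [simp]:
  "carrier type_ring = UNIV" "x \<otimes>\<^bsub>type_ring\<^esub> y = x * y" "x \<oplus>\<^bsub>type_ring\<^esub> y = x + y"
  "\<zero>\<^bsub>type_ring\<^esub> = 0" "\<one>\<^bsub>type_ring\<^esub> = 1"
  by (simp_all add: type_ring_def)

lemma ring_type_ring: "ring type_ring"
proof (rule ringI)
  show "abelian_group type_ring"
    by (rule abelian_groupI) (auto simp: algebra_simps intro: exI[of _ "- x" for x])
  show "monoid type_ring" by (rule monoidI) (simp_all add: mult.assoc)
qed (simp_all add: algebra_simps)

lemma mult_cscale: "p * (z *\<^sub>C q) = z *\<^sub>C (p * (q :: 'l list \<Rightarrow>\<^sub>0 complex))"
proof -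
  have "p * (scal z * q) = scal z * (p * q)" using scal_central[of z p] by (simp add: mult.assoc[symmetric])
  then show ?thesis by (simp add: scal_mult)
qed

lemma cscale_sum_product: "(\<Sum>i\<in>A. a i *\<^sub>C f i) * (\<Sum>j\<in>B. b j *\<^sub>C g j) =
    (\<Sum>i\<in>A. \<Sum>j\<in>B. (a i * b j) *\<^sub>C (f i * (g j :: 'l list \<Rightarrow>\<^sub>0 complex)))"
  by (simp add: sum_product cscale_mult_left mult_cscale mult.commute)

section \<open>The ideal of Clifford relations\<close>

abbreviation CI :: "'n::finite tens set" where "CI \<equiv> Idl\<^bsub>type_ring\<^esub> clifford_relators"

lemma ideal_CI: "ideal CI type_ring"
  by (rule ring.genideal_ideal[OF ring_type_ring]) simp

lemma CI_relator: "r \<in> clifford_relators \<Longrightarrow> r \<in> CI"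
  using ring.genideal_self[OF ring_type_ring, of clifford_relators] by auto

lemma CI_add: "a \<in> CI \<Longrightarrow> b \<in> CI \<Longrightarrow> a + b \<in> CI"
  using additive_subgroup.a_closed[OF ideal.axioms(1)[OF ideal_CI], of a b] by simp

lemma CI_zero: "0 \<in> CI"
  using additive_subgroup.zero_closed[OF ideal.axioms(1)[OF ideal_CI]] by simp

lemma CI_left: "a \<in> CI \<Longrightarrow> b * a \<in> CI" and CI_right: "a \<in> CI \<Longrightarrow> a * b \<in> CI"
  using ideal.I_l_closed[OF ideal_CI, of a b] ideal.I_r_closed[OF ideal_CI, of a b] by simp_all

lemma CI_scale: "a \<in> CI \<Longrightarrow> z *\<^sub>C a \<in> CI"
  using CI_left[of a "scal z"] by (simp add: scal_mult)

lemma CI_sum: "(\<And>i. i \<in> A \<Longrightarrow> f i \<in> CI) \<Longrightarrow> (\<Sum>i\<in>A. f i) \<in> CI"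
  by (induction A rule: infinite_finite_induct) (auto simp: CI_zero CI_add)

lemma tens_x_axis_sum: "tens_x x = (\<Sum>i\<in>UNIV. x $ i *\<^sub>C tens_x (axis i 1))"
  by (rule clin_vec_expand[OF clin_tens_x])

lemma tens_y_axis_sum: "tens_y y = (\<Sum>i\<in>UNIV. y $ i *\<^sub>C tens_y (axis i 1))"
  by (rule clin_vec_expand[OF clin_tens_y])

text \<open>The relators speak of basis vectors only; twice the square of a general \<open>x\<close>
  is a combination of them.\<close>

lemma CI_xx: "tens_x x * tens_x x \<in> CI"
proof -
  let ?X = "\<lambda>i. tens_x (axis i 1)"
  have xx: "tens_x x * tens_x x = (\<Sum>i\<in>UNIV. \<Sum>j\<in>UNIV. (x $ i * x $ j) *\<^sub>C (?X i * ?X j))"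
    unfolding tens_x_axis_sum[of x] by (rule cscale_sum_product)
  also have "\<dots> = (\<Sum>j\<in>UNIV. \<Sum>i\<in>UNIV. (x $ i * x $ j) *\<^sub>C (?X i * ?X j))" by (rule sum.swap)
  finally have "tens_x x * tens_x x + tens_x x * tens_x x =
      (\<Sum>i\<in>UNIV. \<Sum>j\<in>UNIV. (x $ i * x $ j) *\<^sub>C (?X i * ?X j + ?X j * ?X i))"
    by (simp add: xx cscale_add_right sum.distrib mult.commute)
  also have "\<dots> \<in> CI"
    by (intro CI_sum CI_scale CI_relator) (auto simp: clifford_relators_def Let_def)
  finally have "(1/2) *\<^sub>C (tens_x x * tens_x x + tens_x x * tens_x x) \<in> CI" by (rule CI_scale)
  then show ?thesis by (simp add: cscale_add_right flip: cscale_add_left)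
qed

lemma CI_xy: "tens_x x * tens_y y + tens_y y * tens_x x + scal (2 * pairing y x) \<in> CI"
proof -
  let ?X = "\<lambda>i. tens_x (axis i 1)" and ?Y = "\<lambda>i. tens_y (axis i 1)"
  have xy: "tens_x x * tens_y y = (\<Sum>i\<in>UNIV. \<Sum>j\<in>UNIV. (x $ i * y $ j) *\<^sub>C (?X i * ?Y j))"
    unfolding tens_x_axis_sum[of x] tens_y_axis_sum[of y] by (rule cscale_sum_product)
  have "tens_y y * tens_x x = (\<Sum>j\<in>UNIV. \<Sum>i\<in>UNIV. (y $ j * x $ i) *\<^sub>C (?Y j * ?X i))"
    unfolding tens_x_axis_sum[of x] tens_y_axis_sum[of y] by (rule cscale_sum_product)
  also have "\<dots> = (\<Sum>i\<in>UNIV. \<Sum>j\<in>UNIV. (y $ j * x $ i) *\<^sub>C (?Y j * ?X i))" by (rule sum.swap)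
  finally have yx: "tens_y y * tens_x x = (\<Sum>i\<in>UNIV. \<Sum>j\<in>UNIV. (y $ j * x $ i) *\<^sub>C (?Y j * ?X i))" .
  have "2 * pairing y x = (\<Sum>i\<in>UNIV. \<Sum>j\<in>UNIV. (x $ i * y $ j) * (if i = j then 2 else 0))"
    by (simp add: if_distrib pairing_def sum_distrib_left mult_ac cong: if_cong)
  then have p: "scal (2 * pairing y x) = (\<Sum>i\<in>UNIV. \<Sum>j\<in>UNIV. (x $ i * y $ j) *\<^sub>C scal (if i = j then 2 else 0))"
    by (simp only: single_sum cscale_single)
  have "tens_x x * tens_y y + tens_y y * tens_x x + scal (2 * pairing y x) =
    (\<Sum>i\<in>UNIV. \<Sum>j\<in>UNIV. (x $ i * y $ j) *\<^sub>C (?X i * ?Y j + ?Y j * ?X i + scal (if i = j then 2 else 0)))"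
    unfolding xy yx p by (simp only: cscale_add_right sum.distrib mult.commute)
  also have "\<dots> \<in> CI"
    by (intro CI_sum CI_scale CI_relator) (auto simp: clifford_relators_def Let_def)
  finally show ?thesis .
qed

abbreviation lt :: "'n::{finite,linorder} + 'n \<Rightarrow> 'n ext \<Rightarrow> 'n ext" where
  "lt \<equiv> case_sum (\<lambda>i. wedge (axis i 1)) (\<lambda>i. contract (axis i 1))"

lemma clin_lt: "clin (lt l)"
  by (cases l) (simp_all add: clin_wedge clin_contract)

lemma spin_tens_word_act: "spin_tens t v = word_act lt t v"
  by (simp add: spin_tens_def word_act_def cscale_vec_eq)

lemma spin_tens_simps: "spin_tens (t + u) v = spin_tens t v + spin_tens u v"
  "spin_tens (t * u) v = spin_tens t (spin_tens u v)" "spin_tens (scal z) v = z *\<^sub>C v"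
  "spin_tens (- t) v = - spin_tens t v" "spin_tens 1 v = v"
  unfolding spin_tens_word_act
  by (rule word_act_add word_act_mult[OF clin_lt] word_act_scal word_act_minus word_act_one)+

lemma spin_tens_x: "spin_tens (tens_x x) v = contract x v"
  by (simp add: spin_tens_word_act word_act_tens_x) (simp add: clin_vec_expand[OF clin_contract_left, of x])

lemma spin_tens_y: "spin_tens (tens_y y) v = wedge y v"
  by (simp add: spin_tens_word_act word_act_tens_y) (simp add: clin_vec_expand[OF clin_wedge_left, of y])

lemma clin_spin_tens: "clin (spin_tens t)"
  unfolding spin_tens_word_act[abs_def] by (rule clin_word_act[OF clin_lt])

text \<open>The tensors that act by zero on spinors form an ideal containing the relators.
  Consequently \<open>spin\<close> is independent of the representative, which is
  \<open>spin_cl_class\<close>.\<close>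

lemma spin_tens_CI:
  fixes t :: "'n::{finite,linorder} tens"
  assumes "t \<in> CI"
  shows "spin_tens t v = 0"
proof -
  let ?A = "{t :: 'n tens. \<forall>v. spin_tens t v = 0}"
  have "ideal ?A type_ring"
  proof (rule idealI[OF ring_type_ring])
    show "subgroup ?A (add_monoid type_ring)"
    proof (rule group.subgroupI)
      show "Group.group (add_monoid (type_ring :: 'n tens ring))"
        using abelian_group.a_group[OF ring.is_abelian_group[OF ring_type_ring]] .
      have "spin_tens 0 v = 0" for v :: "'n ext" by (simp add: spin_tens_word_act)
      then show "?A \<noteq> {}" by blast
      fix a :: "'n tens" assume a: "a \<in> ?A"
      have "a \<oplus>\<^bsub>type_ring\<^esub> inv\<^bsub>add_monoid type_ring\<^esub> a = 0"
        using abelian_group.r_neg[OF ring.is_abelian_group[OF ring_type_ring], of a] by (simp add: a_inv_def)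
      then have "inv\<^bsub>add_monoid type_ring\<^esub> a = - a" by (simp add: eq_neg_iff_add_eq_0 add.commute)
      then show "inv\<^bsub>add_monoid type_ring\<^esub> a \<in> ?A" using a by (simp add: spin_tens_simps)
    qed (auto simp: spin_tens_simps)
  qed (auto simp: spin_tens_simps clin_zero[OF clin_spin_tens])
  moreover have "clifford_relators \<subseteq> ?A"
  proof -
    have "contract a (contract b v) + contract b (contract a v) = 0" for a b :: "'n cvect" and v
      using contract_anticomm[of a b v] by simp
    moreover have "wedge a (wedge b v) + wedge b (wedge a v) = 0" for a b :: "'n cvect" and v
      using wedge_anticomm[of a b v] by simp
    moreover have "scal 2 \<noteq> (0 :: 'n tens)" by (metis lookup_single_eq lookup_zero zero_neq_numeral)
    ultimately show ?thesis
      by (auto simp: clifford_relators_def Let_def spin_tens_simps spin_tens_x spin_tens_y contract_wedge pairing_axis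
          simp del: single_numeral pairing_axis_left pairing_axis_right)
  qed
  ultimately have "CI \<subseteq> ?A" by (rule ring.genideal_minimal[OF ring_type_ring])
  then show ?thesis using assms by auto
qed

lemma cl_class_eq: "cl_class t = (\<lambda>r. r + t) ` CI"
  by (auto simp: cl_class_def a_r_coset_def')

lemma spin_cl_class: "spin (cl_class t) v = spin_tens t v"
proof -
  have "(\<lambda>t. spin_tens t v) ` cl_class t = {spin_tens t v}"
    using CI_zero by (auto simp: cl_class_eq spin_tens_simps spin_tens_CI image_iff)
  then show ?thesis by (simp add: spin_def)
qed

lemma cl_class_subset: "t - u \<in> CI \<Longrightarrow> cl_class t \<subseteq> cl_class u"
proof
  fix q assume tu: "t - u \<in> CI" and "q \<in> cl_class t"
  then obtain r where r: "r \<in> CI" "q = r + t" by (auto simp: cl_class_eq)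
  then have "q = (r + (t - u)) + u" by simp
  then show "q \<in> cl_class u" using CI_add[OF r(1) tu] unfolding cl_class_eq by (rule image_eqI)
qed

lemma cl_class_cong: "t - u \<in> CI \<Longrightarrow> cl_class t = cl_class u"
  using cl_class_subset[of t u] cl_class_subset[of u t] CI_scale[of "t - u" "-1"] by auto

lemma ring_clifford: "ring clifford"
  unfolding clifford_def by (rule ideal.quotient_is_ring[OF ideal_CI])

lemma cl_class_carrier: "cl_class t \<in> carrier clifford"
  by (auto simp: clifford_def FactRing_def A_RCOSETS_def' cl_class_def)

lemma cl_class_mult: "cl_class t \<otimes>\<^bsub>clifford\<^esub> cl_class u = cl_class (t * u)"
  using ring_hom_mult[OF ideal.rcos_ring_hom[OF ideal_CI], of t u] by (simp add: clifford_def cl_class_def)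

lemma cl_class_one: "\<one>\<^bsub>clifford\<^esub> = cl_class 1"
  using ring_hom_one[OF ideal.rcos_ring_hom[OF ideal_CI], symmetric] by (simp add: clifford_def cl_class_def)

section \<open>The double cover and its character\<close>

context
  fixes \<Phi> :: "(real^'n::{finite,linorder}) set" and P :: "'n cherednik_data" and p :: "'n cliff \<Rightarrow> 'n mtx"
  assumes irr: "irreducible_root_system \<Phi>" and grp: "refl_grp P = weyl_group \<Phi>"
    and data: "is_cherednik_data P" and cov: "is_covering P p"
begin

text \<open>The determinant is -1, so the chosen square root is \<open>\<i>\<close>, and
  \<open>\<i> - 1 / \<i> = 2 * \<i>\<close>.\<close>

lemma mu_tens_reflection:
  assumes s: "s \<in> reflections (weyl_group \<Phi>)"
  shows "mu_tens P s = (\<i> / pairing (alpha_vee P s) (alpha P s)) *\<^sub>C (tens_x (alpha P s) * tens_y (alpha_vee P s)) + scal \<i>"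
proof -
  have "csqrt (det s) = \<i>" by (simp add: det_reflection_weyl[OF irr grp data s])
  then show ?thesis
    by (simp add: mu_tens_def scal_mult cscale_mult_left mult.assoc)
qed

text \<open>It follows that \<open>mu\<close> and \<open>neg_mu\<close> are inverse to each other,
  which covers the inverses of generators in the double cover.\<close>

lemma mu_tens_sq:
  assumes s: "s \<in> reflections (weyl_group \<Phi>)"
  shows "mu_tens P s * mu_tens P s + 1 \<in> CI"
proof -
  define x where "x = tens_x (alpha P s)"
  define y where "y = tens_y (alpha_vee P s)"
  define q where "q = pairing (alpha_vee P s) (alpha P s)"
  have q: "q \<noteq> 0" using reflection_formula(3)[OF irr grp data s] by (simp add: q_def)
  define r where "r = x * y + y * x + scal (2 * q)"
  have rI: "r \<in> CI" unfolding r_def x_def y_def q_def by (rule CI_xy)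
  have xI: "x * x \<in> CI" unfolding x_def by (rule CI_xx)
  have mu: "mu_tens P s = (\<i> / q) *\<^sub>C (x * y) + scal \<i>"
    unfolding mu_tens_reflection[OF s] x_def y_def q_def ..
  \<comment> \<open>Sandwiching the mixed relation gives \<open>(x y)\<^sup>2 = - 2 q x y\<close>
    modulo the ideal, since \<open>x x\<close> lies in it.\<close>
  have "x * r * y = x * x * y * y + x * y * x * y + (2 * q) *\<^sub>C (x * y)"
    unfolding r_def distrib_left distrib_right scal_central[of "2 * q" x, symmetric] scal_mult
    by (simp add: mult.assoc scal_mult mult_cscale cscale_mult_left)
  then have "(x * y) * (x * y) = x * r * y - x * x * y * y - (2 * q) *\<^sub>C (x * y)" by (simp add: mult.assoc)
  moreover have "mu_tens P s * mu_tens P s + 1 = (\<i> / q * (\<i> / q)) *\<^sub>C ((x * y) * (x * y)) + (2 * \<i> * \<i> / q) *\<^sub>C (x * y)"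
  proof -
    have "scal \<i> * scal \<i> = (- 1 :: 'n tens)"
      unfolding scal_times_scal by (simp add: single_one[symmetric] single_uminus del: single_one)
    moreover have "(\<i> / q) *\<^sub>C (x * y) * scal \<i> = (\<i> * \<i> / q) *\<^sub>C (x * y)"
      "scal \<i> * ((\<i> / q) *\<^sub>C (x * y)) = (\<i> * \<i> / q) *\<^sub>C (x * y)"
      unfolding scal_central[of \<i>, symmetric] scal_mult by simp_all
    moreover have "(2 * \<i> * \<i> / q) *\<^sub>C (x * y) = (\<i> * \<i> / q) *\<^sub>C (x * y) + (\<i> * \<i> / q) *\<^sub>C (x * y)"
    proof -
      have "2 * \<i> * \<i> / q = \<i> * \<i> / q + \<i> * \<i> / q" by (simp only: mult_2 distrib_right add_divide_distrib)
      then show ?thesis by (simp only: cscale_add_left)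
    qed
    ultimately show ?thesis unfolding mu distrib_left distrib_right
      by (simp add: cscale_mult_left mult_cscale add_ac del: cscale_cscale) (simp add: cscale_cscale)
  qed
  ultimately have "mu_tens P s * mu_tens P s + 1 = (\<i> / q * (\<i> / q)) *\<^sub>C (x * r * y - x * x * y * y) + (2 / q + 2 * \<i> * \<i> / q) *\<^sub>C (x * y)"
    using q by (simp add: cscale_diff_right cscale_add_left)
  also have "2 / q + 2 * \<i> * \<i> / q = 0" unfolding add_divide_distrib[symmetric] mult.assoc by simp
  also have "(\<i> / q * (\<i> / q)) *\<^sub>C (x * r * y - x * x * y * y) + 0 *\<^sub>C (x * y) = (\<i> / q * (\<i> / q)) *\<^sub>C (x * r * y + (- 1) *\<^sub>C (x * x * y * y))" by simp
  also have "\<dots> \<in> CI" 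
    by (rule CI_scale[OF CI_add[OF CI_right[OF CI_left[OF rI]] CI_scale[OF CI_right[OF CI_right[OF xI]]]]])
  finally show ?thesis .
qed

lemma mu_neg_mu:
  assumes s: "s \<in> reflections (weyl_group \<Phi>)"
  shows "mu P s \<otimes>\<^bsub>clifford\<^esub> neg_mu P s = \<one>\<^bsub>clifford\<^esub>" "neg_mu P s \<otimes>\<^bsub>clifford\<^esub> mu P s = \<one>\<^bsub>clifford\<^esub>"
proof -
  have "- (mu_tens P s * mu_tens P s) - 1 = (- 1) *\<^sub>C (mu_tens P s * mu_tens P s + 1)" by simp
  also have "\<dots> \<in> CI" by (rule CI_scale[OF mu_tens_sq[OF s]])
  finally have "cl_class (- (mu_tens P s * mu_tens P s)) = cl_class 1" by (rule cl_class_cong)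
  then show "mu P s \<otimes>\<^bsub>clifford\<^esub> neg_mu P s = \<one>\<^bsub>clifford\<^esub>" "neg_mu P s \<otimes>\<^bsub>clifford\<^esub> mu P s = \<one>\<^bsub>clifford\<^esub>"
    by (simp_all add: mu_def neg_mu_def cl_class_mult cl_class_one)
qed

lemma mu_inv:
  assumes s: "s \<in> reflections (weyl_group \<Phi>)"
  shows "inv\<^bsub>units_of clifford\<^esub> (mu P s) = neg_mu P s" "inv\<^bsub>units_of clifford\<^esub> (neg_mu P s) = mu P s"
proof -
  interpret ring clifford by (rule ring_clifford)
  have "mu P s \<in> carrier clifford" "neg_mu P s \<in> carrier clifford" by (simp_all add: mu_def neg_mu_def cl_class_carrier)
  then have "mu P s \<in> Units clifford" "neg_mu P s \<in> Units clifford" using mu_neg_mu[OF s] by (auto simp: Units_def)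
  then show "inv\<^bsub>units_of clifford\<^esub> (mu P s) = neg_mu P s" "inv\<^bsub>units_of clifford\<^esub> (neg_mu P s) = mu P s"
    using mu_neg_mu[OF s] group.inv_equality[OF units_group] by (simp_all add: units_of_carrier units_of_mult units_of_one)
qed

text \<open>The Clifford product in \<open>mu\<close> acts as a contraction after a wedge, so
  \<open>contract_wedge_reflection\<close> applies. The remaining scalar \<open>- \<i>\<close> is a
  square root of the determinant.\<close>

lemma spin_mu:
  assumes s: "s \<in> reflections (weyl_group \<Phi>)"
  shows "spin_tens (mu_tens P s) v = (- \<i>) *\<^sub>C ext_act s v"
proof -
  let ?a = "alpha P s" and ?b = "alpha_vee P s"
  define q where "q = pairing ?b ?a"
  note f = reflection_formula[OF irr grp data s]
  have q: "q \<noteq> 0" using f(3) by (simp add: q_def)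
  have "contract ?a (wedge (coroot P s) v) = (- 2) *\<^sub>C (v + ext_act s v)"
    by (rule contract_wedge_reflection[OF f(1,2)])
  moreover have "contract ?a (wedge (coroot P s) v) = (2 / q) *\<^sub>C contract ?a (wedge ?b v)"
    by (simp add: coroot_def[OF irr grp data] q_def clin_scale[OF clin_wedge_left] clin_scale[OF clin_contract])
  ultimately have "(q / 2) *\<^sub>C ((2 / q) *\<^sub>C contract ?a (wedge ?b v)) = (q / 2) *\<^sub>C ((- 2) *\<^sub>C (v + ext_act s v))" by simp
  then have "contract ?a (wedge ?b v) = (- q) *\<^sub>C (v + ext_act s v)" using q by simp
  then have "spin_tens (mu_tens P s) v = (\<i> / q) *\<^sub>C ((- q) *\<^sub>C (v + ext_act s v)) + \<i> *\<^sub>C v"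
    unfolding mu_tens_reflection[OF s] q_def
    by (simp add: spin_tens_simps spin_tens_x spin_tens_y flip: scal_mult)
  then show ?thesis using q by (simp add: cscale_add_right cscale_diff_right)
qed

text \<open>Collected into one predicate that products preserve. \<open>top_char\<close> is the
  determinant on \<open>h\<close>, which for orthogonal matrices is also the one on
  \<open>h*\<close>.\<close>

definition spin_ok :: "'n cliff \<Rightarrow> bool" where
  "spin_ok g \<longleftrightarrow> p g \<in> weyl_group \<Phi> \<and> (\<exists>t. g = cl_class t \<and> (\<forall>v. spin_tens t v = chi g *\<^sub>C ext_act (p g) v)) \<and>
     chi g * chi g = top_char (p g)"

lemma chi_cl_class: "(\<And>v. spin_tens t v = z *\<^sub>C ext_act w v) \<Longrightarrow> chi (cl_class t) = z"
  unfolding chi_def spin_cl_class by (simp add: cscale_complex_def axis_def flip: axis_def)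

lemma spin_okI:
  assumes "g = cl_class t" "p g \<in> weyl_group \<Phi>" "\<And>v. spin_tens t v = z *\<^sub>C ext_act (p g) v" "z * z = top_char (p g)"
  shows "spin_ok g"
proof -
  have "chi g = z" unfolding assms(1) by (rule chi_cl_class) (rule assms(3))
  then show ?thesis using assms by (auto simp: spin_ok_def)
qed

lemma spin_ok_mu:
  assumes s: "s \<in> reflections (weyl_group \<Phi>)"
  shows "spin_ok (mu P s)" "spin_ok (neg_mu P s)"
proof -
  have p: "p (mu P s) = s" "p (neg_mu P s) = s" using cov s by (auto simp: is_covering_def grp)
  have w: "s \<in> weyl_group \<Phi>" using s by (simp add: reflections_def)
  have "top_char s = - 1" using top_char_reflection reflection_formula(1,2)[OF irr grp data s] by blast
  then show "spin_ok (mu P s)" "spin_ok (neg_mu P s)"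
    using spin_okI[of "mu P s" "mu_tens P s" "- \<i>"] spin_okI[of "neg_mu P s" "- mu_tens P s" "\<i>"]
    by (simp_all add: p w mu_def[symmetric] neg_mu_def[symmetric] spin_tens_simps spin_mu[OF s])
qed

lemma W_tilde_simps: "carrier (W_tilde P) = generate (units_of clifford)
     (mu P ` reflections (weyl_group \<Phi>) \<union> neg_mu P ` reflections (weyl_group \<Phi>))"
   "g \<otimes>\<^bsub>W_tilde P\<^esub> h = g \<otimes>\<^bsub>clifford\<^esub> h"
  by (simp_all add: W_tilde_def grp units_of_def)

lemma p_mult: "g \<in> carrier (W_tilde P) \<Longrightarrow> h \<in> carrier (W_tilde P) \<Longrightarrow> p (g \<otimes>\<^bsub>clifford\<^esub> h) = p g ** p h"
  using cov by (auto simp: is_covering_def hom_def W_tilde_simps(2) GLn_def)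

lemma p_weyl: "g \<in> carrier (W_tilde P) \<Longrightarrow> p g \<in> weyl_group \<Phi>"
  using cov by (auto simp: is_covering_def hom_def grp)

lemma spin_ok: "g \<in> carrier (W_tilde P) \<Longrightarrow> spin_ok g"
proof -
  assume "g \<in> carrier (W_tilde P)"
  then have "g \<in> carrier (W_tilde P) \<and> spin_ok g" unfolding W_tilde_simps
  proof (induction rule: generate.induct)
    case one
    let ?e = "\<one>\<^bsub>clifford\<^esub> :: 'n cliff"
    have e: "?e \<in> carrier (W_tilde P)" unfolding W_tilde_simps
      using generate.one[of "units_of clifford"] by (simp add: units_of_one)
    \<comment> \<open>A homomorphism is here only required to be multiplicative, so \<open>p\<close>
      of the unit is found as an idempotent among invertible matrices.\<close>
    have "p ?e ** p ?e = p ?e"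
      using p_mult[OF e e] by (simp add: cl_class_one cl_class_mult)
    then have "transpose (p ?e) ** (p ?e ** p ?e) = transpose (p ?e) ** p ?e" by simp
    moreover have "transpose (p ?e) ** p ?e = mat 1"
      using weyl_group_orthogonal[OF irr p_weyl[OF e]] matrix_left_right_inverse by blast
    ultimately have "p ?e = mat 1" by (simp add: matrix_mul_assoc)
    then have "spin_ok ?e"
      using p_weyl[OF e] by (intro spin_okI[of _ 1 1]) (simp_all add: cl_class_one spin_tens_simps ext_act_one top_char_one)
    then show ?case using e by (simp add: units_of_one W_tilde_simps)
  next
    case (incl h)
    then show ?case using spin_ok_mu by (auto intro: generate.incl)
  next
    case (inv h)
    then show ?case using spin_ok_mu mu_inv by (auto intro: generate.incl)
  next
    case (eng g h)
    then have c: "g \<in> carrier (W_tilde P)" "h \<in> carrier (W_tilde P)" and ok: "spin_ok g" "spin_ok h"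
      by (simp_all add: W_tilde_simps)
    from ok obtain t u where t: "g = cl_class t" "\<And>v. spin_tens t v = chi g *\<^sub>C ext_act (p g) v"
      and u: "h = cl_class u" "\<And>v. spin_tens u v = chi h *\<^sub>C ext_act (p h) v" by (auto simp: spin_ok_def)
    have "spin_ok (g \<otimes>\<^bsub>clifford\<^esub> h)"
    proof (rule spin_okI)
      show "g \<otimes>\<^bsub>clifford\<^esub> h = cl_class (t * u)" unfolding t(1) u(1) by (rule cl_class_mult)
      show "p (g \<otimes>\<^bsub>clifford\<^esub> h) \<in> weyl_group \<Phi>"
        using weyl_group_mult[OF irr p_weyl p_weyl] c by (simp add: p_mult)
      show "spin_tens (t * u) v = (chi g * chi h) *\<^sub>C ext_act (p (g \<otimes>\<^bsub>clifford\<^esub> h)) v" for v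
        by (simp add: spin_tens_simps t(2) u(2) clin_scale[OF clin_ext_act] p_mult[OF c] ext_act_mult mult.commute)
      show "chi g * chi h * (chi g * chi h) = top_char (p (g \<otimes>\<^bsub>clifford\<^esub> h))"
        using ok by (simp add: spin_ok_def p_mult[OF c] top_char_mult mult_ac)
    qed
    then show ?case using generate.eng[OF eng(1,2)] by (simp add: units_of_mult)
  qed
  then show ?thesis by simp
qed

lemma spin_W_tilde:
  assumes "g \<in> carrier (W_tilde P)"
  shows "p g \<in> weyl_group \<Phi>" "spin g v = chi g *\<^sub>C ext_act (p g) v" "chi g * chi g = top_char (p g)"
  using spin_ok[OF assms] by (auto simp: spin_ok_def spin_cl_class)

end

section \<open>The resolution on the level of polynomials\<close>

locale bgg = cherednik_rep +
  fixes L :: "('a ch, 'l) module" and \<pi> :: "('a, 'a ext) std \<Rightarrow> 'l"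
    and d :: "nat \<Rightarrow> ('a, 'a ext) std \<Rightarrow> ('a, 'a ext) std"
  assumes irrL: "irreducible_module H L" and finL: "finite_dim_module P L"
    and \<pi>hom: "\<pi> \<in> module_homs H (Mstd 0) L"
    and dhom: "\<And>k. 1 \<le> k \<Longrightarrow> k \<le> CARD('a) \<Longrightarrow> d k \<in> module_homs H (Mstd k) (Mstd (k - 1))"
    and \<pi>surj: "\<pi> ` carrier (Mstd 0) = carrier L"
    and d1: "d 1 ` carrier (Mstd 1) = {m \<in> carrier (Mstd 0). \<pi> m = \<zero>\<^bsub>L\<^esub>}"
    and dk: "\<And>k. 1 \<le> k \<Longrightarrow> k < CARD('a) \<Longrightarrow>
      d (k + 1) ` carrier (Mstd (k + 1)) = {m \<in> carrier (Mstd k). d k m = \<zero>\<^bsub>Mstd (k - 1)\<^esub>}"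
    and dn: "inj_on (d CARD('a)) (carrier (Mstd CARD('a)))"
begin

sublocale L: left_module H L
  using irrL by (simp add: irreducible_module_def)

definition Phi :: "nat \<Rightarrow> 'a pext \<Rightarrow> ('a, 'a ext) std" where
  "Phi k = inv_into (carrier (Mstd k)) Psi"

lemma Phi_closed: "f \<in> Ej k \<Longrightarrow> Phi k f \<in> carrier (Mstd k)"
  unfolding Phi_def by (rule inv_into_into) (use Psi_bij[of k] in \<open>simp add: bij_betw_def\<close>)

lemma Psi_Phi: "f \<in> Ej k \<Longrightarrow> Psi (Phi k f) = f"
  unfolding Phi_def using Psi_bij[of k] by (simp add: bij_betw_def f_inv_into_f)

lemma Phi_Psi: "X \<in> carrier (Mstd k) \<Longrightarrow> Phi k (Psi X) = X"
  unfolding Phi_def using Psi_bij[of k] by (simp add: bij_betw_def inv_into_f_f)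

lemma Psi_closed: "X \<in> carrier (Mstd k) \<Longrightarrow> Psi X \<in> Ej k"
  using Psi_bij[of k] by (auto simp: bij_betw_def)

lemma Phi_add: "f \<in> Ej k \<Longrightarrow> g \<in> Ej k \<Longrightarrow> Phi k (f + g) = Phi k f \<oplus>\<^bsub>Mstd k\<^esub> Phi k g"
  using Psi_add[OF Phi_closed Phi_closed, of f k g] Phi_Psi[of "Phi k f \<oplus>\<^bsub>Mstd k\<^esub> Phi k g" k]
  by (simp add: Psi_Phi)

lemma Phi_rho: "a \<in> carrier H \<Longrightarrow> f \<in> Ej k \<Longrightarrow> Phi k (rho a f) = a \<odot>\<^bsub>Mstd k\<^esub> Phi k f"
  using Psi_smult[OF _ Phi_closed, of a f k] Phi_Psi[of "a \<odot>\<^bsub>Mstd k\<^esub> Phi k f" k] by (simp add: Psi_Phi)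

lemma Mstd_zero: "\<zero>\<^bsub>Mstd k\<^esub> \<in> carrier (Mstd k)" "Psi \<zero>\<^bsub>Mstd k\<^esub> = 0"
proof -
  have "NN k #>\<^bsub>FF k\<^esub> 0 = NN k" by (simp add: coset_eq)
  moreover have "0 \<in> carrier (FF k)" using psi_FF[OF Ej_zero] by simp
  ultimately show "\<zero>\<^bsub>Mstd k\<^esub> \<in> carrier (Mstd k)" by (auto simp: Mstd_simps)
  show "Psi \<zero>\<^bsub>Mstd k\<^esub> = 0" using Psi_coset[of k 0] \<open>NN k #>\<^bsub>FF k\<^esub> 0 = NN k\<close> by (simp add: Mstd_simps)
qed

lemma Psi_eq_0_iff: "X \<in> carrier (Mstd k) \<Longrightarrow> Psi X = 0 \<longleftrightarrow> X = \<zero>\<^bsub>Mstd k\<^esub>"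
  by (metis Mstd_zero Phi_Psi)

definition pm :: "'a pext \<Rightarrow> 'l" where "pm f = \<pi> (Phi 0 f)"

text \<open>The differentials in the polynomial model, with the index lowered by one:
  \<open>dE j\<close> goes from exterior degree \<open>j + 1\<close> to \<open>j\<close>. The value
  0 from \<open>CARD('a)\<close> on continues the resolution by zero.\<close>

definition dE :: "nat \<Rightarrow> 'a pext \<Rightarrow> 'a pext" where
  "dE j f = (if j < CARD('a) then Psi (d (Suc j) (Phi (Suc j) f)) else 0)"

lemma pm_closed: "f \<in> Ej 0 \<Longrightarrow> pm f \<in> carrier L"
  using \<pi>hom Phi_closed[of f 0] by (auto simp: module_homs_def pm_def)

lemma pm_add: "f \<in> Ej 0 \<Longrightarrow> g \<in> Ej 0 \<Longrightarrow> pm (f + g) = pm f \<oplus>\<^bsub>L\<^esub> pm g"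
  using \<pi>hom Phi_closed[of _ 0] by (auto simp: module_homs_def pm_def Phi_add)

lemma pm_rho: "a \<in> carrier H \<Longrightarrow> f \<in> Ej 0 \<Longrightarrow> pm (rho a f) = a \<odot>\<^bsub>L\<^esub> pm f"
  using \<pi>hom Phi_closed[of _ 0] by (auto simp: module_homs_def pm_def Phi_rho)

lemma pm_surj: "x \<in> carrier L \<Longrightarrow> \<exists>f\<in>Ej 0. pm f = x"
proof -
  assume "x \<in> carrier L"
  then have "x \<in> \<pi> ` carrier (Mstd 0)" by (simp only: \<pi>surj)
  then obtain X where X: "x = \<pi> X" "X \<in> carrier (Mstd 0)" ..
  have "pm (Psi X) = x" unfolding pm_def Phi_Psi[OF X(2)] X(1) ..
  then show ?thesis using Psi_closed[OF X(2)] by blast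
qed

lemma dhom': "j < CARD('a) \<Longrightarrow> d (Suc j) \<in> module_homs H (Mstd (Suc j)) (Mstd j)"
  using dhom[of "Suc j"] by simp

lemma dE_closed: "f \<in> Ej (Suc j) \<Longrightarrow> dE j f \<in> Ej j"
  using dhom'[of j] Phi_closed[of f "Suc j"] by (auto simp: dE_def module_homs_def Ej_zero intro!: Psi_closed)

lemma dE_add: "f \<in> Ej (Suc j) \<Longrightarrow> g \<in> Ej (Suc j) \<Longrightarrow> dE j (f + g) = dE j f + dE j g"
proof (cases "j < CARD('a)")
  case True
  assume f: "f \<in> Ej (Suc j)" "g \<in> Ej (Suc j)"
  have "d (Suc j) (Phi (Suc j) f) \<in> carrier (Mstd j)" "d (Suc j) (Phi (Suc j) g) \<in> carrier (Mstd j)"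
    using dhom'[OF True] Phi_closed[OF f(1)] Phi_closed[OF f(2)] by (auto simp: module_homs_def)
  then show ?thesis
    using dhom'[OF True] Phi_closed[OF f(1)] Phi_closed[OF f(2)] True f
    by (auto simp: module_homs_def dE_def Phi_add Psi_add)
qed (simp add: dE_def)

lemma dE_rho: "a \<in> carrier H \<Longrightarrow> f \<in> Ej (Suc j) \<Longrightarrow> dE j (rho a f) = rho a (dE j f)"
proof (cases "j < CARD('a)")
  case True
  assume a: "a \<in> carrier H" and f: "f \<in> Ej (Suc j)"
  have "d (Suc j) (Phi (Suc j) f) \<in> carrier (Mstd j)"
    using dhom'[OF True] Phi_closed[OF f] by (auto simp: module_homs_def)
  then show ?thesis using dhom'[OF True] Phi_closed[OF f] True f a
    by (auto simp: module_homs_def dE_def Phi_rho Psi_smult)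
qed (simp add: dE_def clin_zero[OF clin_rho])

lemma Ej_big: "j > CARD('a) \<Longrightarrow> f \<in> Ej j \<Longrightarrow> f = 0"
proof -
  assume j: "j > CARD('a)" and f: "f \<in> Ej j"
  have "card J \<noteq> j" for J :: "'a set" using card_mono[of UNIV J] j by auto
  then show ?thesis using f by (auto simp: Ej_def fun_eq_iff fun_apply)
qed

lemma pm_exact: "f \<in> Ej 0 \<Longrightarrow> pm f = \<zero>\<^bsub>L\<^esub> \<longleftrightarrow> (\<exists>g\<in>Ej 1. f = dE 0 g)"
proof
  assume f: "f \<in> Ej 0" "pm f = \<zero>\<^bsub>L\<^esub>"
  then have "Phi 0 f \<in> d 1 ` carrier (Mstd 1)" using d1 Phi_closed[OF f(1)] by (simp add: pm_def)
  then obtain X where X: "X \<in> carrier (Mstd 1)" "Phi 0 f = d 1 X" by blast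
  have "f = dE 0 (Psi X)" using Psi_Phi[OF f(1)] X Phi_Psi[of X 1] by (simp add: dE_def)
  then show "\<exists>g\<in>Ej 1. f = dE 0 g" using Psi_closed[OF X(1)] by blast
next
  assume "f \<in> Ej 0" "\<exists>g\<in>Ej 1. f = dE 0 g"
  then obtain g where g: "g \<in> Ej 1" "f = dE 0 g" by blast
  have "d 1 (Phi 1 g) \<in> d 1 ` carrier (Mstd 1)" using Phi_closed[OF g(1)] by blast
  then have "d 1 (Phi 1 g) \<in> carrier (Mstd 0)" "\<pi> (d 1 (Phi 1 g)) = \<zero>\<^bsub>L\<^esub>" using d1 by auto
  then show "pm f = \<zero>\<^bsub>L\<^esub>" by (simp add: pm_def g(2) dE_def Phi_Psi)
qed

lemma dE_zero [simp]: "dE j 0 = 0"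
  using dE_add[OF Ej_zero Ej_zero, of j] by simp

text \<open>In the top degree the next differential is 0, so exactness means injectivity, the left
  end of the given sequence; beyond it the spaces vanish.\<close>

lemma dE_exact: "f \<in> Ej (Suc j) \<Longrightarrow> dE j f = 0 \<longleftrightarrow> (\<exists>g\<in>Ej (Suc (Suc j)). f = dE (Suc j) g)"
proof (cases "Suc j < CARD('a)")
  case True
  assume f: "f \<in> Ej (Suc j)"
  have ex: "d (Suc (Suc j)) ` carrier (Mstd (Suc (Suc j))) = {m \<in> carrier (Mstd (Suc j)). d (Suc j) m = \<zero>\<^bsub>Mstd j\<^esub>}"
    using dk[of "Suc j"] True by simp
  show ?thesis
  proof
    assume "dE j f = 0"
    moreover have "d (Suc j) (Phi (Suc j) f) \<in> carrier (Mstd j)"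
      using dhom'[of j] True Phi_closed[OF f] by (auto simp: module_homs_def)
    ultimately have "d (Suc j) (Phi (Suc j) f) = \<zero>\<^bsub>Mstd j\<^esub>" using True by (simp add: dE_def Psi_eq_0_iff)
    then have "Phi (Suc j) f \<in> d (Suc (Suc j)) ` carrier (Mstd (Suc (Suc j)))" using ex Phi_closed[OF f] by simp
    then obtain X where X: "X \<in> carrier (Mstd (Suc (Suc j)))" "Phi (Suc j) f = d (Suc (Suc j)) X" by blast
    have "f = dE (Suc j) (Psi X)" using Psi_Phi[OF f] X Phi_Psi[OF X(1)] True by (simp add: dE_def)
    then show "\<exists>g\<in>Ej (Suc (Suc j)). f = dE (Suc j) g" using Psi_closed[OF X(1)] by blast
  next
    assume "\<exists>g\<in>Ej (Suc (Suc j)). f = dE (Suc j) g"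
    then obtain g where g: "g \<in> Ej (Suc (Suc j))" "f = dE (Suc j) g" by blast
    have "d (Suc (Suc j)) (Phi (Suc (Suc j)) g) \<in> d (Suc (Suc j)) ` carrier (Mstd (Suc (Suc j)))"
      using Phi_closed[OF g(1)] by blast
    then have "d (Suc (Suc j)) (Phi (Suc (Suc j)) g) \<in> carrier (Mstd (Suc j))"
      "d (Suc j) (d (Suc (Suc j)) (Phi (Suc (Suc j)) g)) = \<zero>\<^bsub>Mstd j\<^esub>" using ex by auto
    then show "dE j f = 0" using True by (simp add: g(2) dE_def Phi_Psi Mstd_zero)
  qed
next
  case False
  assume f: "f \<in> Ej (Suc j)"
  have rhs: "(\<exists>g\<in>Ej (Suc (Suc j)). f = dE (Suc j) g) \<longleftrightarrow> f = 0"
    using False by (auto simp: dE_def intro: bexI[of _ 0] Ej_zero)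
  show ?thesis
  proof (cases "Suc j = CARD('a)")
    case True
    have "f = 0" if z: "dE j f = 0"
    proof -
      have "d (Suc j) (Phi (Suc j) f) \<in> carrier (Mstd j)" "d (Suc j) (Phi (Suc j) 0) \<in> carrier (Mstd j)"
        using dhom'[of j] True Phi_closed[OF f] Phi_closed[OF Ej_zero, of "Suc j"] by (auto simp: module_homs_def)
      moreover have "Psi (d (Suc j) (Phi (Suc j) f)) = 0" "Psi (d (Suc j) (Phi (Suc j) 0)) = 0"
        using z dE_zero[of j] True by (simp_all add: dE_def)
      ultimately have "d (Suc j) (Phi (Suc j) f) = d (Suc j) (Phi (Suc j) 0)" by (simp add: Psi_eq_0_iff)
      then have "Phi (Suc j) f = Phi (Suc j) 0"
        using dn True Phi_closed[OF f] Phi_closed[OF Ej_zero, of "Suc j"] by (auto dest: inj_onD)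
      then show ?thesis using Psi_Phi[OF f] Psi_Phi[OF Ej_zero, of "Suc j"] by simp
    qed
    then show ?thesis using rhs by auto
  next
    case neq: False
    then have "f = 0" using Ej_big[OF _ f] False by simp
    then show ?thesis using rhs by simp
  qed
qed

lemma dE_scale: "f \<in> Ej (Suc j) \<Longrightarrow> dE j (z *\<^sub>C f) = z *\<^sub>C dE j f"
  using dE_rho[OF ch_closed(3), of f j z] by (simp add: rho_ch)

lemma dE_sum: "(\<And>i. i \<in> A \<Longrightarrow> f i \<in> Ej (Suc j)) \<Longrightarrow> dE j (\<Sum>i\<in>A. f i) = (\<Sum>i\<in>A. dE j (f i))"
  by (induction A rule: infinite_finite_induct) (simp_all add: dE_add Ej_sum)

lemma dE_minus: "f \<in> Ej (Suc j) \<Longrightarrow> dE j (- f) = - dE j f"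
  using dE_scale[of f j "-1"] by simp

lemma dE_diff: "f \<in> Ej (Suc j) \<Longrightarrow> g \<in> Ej (Suc j) \<Longrightarrow> dE j (f - g) = dE j f - dE j g"
  using dE_add[of f j "- g"] by (simp add: dE_minus Ej_minus)

text \<open>\<open>euler\<close> is built from multiplications, Dunkl operators and group elements,
  all of which come from \<open>H\<close>, so homomorphisms of modules commute with it.\<close>

lemma dE_euler: "f \<in> Ej (Suc j) \<Longrightarrow> dE j (euler f) = euler (dE j f)"
proof -
  assume f: "f \<in> Ej (Suc j)"
  have x: "dE j (xmul v g) = xmul v (dE j g)" and y: "dE j (dunkl v g) = dunkl v (dE j g)"
    if "g \<in> Ej (Suc j)" for v g
    using dE_rho[OF ch_closed(1) that, of v] dE_rho[OF ch_closed(2) that, of v] by (simp_all add: rho_ch)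
  have w: "dE j (wact s f) = wact s (dE j f)" if "s \<in> Rf" for s
    using dE_rho[OF ch_closed(4) f, of s] RfW that by (auto simp: rho_ch)
  show ?thesis
    unfolding euler_def using f
    by (simp add: dE_diff dE_scale dE_sum Ej_sum Ej_xmul Ej_dunkl Ej_wact Ej_scale x y w)
qed

lemma emb_unit_generates:
  assumes Q0: "Q (emb (axis {} 1))" and Qs: "\<And>z f. Q f \<Longrightarrow> Q (z *\<^sub>C f)"
    and Qx: "\<And>i f. f \<in> Ej 0 \<Longrightarrow> Q f \<Longrightarrow> Q (xmul (axis i 1) f)"
    and Qa: "\<And>f g. f \<in> Ej 0 \<Longrightarrow> g \<in> Ej 0 \<Longrightarrow> Q f \<Longrightarrow> Q g \<Longrightarrow> Q (f + g)"
    and f: "f \<in> Ej 0"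
  shows "Q f"
  using f
proof (induction rule: Ej_induct)
  case (emb v)
  have "v = v $ {} *\<^sub>C axis {} 1"
    using emb by (auto simp: extgr_def vec_eq_iff axis_def cscale_complex_def)
  then show ?case using Qs[OF Q0, of "v $ {}"] by (metis clin_emb clin_scale)
qed (auto intro: Qx Qa)

lemma pm_nontrivial: "\<exists>f\<in>Ej 0. pm f \<noteq> \<zero>\<^bsub>L\<^esub>"
proof -
  have "carrier L \<noteq> {\<zero>\<^bsub>L\<^esub>}" using irrL by (simp add: irreducible_module_def)
  then obtain x where "x \<in> carrier L" "x \<noteq> \<zero>\<^bsub>L\<^esub>" using L.zero_closed by blast
  then show ?thesis using pm_surj by blast
qed

lemma pm_zero: "pm 0 = \<zero>\<^bsub>L\<^esub>"
  using pm_exact[OF Ej_zero] Ej_zero by (metis dE_zero)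

lemma pm_sum: "finite A \<Longrightarrow> (\<And>i. i \<in> A \<Longrightarrow> f i \<in> Ej 0) \<Longrightarrow> pm (\<Sum>i\<in>A. f i) = (\<Oplus>\<^bsub>L\<^esub>i\<in>A. pm (f i))"
proof (induction A rule: finite_induct)
  case (insert x A)
  then have "pm (\<Sum>i\<in>insert x A. f i) = pm (f x) \<oplus>\<^bsub>L\<^esub> pm (\<Sum>i\<in>A. f i)" by (simp add: pm_add Ej_sum)
  also have "\<dots> = (\<Oplus>\<^bsub>L\<^esub>i\<in>insert x A. pm (f i))" using insert by (simp add: pm_closed Pi_def)
  finally show ?case .
qed (simp add: pm_zero)

lemma pm_scale: "f \<in> Ej 0 \<Longrightarrow> pm (z *\<^sub>C f) = ch_scal P z \<odot>\<^bsub>L\<^esub> pm f"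
  using pm_rho[OF ch_closed(3), of f z] by (simp add: rho_ch)

text \<open>Otherwise \<open>M(triv)\<close> would be finite-dimensional. Preimages of finitely many
  spanning vectors involve finitely many monomials, and a monomial outside them is not in their
  span.\<close>

lemma pm_not_injective: "\<exists>f\<in>Ej 0. f \<noteq> 0 \<and> pm f = \<zero>\<^bsub>L\<^esub>"
proof (rule ccontr)
  assume "\<not> ?thesis"
  then have inj: "f = 0" if "f \<in> Ej 0" "pm f = \<zero>\<^bsub>L\<^esub>" for f using that by blast
  obtain B where B: "finite B" "B \<subseteq> carrier L" "\<And>m. m \<in> carrier L \<Longrightarrow> \<exists>z. m = (\<Oplus>\<^bsub>L\<^esub>b\<in>B. ch_scal P (z b) \<odot>\<^bsub>L\<^esub> b)"
    using finL unfolding finite_dim_module_def by blast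
  have "\<forall>b\<in>B. \<exists>f. f \<in> Ej 0 \<and> pm f = b" using B(2) pm_surj by blast
  then obtain F where F: "\<And>b. b \<in> B \<Longrightarrow> F b \<in> Ej 0" "\<And>b. b \<in> B \<Longrightarrow> pm (F b) = b" by metis
  define M where "M = (\<Union>b\<in>B. Poly_Mapping.keys (F b {}))"
  have finM: "finite M" using B(1) by (simp add: M_def)
  obtain i :: 'a where True by blast
  have "infinite (range (\<lambda>k. Poly_Mapping.single i (k :: nat)))"
    by (rule range_inj_infinite) (metis injI lookup_single_eq)
  then obtain m where m: "m \<notin> M" using finM by (metis finite_subset subsetI)
  define f :: "'a pext" where "f = (\<lambda>J. if J = {} then Poly_Mapping.single m 1 else 0)"
  have f: "f \<in> Ej 0" by (auto simp: f_def Ej_def)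
  obtain z where "pm f = (\<Oplus>\<^bsub>L\<^esub>b\<in>B. ch_scal P (z b) \<odot>\<^bsub>L\<^esub> b)" using B(3)[OF pm_closed[OF f]] by blast
  also have "\<dots> = (\<Oplus>\<^bsub>L\<^esub>b\<in>B. pm (z b *\<^sub>C F b))"
    using F B(2) by (intro L.M.finsum_cong') (auto simp: pm_scale Pi_def intro!: L.smult_closed ch_closed)
  also have "\<dots> = pm (\<Sum>b\<in>B. z b *\<^sub>C F b)" by (rule pm_sum[symmetric, OF B(1) Ej_scale[OF F(1)]])
  finally have eq: "pm f = pm (\<Sum>b\<in>B. z b *\<^sub>C F b)" .
  let ?g = "\<Sum>b\<in>B. z b *\<^sub>C F b"
  have g: "?g \<in> Ej 0" by (intro Ej_sum Ej_scale F(1))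
  have "pm (f - ?g) \<oplus>\<^bsub>L\<^esub> pm ?g = pm f" using pm_add[OF Ej_diff[OF f g] g] by simp
  then have "pm (f - ?g) = \<zero>\<^bsub>L\<^esub>"
    using L.M.add.r_cancel_one[OF pm_closed[OF g] pm_closed[OF Ej_diff[OF f g]]] eq by simp
  then have "f - ?g = 0" using inj Ej_diff[OF f g] by blast
  then have "Poly_Mapping.lookup (f {}) m = Poly_Mapping.lookup (?g {}) m" by simp
  also have "\<dots> = (\<Sum>b\<in>B. z b * Poly_Mapping.lookup (F b {}) m)"
    by (simp add: sum_fun_apply lookup_sum fun_apply)
  also have "\<dots> = 0" using m by (intro sum.neutral) (auto simp: M_def in_keys_iff)
  finally show False by (simp add: f_def)
qed

text \<open>If \<open>\<kappa> = 0\<close>, the differential would preserve polynomial degrees, so it would either vanish or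
  hit the constants; neither leaves a nonzero finite-dimensional cokernel.\<close>

lemma kappa_nonzero: "\<kappa> \<noteq> 0"
proof
  assume "\<kappa> = 0"
  then have \<kappa>: "ewt j m = of_nat (mdeg m) - Nc / 2" for j m unfolding ewt_def by simp
  have *: "dE 0 (emb v) = 0" if v: "v \<in> extgr 1" for v
  proof (rule ccontr)
    assume nz: "dE 0 (emb v) \<noteq> 0"
    let ?g = "dE 0 (emb v)"
    have e: "emb v \<in> Ej (Suc 0)" using Ej_emb[OF v] by simp
    have g: "?g \<in> Ej 0" by (rule dE_closed[OF e])
    \<comment> \<open>For \<open>\<kappa> = 0\<close> constants have the same Euler weight in every
      exterior degree, so the image of a constant is again constant.\<close>
    have "euler (emb v) = (- (Nc / 2)) *\<^sub>C emb v"
      by (rule ext, rule poly_mapping_eqI)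
        (auto simp: euler_lookup fun_apply \<kappa> emb_def lookup_single when_def mdeg_def)
    then have "euler ?g = (- (Nc / 2)) *\<^sub>C ?g" using dE_euler[OF e] dE_scale[OF e, of "- (Nc / 2)"] by simp
    then have deg: "mdeg m = 0" if "Poly_Mapping.lookup (?g J) m \<noteq> 0" for J m
      using euler_lookup[of ?g J m] that by (simp add: fun_apply \<kappa> left_diff_distrib)
    have g_eq: "?g = emb (\<chi> J. Poly_Mapping.lookup (?g J) 0)"
    proof (rule ext, rule poly_mapping_eqI)
      fix J m
      have "m = 0" if "mdeg m = 0" for m :: "'a \<Rightarrow>\<^sub>0 nat"
        using that by (intro poly_mapping_eqI) (simp add: mdeg_def)
      then show "Poly_Mapping.lookup (?g J) m = Poly_Mapping.lookup (emb (\<chi> J. Poly_Mapping.lookup (?g J) 0) J) m"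
        using deg[of J m] by (auto simp: emb_def lookup_single when_def)
    qed
    define z where "z = Poly_Mapping.lookup (?g {}) 0"
    have "(\<chi> J. Poly_Mapping.lookup (?g J) 0) = z *\<^sub>C axis {} 1"
      using g by (auto simp: vec_eq_iff axis_def z_def cscale_complex_def Ej_def)
    then have gz: "?g = z *\<^sub>C emb (axis {} 1)" using g_eq by (metis clin_emb clin_scale)
    then have z: "z \<noteq> 0" using nz by auto
    have "pm f = \<zero>\<^bsub>L\<^esub>" if "f \<in> Ej 0" for f
    proof -
      have "f \<in> Ej 0 \<and> (\<exists>g\<in>Ej (Suc 0). f = dE 0 g)"
      proof (rule emb_unit_generates[OF _ _ _ _ that])
        have "emb (axis {} 1) = dE 0 ((1 / z) *\<^sub>C emb v)" using z by (simp add: dE_scale[OF e] gz)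
        then show "emb (axis {} 1) \<in> Ej 0 \<and> (\<exists>g\<in>Ej (Suc 0). emb (axis {} 1) = dE 0 g)"
          using Ej_scale[OF e] Ej_emb[OF extgr_axis[of "{} :: 'a set"]] by auto
      next
        fix i f assume f: "f \<in> Ej 0 \<and> (\<exists>g\<in>Ej (Suc 0). f = dE 0 g)"
        then obtain g where g: "g \<in> Ej (Suc 0)" "f = dE 0 g" by blast
        then have "xmul (axis i 1) f = dE 0 (xmul (axis i 1) g)"
          using dE_rho[OF ch_closed(1) g(1), of "axis i 1"] by (simp add: rho_ch)
        then show "xmul (axis i 1) f \<in> Ej 0 \<and> (\<exists>g\<in>Ej (Suc 0). xmul (axis i 1) f = dE 0 g)"
          using Ej_xmul[OF g(1)] Ej_xmul f by blast
      next
        fix z f assume f: "f \<in> Ej 0 \<and> (\<exists>g\<in>Ej (Suc 0). f = dE 0 g)"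
        then show "z *\<^sub>C f \<in> Ej 0 \<and> (\<exists>g\<in>Ej (Suc 0). z *\<^sub>C f = dE 0 g)"
          using dE_scale Ej_scale by metis
      next
        fix f g assume "f \<in> Ej 0 \<and> (\<exists>g\<in>Ej (Suc 0). f = dE 0 g)" "g \<in> Ej 0 \<and> (\<exists>g'\<in>Ej (Suc 0). g = dE 0 g')"
        then show "f + g \<in> Ej 0 \<and> (\<exists>g'\<in>Ej (Suc 0). f + g = dE 0 g')"
          using dE_add Ej_add by metis
      qed
      then show ?thesis using pm_exact[OF that] by simp
    qed
    then show False using pm_nontrivial by blast
  qed
  have "dE 0 f = 0" if "f \<in> Ej 1" for f
    using that
  proof (induction rule: Ej_induct)
    case (emb v)
    then show ?case by (rule *)
  next
    case (xmul i f)
    then show ?case using dE_rho[OF ch_closed(1), of f 0 "axis i 1"] by (simp add: rho_ch clin_zero[OF clin_xmul])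
  next
    case (add f g)
    then show ?case by (simp add: dE_add)
  qed
  then show False using pm_exact pm_not_injective by metis
qed

lemma aw_inj: "aw j = aw k \<longleftrightarrow> j = k"
  using kappa_nonzero by (simp add: aw_def)

section \<open>The resolution tensored with spinors and cut into eigenspaces\<close>

definition dY :: "nat \<Rightarrow> ('a set \<Rightarrow> 'a pext) \<Rightarrow> 'a set \<Rightarrow> 'a pext" where
  "dY j t = (\<lambda>I. dE j (t I))"

lemma dY_YE: "t \<in> YE (Suc j) \<Longrightarrow> dY j t \<in> YE j"
  by (simp add: YE_def dY_def dE_closed)

lemma dY_add: "t \<in> YE (Suc j) \<Longrightarrow> u \<in> YE (Suc j) \<Longrightarrow> dY j (t + u) = dY j t + dY j u"
  by (simp add: YE_def dY_def fun_eq_iff[of _ "_ + _"] plus_fun_apply dE_add)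

lemma dY_scale: "t \<in> YE (Suc j) \<Longrightarrow> dY j (z *\<^sub>C t) = z *\<^sub>C dY j t"
  by (rule ext) (simp add: YE_def dY_def cscale_fun_apply dE_scale)

lemma dY_zero [simp]: "dY j 0 = 0"
  using dY_add[OF YE_zero YE_zero, of j] by simp

lemma dY_sum: "(\<And>i. i \<in> A \<Longrightarrow> f i \<in> YE (Suc j)) \<Longrightarrow> dY j (\<Sum>i\<in>A. f i) = (\<Sum>i\<in>A. dY j (f i))"
  by (induction A rule: infinite_finite_induct) (simp_all add: dY_add YE_sum)

lemma dY_tns: "a \<in> carrier H \<Longrightarrow> t \<in> YE (Suc j) \<Longrightarrow> dY j (tns X (rho a) t) = tns X (rho a) (dY j t)"
  unfolding dY_def tns_def
  by (rule ext) (simp add: YE_def dE_sum dE_scale dE_rho Ej_scale Ej_rho)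

lemma rho_ch': "rho (ch_x P v) = xmul v" "rho (ch_y P v) = dunkl v" "w \<in> W \<Longrightarrow> rho (ch_grp P w) = wact w"
  by (auto simp: rho_ch)

lemma dY_wS: "w \<in> W \<Longrightarrow> t \<in> YE (Suc j) \<Longrightarrow> dY j (wS w t) = wS w (dY j t)"
  unfolding wS_def using dY_tns[OF ch_closed(4)] by (simp add: rho_ch')

lemma dY_dirac: "t \<in> YE (Suc j) \<Longrightarrow> dY j (dirac_op t) = dirac_op (dY j t)"
proof -
  assume t: "t \<in> YE (Suc j)"
  have x: "dY j (tns X (xmul v) t) = tns X (xmul v) (dY j t)" and y: "dY j (tns X (dunkl v) t) = tns X (dunkl v) (dY j t)" for X v
    using dY_tns[OF ch_closed(1) t, of X v] dY_tns[OF ch_closed(2) t, of X v] by (simp_all add: rho_ch')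
  have Y: "tns X (xmul v) t \<in> YE (Suc j)" "tns X (dunkl v) t \<in> YE (Suc j)" for X v
    using t by (auto intro: YE_tns Ej_xmul Ej_dunkl)
  show ?thesis by (simp add: dirac_op_def kx_def ky_def dY_add dY_sum YE_sum x y Y)
qed

lemma dY_Om: "t \<in> YE (Suc j) \<Longrightarrow> dY j (Om t) = Om (dY j t)"
  unfolding Om_def using RfW by (simp add: dY_scale dY_sum YE_sum YE_scale YE_wS dY_wS subset_iff)

lemma dY_WT: "t \<in> YE (Suc j) \<Longrightarrow> t \<in> WT b \<Longrightarrow> dY j t \<in> WT b"
  unfolding WT_def dY_def YE_def by (simp add: dE_scale flip: dE_euler)

lemma dY_Kb: "t \<in> Kb b (Suc j) \<Longrightarrow> dY j t \<in> Kb b j"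
  unfolding Kb_def using dY_Om[of t j] by (simp add: dY_YE dY_WT) (simp add: dY_scale)

lemma dY_eb: "t \<in> YE (Suc j) \<Longrightarrow> dY j (eb b t) = eb b (dY j t)"
  unfolding eb_def by (rule ga_commute[where F = "dY j"]) (simp_all add: dY_add dY_scale dY_wS)

lemma dY_prj: "t \<in> YE (Suc j) \<Longrightarrow> prj b (dY j t) = dY j (prj b t)"
  by (rule prj_commute[where F = "dY j"]) (simp_all add: dY_add dY_WT)

text \<open>The projection of \<open>YE j\<close> onto \<open>Kb b j\<close>: first the weight, then
  the eigenspace of \<open>Om\<close>. Applied to preimages, it carries exactness of the resolution
  over to the spaces \<open>Kb b j\<close>.\<close>

definition cut :: "complex \<Rightarrow> ('a set \<Rightarrow> 'a pext) \<Rightarrow> 'a set \<Rightarrow> 'a pext" where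
  "cut b t = eb b (prj b t)"

lemma cut_Kb: "t \<in> YE j \<Longrightarrow> cut b t \<in> Kb b j"
  unfolding cut_def by (intro eb_Kb prj_WT prj_YE)

lemma cut_fix: "t \<in> Kb b j \<Longrightarrow> cut b t = t"
  using prj_WT_eq[of t b b] by (simp add: cut_def Kb_def eb_fix)

lemma clin_cut: "clin (cut b)"
  unfolding cut_def by (intro clin_compose[OF clin_eb clin_prj])

lemma cut_dY: "t \<in> YE (Suc j) \<Longrightarrow> cut b (dY j t) = dY j (cut b t)"
  by (simp add: cut_def dY_prj dY_eb prj_YE)

lemma cut_wS: "w \<in> W \<Longrightarrow> cut b (wS w t) = wS w (cut b t)"
  by (simp add: cut_def prj_wS wS_eb)

lemma cut_dirac: "t \<in> YE j \<Longrightarrow> cut b (dirac_op t) = dirac_op (cut b t)"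
  unfolding cut_def prj_dirac eb_def
  by (rule ga_commute[where F = dirac_op and j = j, symmetric])
    (simp_all add: clin_add[OF clin_dirac] clin_scale[OF clin_dirac] wS_dirac prj_YE)

lemma cut_other: "t \<in> Kb b' j \<Longrightarrow> b \<noteq> b' \<Longrightarrow> cut b t = 0"
  using prj_WT_eq[of t b' b] by (simp add: cut_def Kb_def clin_zero[OF clin_eb])

lemma dY_exact_YE: "t \<in> YE (Suc j) \<Longrightarrow> dY j t = 0 \<longleftrightarrow> (\<exists>u\<in>YE (Suc (Suc j)). t = dY (Suc j) u)"
proof
  assume t: "t \<in> YE (Suc j)" "dY j t = 0"
  have "\<exists>g. g \<in> Ej (Suc (Suc j)) \<and> t I = dE (Suc j) g" for I
    using dE_exact[of "t I" j] t by (auto simp: YE_def dY_def fun_eq_iff[of _ "0 :: 'a set \<Rightarrow> 'a pext"] zero_fun_apply)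
  then obtain u where "\<And>I. u I \<in> Ej (Suc (Suc j)) \<and> t I = dE (Suc j) (u I)" by metis
  then show "\<exists>u\<in>YE (Suc (Suc j)). t = dY (Suc j) u" by (intro bexI[of _ u]) (auto simp: YE_def dY_def)
next
  assume "t \<in> YE (Suc j)" "\<exists>u\<in>YE (Suc (Suc j)). t = dY (Suc j) u"
  then show "dY j t = 0"
    using dE_exact[of _ j] by (fastforce simp: YE_def dY_def fun_eq_iff[of _ "0 :: 'a set \<Rightarrow> 'a pext"] zero_fun_apply)
qed

lemma YE_big: "j > CARD('a) \<Longrightarrow> t \<in> YE j \<Longrightarrow> t = 0"
  using Ej_big[of j] by (auto simp: YE_def fun_eq_iff[of t] zero_fun_apply)

lemma Kb_YE: "t \<in> Kb b j \<Longrightarrow> t \<in> YE j" by (simp add: Kb_def)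

text \<open>Collects what holds for every \<open>b\<close>; the assumptions concern only the one
  column \<open>k\<close> in which \<open>D\<close> may fail to be exact.\<close>

lemma resolved:
  assumes V: "0 \<in> V" "\<And>v v'. v \<in> V \<Longrightarrow> v' \<in> V \<Longrightarrow> v + v' \<in> V" "\<And>v. v \<in> V \<Longrightarrow> \<iota> v \<in> Kb b k"
    "\<And>v. v \<in> V \<Longrightarrow> dirac_op (\<iota> v) = 0" "\<And>v v'. \<iota> (v + v') = \<iota> v + \<iota> v'"
    and ex: "\<And>j. j \<noteq> k \<Longrightarrow> j \<le> CARD('a) \<Longrightarrow> b \<noteq> aw j"
    and exk: "\<And>x. x \<in> Kb b k \<Longrightarrow> dirac_op x = 0 \<Longrightarrow> \<exists>v\<in>V. \<exists>u\<in>Kb b k. x = dirac_op u + \<iota> v"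
    and inj: "\<And>v u. v \<in> V \<Longrightarrow> u \<in> Kb b k \<Longrightarrow> \<iota> v = dirac_op u \<Longrightarrow> v = 0"
  shows "resolved_complex (Kb b) dirac_op dY CARD('a) k V \<iota>"
proof
  fix x j assume x: "x \<in> Kb b (Suc j)" "dY j x = 0"
  then obtain u where u: "u \<in> YE (Suc (Suc j))" "x = dY (Suc j) u" using dY_exact_YE[of x j] Kb_YE by blast
  then have "x = dY (Suc j) (cut b u)" using cut_fix[OF x(1)] cut_dY[OF u(1)] by simp
  then show "\<exists>u\<in>Kb b (Suc (Suc j)). x = dY (Suc j) u" using cut_Kb[OF u(1)] by blast
next
  fix x j assume x: "x \<in> Kb b (Suc (Suc j))"
  then show "dY j (dY (Suc j) x) = 0"
    using dY_exact_YE[of "dY (Suc j) x" j] dY_YE Kb_YE by blast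
next
  fix x j assume x: "j > CARD('a)" "x \<in> Kb b j"
  then show "x = 0" using YE_big Kb_YE by blast
next
  fix x j assume x: "j \<noteq> k" "x \<in> Kb b j" "dirac_op x = 0"
  show "\<exists>u\<in>Kb b j. x = dirac_op u"
  proof (cases "j \<le> CARD('a)")
    case True
    then show ?thesis using dirac_exact[OF ex[OF x(1)]] x by blast
  next
    case False
    then have "x = dirac_op 0" using YE_big[of j x] Kb_YE[OF x(2)] by (simp add: clin_zero[OF clin_dirac])
    then show ?thesis using Kb_zero by blast
  qed
qed (use assms in \<open>auto simp: Kb_zero Kb_add Kb_dirac clin_add[OF clin_dirac] dY_Kb dY_add Kb_YE dirac_dirac dY_dirac
    Kb_scale[of _ b _ "-1", simplified]\<close>)

lemma resolved_aw: "resolved_complex (Kb (aw k)) dirac_op dY CARD('a) k (extgr k) inc"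
proof (rule resolved)
  fix x assume "x \<in> Kb (aw k) k"
  then obtain v where v: "v \<in> extgr k" "x = inc v" using WT_aw[of x k] by (auto simp: Kb_def)
  then show "\<exists>v\<in>extgr k. \<exists>u\<in>Kb (aw k) k. x = dirac_op u + inc v"
    using Kb_zero by (intro bexI[of _ v] bexI[of _ 0]) (simp_all add: clin_zero[OF clin_dirac])
next
  fix v :: "'a ext" and u assume v: "v \<in> extgr k" "inc v = dirac_op u" and u: "u \<in> Kb (aw k) k"
  then obtain v' where "u = inc v'" using WT_aw[of u k] by (auto simp: Kb_def)
  then have "inc v = 0" using v(2) by (simp add: dirac_inc)
  then have "emb v = 0" by (metis inc_def zero_fun_apply)
  then show "v = 0" by (auto simp: emb_def vec_eq_iff fun_eq_iff zero_fun_apply) (metis lookup_single_eq lookup_zero)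
qed (auto simp: extgr_add inc_Kb dirac_inc inc_add aw_inj)

text \<open>No column has cohomology. To fit the locale, the exceptional column is placed at
  \<open>CARD('a) + 1\<close>, where everything vanishes.\<close>

lemma resolved_other:
  assumes "b \<notin> aw ` {..CARD('a)}"
  shows "resolved_complex (Kb b) dirac_op dY CARD('a) (Suc CARD('a)) {0 :: 'a ext} (\<lambda>_. 0)"
  by (rule resolved)
    (use assms YE_big[of "Suc CARD('a)"] Kb_YE in \<open>auto simp: Kb_zero clin_zero[OF clin_dirac] intro!: bexI[of _ 0]\<close>)

end

section \<open>Dirac cohomology of the irreducible quotient\<close>

definition gr :: "nat \<Rightarrow> 'n::finite ext \<Rightarrow> 'n ext" where
  "gr k v = (\<chi> I. if card I = k then v $ I else 0)"

lemma clin_gr: "clin (gr k)"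
  by (rule clinI) (simp_all add: gr_def vec_eq_iff)

lemma gr_extgr: "gr k v \<in> extgr k"
  by (simp add: gr_def extgr_def)

lemma gr_same: "v \<in> extgr k \<Longrightarrow> gr j v = (if j = k then v else 0)"
  by (auto simp: gr_def extgr_def vec_eq_iff)

lemma gr_sum: "(\<Sum>k\<le>CARD('n). gr k v) = (v :: 'n::finite ext)"
  by (simp add: vec_eq_iff sum_component gr_def card_mono)

lemma gr_ext_act: "gr k (ext_act w v) = ext_act w (gr k v)"
proof -
  have "gr k (ext_act w v) = (\<Sum>j\<le>CARD('a). gr k (ext_act w (gr j v)))"
    by (subst gr_sum[symmetric, of v]) (simp only: clin_sum[OF clin_ext_act] clin_sum[OF clin_gr])
  also have "\<dots> = (\<Sum>j\<le>CARD('a). if k = j then ext_act w (gr k v) else 0)"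
    by (rule sum.cong[OF refl]) (simp add: gr_same[OF ext_act_extgr[OF gr_extgr]])
  also have "\<dots> = ext_act w (gr k v)"
  proof (cases "k \<le> CARD('a)")
    case False
    have "gr k v = 0" using False card_mono[of "UNIV :: 'a set"] by (auto simp: gr_def vec_eq_iff)
    then show ?thesis using False by (simp add: clin_zero[OF clin_ext_act])
  qed simp
  finally show ?thesis .
qed

context bgg
begin

abbreviation ST where "ST \<equiv> spinor_tensor P L"
abbreviation bd where "bd \<equiv> dirac_boundary P L"

lemma ST_simps [simp]: "carrier ST = {t. \<forall>I. t I \<in> carrier L}" "\<zero>\<^bsub>ST\<^esub> = (\<lambda>I. \<zero>\<^bsub>L\<^esub>)"
  "t \<oplus>\<^bsub>ST\<^esub> t' = (\<lambda>I. t I \<oplus>\<^bsub>L\<^esub> t' I)" "z \<odot>\<^bsub>ST\<^esub> t = (\<lambda>I. ch_scal P z \<odot>\<^bsub>L\<^esub> t I)"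
  by (simp_all add: spinor_tensor_def)

lemma ST_group: "abelian_group ST"
proof (rule abelian_groupI)
  fix x assume "x \<in> carrier ST"
  then show "\<exists>y\<in>carrier ST. y \<oplus>\<^bsub>ST\<^esub> x = \<zero>\<^bsub>ST\<^esub>"
    by (intro bexI[of _ "\<lambda>I. \<ominus>\<^bsub>L\<^esub> x I"]) (auto simp: L.M.l_neg)
qed (auto simp: L.M.a_assoc L.M.a_comm L.M.a_lcomm)

sublocale ST: abelian_group ST by (rule ST_group)

text \<open>The map from \<open>M(triv) \<otimes> S\<close> to \<open>L \<otimes> S\<close> induced
  by \<open>\<pi>\<close>, on the polynomial model.\<close>

definition Pi :: "('a set \<Rightarrow> 'a pext) \<Rightarrow> 'a set \<Rightarrow> 'l" where "Pi t = (\<lambda>I. pm (t I))"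

lemma Pi_closed: "t \<in> YE 0 \<Longrightarrow> Pi t \<in> carrier ST"
  by (simp add: Pi_def YE_def pm_closed)

lemma Pi_add: "t \<in> YE 0 \<Longrightarrow> u \<in> YE 0 \<Longrightarrow> Pi (t + u) = Pi t \<oplus>\<^bsub>ST\<^esub> Pi u"
  by (simp add: Pi_def YE_def plus_fun_apply pm_add)

lemma Pi_scale: "t \<in> YE 0 \<Longrightarrow> Pi (z *\<^sub>C t) = z \<odot>\<^bsub>ST\<^esub> Pi t"
  by (simp add: Pi_def YE_def cscale_fun_apply pm_scale)

lemma Pi_zero: "Pi 0 = \<zero>\<^bsub>ST\<^esub>"
  by (simp add: Pi_def zero_fun_apply pm_zero)

lemma Pi_surj:
  assumes "x \<in> carrier ST"
  obtains t where "t \<in> YE 0" "x = Pi t"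
proof -
  have "\<forall>I. \<exists>f. f \<in> Ej 0 \<and> pm f = x I" using assms pm_surj by auto
  then obtain t where "\<And>I. t I \<in> Ej 0 \<and> pm (t I) = x I" by metis
  then show thesis by (intro that[of t]) (auto simp: YE_def Pi_def)
qed

lemma Pi_sum: "finite A \<Longrightarrow> (\<And>i. i \<in> A \<Longrightarrow> f i \<in> YE 0) \<Longrightarrow> Pi (\<Sum>i\<in>A. f i) = (\<Oplus>\<^bsub>ST\<^esub>i\<in>A. Pi (f i))"
proof (induction A rule: finite_induct)
  case (insert x A)
  then have "Pi (\<Sum>i\<in>insert x A. f i) = Pi (f x) \<oplus>\<^bsub>ST\<^esub> Pi (\<Sum>i\<in>A. f i)"
    by (simp add: Pi_add YE_sum del: ST_simps)
  also have "\<dots> = (\<Oplus>\<^bsub>ST\<^esub>i\<in>insert x A. Pi (f i))"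
    using insert Pi_closed by (simp add: Pi_closed FuncSet.Pi_def del: ST_simps)
  finally show ?case .
qed (simp add: Pi_zero del: ST_simps)

lemma Pi_zero_iff: "t \<in> YE 0 \<Longrightarrow> Pi t = \<zero>\<^bsub>ST\<^esub> \<longleftrightarrow> (\<exists>u\<in>YE 1. t = dY 0 u)"
proof
  assume t: "t \<in> YE 0" "Pi t = \<zero>\<^bsub>ST\<^esub>"
  then have "\<forall>I. \<exists>g. g \<in> Ej 1 \<and> t I = dE 0 g"
    using pm_exact by (auto simp: Pi_def YE_def fun_eq_iff[of _ "\<lambda>I. \<zero>\<^bsub>L\<^esub>"])
  then obtain u where "\<And>I. u I \<in> Ej 1 \<and> t I = dE 0 (u I)" by metis
  then show "\<exists>u\<in>YE 1. t = dY 0 u" by (intro bexI[of _ u]) (auto simp: YE_def dY_def)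
next
  assume "t \<in> YE 0" "\<exists>u\<in>YE 1. t = dY 0 u"
  then show "Pi t = \<zero>\<^bsub>ST\<^esub>"
    using pm_exact by (auto simp: Pi_def YE_def dY_def fun_eq_iff[of _ "\<lambda>I. \<zero>\<^bsub>L\<^esub>"])
qed

lemma Pi_eq_iff:
  assumes t: "t \<in> YE 0" "u \<in> YE 0"
  shows "Pi t = Pi u \<longleftrightarrow> (\<exists>y\<in>YE 1. t = u + dY 0 y)"
proof -
  have "Pi (t - u) \<oplus>\<^bsub>ST\<^esub> Pi u = Pi t" using Pi_add[OF YE_diff[OF t] t(2)] by simp
  then have "Pi t = Pi u \<longleftrightarrow> Pi (t - u) = \<zero>\<^bsub>ST\<^esub>"
    using ST.add.r_cancel_one[OF Pi_closed[OF t(2)] Pi_closed[OF YE_diff[OF t]]] by simp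
  also have "\<dots> \<longleftrightarrow> (\<exists>y\<in>YE 1. t = u + dY 0 y)"
    unfolding Pi_zero_iff[OF YE_diff[OF t]] by (auto simp: diff_eq_eq add.commute)
  finally show ?thesis .
qed

text \<open>Operators on \<open>L \<otimes> S\<close> lift to the polynomial model because
  \<open>\<pi>\<close> is a homomorphism of modules.\<close>

lemma tensor_op_Pi:
  assumes a: "a \<in> carrier H" and t: "t \<in> YE 0"
  shows "tensor_op P L a X (Pi t) = Pi (tns (spin X) (rho a) t)"
proof
  fix J
  have e: "(spin X (axis I 1) $ J) *\<^sub>C rho a (t I) \<in> Ej 0" for I
    using t by (intro Ej_scale Ej_rho[OF a]) (simp add: YE_def)
  have "Pi (tns (spin X) (rho a) t) J = (\<Oplus>\<^bsub>L\<^esub>I\<in>UNIV. pm ((spin X (axis I 1) $ J) *\<^sub>C rho a (t I)))"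
    unfolding Pi_def tns_def using e by (intro pm_sum) auto
  also have "\<dots> = tensor_op P L a X (Pi t) J"
    unfolding tensor_op_def Pi_def using t
    by (intro L.M.finsum_cong') (auto simp: pm_scale pm_rho Ej_rho a YE_def intro!: L.smult_closed ch_closed pm_closed)
  finally show "tensor_op P L a X (Pi t) J = Pi (tns (spin X) (rho a) t) J" ..
qed

lemma tns_spin_cl_class: "tns (spin (cl_class q)) g t = tns (spin_tens q) g t"
  by (simp add: tns_def spin_cl_class)

lemma dirac_Pi:
  assumes t: "t \<in> YE 0"
  shows "dirac P L (Pi t) = Pi (dirac_op t)"
proof -
  let ?f = "\<lambda>i. tns (wedge (axis i 1)) (xmul (axis i 1)) t + tns (contract (axis i 1)) (dunkl (axis i 1)) t"
  have Y: "tns X (xmul v) t \<in> YE 0" "tns X (dunkl v) t \<in> YE 0" for X v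
    using t by (auto intro: YE_tns Ej_xmul Ej_dunkl)
  have "Pi (dirac_op t) = Pi (\<Sum>i\<in>UNIV. ?f i)" by (simp add: dirac_op_def kx_def ky_def sum.distrib)
  also have "\<dots> = (\<Oplus>\<^bsub>ST\<^esub>i\<in>UNIV. Pi (?f i))" by (intro Pi_sum YE_add Y) auto
  also have "\<dots> = dirac P L (Pi t)" unfolding dirac_def
  proof (rule ST.finsum_cong')
    show "(\<lambda>i. tensor_op P L (ch_x P (axis i 1)) (cl_class (tens_y (axis i 1))) (Pi t) \<oplus>\<^bsub>ST\<^esub>
      tensor_op P L (ch_y P (axis i 1)) (cl_class (tens_x (axis i 1))) (Pi t)) \<in> UNIV \<rightarrow> carrier ST"
      by (intro Pi_I ST.a_closed) (simp_all only: tensor_op_Pi[OF ch_closed(1) t] tensor_op_Pi[OF ch_closed(2) t]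
        tns_spin_cl_class spin_tens_x[abs_def] spin_tens_y[abs_def] rho_ch' Pi_closed[OF Y(1)] Pi_closed[OF Y(2)])
    fix i
    show "Pi (?f i) = tensor_op P L (ch_x P (axis i 1)) (cl_class (tens_y (axis i 1))) (Pi t) \<oplus>\<^bsub>ST\<^esub>
      tensor_op P L (ch_y P (axis i 1)) (cl_class (tens_x (axis i 1))) (Pi t)"
      by (simp only: tensor_op_Pi[OF ch_closed(1) t] tensor_op_Pi[OF ch_closed(2) t]
        tns_spin_cl_class spin_tens_x[abs_def] spin_tens_y[abs_def] rho_ch' Pi_add[OF Y])
  qed simp
  finally show ?thesis ..
qed

lemma kernel_iff: "t \<in> YE 0 \<Longrightarrow> Pi t \<in> dirac_kernel P L \<longleftrightarrow> (\<exists>y\<in>YE 1. dirac_op t = dY 0 y)"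
  using Pi_closed[of t] by (simp add: dirac_kernel_def dirac_Pi Pi_zero_iff[OF YE_dirac] del: ST_simps)

lemma kernel_obtain:
  assumes "z \<in> dirac_kernel P L"
  obtains t y where "t \<in> YE 0" "z = Pi t" "y \<in> YE 1" "dirac_op t = dY 0 y"
proof -
  have "z \<in> carrier ST" using assms by (simp add: dirac_kernel_def)
  then obtain t where "t \<in> YE 0" "z = Pi t" by (rule Pi_surj)
  then show thesis using that kernel_iff assms by blast
qed

text \<open>Together with \<open>kernel_iff\<close>, this puts kernel and boundaries of
  \<open>L\<close> into the terms in which \<open>R_total\<close> and \<open>R_zero_iff\<close> are
  stated.\<close>

lemma boundary_iff:
  assumes t: "t \<in> YE 0" "Pi t \<in> dirac_kernel P L"
  shows "Pi t \<in> bd \<longleftrightarrow> (\<exists>u\<in>YE 0. \<exists>y\<in>YE 1. t = dirac_op u + dY 0 y)"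
proof -
  have "Pi t \<in> bd \<longleftrightarrow> (\<exists>u\<in>YE 0. Pi t = Pi (dirac_op u))"
  proof
    assume "Pi t \<in> bd"
    then obtain x where x: "x \<in> carrier ST" "Pi t = dirac P L x" by (auto simp: dirac_boundary_def)
    from x(1) obtain u where u: "u \<in> YE 0" "x = Pi u" by (rule Pi_surj)
    then show "\<exists>u\<in>YE 0. Pi t = Pi (dirac_op u)" using x(2) dirac_Pi[OF u(1)] by auto
  next
    assume "\<exists>u\<in>YE 0. Pi t = Pi (dirac_op u)"
    then obtain u where u: "u \<in> YE 0" "Pi t = dirac P L (Pi u)" using dirac_Pi by metis
    then show "Pi t \<in> bd" using t(2) Pi_closed[OF u(1)] unfolding dirac_boundary_def by blast
  qed
  then show ?thesis using Pi_eq_iff[OF t(1) YE_dirac] by blast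
qed

interpretation RC: resolved_complex "Kb (aw k)" dirac_op dY "CARD('a)" k "extgr k" inc for k
  by (rule resolved_aw)

text \<open>The graph of the isomorphism, on the level of cycles: \<open>z\<close> is lifted to
  \<open>t\<close>, and for each \<open>k\<close> the component of \<open>t\<close> in
  \<open>Kb (aw k) 0\<close> corresponds to the part of degree \<open>k\<close> of \<open>v\<close>.
  It is again a relation, as the lift and the zigzags are choices.\<close>

definition Q :: "('a set \<Rightarrow> 'l) \<Rightarrow> 'a ext \<Rightarrow> bool" where
  "Q z v \<longleftrightarrow> z \<in> dirac_kernel P L \<and>
     (\<exists>t\<in>YE 0. z = Pi t \<and> (\<forall>k\<le>CARD('a). RC.R k (cut (aw k) t) (gr k v)))"

lemma Q_kernel: "Q z v \<Longrightarrow> z \<in> dirac_kernel P L" by (simp add: Q_def)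

lemma Q_total:
  assumes "z \<in> dirac_kernel P L"
  shows "\<exists>v. Q z v"
proof -
  obtain t y where t: "t \<in> YE 0" "z = Pi t" "y \<in> YE 1" "dirac_op t = dY 0 y" using assms by (rule kernel_obtain)
  have "\<exists>v. RC.R k (cut (aw k) t) v" for k
  proof (rule RC.R_total)
    show "cut (aw k) t \<in> Kb (aw k) 0" by (rule cut_Kb[OF t(1)])
    show "cut (aw k) y \<in> Kb (aw k) 1" by (rule cut_Kb[OF t(3)])
    show "dirac_op (cut (aw k) t) = dY 0 (cut (aw k) y)"
      using cut_dirac[OF t(1)] cut_dY[of y 0] t(3,4) by simp
  qed
  then obtain V where V: "\<And>k. RC.R k (cut (aw k) t) (V k)" by metis
  have "gr k (\<Sum>j\<le>CARD('a). V j) = V k" if "k \<le> CARD('a)" for k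
    using that by (simp add: clin_sum[OF clin_gr] gr_same[OF RC.R_V[OF V]])
  then have "Q z (\<Sum>j\<le>CARD('a). V j)" using V t assms by (auto simp: Q_def)
  then show ?thesis ..
qed

text \<open>One representative for each \<open>k\<close>, added up; the projection for
  \<open>aw k\<close> does not see the others because these weights are distinct.\<close>

lemma Q_surj: "\<exists>z. Q z v"
proof -
  have "\<forall>k. \<exists>x. RC.R k x (gr k v)" using RC.R_surj[OF gr_extgr] by blast
  then obtain x where x: "\<And>k. RC.R k (x k) (gr k v)" by metis
  have xK: "x k \<in> Kb (aw k) 0" for k by (rule RC.R_K[OF x])
  have "\<forall>k. \<exists>y. y \<in> Kb (aw k) 1 \<and> dirac_op (x k) = dY 0 y" using RC.R_cycle[OF x] by blast
  then obtain y where y: "\<And>k. y k \<in> Kb (aw k) 1" "\<And>k. dirac_op (x k) = dY 0 (y k)" by metis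
  let ?t = "\<Sum>k\<le>CARD('a). x k" and ?y = "\<Sum>k\<le>CARD('a). y k"
  have t: "?t \<in> YE 0" by (intro YE_sum Kb_YE[OF xK])
  have "dirac_op ?t = dY 0 ?y"
    using y Kb_YE[OF y(1)] by (simp add: clin_sum[OF clin_dirac] dY_sum)
  moreover have "?y \<in> YE 1" by (intro YE_sum Kb_YE[OF y(1)])
  ultimately have "Pi ?t \<in> dirac_kernel P L" using kernel_iff[OF t] by blast
  moreover have "cut (aw k) ?t = x k" if "k \<le> CARD('a)" for k
  proof -
    have "cut (aw k) ?t = (\<Sum>j\<le>CARD('a). if k = j then x k else 0)"
      unfolding clin_sum[OF clin_cut]
      by (rule sum.cong[OF refl]) (auto simp: cut_fix[OF xK] cut_other[OF xK] aw_inj)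
    then show ?thesis using that by simp
  qed
  ultimately have "Q (Pi ?t) v" using t x by (auto simp: Q_def)
  then show ?thesis by (rule exI[of _ "Pi ?t"])
qed

lemma Q_add:
  assumes "Q z v" "Q z' v'"
  shows "Q (z \<oplus>\<^bsub>ST\<^esub> z') (v + v')"
proof -
  from assms obtain t t' where t: "t \<in> YE 0" "z = Pi t" "\<And>k. k \<le> CARD('a) \<Longrightarrow> RC.R k (cut (aw k) t) (gr k v)"
    and t': "t' \<in> YE 0" "z' = Pi t'" "\<And>k. k \<le> CARD('a) \<Longrightarrow> RC.R k (cut (aw k) t') (gr k v')"
    by (auto simp: Q_def)
  have ker: "Pi t \<in> dirac_kernel P L" "Pi t' \<in> dirac_kernel P L" using assms t t' by (auto simp: Q_def)
  obtain y y' where y: "y \<in> YE 1" "dirac_op t = dY 0 y" "y' \<in> YE 1" "dirac_op t' = dY 0 y'"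
    using kernel_iff[OF t(1)] kernel_iff[OF t'(1)] ker by blast
  have "dirac_op (t + t') = dY 0 (y + y')" using y by (simp add: clin_add[OF clin_dirac] dY_add)
  then have "Pi (t + t') \<in> dirac_kernel P L"
    using kernel_iff[OF YE_add[OF t(1) t'(1)]] YE_add[OF y(1,3)] by blast
  moreover have "RC.R k (cut (aw k) (t + t')) (gr k (v + v'))" if "k \<le> CARD('a)" for k
    using RC.R_add[OF t(3)[OF that] t'(3)[OF that]] by (simp add: clin_add[OF clin_cut] clin_add[OF clin_gr])
  ultimately show ?thesis
    unfolding Q_def t(2) t'(2) Pi_add[OF t(1) t'(1), symmetric] using YE_add[OF t(1) t'(1)] by blast
qed

text \<open>Naturality in a form that fits both scalars and group elements. The assumption on
  \<open>z'\<close> ranges over all lifts of \<open>Pi t0\<close>, because \<open>Q\<close> provides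
  some lift and not the given one.\<close>

lemma Q_map:
  assumes "Q (Pi t0) v"
    and g: "\<And>t. t \<in> YE 0 \<Longrightarrow> Pi t = Pi t0 \<Longrightarrow> Pi (g t) = z'"
    and gY: "\<And>j t. t \<in> YE j \<Longrightarrow> g t \<in> YE j" and gK: "\<And>b j t. t \<in> Kb b j \<Longrightarrow> g t \<in> Kb b j"
    and ga: "\<And>t u. g (t + u) = g t + g u"
    and gD: "\<And>t. dirac_op (g t) = g (dirac_op t)" and gd: "\<And>j t. t \<in> YE (Suc j) \<Longrightarrow> dY j (g t) = g (dY j t)"
    and gc: "\<And>b t. cut b (g t) = g (cut b t)"
    and h: "\<And>k v. v \<in> extgr k \<Longrightarrow> h v \<in> extgr k" "\<And>v. inc (h v) = g (inc v)" "\<And>k v. gr k (h v) = h (gr k v)"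
  shows "Q z' (h v)"
proof -
  from assms(1) obtain t where t: "t \<in> YE 0" "Pi t0 = Pi t" "\<And>k. k \<le> CARD('a) \<Longrightarrow> RC.R k (cut (aw k) t) (gr k v)"
    by (auto simp: Q_def)
  have "Pi t \<in> dirac_kernel P L" using assms(1) t(2) by (simp add: Q_def)
  then obtain y where y: "y \<in> YE 1" "dirac_op t = dY 0 y" using kernel_iff[OF t(1)] by blast
  have "dirac_op (g t) = dY 0 (g y)" using y gd[of y 0] by (simp add: gD)
  then have "Pi (g t) \<in> dirac_kernel P L" using kernel_iff[OF gY[OF t(1)]] gY[OF y(1)] by blast
  moreover have "RC.R k (cut (aw k) (g t)) (gr k (h v))" if "k \<le> CARD('a)" for k
    unfolding gc h(3) by (rule RC.R_map[OF t(3)[OF that]]) (auto simp: gK ga gD gd Kb_YE h gr_extgr)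
  ultimately show ?thesis using g[OF t(1)] t(2) gY[OF t(1)] unfolding Q_def by auto
qed

lemma Q_scale:
  assumes "Q z v"
  shows "Q (a \<odot>\<^bsub>ST\<^esub> z) (a *\<^sub>C v)"
proof -
  from assms obtain t where t: "t \<in> YE 0" "z = Pi t" by (auto simp: Q_def)
  have q: "Q (Pi t) v" using assms t by simp
  show ?thesis
  proof (rule Q_map[OF q, where g = "\<lambda>t. a *\<^sub>C t" and h = "\<lambda>v. a *\<^sub>C v"])
    show "Pi (a *\<^sub>C t') = a \<odot>\<^bsub>ST\<^esub> z" if "t' \<in> YE 0" "Pi t' = Pi t" for t'
      using that t(2) by (simp add: Pi_scale del: ST_simps)
  qed (auto simp: YE_scale Kb_scale cscale_add_right clin_scale[OF clin_dirac] dY_scale clin_scale[OF clin_cut]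
      extgr_scale inc_scale clin_scale[OF clin_gr])
qed

lemma Q_wS:
  assumes w: "w \<in> W" and t: "t \<in> YE 0" "Q (Pi t) v"
  shows "Q (Pi (wS w t)) (top_char w *\<^sub>C ext_act w v)"
proof (rule Q_map[OF t(2), where g = "wS w" and h = "\<lambda>v. top_char w *\<^sub>C ext_act w v"])
  fix t' assume t': "t' \<in> YE 0" "Pi t' = Pi t"
  obtain y where y: "y \<in> YE 1" "t' = t + dY 0 y" using Pi_eq_iff[OF t'(1) t(1)] t'(2) by blast
  have "wS w t' = wS w t + dY 0 (wS w y)" using y dY_wS[OF w, of y 0] by (simp add: clin_add[OF clin_wS])
  then show "Pi (wS w t') = Pi (wS w t)"
    using Pi_eq_iff[OF YE_wS[OF t'(1)] YE_wS[OF t(1)]] YE_wS[OF y(1)] by blast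
qed (auto simp: YE_wS Kb_wS[OF w] clin_add[OF clin_wS] wS_dirac[OF w] dY_wS[OF w] cut_wS[OF w]
    extgr_scale ext_act_extgr wS_inc clin_scale[OF clin_gr] gr_ext_act)

lemma Q_boundary:
  assumes "Q z v"
  shows "z \<in> bd \<longleftrightarrow> v = 0"
proof -
  from assms obtain t where t: "t \<in> YE 0" "z = Pi t" "\<And>k. k \<le> CARD('a) \<Longrightarrow> RC.R k (cut (aw k) t) (gr k v)"
    by (auto simp: Q_def)
  have ker: "Pi t \<in> dirac_kernel P L" using assms t(2) by (simp add: Q_def)
  obtain y where y: "y \<in> YE 1" "dirac_op t = dY 0 y" using kernel_iff[OF t(1)] ker by blast
  show ?thesis
  proof
    assume "z \<in> bd"
    then obtain u x where u: "u \<in> YE 0" "x \<in> YE 1" "t = dirac_op u + dY 0 x"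
      using boundary_iff[OF t(1) ker] t(2) by blast
    have "gr k v = 0" if k: "k \<le> CARD('a)" for k
    proof -
      have "cut (aw k) t = dirac_op (cut (aw k) u) + dY 0 (cut (aw k) x)"
        using cut_dirac[OF u(1)] cut_dY[of x 0] u(2,3) by (simp add: clin_add[OF clin_cut])
      then show ?thesis using RC.R_zero_iff[OF t(3)[OF k]] cut_Kb[OF u(1)] cut_Kb[OF u(2)] by blast
    qed
    then show "v = 0" by (subst gr_sum[symmetric]) simp
  next
    assume v: "v = 0"
    \<comment> \<open>Representatives of boundaries. As \<open>Bd\<close> is closed under addition,
      \<open>t \<in> Bd\<close> can be checked on weight components.\<close>
    define Bd where "Bd = {s. \<exists>u\<in>YE 0. \<exists>x\<in>YE 1. s = dirac_op u + dY 0 x}"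
    have Bd0: "0 \<in> Bd" unfolding Bd_def
      by (intro CollectI bexI[of _ 0]) (simp_all add: clin_zero[OF clin_dirac] YE_zero)
    have Bd_add: "s + s' \<in> Bd" if s: "s \<in> Bd" "s' \<in> Bd" for s s'
    proof -
      from s obtain u x u' x' where "u \<in> YE 0" "x \<in> YE 1" "s = dirac_op u + dY 0 x"
        "u' \<in> YE 0" "x' \<in> YE 1" "s' = dirac_op u' + dY 0 x'" unfolding Bd_def by blast
      then show ?thesis unfolding Bd_def
        by (intro CollectI bexI[of _ "u + u'"] bexI[of _ "x + x'"])
          (simp_all add: clin_add[OF clin_dirac] dY_add YE_add algebra_simps)
    qed
    \<comment> \<open>For \<open>b\<close> among the weights \<open>aw k\<close> the assumption
      \<open>v = 0\<close> decides; for all other \<open>b\<close> there is no cohomology at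
      all.\<close>
    have cutBd: "cut b t \<in> Bd" for b
    proof (cases "b \<in> aw ` {..CARD('a)}")
      case True
      then obtain k where k: "k \<le> CARD('a)" "b = aw k" by auto
      have "\<exists>u0\<in>Kb (aw k) 0. \<exists>u1\<in>Kb (aw k) 1. cut b t = dirac_op u0 + dY 0 u1"
        using RC.R_zero_iff[OF t(3)[OF k(1)]] k(2) v by (simp add: clin_zero[OF clin_gr])
      then show ?thesis unfolding Bd_def using Kb_YE by blast
    next
      case False
      then interpret RO: resolved_complex "Kb b" dirac_op dY "CARD('a)" "Suc CARD('a)" "{0 :: 'a ext}" "\<lambda>_. 0"
        by (rule resolved_other)
      have "dirac_op (cut b t) = dY 0 (cut b y)"
        using cut_dirac[OF t(1)] cut_dY[of y 0] y by simp
      then obtain v' where v': "RO.R (cut b t) v'"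
        using RO.R_total[OF cut_Kb[OF t(1)] cut_Kb[OF y(1)]] by blast
      then have "v' = 0" using RO.R_V by blast
      then show ?thesis using RO.R_zero_iff[OF v'] Kb_YE unfolding Bd_def by blast
    qed
    have "prj b t \<in> Bd" for b
    proof -
      let ?s = "prj b t" and ?g = "ga (snd (split_pair b))"
      have s: "?s \<in> YE 0" "?s \<in> WT b" by (rule prj_YE[OF t(1)], rule prj_WT)
      have "?s - cut b t = ?g (b *\<^sub>C ?s - Om ?s)" unfolding cut_def by (rule eb_diff)
      \<comment> \<open>Outside the \<open>b\<close>-eigenspace of \<open>Om\<close> the operator
        \<open>b - Om\<close> can be inverted, and on this weight space it is a multiple of
        \<open>D\<^sup>2\<close>; so the rest of the component lies in the image of
        \<open>D\<close>.\<close>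
      also have "b *\<^sub>C ?s - Om ?s = (- 1 / 2) *\<^sub>C dirac_op (dirac_op ?s)"
        by (simp add: dirac_dirac_WT[OF s(2)])
      also have "?g ((- 1 / 2) *\<^sub>C dirac_op (dirac_op ?s)) = dirac_op (?g ((- 1 / 2) *\<^sub>C dirac_op ?s))"
        unfolding clin_scale[OF clin_dirac, symmetric]
        using YE_scale[OF YE_dirac[OF s(1)], of "- 1 / 2"]
        by (intro ga_commute[where F = dirac_op and j = 0, symmetric])
          (simp_all add: clin_add[OF clin_dirac] clin_scale[OF clin_dirac] wS_dirac YE_scale YE_dirac s)
      finally have "?s = dirac_op (?g ((- 1 / 2) *\<^sub>C dirac_op ?s)) + cut b t" by (simp add: diff_eq_eq)
      moreover have "dirac_op (?g ((- 1 / 2) *\<^sub>C dirac_op ?s)) \<in> Bd" unfolding Bd_def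
        by (intro CollectI bexI[of _ "?g ((- 1 / 2) *\<^sub>C dirac_op ?s)"] bexI[of _ 0])
          (simp_all only: YE_zero dY_zero add_0_right ga_YE[OF YE_scale[OF YE_dirac[OF s(1)]]])
      ultimately show ?thesis using Bd_add cutBd by metis
    qed
    then have "(\<Sum>b\<in>A. prj b t) \<in> Bd" for A
      by (induction A rule: infinite_finite_induct) (simp_all add: Bd0 Bd_add)
    from this[of "wts t"] have "t \<in> Bd" by (simp add: prj_sum)
    then show "z \<in> bd" using boundary_iff[OF t(1) ker] unfolding Bd_def t(2) by blast
  qed
qed

text \<open>Differences in \<open>ST\<close> are taken as sums with -1 times a vector, so that
  \<open>Q_add\<close> and \<open>Q_scale\<close> apply to them.\<close>

lemma Q_neg:
  assumes "Q z v"
  shows "Q (z \<oplus>\<^bsub>ST\<^esub> (- 1) \<odot>\<^bsub>ST\<^esub> z) 0" "z \<oplus>\<^bsub>ST\<^esub> (- 1) \<odot>\<^bsub>ST\<^esub> z = \<zero>\<^bsub>ST\<^esub>"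
proof -
  show "Q (z \<oplus>\<^bsub>ST\<^esub> (- 1) \<odot>\<^bsub>ST\<^esub> z) 0" using Q_add[OF assms Q_scale[OF assms, of "-1"]] by simp
  obtain t where t: "t \<in> YE 0" "z = Pi t" using assms by (auto simp: Q_def)
  have "Pi t \<oplus>\<^bsub>ST\<^esub> Pi ((- 1) *\<^sub>C t) = Pi (t + (- 1) *\<^sub>C t)" by (rule Pi_add[OF t(1) YE_scale[OF t(1)], symmetric])
  then show "z \<oplus>\<^bsub>ST\<^esub> (- 1) \<odot>\<^bsub>ST\<^esub> z = \<zero>\<^bsub>ST\<^esub>" unfolding t(2) Pi_scale[OF t(1), symmetric] using Pi_zero by simp
qed

lemma kernel_carrier: "z \<in> dirac_kernel P L \<Longrightarrow> z \<in> carrier ST" by (simp add: dirac_kernel_def)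

lemma Q_carrier: "Q z v \<Longrightarrow> z \<in> carrier ST" using Q_kernel kernel_carrier by blast

lemma zero_kernel: "\<zero>\<^bsub>ST\<^esub> \<in> dirac_kernel P L"
  using kernel_iff[OF YE_zero] YE_zero[of 1] unfolding Pi_zero
  by (metis clin_dirac clin_zero dY_zero)

lemma Q_zero: "Q \<zero>\<^bsub>ST\<^esub> 0"
proof -
  obtain v where "Q \<zero>\<^bsub>ST\<^esub> v" using Q_total[OF zero_kernel] by blast
  from Q_neg[OF this] show ?thesis by simp
qed

lemma Q_bd: "z \<in> bd \<longleftrightarrow> Q z 0"
proof
  assume z: "z \<in> bd"
  then obtain v where "Q z v" using Q_total by (auto simp: dirac_boundary_def)
  then show "Q z 0" using z Q_boundary by blast
qed (use Q_boundary in blast)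

lemma Q_unique:
  assumes "Q z v" "Q z v'"
  shows "v = v'"
proof -
  have "Q (z \<oplus>\<^bsub>ST\<^esub> (- 1) \<odot>\<^bsub>ST\<^esub> z) (v + (- 1) *\<^sub>C v')" by (rule Q_add[OF assms(1) Q_scale[OF assms(2)]])
  then have "Q \<zero>\<^bsub>ST\<^esub> (v + (- 1) *\<^sub>C v')" unfolding Q_neg(2)[OF assms(1)] .
  then have "v + (- 1) *\<^sub>C v' = 0" using Q_boundary[of "\<zero>\<^bsub>ST\<^esub>"] Q_bd Q_zero by blast
  then show ?thesis by simp
qed

section \<open>Passage to cosets of boundaries\<close>

lemma bd_subgroup: "abelian_subgroup bd ST"
proof (rule abelian_subgroupI3[OF _ ST_group], rule additive_subgroupI)
  show "subgroup bd (add_monoid ST)"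
  proof (rule group.subgroupI[OF ST.a_group])
    show "bd \<subseteq> carrier (add_monoid ST)" using Q_bd Q_carrier by auto
    show "bd \<noteq> {}" using Q_zero Q_bd by blast
    fix a assume a: "a \<in> bd"
    then have q: "Q a 0" using Q_bd by blast
    then have q': "Q ((- 1) \<odot>\<^bsub>ST\<^esub> a) 0" using Q_scale[OF q, of "-1"] by simp
    have "inv\<^bsub>add_monoid ST\<^esub> a = (- 1) \<odot>\<^bsub>ST\<^esub> a"
      using ST.minus_equality[of "(- 1) \<odot>\<^bsub>ST\<^esub> a" a] Q_neg(2)[OF q] Q_carrier[OF q] Q_carrier[OF q']
      unfolding a_inv_def by (simp only: ST.a_comm)
    then show "inv\<^bsub>add_monoid ST\<^esub> a \<in> bd" using q' Q_bd by simp
    fix b assume "b \<in> bd"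
    then have "Q (a \<oplus>\<^bsub>ST\<^esub> b) 0" using Q_add[OF q, of b 0] Q_bd by simp
    then show "a \<otimes>\<^bsub>add_monoid ST\<^esub> b \<in> bd" using Q_bd by simp
  qed
qed

abbreviation coset where "coset z \<equiv> bd +>\<^bsub>ST\<^esub> z"

lemma mem_coset: "x \<in> coset z \<longleftrightarrow> (\<exists>b\<in>bd. x = b \<oplus>\<^bsub>ST\<^esub> z)"
  by (auto simp: a_r_coset_def' simp del: ST_simps)

lemma Q_coset:
  assumes q: "Q z v" and x: "x \<in> coset z"
  shows "Q x v"
proof -
  obtain b where "b \<in> bd" "x = b \<oplus>\<^bsub>ST\<^esub> z" using x mem_coset by blast
  then show ?thesis using Q_add[of b 0, OF _ q] Q_bd by (simp del: ST_simps)
qed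

lemma self_coset: "Q z v \<Longrightarrow> z \<in> coset z"
  using Q_carrier[of z v] Q_zero Q_bd ST.l_zero[of z] by (metis mem_coset)

lemma coset_eqI:
  assumes q: "Q z v" "Q z' v"
  shows "coset z = coset z'"
proof -
  have "Q (z \<oplus>\<^bsub>ST\<^esub> (- 1) \<odot>\<^bsub>ST\<^esub> z') 0" using Q_add[OF q(1) Q_scale[OF q(2), of "-1"]] by simp
  then have b: "z \<oplus>\<^bsub>ST\<^esub> (- 1) \<odot>\<^bsub>ST\<^esub> z' \<in> bd" using Q_bd by blast
  note c = Q_carrier[OF q(1)] Q_carrier[OF q(2)] Q_carrier[OF Q_scale[OF q(2), of "-1"]]
  have "(z \<oplus>\<^bsub>ST\<^esub> (- 1) \<odot>\<^bsub>ST\<^esub> z') \<oplus>\<^bsub>ST\<^esub> z' = z \<oplus>\<^bsub>ST\<^esub> (z' \<oplus>\<^bsub>ST\<^esub> (- 1) \<odot>\<^bsub>ST\<^esub> z')"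
    using c by (simp only: ST.a_assoc ST.a_comm[OF c(3) c(2)] ST.a_closed)
  also have "\<dots> = z" unfolding Q_neg(2)[OF q(2)] using c by (simp only: ST.r_zero)
  finally have "z \<in> coset z'" using b mem_coset by metis
  then show ?thesis
    using abelian_subgroup.a_repr_independence'[OF bd_subgroup _ c(2)] by metis
qed

text \<open>Well defined on cosets of cycles, because \<open>Q\<close> relates all members of such a
  coset to one and the same vector.\<close>

definition val :: "('a set \<Rightarrow> 'l) set \<Rightarrow> 'a ext" where
  "val X = (THE v. \<exists>z\<in>X. Q z v)"

lemma val_coset: "Q z v \<Longrightarrow> val (coset z) = v"
  unfolding val_def using self_coset Q_coset Q_unique by (intro the_equality) blast+

lemma cohomology_simps: "carrier (dirac_cohomology P L) = {coset z | z. z \<in> dirac_kernel P L}"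
  "X \<oplus>\<^bsub>dirac_cohomology P L\<^esub> Y = X <+>\<^bsub>ST\<^esub> Y"
  "a \<odot>\<^bsub>dirac_cohomology P L\<^esub> X = coset_op P L (\<lambda>t. a \<odot>\<^bsub>ST\<^esub> t) X"
  by (simp_all add: dirac_cohomology_def del: ST_simps)

lemma cohomology_obtain:
  assumes "X \<in> carrier (dirac_cohomology P L)"
  obtains z v where "X = coset z" "Q z v"
proof -
  obtain z where z: "z \<in> dirac_kernel P L" "X = coset z" using assms unfolding cohomology_simps by blast
  obtain v where "Q z v" using Q_total[OF z(1)] by blast
  with z(2) show thesis by (rule that)
qed

text \<open>\<open>coset_op\<close> adds the boundaries back to the image of a coset. The result is
  a single coset because \<open>A\<close> maps boundaries to boundaries, by
  \<open>h 0 = 0\<close>.\<close>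

lemma coset_op_eq:
  assumes q: "Q z v" and A: "\<And>z v. Q z v \<Longrightarrow> Q (A z) (h v)" "h 0 = 0"
    and Aa: "\<And>z v z' v'. Q z v \<Longrightarrow> Q z' v' \<Longrightarrow> A (z \<oplus>\<^bsub>ST\<^esub> z') = A z \<oplus>\<^bsub>ST\<^esub> A z'"
  shows "coset_op P L A (coset z) = coset (A z)"
proof
  have set_add: "X <+>\<^bsub>ST\<^esub> Y = {x \<oplus>\<^bsub>ST\<^esub> y | x y. x \<in> X \<and> y \<in> Y}" for X Y
    by (auto simp: set_add_def' simp del: ST_simps)
  note Az = A(1)[OF q]
  show "coset_op P L A (coset z) \<subseteq> coset (A z)"
  proof
    fix x assume "x \<in> coset_op P L A (coset z)"
    then obtain b y where b: "b \<in> bd" "y \<in> coset z" "x = b \<oplus>\<^bsub>ST\<^esub> A y" unfolding coset_op_def set_add by blast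
    obtain b' where b': "b' \<in> bd" "y = b' \<oplus>\<^bsub>ST\<^esub> z" using b(2) mem_coset by blast
    have qb: "Q b 0" "Q b' 0" "Q (A b') 0" using b b' Q_bd A by metis+
    have "x = (b \<oplus>\<^bsub>ST\<^esub> A b') \<oplus>\<^bsub>ST\<^esub> A z"
      unfolding b(3) b'(2) Aa[OF qb(2) q]
      by (rule ST.a_assoc[symmetric, OF Q_carrier[OF qb(1)] Q_carrier[OF qb(3)] Q_carrier[OF Az]])
    moreover have "b \<oplus>\<^bsub>ST\<^esub> A b' \<in> bd" using Q_add[OF qb(1,3)] Q_bd by simp
    ultimately show "x \<in> coset (A z)" using mem_coset by blast
  qed
  show "coset (A z) \<subseteq> coset_op P L A (coset z)"
    unfolding coset_op_def set_add using mem_coset self_coset[OF q] by blast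
qed

lemma dirac_cohomology_iso:
  fixes G :: "'a cliff monoid"
  assumes G: "\<And>g. g \<in> carrier G \<Longrightarrow> p g \<in> W" "\<And>g v. g \<in> carrier G \<Longrightarrow> spin g v = chi g *\<^sub>C ext_act (p g) v"
    "\<And>g. g \<in> carrier G \<Longrightarrow> chi g * chi g = top_char (p g)"
    "\<And>g. g \<in> carrier G \<Longrightarrow> top_char (p g) * top_char (p g) = 1"
  shows "rep_isomorphic G (dirac_cohomology P L) (dirac_cohomology_act P p L)
    ext_alg (\<lambda>g v. inverse (chi g) *s ext_act (p g) v)"
  unfolding rep_isomorphic_def
proof (intro bexI[of _ val] conjI ballI)
  have set_add: "coset z <+>\<^bsub>ST\<^esub> coset z' = coset (z \<oplus>\<^bsub>ST\<^esub> z')" if "Q z v" "Q z' v'" for z v z' v'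
    by (rule abelian_subgroup.a_rcos_sum[OF bd_subgroup Q_carrier[OF that(1)] Q_carrier[OF that(2)]])
  have scale: "coset_op P L (\<lambda>t. a \<odot>\<^bsub>ST\<^esub> t) (coset z) = coset (a \<odot>\<^bsub>ST\<^esub> z)" if "Q z v" for a z v
  proof (rule coset_op_eq[OF that, where h = "\<lambda>v. a *\<^sub>C v"])
    fix z v z' v' assume q: "Q z v" "Q z' v'"
    then show "a \<odot>\<^bsub>ST\<^esub> (z \<oplus>\<^bsub>ST\<^esub> z') = a \<odot>\<^bsub>ST\<^esub> z \<oplus>\<^bsub>ST\<^esub> a \<odot>\<^bsub>ST\<^esub> z'"
      using Q_carrier[OF q(1)] Q_carrier[OF q(2)] by (simp add: L.smult_r_distr ch_closed)
  qed (simp_all only: Q_scale cscale_zero_right)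
  show "val \<in> module_homs type_ring (dirac_cohomology P L) ext_alg"
    unfolding module_homs_def
  proof (intro CollectI conjI ballI)
    show "val \<in> carrier (dirac_cohomology P L) \<rightarrow> carrier ext_alg" by (simp add: ext_alg_def)
    fix X assume "X \<in> carrier (dirac_cohomology P L)"
    then obtain z v where X: "X = coset z" "Q z v" by (rule cohomology_obtain)
    show "val (a \<odot>\<^bsub>dirac_cohomology P L\<^esub> X) = a \<odot>\<^bsub>ext_alg\<^esub> val X" for a
      unfolding cohomology_simps X(1) scale[OF X(2)] val_coset[OF X(2)] val_coset[OF Q_scale[OF X(2)]]
      by (simp add: ext_alg_def cscale_vec_eq)
    fix Y assume "Y \<in> carrier (dirac_cohomology P L)"
    then obtain z' v' where Y: "Y = coset z'" "Q z' v'" by (rule cohomology_obtain)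
    show "val (X \<oplus>\<^bsub>dirac_cohomology P L\<^esub> Y) = val X \<oplus>\<^bsub>ext_alg\<^esub> val Y"
      unfolding cohomology_simps X(1) Y(1) set_add[OF X(2) Y(2)]
        val_coset[OF X(2)] val_coset[OF Y(2)] val_coset[OF Q_add[OF X(2) Y(2)]]
      by (simp add: ext_alg_def)
  qed
  show "bij_betw val (carrier (dirac_cohomology P L)) (carrier ext_alg)"
    unfolding bij_betw_def
  proof
    show "inj_on val (carrier (dirac_cohomology P L))"
    proof (rule inj_onI)
      fix X Y assume "X \<in> carrier (dirac_cohomology P L)" "Y \<in> carrier (dirac_cohomology P L)" and eq: "val X = val Y"
      then obtain z v z' v' where X: "X = coset z" "Q z v" and Y: "Y = coset z'" "Q z' v'"
        by (metis cohomology_obtain)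
      then show "X = Y" using eq coset_eqI val_coset by metis
    qed
    have "v \<in> val ` carrier (dirac_cohomology P L)" for v
    proof -
      obtain z where z: "Q z v" using Q_surj by blast
      then have "coset z \<in> carrier (dirac_cohomology P L)" using Q_kernel by (auto simp: cohomology_simps)
      then show ?thesis using val_coset[OF z] by blast
    qed
    then show "val ` carrier (dirac_cohomology P L) = carrier ext_alg" by (auto simp: ext_alg_def)
  qed
  fix g X assume g: "g \<in> carrier G" and "X \<in> carrier (dirac_cohomology P L)"
  then obtain z v where X: "X = coset z" "Q z v" using cohomology_obtain by metis
  let ?A = "tensor_op P L (ch_grp P (p g)) g"
  define h where "h v = inverse (chi g) *\<^sub>C ext_act (p g) v" for v
  \<comment> \<open>\<open>chi g\<close> comes from the action on spinors and
    \<open>top_char\<close> from the top spinor in \<open>inc\<close>. The square of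
    \<open>chi g\<close> is \<open>top_char (p g)\<close>, which is its own inverse.\<close>
  have chi: "chi g * top_char (p g) = inverse (chi g)"
  proof -
    have "chi g * (chi g * top_char (p g)) = 1" using G(3,4)[OF g] by (simp add: mult.assoc[symmetric])
    then show ?thesis by (metis inverse_unique)
  qed
  have A_Pi: "?A (Pi t) = Pi (chi g *\<^sub>C wS (p g) t)" if t: "t \<in> YE 0" for t
  proof -
    have "tns (spin g) (rho (ch_grp P (p g))) t = tns (\<lambda>v. chi g *\<^sub>C ext_act (p g) v) (wact (p g)) t"
      by (simp add: tns_def G(2)[OF g] rho_ch'(3)[OF G(1)[OF g]])
    then show ?thesis by (simp add: tensor_op_Pi[OF ch_closed(4)[OF G(1)[OF g]] t] tns_scale_left wS_def)
  qed
  have A_Q: "Q (?A z) (h v)" if q: "Q z v" for z v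
  proof -
    obtain t where t: "t \<in> YE 0" "z = Pi t" using q by (auto simp: Q_def)
    have "Q (chi g \<odot>\<^bsub>ST\<^esub> Pi (wS (p g) t)) (chi g *\<^sub>C (top_char (p g) *\<^sub>C ext_act (p g) v))"
      by (rule Q_scale[OF Q_wS[OF G(1)[OF g] t(1)]]) (use q t in simp)
    then show ?thesis
      unfolding h_def t(2) A_Pi[OF t(1)] Pi_scale[OF YE_wS[OF t(1)]] by (simp only: cscale_cscale chi)
  qed
  have A_add: "?A (z \<oplus>\<^bsub>ST\<^esub> z') = ?A z \<oplus>\<^bsub>ST\<^esub> ?A z'" if q: "Q z v" "Q z' v'" for z v z' v'
  proof -
    obtain t t' where t: "t \<in> YE 0" "z = Pi t" "t' \<in> YE 0" "z' = Pi t'" using q unfolding Q_def by blast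
    show ?thesis
      unfolding t(2,4) Pi_add[OF t(1,3), symmetric] A_Pi[OF t(1)] A_Pi[OF t(3)] A_Pi[OF YE_add[OF t(1,3)]]
        clin_add[OF clin_wS] cscale_add_right
      by (rule Pi_add) (intro YE_scale YE_wS t)+
  qed
  have "dirac_cohomology_act P p L g X = coset (?A z)"
    unfolding dirac_cohomology_act_def X(1)
  proof (rule coset_op_eq[OF X(2), where h = h])
    show "h 0 = 0" by (simp add: h_def clin_zero[OF clin_ext_act])
  qed (rule A_Q A_add; assumption)+
  then show "val (dirac_cohomology_act P p L g X) = inverse (chi g) *s ext_act (p g) (val X)"
    unfolding X(1) val_coset[OF X(2)] by (simp add: val_coset[OF A_Q[OF X(2)]] h_def cscale_vec_eq)
qed

end

text \<open>The determinant is -1 on the generating reflections.\<close>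

lemma top_char_weyl_group:
  assumes irr: "irreducible_root_system \<Phi>" and w: "w \<in> weyl_group \<Phi>"
  shows "top_char w * top_char w = 1"
  using w
proof (induction rule: weyl_group_induct[OF irr, consumes 1, case_names one refl mult])
  case one
  show ?case by (simp add: top_char_one)
next
  case (refl a)
  have a: "a \<noteq> 0" using root_nonzero[OF irr refl] .
  have "cmat (rrm a) *v y = y - pairing y (cvec_of a) *\<^sub>C ((2 / complex_of_real (a \<bullet> a)) *\<^sub>C cvec_of a)" for y
    by (simp add: cmat_rrm_mult mult.commute)
  moreover have "pairing ((2 / complex_of_real (a \<bullet> a)) *\<^sub>C cvec_of a) (cvec_of a) = 2"
    using a by (simp add: clin_scale[OF clin_pairing_left] cscale_complex_def pairing_cvec_of)
  ultimately have "top_char (cmat (rrm a)) = - 1" by (rule top_char_reflection)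
  then show ?case by simp
next
  case (mult g h)
  then show ?case by (simp add: top_char_mult mult_ac)
qed

theorem corollary6p4:
  fixes \<Phi> :: "(real^'n::{finite,linorder}) set"
    and P :: "'n cherednik_data"
    and p :: "'n cliff \<Rightarrow> 'n mtx"
    and L :: "('n ch, 'l) module"
    and d :: "nat \<Rightarrow> ('n, 'n ext) std \<Rightarrow> ('n, 'n ext) std"
    and \<pi> :: "('n, 'n ext) std \<Rightarrow> 'l"
  assumes "irreducible_root_system \<Phi>"
    and "refl_grp P = weyl_group \<Phi>"
    and "is_cherednik_data P"
    and "is_covering P p"
    and "irreducible_module (cherednik P) L"
    and "finite_dim_module P L"
    and "\<pi> \<in> module_homs (cherednik P) (std_ext_dual P 0) L"
    and "\<And>k. 1 \<le> k \<Longrightarrow> k \<le> CARD('n) \<Longrightarrow>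
           d k \<in> module_homs (cherednik P) (std_ext_dual P k) (std_ext_dual P (k - 1))"
    and "\<pi> ` carrier (std_ext_dual P 0) = carrier L"
    and "d 1 ` carrier (std_ext_dual P 1) = {m \<in> carrier (std_ext_dual P 0). \<pi> m = \<zero>\<^bsub>L\<^esub>}"
    and "\<And>k. 1 \<le> k \<Longrightarrow> k < CARD('n) \<Longrightarrow>
           d (k + 1) ` carrier (std_ext_dual P (k + 1)) =
           {m \<in> carrier (std_ext_dual P k). d k m = \<zero>\<^bsub>std_ext_dual P (k - 1)\<^esub>}"
    and "inj_on (d CARD('n)) (carrier (std_ext_dual P CARD('n)))"
  shows "rep_isomorphic (W_tilde P)
           (dirac_cohomology P L) (dirac_cohomology_act P p L)
           ext_alg (\<lambda>g v. inverse (chi g) *s ext_act (p g) v)"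
proof -
  note facts = assms(1,2,3)
  obtain \<kappa> where "cherednik_rep (weyl_group \<Phi>) (reflections (weyl_group \<Phi>)) (param P) (alpha P) (coroot P) \<kappa> P"
    using cherednik_rep_weyl_group[OF facts] by metis
  then interpret bgg "weyl_group \<Phi>" "reflections (weyl_group \<Phi>)" "param P" "alpha P" "coroot P" \<kappa> P L \<pi> d
    by (rule bgg.intro) (rule bgg_axioms.intro[OF assms(5-12)])
  show ?thesis
    by (rule dirac_cohomology_iso)
      (simp_all add: spin_W_tilde[OF facts assms(4)] top_char_weyl_group[OF assms(1)])
qed

end
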